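(* Let the statistic $R_N(\eta)$ be a lattice random variable with span $h$ and set of possible values $\mathfrak R$. If $E|g_m(\xi_m)|^5<\infty$ for $m=1,\dots,N$ and $\mathrm P_{2N}\le(10\ln n)^{-1}$, then there exist positive constants $c,C$ such that uniformly in $z\in\mathfrak R$ $$\left|\frac{\sigma_N}{h}P\{R_N(\eta)=z\}-\frac{d}{du_z}\mathbb W_N^{(5)}(u_z,0)\right|\le C\left(\beta_{5,N}+(\mathrm P_{3N}+n^{-2})^{3/4}+\sigma_N\sqrt n\,\exp\Big\{-\tfrac12N\bar H_N\Big(cT_N,\frac{\pi\sigma_N}{h}\Big)\Big\}\right),$$ where $u_z=(z-\Lambda_N)/\sigma_N$, $T_N=\min(\beta_{3,N}^{-1},\mathcal E_N(1)^{-1})$ and $$\mathcal E_N(1)=\sqrt{n^{-1}+\mathrm P_{2N}}\,\Big(1+\min(1,\lambda^{-1/2})\sqrt{1+n\mathrm P_{2N}}\Big).$$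
   Context: Sampling with replacement. $n\to\infty$, $N=N(n)\to\infty$; $p_m>0$, $p_1+\dots+p_N=1$ (the $p_m$ may depend on $n$), $\max_mp_m\to0$. $\eta=(\eta_1,\dots,\eta_N)$ is multinomial $M(n,p_1,\dots,p_N)$; $\xi_1,\dots,\xi_N$ are independent, $\xi_m$ Poisson with mean $\lambda_m=np_m$ (so $\eta$ has the law of $\xi$ given $\sum\xi_m=n$). $\lambda=n/N$, $\mathrm P_{iN}=p_1^i+\dots+p_N^i$. $f_m=f_{m,N}$ are Borel functions on $[0,\infty)$, possibly random; if random, they are independent of $\xi$ and $\eta$, and the pairs $(f_m(\xi_m),\xi_m)$ are independent over $m$. $R_N(\eta)=\sum_{m=1}^Nf_m(\eta_m)$. Notation: $B_N^2=\sum_m\mathrm{Var}\,\xi_m=n$, $\Lambda_N=\sum_mEf_m(\xi_m)$, $\gamma_N=B_N^{-2}\sum_m\mathrm{cov}(f_m(\xi_m),\xi_m)$, $g_m(y)=f_m(y)-Ef_m(\xi_m)-\gamma_N(y-E\xi_m)$, $\sigma_N^2=\sum_m\mathrm{Var}\,g_m(\xi_m)>0$, $\hat\sigma_N^2=\sigma_N^2/N$, $\hat B_N^2=B_N^2/N$, $\hat g_m=g_m(\xi_m)/\hat\sigma_N$, $\hat\xi_m=(\xi_m-E\xi_m)/\hat B_N$, $\beta_{j,N}=N^{-j/2}\sum_mE|\hat g_m|^j$. $\langle a\rangle$ is the distance from the real $a$ to the nearest integer. Let $\xi_m^*=\xi_m-\xi_m'$, $f_m^*(\xi_m)=f_m(\xi_m)-f_m(\xi_m)'$,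 where $(f_m(\xi_m)',\xi_m')$ is an independent copy of $(f_m(\xi_m),\xi_m)$; $H_m(t,\tau)=E\langle tf_m^*(\xi_m)+\tau\xi_m^*\rangle^2$; $$\bar H_N(a,b)=\inf\Big\{\tfrac1N\sum_{m=1}^NH_m\big(\tfrac t{2\pi},\tfrac\tau{2\pi}\big):a\sigma_N^{-1}\le|t|\le b\sigma_N^{-1},\ |\tau|\le\pi\Big\}$$ (infimum over the empty set is $+\infty$). Expansion: $P_{1,N}(t,\tau)=\frac{i^3}{6N}\sum_mE(t\hat g_m+\tau\hat\xi_m)^3$, $P_{2,N}(t,\tau)=\frac{i^4}{24N}\sum_m\big(E(t\hat g_m+\tau\hat\xi_m)^4-3(E(t\hat g_m+\tau\hat\xi_m)^2)^2\big)+\frac12P_{1,N}^2(t,\tau)$, $G_k(t)=\frac1{\sqrt{2\pi}}\int_{-\infty}^\infty P_{k,N}(t,\tau)e^{-\tau^2/2}d\tau$, $$W_N^{(5)}(t,0)=1+\frac{G_1(t)-G_1(0)}{\sqrt N}+\frac{G_2(t)-G_2(0)-G_1(0)(G_1(t)-G_1(0))}{N},$$ and $\mathbb W_N^{(5)}(u,0)$ is the function of $u$, of bounded variation and tending to $0$ as $u\to-\infty$, with $\int e^{itu}d_u\mathbb W_N^{(5)}(u,0)=W_N^{(5)}(t,0)e^{-t^2/2}$; $\frac d{du_z}\mathbb W_N^{(5)}(u_z,0)$ is its $u$-derivative at $u_z$. The constants $c,C$ do not depend on $n$, $N$, the $p_m$, or the $f_m$.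
   Formalization: The span h is a fixed number and the constants c, C may depend on h (not on n, N, the p_m, or otherwise on the f_m); with C also independent of h the claim fails, since replacing all f_m by εf_m shrinks only the last error term. *)

theory Defs
  imports "HOL-Probability.Probability"
begin

section \<open>General notions\<close>

definition covar :: "'a measure \<Rightarrow> ('a \<Rightarrow> real) \<Rightarrow> ('a \<Rightarrow> real) \<Rightarrow> real" where
  "covar M X Y = (\<integral>\<omega>. (X \<omega> - integral\<^sup>L M X) * (Y \<omega> - integral\<^sup>L M Y) \<partial>M)"

abbreviation var_of :: "'a measure \<Rightarrow> ('a \<Rightarrow> real) \<Rightarrow> real" where
  "var_of M X \<equiv> prob_space.variance M X"

definition int_dist :: "real \<Rightarrow> real" where
  "int_dist a = \<bar>a - of_int (round a)\<bar>"

definition on_lattice :: "'a measure \<Rightarrow> ('a \<Rightarrow> real) \<Rightarrow> real \<Rightarrow> bool" where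
  "on_lattice M X h \<longleftrightarrow> 0 < h \<and> (\<exists>a. AE \<omega> in M. \<exists>k::int. X \<omega> = a + of_int k * h)"

text \<open>As usual, the span of a lattice random variable is its maximal step.\<close>
definition lattice_span :: "'a measure \<Rightarrow> ('a \<Rightarrow> real) \<Rightarrow> real \<Rightarrow> bool" where
  "lattice_span M X h \<longleftrightarrow> on_lattice M X h \<and> (\<forall>h'. on_lattice M X h' \<longrightarrow> h' \<le> h)"

definition possible_values :: "'a measure \<Rightarrow> ('a \<Rightarrow> real) \<Rightarrow> real set" where
  "possible_values M X = {z. 0 < measure M {\<omega> \<in> space M. X \<omega> = z}}"

text \<open>Unlike \<^const>\<open>prob_space.indep_var\<close>, this does not force \<open>X\<close> and \<open>Y\<close> to have
  the same value type.\<close>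
definition indep_rvs ::
  "'a measure \<Rightarrow> 'b measure \<Rightarrow> ('a \<Rightarrow> 'b) \<Rightarrow> 'c measure \<Rightarrow> ('a \<Rightarrow> 'c) \<Rightarrow> bool" where
  "indep_rvs M MX X MY Y \<longleftrightarrow> X \<in> measurable M MX \<and> Y \<in> measurable M MY \<and>
     prob_space.indep_set M (sets (vimage_algebra (space M) X MX))
                            (sets (vimage_algebra (space M) Y MY))"

text \<open>\<open>F\<close> is a function of bounded variation on the line with \<open>F u \<longlonglongrightarrow> 0\<close> as \<open>u \<rightarrow> -\<infinity>\<close>
  (normalised to be right-continuous, i.e., by the Jordan decomposition, a difference of
  distribution functions of two finite Borel measures), and \<open>\<phi> t = \<integral> e\<^sup>i\<^sup>t\<^sup>u dF(u)\<close> for all \<open>t\<close>.\<close>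
definition has_fourier_stieltjes :: "(real \<Rightarrow> real) \<Rightarrow> (real \<Rightarrow> complex) \<Rightarrow> bool" where
  "has_fourier_stieltjes F \<phi> \<longleftrightarrow>
     (\<exists>\<mu> \<nu>. finite_borel_measure \<mu> \<and> finite_borel_measure \<nu> \<and>
        (\<forall>u. F u = cdf \<mu> u - cdf \<nu> u) \<and> (\<forall>t. \<phi> t = char \<mu> t - char \<nu> t))"

text \<open>\<open>exp (- x)\<close> on \<open>[0, \<infinity>]\<close>, with value \<open>0\<close> at \<open>\<infinity>\<close>.\<close>
definition exp_minus :: "ereal \<Rightarrow> real" where
  "exp_minus x = (if x = \<infinity> then 0 else exp (- real_of_ereal x))"


section \<open>Sampling with replacement\<close>

text \<open>Cells are numbered \<open>1, \<dots>, N\<close>. The functions \<open>f\<^sub>m\<close> may be random: \<open>fn S m \<omega>\<close> is the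
  realisation of \<open>f\<^sub>m\<close> at \<open>\<omega>\<close>; non-random \<open>f\<^sub>m\<close> are those not depending on \<open>\<omega>\<close>.\<close>
record 'a sampling =
  prob_sp :: "'a measure"
  ssize :: nat
  cells :: nat
  prb :: "nat \<Rightarrow> real"
  xi :: "nat \<Rightarrow> 'a \<Rightarrow> nat"
  eta :: "nat \<Rightarrow> 'a \<Rightarrow> nat"
  fn :: "nat \<Rightarrow> 'a \<Rightarrow> real \<Rightarrow> real"

definition multinomial_vector ::
  "'a measure \<Rightarrow> nat \<Rightarrow> nat \<Rightarrow> (nat \<Rightarrow> real) \<Rightarrow> (nat \<Rightarrow> 'a \<Rightarrow> nat) \<Rightarrow> bool" where
  "multinomial_vector M n N p X \<longleftrightarrow>
     (\<forall>m\<in>{1..N}. X m \<in> measurable M (count_space UNIV)) \<and>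
     (\<forall>k. (\<Sum>m=1..N. k m) = n \<longrightarrow>
        measure M {\<omega> \<in> space M. \<forall>m\<in>{1..N}. X m \<omega> = k m}
          = fact n / (\<Prod>m=1..N. fact (k m)) * (\<Prod>m=1..N. p m ^ k m))"

definition fxi :: "'a sampling \<Rightarrow> nat \<Rightarrow> 'a \<Rightarrow> real" where
  "fxi S m \<omega> = fn S m \<omega> (real (xi S m \<omega>))"

definition xir :: "'a sampling \<Rightarrow> nat \<Rightarrow> 'a \<Rightarrow> real" where
  "xir S m \<omega> = real (xi S m \<omega>)"

abbreviation vec_space :: "nat \<Rightarrow> (nat \<Rightarrow> nat) measure" where
  "vec_space N \<equiv> Pi\<^sub>M {1..N} (\<lambda>_. count_space UNIV)"

abbreviation fun_space :: "nat \<Rightarrow> (nat \<times> real \<Rightarrow> real) measure" where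
  "fun_space N \<equiv> Pi\<^sub>M ({1..N} \<times> {0..}) (\<lambda>_. borel)"

definition random_vector :: "nat \<Rightarrow> (nat \<Rightarrow> 'a \<Rightarrow> nat) \<Rightarrow> 'a \<Rightarrow> nat \<Rightarrow> nat" where
  "random_vector N X \<omega> = (\<lambda>m\<in>{1..N}. X m \<omega>)"

definition random_functions :: "'a sampling \<Rightarrow> 'a \<Rightarrow> nat \<times> real \<Rightarrow> real" where
  "random_functions S \<omega> = (\<lambda>(m, y)\<in>{1..cells S} \<times> {0..}. fn S m \<omega> y)"

definition sampling_with_replacement :: "'a sampling \<Rightarrow> bool" where
  "sampling_with_replacement S \<longleftrightarrow>
     prob_space (prob_sp S) \<and>
     (\<forall>m\<in>{1..cells S}. 0 < prb S m) \<and> (\<Sum>m=1..cells S. prb S m) = 1 \<and>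
     multinomial_vector (prob_sp S) (ssize S) (cells S) (prb S) (eta S) \<and>
     prob_space.indep_vars (prob_sp S) (\<lambda>_. count_space UNIV) (xi S) {1..cells S} \<and>
     (\<forall>m\<in>{1..cells S}. distr (prob_sp S) (count_space UNIV) (xi S m)
         = measure_pmf (poisson_pmf (real (ssize S) * prb S m))) \<and>
     (\<forall>m\<in>{1..cells S}. \<forall>\<omega>\<in>space (prob_sp S).
         fn S m \<omega> \<in> borel_measurable (restrict_space borel {0..})) \<and>
     indep_rvs (prob_sp S) (fun_space (cells S)) (random_functions S)
        (vec_space (cells S)) (random_vector (cells S) (xi S)) \<and>
     indep_rvs (prob_sp S) (fun_space (cells S)) (random_functions S)
        (vec_space (cells S)) (random_vector (cells S) (eta S)) \<and>
     prob_space.indep_vars (prob_sp S) (\<lambda>_. borel) (\<lambda>m \<omega>. (fxi S m \<omega>, xir S m \<omega>)) {1..cells S}"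

definition R_N :: "'a sampling \<Rightarrow> 'a \<Rightarrow> real" where
  "R_N S \<omega> = (\<Sum>m=1..cells S. fn S m \<omega> (real (eta S m \<omega>)))"

definition lambda_N :: "'a sampling \<Rightarrow> real" where
  "lambda_N S = real (ssize S) / real (cells S)"

definition P_N :: "nat \<Rightarrow> 'a sampling \<Rightarrow> real" where
  "P_N i S = (\<Sum>m=1..cells S. prb S m ^ i)"


section \<open>Normalisation\<close>

abbreviation mean :: "'a sampling \<Rightarrow> ('a \<Rightarrow> real) \<Rightarrow> real" where
  "mean S X \<equiv> integral\<^sup>L (prob_sp S) X"

definition B2_N :: "'a sampling \<Rightarrow> real" where
  "B2_N S = (\<Sum>m=1..cells S. var_of (prob_sp S) (xir S m))"

definition Lambda_N :: "'a sampling \<Rightarrow> real" where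
  "Lambda_N S = (\<Sum>m=1..cells S. mean S (fxi S m))"

definition gamma_N :: "'a sampling \<Rightarrow> real" where
  "gamma_N S = (\<Sum>m=1..cells S. covar (prob_sp S) (fxi S m) (xir S m)) / B2_N S"

definition g_fun :: "'a sampling \<Rightarrow> nat \<Rightarrow> 'a \<Rightarrow> real \<Rightarrow> real" where
  "g_fun S m \<omega> y = fn S m \<omega> y - mean S (fxi S m) - gamma_N S * (y - mean S (xir S m))"

definition gxi :: "'a sampling \<Rightarrow> nat \<Rightarrow> 'a \<Rightarrow> real" where
  "gxi S m \<omega> = g_fun S m \<omega> (xir S m \<omega>)"

definition sigma2_N :: "'a sampling \<Rightarrow> real" where
  "sigma2_N S = (\<Sum>m=1..cells S. var_of (prob_sp S) (gxi S m))"

definition sigma_N :: "'a sampling \<Rightarrow> real" where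
  "sigma_N S = sqrt (sigma2_N S)"

definition g_hat :: "'a sampling \<Rightarrow> nat \<Rightarrow> 'a \<Rightarrow> real" where
  "g_hat S m \<omega> = gxi S m \<omega> / sqrt (sigma2_N S / real (cells S))"

definition xi_hat :: "'a sampling \<Rightarrow> nat \<Rightarrow> 'a \<Rightarrow> real" where
  "xi_hat S m \<omega> = (xir S m \<omega> - mean S (xir S m)) / sqrt (B2_N S / real (cells S))"

definition beta_N :: "nat \<Rightarrow> 'a sampling \<Rightarrow> real" where
  "beta_N j S = real (cells S) powr (- real j / 2) *
     (\<Sum>m=1..cells S. mean S (\<lambda>\<omega>. \<bar>g_hat S m \<omega>\<bar> ^ j))"


section \<open>Smoothness characteristic\<close>

text \<open>The independent copy of \<open>(f\<^sub>m(\<xi>\<^sub>m), \<xi>\<^sub>m)\<close> lives on the second factor of the product space.\<close>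
definition H_fun :: "'a sampling \<Rightarrow> nat \<Rightarrow> real \<Rightarrow> real \<Rightarrow> real" where
  "H_fun S m t \<tau> = (\<integral>(\<omega>, \<omega>'). (int_dist (t * (fxi S m \<omega> - fxi S m \<omega>')
                                  + \<tau> * (xir S m \<omega> - xir S m \<omega>')))\<^sup>2
                   \<partial>(prob_sp S \<Otimes>\<^sub>M prob_sp S))"

text \<open>Extended-real infimum, so that it is \<open>\<infinity>\<close> over the empty set.\<close>
definition Hbar_N :: "'a sampling \<Rightarrow> real \<Rightarrow> real \<Rightarrow> ereal" where
  "Hbar_N S a b =
     Inf {ereal (1 / real (cells S) * (\<Sum>m=1..cells S. H_fun S m (t / (2 * pi)) (\<tau> / (2 * pi)))) | t \<tau>.
            a / sigma_N S \<le> \<bar>t\<bar> \<and> \<bar>t\<bar> \<le> b / sigma_N S \<and> \<bar>\<tau>\<bar> \<le> pi}"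

definition calE_N :: "'a sampling \<Rightarrow> real" where
  "calE_N S = sqrt (1 / real (ssize S) + P_N 2 S) *
     (1 + min 1 (lambda_N S powr (- 1 / 2)) * sqrt (1 + real (ssize S) * P_N 2 S))"

definition T_N :: "'a sampling \<Rightarrow> real" where
  "T_N S = min (1 / beta_N 3 S) (1 / calE_N S)"


section \<open>Asymptotic expansion\<close>

abbreviation lin_comb :: "'a sampling \<Rightarrow> nat \<Rightarrow> real \<Rightarrow> real \<Rightarrow> 'a \<Rightarrow> real" where
  "lin_comb S m t \<tau> \<omega> \<equiv> t * g_hat S m \<omega> + \<tau> * xi_hat S m \<omega>"

definition P_exp1 :: "'a sampling \<Rightarrow> real \<Rightarrow> real \<Rightarrow> complex" where
  "P_exp1 S t \<tau> = \<i> ^ 3 / (6 * of_nat (cells S)) *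
     complex_of_real (\<Sum>m=1..cells S. mean S (\<lambda>\<omega>. lin_comb S m t \<tau> \<omega> ^ 3))"

definition P_exp2 :: "'a sampling \<Rightarrow> real \<Rightarrow> real \<Rightarrow> complex" where
  "P_exp2 S t \<tau> = \<i> ^ 4 / (24 * of_nat (cells S)) *
     complex_of_real (\<Sum>m=1..cells S. mean S (\<lambda>\<omega>. lin_comb S m t \<tau> \<omega> ^ 4)
                                     - 3 * (mean S (\<lambda>\<omega>. lin_comb S m t \<tau> \<omega> ^ 2))\<^sup>2)
     + 1 / 2 * (P_exp1 S t \<tau>)\<^sup>2"

definition gauss_avg :: "(real \<Rightarrow> complex) \<Rightarrow> complex" where
  "gauss_avg Q = complex_of_real (1 / sqrt (2 * pi)) *
     (\<integral>\<tau>. Q \<tau> * complex_of_real (exp (- \<tau>\<^sup>2 / 2)) \<partial>lborel)"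

definition G1_N :: "'a sampling \<Rightarrow> real \<Rightarrow> complex" where
  "G1_N S t = gauss_avg (P_exp1 S t)"

definition G2_N :: "'a sampling \<Rightarrow> real \<Rightarrow> complex" where
  "G2_N S t = gauss_avg (P_exp2 S t)"

definition W5 :: "'a sampling \<Rightarrow> real \<Rightarrow> complex" where
  "W5 S t = 1 + (G1_N S t - G1_N S 0) / complex_of_real (sqrt (real (cells S)))
     + (G2_N S t - G2_N S 0 - G1_N S 0 * (G1_N S t - G1_N S 0)) / of_nat (cells S)"

definition bbW5 :: "'a sampling \<Rightarrow> real \<Rightarrow> real" where
  "bbW5 S = (THE F. has_fourier_stieltjes F (\<lambda>t. W5 S t * complex_of_real (exp (- t\<^sup>2 / 2))))"

end

theory Submission
  imports Defs "HOL-Computational_Algebra.Polynomial"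
begin

text \<open>Conditioning on \<open>\<xi>\<^sub>1 + \<dots> + \<xi>\<^sub>N = n\<close> turns the characteristic function of \<open>(R\<^sub>N(\<eta>) - \<Lambda>\<^sub>N) / \<sigma>\<^sub>N\<close>
  into Bartlett's quotient \<open>I(u) / I(0)\<close>, where \<open>I(u)\<close> is the integral over \<open>\<bar>v\<bar> \<le> \<pi> \<surd>n\<close> of the product
  \<open>\<Psi>(u, v)\<close> of the characteristic functions of the independent pairs \<open>(g\<^sub>m(\<xi>\<^sub>m), \<xi>\<^sub>m)\<close>. For \<open>\<bar>u\<bar>\<close> below a
  multiple of \<open>T\<^sub>N\<close> the product is compared with its Edgeworth expansion, on three ranges of \<open>v\<close>: a Taylor
  expansion for small \<open>v\<close>, Gaussian decay of the factors for moderate \<open>v\<close>, and for large \<open>v\<close> the decay of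
  the Poisson factors alone, which beats the factor \<open>\<surd>n\<close> because \<open>P\<^sub>2\<^sub>N \<le> 1 / (10 ln n)\<close>. Averaging over \<open>v\<close> and
  dividing by \<open>I(0)\<close> produces \<open>W(u) exp (- u\<^sup>2 / 2)\<close>. For larger \<open>\<bar>u\<bar>\<close> each factor is at most
  \<open>exp (- H\<^sub>m / 2)\<close>, whence the third error term. Inversion over one period of the lattice, and over the whole
  line for the expansion, gives the local estimate.\<close>

section \<open>Elementary inequalities\<close>

text \<open>One scale carries the whole error: \<open>rho\<close> is the cube root of
  \<open>beta 5 + 46 * delta\<close>, so the target is a multiple of \<open>rho ^ 3\<close>, and
  moment sums of order j of both coordinates are at most of order \<open>rho ^ (j - 2)\<close>.
  Nothing makes \<open>rho\<close> small. Wherever an expansion needs smallness, the opposite case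
  is settled by bounding both sides separately; hence the many case splits and the crude explicit
  constants. The correction by \<open>gamma_N\<close> makes the coordinates uncorrelated only in
  total, so the quadratic form is u^2 + v^2 while each pair stays dependent. For large v the u-part
  is therefore treated as a perturbation. It costs a factor exp (u^2 / 2), affordable because
  \<bar>u\<bar> \<open>sqrt eps\<close> is at most 1/1000. In Bartlett's quotient the part of the
  average that does not depend on u cancels up to order \<open>rho ^ 3\<close>, so the expansion
  itself never has to be divided. A second obstacle is that the period of the lattice might end
  inside the range where the expansion is not yet negligible; the modulus 1 at multiples of the
  period excludes this for small \<open>rho\<close>.\<close>

lemma norm_exp_minus_quadratic_le:
  fixes z :: complex
  shows "norm (exp z - (1 + z + z\<^sup>2 / 2)) \<le> norm z ^ 3 * exp (norm z)"
proof -
  have s: "(\<Sum>k\<le>2. z ^ k / fact k) = 1 + z + z\<^sup>2 / 2"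
    by (simp add: numeral_2_eq_2 field_simps)
  have "norm (exp z - (\<Sum>k\<le>2. z ^ k / fact k)) \<le> exp \<bar>Re z\<bar> * (norm z ^ Suc 2) / fact 2"
    by (rule Taylor_exp)
  also have "\<dots> \<le> exp \<bar>Re z\<bar> * norm z ^ 3"
    by (simp add: numeral_3_eq_3 fact_numeral)
  also have "\<dots> \<le> exp (norm z) * norm z ^ 3"
    using abs_Re_le_cmod[of z] by (intro mult_right_mono) auto
  finally show ?thesis unfolding s by (simp add: mult.commute)
qed

lemma power_le_fact_exp:
  fixes x :: real
  assumes "0 \<le> x"
  shows "x ^ k \<le> fact k * exp x"
proof -
  have "(\<Sum>n\<in>{k}. x ^ n /\<^sub>R fact n) \<le> (\<Sum>n. x ^ n /\<^sub>R fact n)"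
    using assms by (intro sum_le_suminf summable_exp_generic) auto
  then have "x ^ k / fact k \<le> exp x"
    by (simp add: exp_def scaleR_conv_of_real field_simps)
  then show ?thesis by (simp add: field_simps)
qed

text \<open>Jordan's inequality: sine is concave on [0, \<pi>], so on [0, \<pi>/2] it lies above the
  chord through the end points.\<close>

lemma sin_ge_two_over_pi:
  fixes x :: real
  assumes "0 \<le> x" "x \<le> pi / 2"
  shows "2 / pi * x \<le> sin x"
proof -
  have "concave_on {0..pi} sin"
    by (rule f''_le0_imp_concave[where f' = cos and f'' = "\<lambda>x. - sin x"])
       (auto intro!: derivative_eq_intros sin_ge_zero)
  from concave_onD[OF this, of "2 / pi * x" 0 "pi / 2"] show ?thesis
    using assms by (simp add: field_simps)
qed

text \<open>Half-angle form of Jordan's inequality. A quadratic lower bound valid on a whole period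
  is what both the Poisson factors and the distance to the nearest integer require.\<close>

lemma one_minus_cos_ge:
  fixes x :: real
  assumes "\<bar>x\<bar> \<le> pi"
  shows "2 / pi\<^sup>2 * x\<^sup>2 \<le> 1 - cos x"
proof -
  have "2 / pi * (\<bar>x\<bar> / 2) \<le> sin (\<bar>x\<bar> / 2)"
    using assms by (intro sin_ge_two_over_pi) auto
  then have "(2 / pi * (\<bar>x\<bar> / 2))\<^sup>2 \<le> (sin (\<bar>x\<bar> / 2))\<^sup>2"
    by (intro power_mono) auto
  moreover have "1 - cos \<bar>x\<bar> = 2 * (sin (\<bar>x\<bar> / 2))\<^sup>2"
    using cos_double_sin[of "\<bar>x\<bar> / 2"] by simp
  moreover have "2 * (2 / pi * (\<bar>x\<bar> / 2))\<^sup>2 = 2 / pi\<^sup>2 * x\<^sup>2"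
    by (simp add: power_divide)
  ultimately show ?thesis by simp
qed

text \<open>After the half-angle formula this is \<open>\<bar>sin (A - B)\<bar> \<le> \<bar>sin
  A\<bar> + \<bar>sin B\<bar>\<close>, squared. The contribution of b thus survives a perturbation a
  that may depend on it.\<close>

lemma one_minus_cos_add_ge:
  fixes a b :: real
  shows "1 - cos (a + b) \<ge> (1 - cos b) / 2 - (1 - cos a)"
proof -
  have h: "1 - cos x = 2 * (sin (x / 2))\<^sup>2" for x :: real
    using cos_double_sin[of "x / 2"] by simp
  define A B where "A = (a + b) / 2" and "B = a / 2"
  have "sin (b / 2) = sin (A - B)" by (simp add: A_def B_def field_simps)
  also have "\<dots> = sin A * cos B - cos A * sin B" by (rule sin_diff)
  finally have "\<bar>sin (b / 2)\<bar> \<le> \<bar>sin A\<bar> * \<bar>cos B\<bar> + \<bar>cos A\<bar> * \<bar>sin B\<bar>"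
    by (metis abs_mult abs_triangle_ineq4)
  also have "\<dots> \<le> \<bar>sin A\<bar> + \<bar>sin B\<bar>"
    by (intro add_mono) (auto simp: mult_left_le mult_left_le_one_le)
  finally have "(sin (b / 2))\<^sup>2 \<le> (\<bar>sin A\<bar> + \<bar>sin B\<bar>)\<^sup>2"
    by (metis abs_ge_zero power2_abs power_mono)
  also have "\<dots> \<le> 2 * (sin A)\<^sup>2 + 2 * (sin B)\<^sup>2"
    using sum_squares_bound[of "\<bar>sin A\<bar>" "\<bar>sin B\<bar>"] by (simp add: power2_sum)
  finally show ?thesis unfolding h A_def B_def by simp
qed

lemma one_minus_exp_ge:
  fixes y :: real
  assumes "0 \<le> y"
  shows "y / (1 + y) \<le> 1 - exp (- y)"
proof -
  have "exp (- y) \<le> 1 / (1 + y)"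
    using assms exp_ge_add_one_self[of y] by (simp add: exp_minus field_simps)
  moreover have "1 / (1 + y) = 1 - y / (1 + y)" using assms by (simp add: field_simps)
  ultimately show ?thesis by linarith
qed

text \<open>Cauchy-Schwarz for y = sqrt (y / (1 + y)) * sqrt (y + y^2). The sum of saturated terms
  is bounded below through the first two power sums alone.\<close>

lemma sum_ratio_ge:
  fixes y :: "'b \<Rightarrow> real"
  assumes "finite I" "\<And>i. i \<in> I \<Longrightarrow> 0 < y i" "I \<noteq> {}"
  shows "(\<Sum>i\<in>I. y i)\<^sup>2 / (\<Sum>i\<in>I. y i + (y i)\<^sup>2) \<le> (\<Sum>i\<in>I. y i / (1 + y i))"
proof -
  have pos: "0 < (\<Sum>i\<in>I. y i + (y i)\<^sup>2)"
    using assms by (intro sum_pos) (auto simp: add_pos_nonneg)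
  have "(\<Sum>i\<in>I. y i)\<^sup>2 = (\<Sum>i\<in>I. sqrt (y i / (1 + y i)) * sqrt (y i + (y i)\<^sup>2))\<^sup>2"
  proof -
    have "y i = sqrt (y i / (1 + y i)) * sqrt (y i + (y i)\<^sup>2)" if "i \<in> I" for i
    proof -
      have "y i / (1 + y i) * (y i + (y i)\<^sup>2) = (y i)\<^sup>2"
        using assms(2)[OF that] by (simp add: field_simps power2_eq_square)
      then show ?thesis
        using assms(2)[OF that] by (simp add: real_sqrt_mult[symmetric] del: real_sqrt_mult)
    qed
    then show ?thesis by (simp cong: sum.cong)
  qed
  also have "\<dots> \<le> (\<Sum>i\<in>I. (sqrt (y i / (1 + y i)))\<^sup>2) * (\<Sum>i\<in>I. (sqrt (y i + (y i)\<^sup>2))\<^sup>2)"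
    by (rule Cauchy_Schwarz_ineq_sum)
  also have "\<dots> = (\<Sum>i\<in>I. y i / (1 + y i)) * (\<Sum>i\<in>I. y i + (y i)\<^sup>2)"
    using assms by (intro arg_cong2[where f = "(*)"] sum.cong) (auto simp: less_imp_le)
  finally show ?thesis using pos by (simp add: pos_divide_le_eq)
qed

text \<open>Meant for x = 1 / (2 n + 1), where the quotient becomes (n + 1) / n.\<close>

lemma two_x_le_ln:
  fixes x :: real
  assumes "0 \<le> x" "x < 1"
  shows "2 * x \<le> ln ((1 + x) / (1 - x))"
proof -
  define f where "f = (\<lambda>x::real. ln (1 + x) - ln (1 - x) - 2 * x)"
  have "f 0 \<le> f x"
  proof (rule DERIV_nonneg_imp_nondecreasing[of 0 x f])
    show "0 \<le> x" by fact
    fix y assume y: "0 \<le> y" "y \<le> x"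
    have "(f has_real_derivative (1 / (1 + y) + 1 / (1 - y) - 2)) (at y)"
      unfolding f_def using y assms by (auto intro!: derivative_eq_intros)
    moreover have "1 / (1 + y) + 1 / (1 - y) - 2 = 2 * y\<^sup>2 / (1 - y\<^sup>2)"
    proof -
      have "y * y < 1" using y assms mult_strict_mono[of y 1 y 1] by (cases "y = 0") auto
      moreover have "1 - y\<^sup>2 = (1 + y) * (1 - y)" by algebra
      ultimately show ?thesis using y assms by (simp add: field_simps power2_eq_square)
    qed
    moreover have "y\<^sup>2 \<le> 1" using y assms by (simp add: power_le_one)
    ultimately show "\<exists>z. (f has_real_derivative z) (at y) \<and> 0 \<le> z"
      by (intro exI[of _ "2 * y\<^sup>2 / (1 - y\<^sup>2)"]) auto
  qed
  then show ?thesis using assms by (simp add: f_def ln_div)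
qed

text \<open>Stirling's upper bound with the constant e. The induction step amounts to ((n + 1) /
  n)^(n + 1/2) being at least e, which is \<open>two_x_le_ln\<close> at 1 / (2 n + 1). It will bound
  from below the probability that the total count equals n.\<close>

lemma fact_upper_bound:
  fixes n :: nat
  assumes "1 \<le> n"
  shows "fact n \<le> exp 1 * sqrt n * (real n ^ n * exp (- real n))"
  using assms
proof (induction n rule: dec_induct)
  case base
  then show ?case by (simp add: exp_add[symmetric])
next
  case (step n)
  have n: "0 < real n" using step by simp
  have "1 \<le> (real n + 1 / 2) * ln ((real n + 1) / real n)"
  proof -
    have "2 * (1 / (2 * real n + 1)) \<le> ln ((1 + 1 / (2 * real n + 1)) / (1 - 1 / (2 * real n + 1)))"
      using n by (intro two_x_le_ln) auto
    moreover have "(1 + 1 / (2 * real n + 1)) / (1 - 1 / (2 * real n + 1)) = (real n + 1) / real n"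
    proof -
      have "1 + 1 / (2 * real n + 1) = 2 * (real n + 1) / (2 * real n + 1)"
        "1 - 1 / (2 * real n + 1) = 2 * real n / (2 * real n + 1)"
        using n by (simp_all add: field_simps)
      then have "(1 + 1 / (2 * real n + 1)) / (1 - 1 / (2 * real n + 1))
          = (2 * (real n + 1) / (2 * real n + 1)) / (2 * real n / (2 * real n + 1))"
        by (simp only:)
      also have "\<dots> = (2 * (real n + 1)) / (2 * real n)" using n by simp
      also have "\<dots> = (real n + 1) / real n" by (rule mult_divide_mult_cancel_left) simp
      finally show ?thesis .
    qed
    ultimately have "2 * (1 / (2 * real n + 1)) \<le> ln ((real n + 1) / real n)" by (simp only:)
    then show ?thesis using n by (simp add: field_simps)
  qed
  then have "exp 1 \<le> exp ((n + 1 / 2) * ln ((real n + 1) / real n))" by (simp add: add.commute)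
  also have "\<dots> = ((real n + 1) / real n) powr (n + 1 / 2)" using n by (simp add: powr_def)
  also have "\<dots> = ((real n + 1) / real n) ^ n * sqrt ((real n + 1) / real n)"
    using n by (simp add: powr_add powr_realpow powr_half_sqrt)
  finally have e: "exp 1 \<le> ((real n + 1) / real n) ^ n * sqrt ((real n + 1) / real n)" .
  have "fact (Suc n) = (real n + 1) * fact n" by simp
  also have "\<dots> \<le> (real n + 1) * (exp 1 * sqrt n * (real n ^ n * exp (- real n)))"
    using step by (intro mult_left_mono) auto
  also have "\<dots> = exp 1 * ((real n + 1) * sqrt n * real n ^ n * exp (- real (Suc n))) * exp 1"
    using exp_add[of "- real (Suc n)" 1] by simp
  also have "\<dots> \<le> exp 1 * ((real n + 1) * sqrt n * real n ^ n * exp (- real (Suc n))) * (((real n + 1) / real n) ^ n * sqrt ((real n + 1) / real n))"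
    by (intro mult_left_mono e) auto
  also have "\<dots> = exp 1 * sqrt (Suc n) * (real (Suc n) ^ Suc n * exp (- real (Suc n)))"
    using n by (simp add: power_divide real_sqrt_divide field_simps)
  finally show ?case .
qed

section \<open>Taylor expansion of characteristic functions\<close>

lemma power_le_one_plus_power:
  fixes x :: real
  assumes "0 \<le> x" "j \<le> k"
  shows "x ^ j \<le> 1 + x ^ k"
proof (cases "x \<le> 1")
  case True
  then have "x ^ j \<le> 1" "0 \<le> x ^ k" using assms by (auto simp: power_le_one)
  then show ?thesis by linarith
next
  case False
  then have "x ^ j \<le> x ^ k" using assms by (intro power_increasing) auto
  then show ?thesis by linarith
qed

text \<open>A form of Lyapunov's inequality that passes to sums, at the price of a factor 2.\<close>

lemma power_interpolation:
  fixes x m :: real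
  assumes "0 < m" "0 \<le> x" "2 \<le> j" "j \<le> 5"
  shows "x ^ j \<le> m ^ (j - 2) * x\<^sup>2 + x ^ 5 / m ^ (5 - j)"
proof (cases "x \<le> m")
  case True
  have "x ^ j = x ^ (j - 2) * x\<^sup>2" using assms by (metis le_add_diff_inverse2 power_add)
  also have "\<dots> \<le> m ^ (j - 2) * x\<^sup>2" using True assms by (intro mult_right_mono power_mono) auto
  finally show ?thesis using assms by (simp add: add_increasing2)
next
  case False
  have "x ^ j * m ^ (5 - j) \<le> x ^ j * x ^ (5 - j)"
    using False assms by (intro mult_left_mono power_mono) auto
  also have "\<dots> = x ^ 5" using assms by (simp flip: power_add)
  finally have "x ^ j \<le> x ^ 5 / m ^ (5 - j)" using assms by (simp add: field_simps)
  then show ?thesis using assms by (simp add: add_increasing)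
qed

text \<open>Counterpart for one random variable: below the threshold m the constant m^j replaces the
  second moment, since a probability measure integrates it to itself.\<close>

lemma power_interpolation_const:
  fixes x m :: real
  assumes "0 < m" "0 \<le> x" "j \<le> 5"
  shows "x ^ j \<le> m ^ j + x ^ 5 / m ^ (5 - j)"
proof (cases "x \<le> m")
  case True
  then have "x ^ j \<le> m ^ j" using assms by (intro power_mono) auto
  then show ?thesis using assms by (simp add: add_increasing2)
next
  case False
  have "x ^ j * m ^ (5 - j) \<le> x ^ j * x ^ (5 - j)"
    using False assms by (intro mult_left_mono power_mono) auto
  also have "\<dots> = x ^ 5" using assms by (simp flip: power_add)
  finally have "x ^ j \<le> x ^ 5 / m ^ (5 - j)" using assms by (simp add: field_simps)
  then show ?thesis using assms by (simp add: add_increasing)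
qed

lemma norm_integral_le_integral:
  fixes f :: "'a \<Rightarrow> 'b::{banach, second_countable_topology}"
  assumes "integrable M g" "\<And>x. x \<in> space M \<Longrightarrow> norm (f x) \<le> g x"
  shows "norm (integral\<^sup>L M f) \<le> integral\<^sup>L M g"
  using assms
  by (intro order_trans[OF integral_norm_bound integral_mono']) (auto intro: order_trans[OF norm_ge_zero])

context prob_space
begin

lemma integrable_abs_power_mono:
  assumes [measurable]: "X \<in> borel_measurable M"
    and "integrable M (\<lambda>\<omega>. \<bar>X \<omega>\<bar> ^ k)" "j \<le> k"
  shows "integrable M (\<lambda>\<omega>. \<bar>X \<omega> :: real\<bar> ^ j)"
proof (rule Bochner_Integration.integrable_bound)
  show "integrable M (\<lambda>\<omega>. 1 + \<bar>X \<omega>\<bar> ^ k)" using assms by simp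
  show "AE \<omega> in M. norm (\<bar>X \<omega>\<bar> ^ j) \<le> norm (1 + \<bar>X \<omega>\<bar> ^ k)"
    using power_le_one_plus_power[OF abs_ge_zero assms(3)] by (auto simp: abs_of_nonneg add_nonneg_nonneg)
qed simp

lemma integrable_power_mono:
  assumes [measurable]: "X \<in> borel_measurable M"
    and "integrable M (\<lambda>\<omega>. \<bar>X \<omega>\<bar> ^ k)" "j \<le> k"
  shows "integrable M (\<lambda>\<omega>. (X \<omega> :: real) ^ j)"
  using integrable_abs_power_mono[OF assms]
  by (subst integrable_norm_iff[symmetric]) (auto simp: power_abs)

lemma cmod_char_variable_le_1:
  "cmod (expectation (\<lambda>\<omega>. iexp (X \<omega>))) \<le> 1"
proof (cases "integrable M (\<lambda>\<omega>. iexp (X \<omega>))")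
  case True
  have "cmod (expectation (\<lambda>\<omega>. iexp (X \<omega>))) \<le> (\<integral>\<omega>. cmod (iexp (X \<omega>)) \<partial>M)" by (rule integral_norm_bound)
  also have "\<dots> = 1" by (simp add: prob_space)
  finally show ?thesis .
qed (simp add: not_integrable_integral_eq)

lemma char_variable_taylor:
  assumes [measurable]: "X \<in> borel_measurable M" and "integrable M (\<lambda>\<omega>. \<bar>X \<omega>\<bar> ^ Suc k)"
  shows "cmod (expectation (\<lambda>\<omega>. iexp (X \<omega>)) - (\<Sum>j\<le>k. \<i> ^ j * of_real (expectation (\<lambda>\<omega>. X \<omega> ^ j)) / fact j))
           \<le> expectation (\<lambda>\<omega>. \<bar>X \<omega>\<bar> ^ Suc k) / fact (Suc k)"
proof -
  have i: "integrable M (\<lambda>\<omega>. X \<omega> ^ j)" if "j \<le> k" for j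
    using integrable_power_mono[OF assms, of j] that by simp
  have ic: "integrable M (\<lambda>\<omega>. (\<i> * of_real (X \<omega>)) ^ j / fact j)" if "j \<le> k" for j
    using integrable_of_real[OF i[OF that], where 'a = complex] by (simp add: power_mult_distrib)
  have ie: "integrable M (\<lambda>\<omega>. iexp (X \<omega>))" by (rule integrable_iexp) auto
  have "(\<Sum>j\<le>k. \<i> ^ j * of_real (expectation (\<lambda>\<omega>. X \<omega> ^ j)) / fact j)
      = (\<Sum>j\<le>k. expectation (\<lambda>\<omega>. (\<i> * of_real (X \<omega>)) ^ j / fact j))"
    by (intro sum.cong refl) (simp add: power_mult_distrib flip: integral_complex_of_real of_real_power)
  also have "\<dots> = expectation (\<lambda>\<omega>. \<Sum>j\<le>k. (\<i> * of_real (X \<omega>)) ^ j / fact j)"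
    by (intro Bochner_Integration.integral_sum[symmetric] ic) auto
  finally have "expectation (\<lambda>\<omega>. iexp (X \<omega>)) - (\<Sum>j\<le>k. \<i> ^ j * of_real (expectation (\<lambda>\<omega>. X \<omega> ^ j)) / fact j)
     = expectation (\<lambda>\<omega>. iexp (X \<omega>) - (\<Sum>j\<le>k. (\<i> * of_real (X \<omega>)) ^ j / fact j))"
    by (simp only:) (intro Bochner_Integration.integral_diff[symmetric] ie Bochner_Integration.integrable_sum ic, auto)
  also have "cmod \<dots> \<le> expectation (\<lambda>\<omega>. \<bar>X \<omega>\<bar> ^ Suc k / fact (Suc k))"
  proof (rule norm_integral_le_integral)
    show "integrable M (\<lambda>\<omega>. \<bar>X \<omega>\<bar> ^ Suc k / fact (Suc k))" using assms(2) by (rule integrable_divide)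
  qed (rule iexp_approx1)
  finally show ?thesis by simp
qed

text \<open>If the second moment s is at most 2, the Taylor polynomial 1 - s / 2 is nonnegative and
  1 + y \<le> exp y finishes. If s exceeds 2, the third absolute moment is at least s - 1 > s / 2,
  so the exponent is positive and the trivial bound 1 suffices. The bound therefore holds at every
  scale of X.\<close>

lemma char_variable_le_exp:
  assumes [measurable]: "X \<in> borel_measurable M" and X3: "integrable M (\<lambda>\<omega>. \<bar>X \<omega>\<bar> ^ 3)"
    and X0: "expectation X = 0"
  shows "cmod (expectation (\<lambda>\<omega>. iexp (X \<omega>)))
           \<le> exp (- expectation (\<lambda>\<omega>. (X \<omega>)\<^sup>2) / 2 + expectation (\<lambda>\<omega>. \<bar>X \<omega>\<bar> ^ 3))"
proof -
  define s where "s = expectation (\<lambda>\<omega>. (X \<omega>)\<^sup>2)"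
  define b where "b = expectation (\<lambda>\<omega>. \<bar>X \<omega>\<bar> ^ 3)"
  have b0: "0 \<le> b" unfolding b_def by simp
  show ?thesis
  proof (cases "s \<le> 2")
    case True
    have "(\<Sum>j\<le>2. \<i> ^ j * of_real (expectation (\<lambda>\<omega>. X \<omega> ^ j)) / fact j) = of_real (1 - s / 2)"
      using X0 by (simp add: numeral_2_eq_2 s_def prob_space)
    with char_variable_taylor[of X 2] X3
    have "cmod (expectation (\<lambda>\<omega>. iexp (X \<omega>)) - of_real (1 - s / 2)) \<le> b / fact 3"
      by (simp add: numeral_3_eq_3[symmetric] b_def)
    then have "cmod (expectation (\<lambda>\<omega>. iexp (X \<omega>))) \<le> cmod (of_real (1 - s / 2)) + b / 6"
      using norm_triangle_sub[of "expectation (\<lambda>\<omega>. iexp (X \<omega>))" "of_real (1 - s / 2)"] by (simp add: fact_numeral)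
    also have "\<dots> \<le> 1 + (- s / 2 + b)"
      using True b0 by (simp only: norm_of_real)
    also have "\<dots> \<le> exp (- s / 2 + b)" by (rule exp_ge_add_one_self)
    finally show ?thesis by (simp add: s_def b_def)
  next
    case False
    have sb: "s \<le> expectation (\<lambda>\<omega>. 1 + \<bar>X \<omega>\<bar> ^ 3)"
      unfolding s_def using X3 integrable_power_mono[OF assms(1) X3, of 2]
      using power_le_one_plus_power[of "\<bar>X _\<bar>" 2 3] by (intro integral_mono) auto
    also have "\<dots> = 1 + b" using X3 by (simp add: b_def prob_space)
    finally have "0 \<le> - s / 2 + b" using False by simp
    then have "1 \<le> exp (- s / 2 + b)" by (simp only: one_le_exp_iff)
    then show ?thesis using cmod_char_variable_le_1[of X] unfolding s_def b_def by linarith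
  qed
qed

text \<open>The comparison is with the exponential of the cumulants up to order four, so that
  exponents add in a product. As m bounds the norm of order five, absolute moments of order j up to
  five are at most 2 m^j. The error consists of 64 m^5 from the exponential series, 2 m^5 from mixed
  terms and m^5 / 120 from Taylor's formula.\<close>

lemma char_variable_cumulants:
  assumes [measurable]: "X \<in> borel_measurable M" and X5: "integrable M (\<lambda>\<omega>. \<bar>X \<omega>\<bar> ^ 5)"
    and X0: "expectation X = 0" and m: "expectation (\<lambda>\<omega>. \<bar>X \<omega>\<bar> ^ 5) \<le> m ^ 5" "0 < m" "m \<le> 1"
  shows "cmod (expectation (\<lambda>\<omega>. iexp (X \<omega>))
           - exp (Complex (- expectation (\<lambda>\<omega>. (X \<omega>)\<^sup>2) / 2
                     + (expectation (\<lambda>\<omega>. X \<omega> ^ 4) - 3 * (expectation (\<lambda>\<omega>. (X \<omega>)\<^sup>2))\<^sup>2) / 24)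
                (- expectation (\<lambda>\<omega>. X \<omega> ^ 3) / 6))) \<le> 70 * m ^ 5"
proof -
  define s where "s = expectation (\<lambda>\<omega>. (X \<omega>)\<^sup>2)"
  define \<mu>3 where "\<mu>3 = expectation (\<lambda>\<omega>. X \<omega> ^ 3)"
  define \<mu>4 where "\<mu>4 = expectation (\<lambda>\<omega>. X \<omega> ^ 4)"
  define z where "z = Complex ((\<mu>4 - 3 * s\<^sup>2) / 24) (- \<mu>3 / 6)"
  define Z where "Z = of_real (- s / 2) + z"
  have mom: "expectation (\<lambda>\<omega>. \<bar>X \<omega>\<bar> ^ j) \<le> 2 * m ^ j" if "j \<le> 5" for j
  proof -
    have "expectation (\<lambda>\<omega>. \<bar>X \<omega>\<bar> ^ j) \<le> expectation (\<lambda>\<omega>. m ^ j + \<bar>X \<omega>\<bar> ^ 5 / m ^ (5 - j))"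
      using X5 integrable_abs_power_mono[OF assms(1) X5 that] power_interpolation_const[OF m(2) abs_ge_zero that]
      by (intro integral_mono) auto
    also have "\<dots> = m ^ j + expectation (\<lambda>\<omega>. \<bar>X \<omega>\<bar> ^ 5) / m ^ (5 - j)"
      using X5 by (simp add: prob_space)
    also have "\<dots> \<le> m ^ j + m ^ 5 / m ^ (5 - j)"
      using m by (intro add_left_mono divide_right_mono) auto
    also have "m ^ 5 / m ^ (5 - j) = m ^ j" using that m by (simp add: power_diff)
    finally show ?thesis by simp
  qed
  have s: "0 \<le> s" "s \<le> 2 * m\<^sup>2" using mom[of 2] by (auto simp: s_def)
  have m3: "\<bar>\<mu>3\<bar> \<le> 2 * m ^ 3"
    using order_trans[OF integral_abs_bound[of M "\<lambda>\<omega>. X \<omega> ^ 3"]] mom[of 3] by (simp add: \<mu>3_def power_abs)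
  have m4: "\<bar>\<mu>4\<bar> \<le> 2 * m ^ 4"
    using order_trans[OF integral_abs_bound[of M "\<lambda>\<omega>. X \<omega> ^ 4"]] mom[of 4] by (simp add: \<mu>4_def power_abs)
  have le: "m ^ j \<le> m ^ k" if "k \<le> j" for j k using m that by (intro power_decreasing) auto
  have s2: "s\<^sup>2 \<le> 4 * m ^ 4"
    using power_mono[OF s(2) s(1), of 2] by (simp add: power_mult_distrib flip: power_mult)
  have z: "cmod z \<le> m ^ 3"
  proof -
    have "cmod z \<le> \<bar>(\<mu>4 - 3 * s\<^sup>2) / 24\<bar> + \<bar>- \<mu>3 / 6\<bar>"
      unfolding z_def using cmod_le[of "Complex ((\<mu>4 - 3 * s\<^sup>2) / 24) (- \<mu>3 / 6)"] by simp
    also have "\<dots> \<le> 14 / 24 * m ^ 4 + m ^ 3 / 3"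
    proof -
      have "0 \<le> m ^ 4" using m by simp
      then have "\<bar>\<mu>4 - 3 * s\<^sup>2\<bar> \<le> 14 * m ^ 4"
        using s2 m4 zero_le_power2[of s] unfolding abs_le_iff by linarith
      then show ?thesis using m3 by simp
    qed
    also have "\<dots> \<le> m ^ 3" using le[of 3 4] zero_le_power[of m 3] m(2) by linarith
    finally show ?thesis .
  qed
  have Z: "cmod Z \<le> 2 * m\<^sup>2"
  proof -
    have "cmod Z \<le> s / 2 + cmod z"
      unfolding Z_def by (rule order_trans[OF norm_triangle_ineq]) (simp add: s(1) del: of_real_minus of_real_divide)
    also have "\<dots> \<le> m\<^sup>2 + m ^ 3" using s z by simp
    also have "\<dots> \<le> 2 * m\<^sup>2" using le[of 2 3] by simp
    finally show ?thesis .
  qed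
  have e: "exp (cmod Z) \<le> 8"
  proof -
    have "cmod Z \<le> 2" using Z le[of 0 2] by simp
    then have "exp (cmod Z) \<le> exp 1 * exp 1" by (simp flip: exp_add)
    also have "\<dots> \<le> 2.8 * 2.8" using e_less_272 by (intro mult_mono) auto
    finally show ?thesis by simp
  qed
  have 1: "cmod (exp Z - (1 + Z + Z\<^sup>2 / 2)) \<le> 64 * m ^ 5"
  proof -
    have "cmod (exp Z - (1 + Z + Z\<^sup>2 / 2)) \<le> cmod Z ^ 3 * exp (cmod Z)"
      by (rule norm_exp_minus_quadratic_le)
    also have "\<dots> \<le> (2 * m\<^sup>2) ^ 3 * 8" using Z e by (intro mult_mono power_mono) auto
    also have "\<dots> \<le> 64 * m ^ 5" using le[of 5 6] by (simp add: power_mult_distrib flip: power_mult)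
    finally show ?thesis .
  qed
  \<comment> \<open>The term s^2 / 8 of Z^2 / 2 is kept, because it cancels the - 3 s^2 / 24 inside
    z and leaves the plain Taylor polynomial with \<mu>4 / 24. The other terms of Z^2 / 2 have order
    five or higher.\<close>
  have 2: "cmod (1 + Z + Z\<^sup>2 / 2 - (1 + of_real (- s / 2) + z + of_real (s\<^sup>2 / 8))) \<le> 2 * m ^ 5"
  proof -
    have "1 + Z + Z\<^sup>2 / 2 - (1 + of_real (- s / 2) + z + of_real (s\<^sup>2 / 8)) = - of_real (s / 2) * z + z\<^sup>2 / 2"
      unfolding Z_def by (simp add: power2_eq_square field_simps)
    also have "cmod \<dots> \<le> s / 2 * cmod z + cmod z ^ 2 / 2"
      using s(1) by (intro order_trans[OF norm_triangle_ineq]) (simp add: norm_mult norm_power norm_divide)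
    also have "\<dots> \<le> m\<^sup>2 * m ^ 3 + (m ^ 3)\<^sup>2 / 2"
      using s z by (intro add_mono mult_mono divide_right_mono power_mono) auto
    also have "\<dots> \<le> 2 * m ^ 5"
    proof -
      have "m\<^sup>2 * m ^ 3 = m ^ 5" "(m ^ 3)\<^sup>2 = m ^ 6" by (simp_all flip: power_mult power_add)
      moreover have "0 \<le> m ^ 5" using m by simp
      ultimately show ?thesis using le[of 5 6] by linarith
    qed
    finally show ?thesis .
  qed
  have 3: "cmod (expectation (\<lambda>\<omega>. iexp (X \<omega>)) - (1 + of_real (- s / 2) + z + of_real (s\<^sup>2 / 8))) \<le> m ^ 5 / 120"
  proof -
    have "(\<Sum>j\<le>4. \<i> ^ j * of_real (expectation (\<lambda>\<omega>. X \<omega> ^ j)) / fact j) = 1 + of_real (- s / 2) + z + of_real (s\<^sup>2 / 8)"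
    proof -
      have e: "(\<Sum>j\<le>4. F j) = F 0 + F 1 + F 2 + F 3 + F 4" for F :: "nat \<Rightarrow> complex"
      proof -
        have "{..4::nat} = {0,1,2,3,4}" by auto
        then show ?thesis by (simp add: ac_simps)
      qed
      have i: "\<i> ^ 3 = - \<i>" "\<i> ^ 4 = 1" by (simp_all add: power3_eq_cube power4_eq_xxxx)
      show ?thesis
        unfolding e s_def \<mu>3_def \<mu>4_def z_def
        using X0 by (simp add: i prob_space complex_eq_iff fact_numeral field_simps)
    qed
    with char_variable_taylor[of X 4] X5 m(1) show ?thesis
      by (simp add: fact_numeral)
  qed
  have tri: "cmod (a - d) \<le> cmod (a - b) + cmod (d - c) + cmod (c - b)" for a b c d :: complex
    using norm_triangle_ineq4[of "a - b" "d - b"] norm_triangle_ineq[of "d - c" "c - b"] by simp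
  have "0 \<le> m ^ 5" using m by simp
  with 1 2 3 tri[of "expectation (\<lambda>\<omega>. iexp (X \<omega>))" "exp Z"
      "1 + of_real (- s / 2) + z + of_real (s\<^sup>2 / 8)" "1 + Z + Z\<^sup>2 / 2"]
  have "cmod (expectation (\<lambda>\<omega>. iexp (X \<omega>)) - exp Z) \<le> 70 * m ^ 5"
    by linarith
  moreover have "Z = Complex (- s / 2 + (\<mu>4 - 3 * s\<^sup>2) / 24) (- \<mu>3 / 6)"
    by (simp add: Z_def z_def complex_eq_iff)
  ultimately show ?thesis by (simp add: s_def \<mu>3_def \<mu>4_def)
qed

end

section \<open>Symmetrisation of characteristic functions\<close>

context prob_space
begin

lemma
  fixes f g :: "'a \<Rightarrow> real"
  assumes f: "integrable M f" and g: "integrable M g"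
  shows integrable_pair_mult: "integrable (M \<Otimes>\<^sub>M M) (\<lambda>(\<omega>, \<omega>'). f \<omega> * g \<omega>')"
    and integral_pair_mult: "(\<integral>(\<omega>, \<omega>'). f \<omega> * g \<omega>' \<partial>(M \<Otimes>\<^sub>M M)) = expectation f * expectation g"
proof -
  interpret P: pair_prob_space M M ..
  note [measurable] = borel_measurable_integrable[OF f] borel_measurable_integrable[OF g]
  show i: "integrable (M \<Otimes>\<^sub>M M) (\<lambda>(\<omega>, \<omega>'). f \<omega> * g \<omega>')"
  proof (rule P.Fubini_integrable)
    show "integrable M (\<lambda>x. \<integral>y. norm (case (x, y) of (\<omega>, \<omega>') \<Rightarrow> f \<omega> * g \<omega>') \<partial>M)"
      using f g by (simp add: abs_mult)
    show "AE x in M. integrable M (\<lambda>y. case (x, y) of (\<omega>, \<omega>') \<Rightarrow> f \<omega> * g \<omega>')"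
      using g by simp
  qed simp
  show "(\<integral>(\<omega>, \<omega>'). f \<omega> * g \<omega>' \<partial>(M \<Otimes>\<^sub>M M)) = expectation f * expectation g"
    using P.integral_fst'[OF i] by simp
qed

lemma integrable_bounded_real:
  fixes f :: "'a \<Rightarrow> real"
  assumes "f \<in> borel_measurable M" "\<And>\<omega>. \<bar>f \<omega>\<bar> \<le> B"
  shows "integrable M f"
  using assms by (intro integrable_const_bound[of _ B]) auto

text \<open>The squared modulus is the characteristic function of the difference of two independent
  copies; it is real, so only the cosine remains.\<close>

lemma
  assumes [measurable]: "X \<in> borel_measurable M"
  shows cmod_char_variable_sq: "(cmod (expectation (\<lambda>\<omega>. iexp (X \<omega>))))\<^sup>2
      = (\<integral>(\<omega>, \<omega>'). cos (X \<omega> - X \<omega>') \<partial>(M \<Otimes>\<^sub>M M))"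
    and integrable_pair_cos: "integrable (M \<Otimes>\<^sub>M M) (\<lambda>(\<omega>, \<omega>'). cos (X \<omega> - X \<omega>'))"
proof -
  have c: "integrable M (\<lambda>\<omega>. cos (X \<omega>))" and s: "integrable M (\<lambda>\<omega>. sin (X \<omega>))"
    by (rule integrable_bounded_real[of _ 1]; simp)+
  have ie: "integrable M (\<lambda>\<omega>. iexp (X \<omega>))" by (rule integrable_iexp) auto
  have re: "Re (expectation (\<lambda>\<omega>. iexp (X \<omega>))) = expectation (\<lambda>\<omega>. cos (X \<omega>))"
    using integral_Re[OF ie] by (simp add: Re_exp)
  have im: "Im (expectation (\<lambda>\<omega>. iexp (X \<omega>))) = expectation (\<lambda>\<omega>. sin (X \<omega>))"
    using integral_Im[OF ie] by (simp add: Im_exp)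
  have eq: "(\<lambda>(\<omega>, \<omega>'). cos (X \<omega> - X \<omega>')) = (\<lambda>p. (case p of (\<omega>, \<omega>') \<Rightarrow> cos (X \<omega>) * cos (X \<omega>'))
      + (case p of (\<omega>, \<omega>') \<Rightarrow> sin (X \<omega>) * sin (X \<omega>')))"
    by (auto simp: cos_diff)
  show "integrable (M \<Otimes>\<^sub>M M) (\<lambda>(\<omega>, \<omega>'). cos (X \<omega> - X \<omega>'))"
    unfolding eq by (intro Bochner_Integration.integrable_add integrable_pair_mult c s)
  show "(cmod (expectation (\<lambda>\<omega>. iexp (X \<omega>))))\<^sup>2
      = (\<integral>(\<omega>, \<omega>'). cos (X \<omega> - X \<omega>') \<partial>(M \<Otimes>\<^sub>M M))"
    unfolding eq cmod_power2 re im
    by (simp add: Bochner_Integration.integral_add integrable_pair_mult c s integral_pair_mult power2_eq_square)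
qed

text \<open>Symmetrise the sum, apply \<open>one_minus_cos_add_ge\<close> to the differences of
  copies and bound 1 - cos x by x^2 / 2 in the X-part. No independence of X and Y enters, which is
  essential: they will be multiples of the normalised g and of the centred Poisson variable of the
  same cell.\<close>

lemma cmod_char_variable_add_sq_le:
  assumes [measurable]: "X \<in> borel_measurable M" "Y \<in> borel_measurable M"
    and X2: "integrable M (\<lambda>\<omega>. \<bar>X \<omega>\<bar> ^ 2)"
  shows "(cmod (expectation (\<lambda>\<omega>. iexp (X \<omega> + Y \<omega>))))\<^sup>2
    \<le> 1 - (1 - (cmod (expectation (\<lambda>\<omega>. iexp (Y \<omega>))))\<^sup>2) / 2 + expectation (\<lambda>\<omega>. (X \<omega>)\<^sup>2)"
proof -
  interpret P: pair_prob_space M M ..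
  have x1: "integrable M X" and x2: "integrable M (\<lambda>\<omega>. (X \<omega>)\<^sup>2)"
    using integrable_power_mono[OF assms(1) X2, of 1] X2 by auto
  have one: "integrable M (\<lambda>_. 1 :: real)" by simp
  \<comment> \<open>This is the square of the difference of two copies of X, written as a sum of
    products so that \<open>integral_pair_mult\<close> integrates it term by term.\<close>
  define q where "q = (\<lambda>p. (case p of (\<omega>, \<omega>') \<Rightarrow> (X \<omega>)\<^sup>2 * 1) + (case p of (\<omega>, \<omega>') \<Rightarrow> 1 * (X \<omega>')\<^sup>2)
      - 2 * (case p of (\<omega>, \<omega>') \<Rightarrow> X \<omega> * X \<omega>'))"
  have qi: "integrable (M \<Otimes>\<^sub>M M) q"
    unfolding q_def
    by (intro Bochner_Integration.integrable_add Bochner_Integration.integrable_diff integrable_mult_right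
        integrable_pair_mult x1 x2 one)
  have "(\<integral>p. q p \<partial>(M \<Otimes>\<^sub>M M)) = 2 * expectation (\<lambda>\<omega>. (X \<omega>)\<^sup>2) - 2 * (expectation X)\<^sup>2"
    unfolding q_def
    by (subst Bochner_Integration.integral_diff Bochner_Integration.integral_add integral_mult_right_zero
        integral_pair_mult integral_mult_right;
        (intro Bochner_Integration.integrable_add integrable_mult_right integrable_pair_mult x1 x2 one)?)+
       (simp add: prob_space power2_eq_square)
  then have qle: "(\<integral>p. q p \<partial>(M \<Otimes>\<^sub>M M)) \<le> 2 * expectation (\<lambda>\<omega>. (X \<omega>)\<^sup>2)" by simp
  have cle: "1 - cos x \<le> x\<^sup>2 / 2" for x :: real
  proof -
    have "(sin (x / 2))\<^sup>2 \<le> (x / 2)\<^sup>2"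
      using abs_sin_x_le_abs_x[of "x / 2"] by (metis abs_ge_zero power2_abs power_mono)
    then show ?thesis using cos_double_sin[of "x / 2"] by (simp add: power_divide)
  qed
  have "(\<integral>(\<omega>, \<omega>'). cos (X \<omega> + Y \<omega> - (X \<omega>' + Y \<omega>')) \<partial>(M \<Otimes>\<^sub>M M))
      \<le> (\<integral>p. 1 / 2 + (case p of (\<omega>, \<omega>') \<Rightarrow> cos (Y \<omega> - Y \<omega>')) / 2 + q p / 2 \<partial>(M \<Otimes>\<^sub>M M))"
  proof (rule integral_mono)
    show "integrable (M \<Otimes>\<^sub>M M) (\<lambda>(\<omega>, \<omega>'). cos (X \<omega> + Y \<omega> - (X \<omega>' + Y \<omega>')))"
      by (rule integrable_pair_cos) simp
    show "integrable (M \<Otimes>\<^sub>M M) (\<lambda>p. 1 / 2 + (case p of (\<omega>, \<omega>') \<Rightarrow> cos (Y \<omega> - Y \<omega>')) / 2 + q p / 2)"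
      using integrable_pair_cos[OF assms(2)] qi by simp
    fix p assume "p \<in> space (M \<Otimes>\<^sub>M M)"
    obtain \<omega> \<omega>' where p: "p = (\<omega>, \<omega>')" by (cases p)
    have "1 - cos ((X \<omega> - X \<omega>') + (Y \<omega> - Y \<omega>')) \<ge> (1 - cos (Y \<omega> - Y \<omega>')) / 2 - (1 - cos (X \<omega> - X \<omega>'))"
      by (rule one_minus_cos_add_ge)
    moreover have "1 - cos (X \<omega> - X \<omega>') \<le> q p / 2"
      using cle[of "X \<omega> - X \<omega>'"] by (simp add: q_def p power2_diff)
    moreover have "(X \<omega> - X \<omega>') + (Y \<omega> - Y \<omega>') = X \<omega> + Y \<omega> - (X \<omega>' + Y \<omega>')" by simp
    ultimately show "(case p of (\<omega>, \<omega>') \<Rightarrow> cos (X \<omega> + Y \<omega> - (X \<omega>' + Y \<omega>')))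
       \<le> 1 / 2 + (case p of (\<omega>, \<omega>') \<Rightarrow> cos (Y \<omega> - Y \<omega>')) / 2 + q p / 2"
      unfolding p by (simp add: field_simps)
  qed
  also have "\<dots> = 1 / 2 + (\<integral>(\<omega>, \<omega>'). cos (Y \<omega> - Y \<omega>') \<partial>(M \<Otimes>\<^sub>M M)) / 2 + (\<integral>p. q p \<partial>(M \<Otimes>\<^sub>M M)) / 2"
    using integrable_pair_cos[OF assms(2)] qi by (simp add: P.prob_space)
  finally show ?thesis
    using qle cmod_char_variable_sq[of "\<lambda>\<omega>. X \<omega> + Y \<omega>"] cmod_char_variable_sq[of Y]
    by (simp only: assms borel_measurable_add) (simp add: field_simps)
qed

end

section \<open>The Poisson distribution: characteristic function and central moments\<close>

locale poisson_variable = prob_space M for M +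
  fixes \<xi> :: "'a \<Rightarrow> nat" and l :: real
  assumes l_pos: "0 < l"
    and \<xi>_meas [measurable]: "\<xi> \<in> measurable M (count_space UNIV)"
    and \<xi>_distr: "distr M (count_space UNIV) \<xi> = measure_pmf (poisson_pmf l)"
begin

lemma pmf_eq: "pmf (poisson_pmf l) k = l ^ k / fact k * exp (- l)"
  using l_pos by simp

lemma prob_eq: "prob {\<omega> \<in> space M. \<xi> \<omega> = k} = l ^ k / fact k * exp (- l)"
proof -
  have "prob {\<omega> \<in> space M. \<xi> \<omega> = k} = measure (distr M (count_space UNIV) \<xi>) {k}"
    by (subst measure_distr) (auto intro!: arg_cong[where f = "measure M"])
  then show ?thesis using l_pos by (simp add: \<xi>_distr measure_pmf_single)
qed

lemma
  fixes f :: "nat \<Rightarrow> 'b::{banach, second_countable_topology}"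
  assumes "summable (\<lambda>k. norm (f k) * (l ^ k / fact k))"
  shows integrable_comp: "integrable M (\<lambda>\<omega>. f (\<xi> \<omega>))"
    and expectation_comp: "expectation (\<lambda>\<omega>. f (\<xi> \<omega>)) = (\<Sum>k. (l ^ k / fact k * exp (- l)) *\<^sub>R f k)"
proof -
  have s: "summable (\<lambda>k. norm ((l ^ k / fact k * exp (- l)) *\<^sub>R f k))"
    using summable_mult2[OF assms, of "exp (- l)"] l_pos by (simp add: abs_mult ac_simps)
  have i: "integrable (measure_pmf (poisson_pmf l)) f"
    unfolding measure_pmf_eq_density
    by (subst integrable_density) (use s l_pos in \<open>auto simp: integrable_count_space_nat_iff pmf_eq\<close>)
  show "integrable M (\<lambda>\<omega>. f (\<xi> \<omega>))"
    using integrable_distr[of \<xi> M "count_space UNIV" f] i by (simp add: \<xi>_distr)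
  have "expectation (\<lambda>\<omega>. f (\<xi> \<omega>)) = integral\<^sup>L (measure_pmf (poisson_pmf l)) f"
    using integral_distr[of \<xi> M "count_space UNIV" f] by (simp add: \<xi>_distr)
  also have "\<dots> = (\<integral>k. pmf (poisson_pmf l) k *\<^sub>R f k \<partial>count_space UNIV)"
    unfolding measure_pmf_eq_density by (subst integral_density) (use l_pos in auto)
  also have "\<dots> = (\<Sum>k. (l ^ k / fact k * exp (- l)) *\<^sub>R f k)"
    by (subst integral_count_space_nat) (use s l_pos in \<open>auto simp: integrable_count_space_nat_iff pmf_eq\<close>)
  finally show "expectation (\<lambda>\<omega>. f (\<xi> \<omega>)) = (\<Sum>k. (l ^ k / fact k * exp (- l)) *\<^sub>R f k)" .
qed

lemma char_poisson: "expectation (\<lambda>\<omega>. iexp (t * real (\<xi> \<omega>))) = exp (of_real l * (iexp t - 1))"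
proof -
  have sm: "summable (\<lambda>k. norm (iexp (t * real k)) * (l ^ k / fact k))"
    using summable_exp[of l] by (simp add: field_simps)
  have "(\<lambda>k. (l ^ k / fact k * exp (- l)) *\<^sub>R iexp (t * real k))
      = (\<lambda>k. of_real (exp (- l)) * ((of_real l * iexp t) ^ k /\<^sub>R fact k))"
  proof
    fix k
    have "iexp (t * real k) = iexp t ^ k"
      by (simp add: exp_of_nat_mult[symmetric] ac_simps)
    then show "(l ^ k / fact k * exp (- l)) *\<^sub>R iexp (t * real k)
      = of_real (exp (- l)) * ((of_real l * iexp t) ^ k /\<^sub>R fact k)"
      by (simp add: scaleR_conv_of_real power_mult_distrib field_simps)
  qed
  then have "expectation (\<lambda>\<omega>. iexp (t * real (\<xi> \<omega>))) = of_real (exp (- l)) * exp (of_real l * iexp t)"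
    using expectation_comp[OF sm] sums_unique[OF sums_mult[OF exp_converges[of "of_real l * iexp t"], of "of_real (exp (- l))"]]
    by simp
  then show ?thesis by (simp add: exp_of_real[symmetric] exp_add[symmetric] algebra_simps)
qed

lemma cmod_char_poisson_sq:
  "(cmod (expectation (\<lambda>\<omega>. iexp (t * real (\<xi> \<omega>)))))\<^sup>2 = exp (- 2 * l * (1 - cos t))"
  unfolding char_poisson by (simp add: norm_exp_eq_Re Re_exp power2_eq_square exp_add[symmetric] algebra_simps)

text \<open>Since k^j is at most j! exp k, the series is dominated by the exponential series at l *
  e.\<close>

lemma integrable_power_nat: "integrable M (\<lambda>\<omega>. real (\<xi> \<omega>) ^ j)"
proof (rule integrable_comp)
  show "summable (\<lambda>k. norm (real k ^ j) * (l ^ k / fact k))"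
  proof (rule summable_comparison_test')
    show "summable (\<lambda>k. fact j * ((l * exp 1) ^ k / fact k))"
      using summable_exp[of "l * exp 1"] by (intro summable_mult) (simp add: field_simps)
    fix k :: nat
    have "real k ^ j \<le> fact j * exp (real k)" by (rule power_le_fact_exp) simp
    then have "real k ^ j * (l ^ k / fact k) \<le> fact j * exp (real k) * (l ^ k / fact k)"
      using l_pos by (intro mult_right_mono) auto
    then show "norm (norm (real k ^ j) * (l ^ k / fact k)) \<le> fact j * ((l * exp 1) ^ k / fact k)"
      using l_pos by (simp add: power_mult_distrib exp_of_nat_mult[symmetric] ac_simps)
  qed
qed

lemma integrable_shift_power: "integrable M (\<lambda>\<omega>. (real (\<xi> \<omega>) - c) ^ j)"
  and integrable_shift_power_mult: "integrable M (\<lambda>\<omega>. real (\<xi> \<omega>) * (real (\<xi> \<omega>) - c) ^ j)"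
proof -
  have "(\<lambda>\<omega>. (real (\<xi> \<omega>) - c) ^ j) = (\<lambda>\<omega>. \<Sum>i\<le>j. real (j choose i) * real (\<xi> \<omega>) ^ i * (- c) ^ (j - i))"
    using binomial_ring[of "real (\<xi> _)" "- c" j] by simp
  then show "integrable M (\<lambda>\<omega>. (real (\<xi> \<omega>) - c) ^ j)"
    using integrable_power_nat by simp
  have "(\<lambda>\<omega>. real (\<xi> \<omega>) * (real (\<xi> \<omega>) - c) ^ j)
      = (\<lambda>\<omega>. \<Sum>i\<le>j. real (j choose i) * real (\<xi> \<omega>) ^ Suc i * (- c) ^ (j - i))"
    using binomial_ring[of "real (\<xi> _)" "- c" j] by (simp add: sum_distrib_left ac_simps)
  then show "integrable M (\<lambda>\<omega>. real (\<xi> \<omega>) * (real (\<xi> \<omega>) - c) ^ j)"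
    using integrable_power_nat by (simp del: power_Suc)
qed

text \<open>The Stein-Chen identity E \<xi> g(\<xi>) = l E g(\<xi> + 1) for g y = (y - l)^j,
  obtained by shifting the summation index. Expanding the power of y - l + 1 gives a recursion for
  the central moments.\<close>

lemma stein_chen: "expectation (\<lambda>\<omega>. (real (\<xi> \<omega>) - l) ^ Suc j)
    = l * (expectation (\<lambda>\<omega>. (real (\<xi> \<omega>) - l + 1) ^ j) - expectation (\<lambda>\<omega>. (real (\<xi> \<omega>) - l) ^ j))"
proof -
  have summ: "summable (\<lambda>k. norm (f k) * (l ^ k / fact k))" if "integrable M (\<lambda>\<omega>. f (\<xi> \<omega>))" for f :: "nat \<Rightarrow> real"
  proof -
    have "integrable (measure_pmf (poisson_pmf l)) f"
      using integrable_distr_eq[of \<xi> M "count_space UNIV" f] that by (simp add: \<xi>_distr)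
    then have "summable (\<lambda>k. norm (l ^ k / fact k * exp (- l) * f k))"
      unfolding measure_pmf_eq_density
      by (subst (asm) integrable_density) (use l_pos in \<open>auto simp: integrable_count_space_nat_iff pmf_eq\<close>)
    from summable_mult[OF this, of "exp l"] show ?thesis
      using l_pos by (simp add: abs_mult ac_simps exp_minus field_simps)
  qed
  let ?g = "\<lambda>y::real. (y - l) ^ j"
  let ?a = "\<lambda>k. l ^ k / fact k * exp (- l) * (real k * ?g (real k))"
  have i1: "integrable M (\<lambda>\<omega>. real (\<xi> \<omega>) * ?g (real (\<xi> \<omega>)))" by (rule integrable_shift_power_mult)
  have i2: "integrable M (\<lambda>\<omega>. ?g (real (\<xi> \<omega>) + 1))"
    using integrable_shift_power[of "l - 1" j] by (simp add: algebra_simps)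
  have "summable ?a"
  proof -
    from summable_mult[OF summable_norm_cancel[of "\<lambda>k. real k * ?g (real k) * (l ^ k / fact k)"], of "exp (- l)"]
    show ?thesis using summ[OF i1] l_pos by (simp add: abs_mult ac_simps)
  qed
  have "expectation (\<lambda>\<omega>. real (\<xi> \<omega>) * ?g (real (\<xi> \<omega>))) = (\<Sum>k. ?a k)"
    using expectation_comp[OF summ[OF i1]] by (simp add: ac_simps)
  also have "\<dots> = (\<Sum>k. ?a (Suc k))"
    using suminf_split_head[OF \<open>summable ?a\<close>] by simp
  also have "\<dots> = (\<Sum>k. l * (l ^ k / fact k * exp (- l) * ?g (real k + 1)))"
  proof (intro arg_cong[where f = suminf] ext)
    fix k
    have "real (Suc k) / fact (Suc k) = 1 / fact k" by (simp del: of_nat_Suc)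
    then have "l ^ Suc k * exp (- l) * ?g (real (Suc k)) * (real (Suc k) / fact (Suc k))
        = l ^ Suc k * exp (- l) * ?g (real (Suc k)) * (1 / fact k)" by (simp only:)
    then show "?a (Suc k) = l * (l ^ k / fact k * exp (- l) * ?g (real k + 1))" by (simp add: ac_simps)
  qed
  also have "\<dots> = l * (\<Sum>k. l ^ k / fact k * exp (- l) * ?g (real k + 1))"
  proof (rule suminf_mult)
    from summable_mult[OF summable_norm_cancel[of "\<lambda>k. ?g (real k + 1) * (l ^ k / fact k)"], of "exp (- l)"]
    show "summable (\<lambda>k. l ^ k / fact k * exp (- l) * ?g (real k + 1))"
      using summ[OF i2] l_pos by (simp add: abs_mult ac_simps)
  qed
  also have "\<dots> = l * expectation (\<lambda>\<omega>. ?g (real (\<xi> \<omega>) + 1))"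
    using expectation_comp[OF summ[OF i2]] by (simp add: ac_simps)
  finally have "expectation (\<lambda>\<omega>. real (\<xi> \<omega>) * ?g (real (\<xi> \<omega>))) = l * expectation (\<lambda>\<omega>. ?g (real (\<xi> \<omega>) + 1))" .
  moreover have "expectation (\<lambda>\<omega>. (real (\<xi> \<omega>) - l) ^ Suc j)
     = expectation (\<lambda>\<omega>. real (\<xi> \<omega>) * ?g (real (\<xi> \<omega>))) - l * expectation (\<lambda>\<omega>. ?g (real (\<xi> \<omega>)))"
    using i1 integrable_shift_power[of l j] by (simp add: left_diff_distrib)
  ultimately show ?thesis by (simp add: algebra_simps)
qed

abbreviation D where "D \<omega> \<equiv> real (\<xi> \<omega>) - l"

lemma central_moments:
  "expectation D = 0" "expectation (\<lambda>\<omega>. D \<omega> ^ 2) = l" "expectation (\<lambda>\<omega>. D \<omega> ^ 3) = l"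
  "expectation (\<lambda>\<omega>. D \<omega> ^ 4) = 3 * l\<^sup>2 + l" "expectation (\<lambda>\<omega>. D \<omega> ^ 5) = 10 * l\<^sup>2 + l"
  "expectation (\<lambda>\<omega>. D \<omega> ^ 6) = 15 * l ^ 3 + 25 * l\<^sup>2 + l"
proof -
  define d where "d = D"
  have i: "integrable M (\<lambda>\<omega>. d \<omega> ^ j)" for j unfolding d_def by (rule integrable_shift_power)
  have i1: "integrable M d" using i[of 1] by simp
  have st: "expectation (\<lambda>\<omega>. d \<omega> ^ Suc j) = l * (expectation (\<lambda>\<omega>. (d \<omega> + 1) ^ j) - expectation (\<lambda>\<omega>. d \<omega> ^ j))" for j
    unfolding d_def by (rule stein_chen)
  have 1: "expectation d = 0" using st[of 0] by simp
  have 2: "expectation (\<lambda>\<omega>. d \<omega> ^ 2) = l"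
    using st[of 1] 1 i1 by (simp add: prob_space numeral_2_eq_2)
  have e: "(\<lambda>\<omega>. (d \<omega> + 1) ^ 2) = (\<lambda>\<omega>. d \<omega> ^ 2 + 2 * d \<omega> + 1)"
    by (intro ext) algebra
  have 3: "expectation (\<lambda>\<omega>. d \<omega> ^ 3) = l"
    using st[of 2, unfolded e] 1 i1 i
    by (simp add: prob_space) (simp add: power2_eq_square power3_eq_cube algebra_simps)?
  have e: "(\<lambda>\<omega>. (d \<omega> + 1) ^ 3) = (\<lambda>\<omega>. d \<omega> ^ 3 + 3 * d \<omega> ^ 2 + 3 * d \<omega> + 1)"
    by (intro ext) algebra
  have 4: "expectation (\<lambda>\<omega>. d \<omega> ^ 4) = 3 * l\<^sup>2 + l"
    using st[of 3, unfolded e] 1 2 3 i1 i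
    by (simp add: prob_space) (simp add: power2_eq_square power3_eq_cube algebra_simps)?
  have e: "(\<lambda>\<omega>. (d \<omega> + 1) ^ 4) = (\<lambda>\<omega>. d \<omega> ^ 4 + 4 * d \<omega> ^ 3 + 6 * d \<omega> ^ 2 + 4 * d \<omega> + 1)"
    by (intro ext) algebra
  have 5: "expectation (\<lambda>\<omega>. d \<omega> ^ 5) = 10 * l\<^sup>2 + l"
    using st[of 4, unfolded e] 1 2 3 4 i1 i
    by (simp add: prob_space) (simp add: power2_eq_square power3_eq_cube algebra_simps)?
  have e: "(\<lambda>\<omega>. (d \<omega> + 1) ^ 5) = (\<lambda>\<omega>. d \<omega> ^ 5 + 5 * d \<omega> ^ 4 + 10 * d \<omega> ^ 3 + 10 * d \<omega> ^ 2 + 5 * d \<omega> + 1)"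
    by (intro ext) algebra
  have 6: "expectation (\<lambda>\<omega>. d \<omega> ^ 6) = 15 * l ^ 3 + 25 * l\<^sup>2 + l"
    using st[of 5, unfolded e] 1 2 3 4 5 i1 i
    by (simp add: prob_space) (simp add: power2_eq_square power3_eq_cube algebra_simps)?
  show "expectation D = 0" "expectation (\<lambda>\<omega>. D \<omega> ^ 2) = l" "expectation (\<lambda>\<omega>. D \<omega> ^ 3) = l"
    "expectation (\<lambda>\<omega>. D \<omega> ^ 4) = 3 * l\<^sup>2 + l" "expectation (\<lambda>\<omega>. D \<omega> ^ 5) = 10 * l\<^sup>2 + l"
    "expectation (\<lambda>\<omega>. D \<omega> ^ 6) = 15 * l ^ 3 + 25 * l\<^sup>2 + l"
    using 1 2 3 4 5 6 unfolding d_def by blast+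
qed

lemma integrable_abs_central: "integrable M (\<lambda>\<omega>. \<bar>D \<omega>\<bar> ^ j)"
  using integrable_norm[OF integrable_shift_power[of l j]] by (simp add: power_abs)

text \<open>The odd absolute moment is interpolated by the arithmetic-geometric mean of x^4 w and
  x^6 / w. The weight w = sqrt l balances the leading orders l^2 and l^3 of the two even moments;
  for l at most 1 the weight 1 is enough.\<close>

lemma abs_central_moment_5: "expectation (\<lambda>\<omega>. \<bar>D \<omega>\<bar> ^ 5) \<le> 23 * (l + l\<^sup>2 * sqrt l)"
proof -
  have *: "expectation (\<lambda>\<omega>. \<bar>D \<omega>\<bar> ^ 5) \<le> ((3 * l\<^sup>2 + l) * w + (15 * l ^ 3 + 25 * l\<^sup>2 + l) / w) / 2" if "0 < w" for w
  proof -
    have "\<bar>x\<bar> ^ 5 \<le> (x ^ 4 * w + x ^ 6 / w) / 2" for x :: real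
    proof -
      have "0 \<le> x ^ 4 * (w - \<bar>x\<bar>)\<^sup>2" by simp
      also have "\<dots> = x ^ 4 * w\<^sup>2 + x ^ 6 - 2 * w * \<bar>x\<bar> ^ 5"
      proof -
        have "x ^ 4 * \<bar>x\<bar> = \<bar>x\<bar> ^ 5" by (cases "0 \<le> x") (simp_all add: power_numeral_reduce)
        moreover have "x ^ 4 * x ^ 2 = x ^ 6" by (simp flip: power_add)
        ultimately show ?thesis by (simp add: power2_diff algebra_simps)
      qed
      finally show ?thesis using that by (simp add: field_simps power2_eq_square)
    qed
    then have "expectation (\<lambda>\<omega>. \<bar>D \<omega>\<bar> ^ 5) \<le> expectation (\<lambda>\<omega>. (D \<omega> ^ 4 * w + D \<omega> ^ 6 / w) / 2)"
      using integrable_abs_central integrable_shift_power[of l] by (intro integral_mono) auto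
    also have "\<dots> = ((3 * l\<^sup>2 + l) * w + (15 * l ^ 3 + 25 * l\<^sup>2 + l) / w) / 2"
      using integrable_shift_power[of l] central_moments by simp
    finally show ?thesis .
  qed
  show ?thesis
  proof (cases "l \<le> 1")
    case True
    have "l\<^sup>2 \<le> l" "l ^ 3 \<le> l" using True l_pos by (auto simp: power_le_one_iff power2_eq_square power3_eq_cube mult_le_one)
    then have "(28 * l\<^sup>2 + (2 * l + 15 * l ^ 3)) / 2 \<le> 23 * l" using l_pos by (simp add: field_simps)
    moreover have "expectation (\<lambda>\<omega>. \<bar>D \<omega>\<bar> ^ 5) \<le> (28 * l\<^sup>2 + (2 * l + 15 * l ^ 3)) / 2" using *[of 1] by simp
    moreover have "23 * l \<le> 23 * (l + l\<^sup>2 * sqrt l)" using l_pos by simp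
    ultimately show ?thesis by (meson order_trans)
  next
    case False
    define r where "r = sqrt l"
    have r: "1 \<le> r" "l = r\<^sup>2" using False l_pos by (auto simp: r_def)
    have le: "r ^ j \<le> r ^ 5" if "j \<le> 5" for j using r that by (intro power_increasing) auto
    have "((3 * l\<^sup>2 + l) * r + (15 * l ^ 3 + 25 * l\<^sup>2 + l) / r) / 2
       = (18 * r ^ 5 + r ^ 3 + 25 * r ^ 3 + r) / 2"
      using r by (simp add: field_simps power_numeral_reduce)
    also have "\<dots> \<le> 23 * r ^ 5" using le[of 3] le[of 1] le[of 0] by simp
    also have "\<dots> = 23 * (l\<^sup>2 * sqrt l)" using r by (simp add: r_def[symmetric] flip: power_mult) (simp add: power_numeral_reduce)
    finally have "expectation (\<lambda>\<omega>. \<bar>D \<omega>\<bar> ^ 5) \<le> 23 * (l\<^sup>2 * sqrt l)"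
      using *[of r] r by linarith
    also have "\<dots> \<le> 23 * (l + l\<^sup>2 * sqrt l)" using l_pos by simp
    finally show ?thesis .
  qed
qed

end

section \<open>Fourier inversion for lattice variables and Hermite functions\<close>

text \<open>Orthogonality of characters over a full period: for nonzero k the antiderivative takes
  equal values at both end points.\<close>

lemma LBINT_iexp_symmetric:
  fixes k :: int and L :: real
  assumes "0 < L"
  shows "(\<integral>v. indicator {- (pi * L)..pi * L} v *\<^sub>R iexp (v * (k / L)) \<partial>lborel)
    = (if k = 0 then of_real (2 * pi * L) else 0)"
proof (cases "k = 0")
  case True
  then show ?thesis using assms by (simp add: scaleR_conv_of_real)
next
  case False
  define w where "w = \<i> * of_real (k / L)"
  have w: "w \<noteq> 0" using False assms by (simp add: w_def)
  have iw: "iexp (v * (k / L)) = exp (w * of_real v)" for v by (simp add: w_def ac_simps)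
  have "(\<integral>v. indicator {- (pi * L)..pi * L} v *\<^sub>R exp (w * of_real v) \<partial>lborel)
      = exp (w * of_real (pi * L)) / w - exp (w * of_real (- (pi * L))) / w"
  proof (rule integral_FTC_atLeastAtMost)
    show "- (pi * L) \<le> pi * L" using assms by simp
    show "((\<lambda>v. exp (w * of_real v) / w) has_vector_derivative exp (w * of_real v))
        (at v within {- (pi * L)..pi * L})" for v
      using w by (intro has_vector_derivative_real_field[where f = "\<lambda>z. exp (w * z) / w"])
        (auto intro!: derivative_eq_intros)
    show "continuous_on {- (pi * L)..pi * L} (\<lambda>v. exp (w * of_real v))"
      by (intro continuous_intros)
  qed
  also have "w * of_real (pi * L) = w * of_real (- (pi * L)) + of_int k * (of_real (2 * pi) * \<i>)"
    using assms by (simp add: w_def)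
  also have "exp \<dots> = exp (w * of_real (- (pi * L)))"
  proof -
    have "exp (of_int k * (of_real (2 * pi) * \<i>)) = 1"
      using exp_integer_2pi[of "of_int k"] by (simp add: ac_simps)
    then show ?thesis by (simp only: exp_add mult_1_right)
  qed
  finally show ?thesis using False iw by simp
qed

text \<open>Fubini and orthogonality of characters. The bounded weight Z lets one statement serve
  two inversions: over the lattice of the total count, with Z carrying the sum of the
  \<open>a m\<close>, and over the lattice of the statistic, with Z the indicator that the total is
  n.\<close>

lemma (in prob_space) lattice_inversion:
  fixes K :: "'a \<Rightarrow> int" and Z :: "'a \<Rightarrow> complex" and L :: real
  assumes [measurable]: "K \<in> measurable M (count_space UNIV)" "Z \<in> borel_measurable M"
    and Z: "\<And>\<omega>. cmod (Z \<omega>) \<le> 1" and L: "0 < L"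
  shows "(\<integral>v. indicator {- (pi * L)..pi * L} v *\<^sub>R expectation (\<lambda>\<omega>. Z \<omega> * iexp (v * (K \<omega> / L))) \<partial>lborel)
    = of_real (2 * pi * L) * expectation (\<lambda>\<omega>. Z \<omega> * indicator {\<omega>. K \<omega> = 0} \<omega>)"
proof -
  interpret P: pair_sigma_finite lborel M ..
  let ?S = "{- (pi * L)..pi * L}"
  let ?f = "\<lambda>v \<omega>. indicator ?S v *\<^sub>R (Z \<omega> * iexp (v * (K \<omega> / L)))"
  have i: "integrable (lborel \<Otimes>\<^sub>M M) (case_prod ?f)"
  proof (rule integrableI_bounded_set[where A = "?S \<times> space M" and B = 1])
    show "emeasure (lborel \<Otimes>\<^sub>M M) (?S \<times> space M) < \<infinity>"
      using L by (simp add: emeasure_pair_measure_Times emeasure_space_1)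
    show "AE x in lborel \<Otimes>\<^sub>M M. x \<notin> ?S \<times> space M \<longrightarrow> case_prod ?f x = 0"
      by (rule AE_I2) (auto simp: space_pair_measure indicator_def split: if_splits)
  qed (auto simp: norm_mult Z indicator_def)
  have "(\<integral>v. indicator ?S v *\<^sub>R expectation (\<lambda>\<omega>. Z \<omega> * iexp (v * (K \<omega> / L))) \<partial>lborel)
      = (\<integral>v. expectation (\<lambda>\<omega>. ?f v \<omega>) \<partial>lborel)"
    by simp
  also have "\<dots> = expectation (\<lambda>\<omega>. \<integral>v. ?f v \<omega> \<partial>lborel)"
    by (rule P.Fubini_integral[OF i, symmetric])
  also have "\<dots> = expectation (\<lambda>\<omega>. Z \<omega> * (if K \<omega> = 0 then of_real (2 * pi * L) else 0))"
  proof (intro Bochner_Integration.integral_cong refl)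
    fix \<omega>
    have "(\<integral>v. ?f v \<omega> \<partial>lborel) = (\<integral>v. Z \<omega> * (indicator ?S v *\<^sub>R iexp (v * (K \<omega> / L))) \<partial>lborel)"
      by simp
    also have "\<dots> = Z \<omega> * (\<integral>v. indicator ?S v *\<^sub>R iexp (v * (K \<omega> / L)) \<partial>lborel)"
      by (rule integral_mult_right_zero)
    finally show "(\<integral>v. ?f v \<omega> \<partial>lborel) = Z \<omega> * (if K \<omega> = 0 then of_real (2 * pi * L) else 0)"
      by (simp only: LBINT_iexp_symmetric[OF L])
  qed
  also have "\<dots> = expectation (\<lambda>\<omega>. of_real (2 * pi * L) * (Z \<omega> * indicator {\<omega>. K \<omega> = 0} \<omega>))"
    by (intro Bochner_Integration.integral_cong refl) auto
  also have "\<dots> = of_real (2 * pi * L) * expectation (\<lambda>\<omega>. Z \<omega> * indicator {\<omega>. K \<omega> = 0} \<omega>)"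
    by (rule integral_mult_right_zero)
  finally show ?thesis .
qed

section \<open>Fourier transforms of polynomials times the Gaussian\<close>

lemma integrable_power_gaussian:
  "integrable lborel (\<lambda>x::real. x ^ k * exp (- x\<^sup>2 / 2))"
proof -
  have "(\<lambda>x::real. x ^ k * exp (- x\<^sup>2 / 2)) = (\<lambda>x. sqrt (2 * pi) * (std_normal_density x * x ^ k))"
    by (simp add: std_normal_density_def fun_eq_iff)
  then show ?thesis using integrable_std_normal_moment[of k] by simp
qed

lemma integrable_iexp_mult:
  fixes g :: "real \<Rightarrow> complex"
  assumes "integrable lborel g"
  shows "integrable lborel (\<lambda>x. iexp (t * x) * g x)"
proof (rule Bochner_Integration.integrable_bound[OF assms])
  have [measurable]: "g \<in> borel_measurable borel" using borel_measurable_integrable[OF assms] by simp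
  show "(\<lambda>x. iexp (t * x) * g x) \<in> borel_measurable lborel" by measurable
qed (auto simp: norm_mult)

lemma integrable_poly_gaussian:
  "integrable lborel (\<lambda>x::real. poly p x * exp (- x\<^sup>2 / 2))"
  unfolding poly_altdef sum_distrib_right mult.assoc
  by (intro Bochner_Integration.integrable_sum integrable_mult_right integrable_power_gaussian)

lemma integrable_iexp_poly_gaussian:
  "integrable lborel (\<lambda>x. iexp (t * x) * of_real (poly p x * exp (- x\<^sup>2 / 2)))"
  by (intro integrable_iexp_mult integrable_of_real integrable_poly_gaussian)

lemma tendsto_poly_gaussian:
  "((\<lambda>x::real. poly p x * exp (- x\<^sup>2 / 2)) \<longlongrightarrow> 0) at_infinity"
proof -
  have b: "norm (x ^ k * exp (- x\<^sup>2 / 2)) \<le> fact (Suc k) * exp (1 / 2) * inverse \<bar>x\<bar>"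
    if "x \<noteq> 0" for x :: real and k
  proof -
    have "\<bar>x\<bar> ^ Suc k \<le> fact (Suc k) * exp \<bar>x\<bar>" by (rule power_le_fact_exp) simp
    then have "\<bar>x\<bar> ^ Suc k * exp (- x\<^sup>2 / 2) \<le> fact (Suc k) * exp \<bar>x\<bar> * exp (- x\<^sup>2 / 2)"
      by (intro mult_right_mono) auto
    also have "\<dots> = fact (Suc k) * exp (\<bar>x\<bar> - x\<^sup>2 / 2)" by (simp flip: exp_add)
    also have "\<dots> \<le> fact (Suc k) * exp (1 / 2)"
    proof -
      have "0 \<le> (\<bar>x\<bar> - 1)\<^sup>2" by simp
      then have "\<bar>x\<bar> - x\<^sup>2 / 2 \<le> 1 / 2" by (simp add: power2_diff)
      then show ?thesis by (intro mult_left_mono) auto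
    qed
    finally have "\<bar>x\<bar> ^ k * exp (- x\<^sup>2 / 2) * \<bar>x\<bar> \<le> fact (Suc k) * exp (1 / 2)" by (simp add: ac_simps)
    then show ?thesis
      using that by (simp add: abs_mult power_abs field_simps)
  qed
  have "((\<lambda>x::real. x ^ k * exp (- x\<^sup>2 / 2)) \<longlongrightarrow> 0) at_infinity" for k
  proof -
    have "filterlim (\<lambda>x::real. \<bar>x\<bar>) at_top at_infinity"
      unfolding real_norm_def[symmetric] by (rule filterlim_norm_at_top)
    then have "((\<lambda>x::real. fact (Suc k) * exp (1 / 2) * inverse \<bar>x\<bar>) \<longlongrightarrow> fact (Suc k) * exp (1 / 2) * 0) at_infinity"
      by (intro tendsto_intros tendsto_inverse_0_at_top)
    then have "((\<lambda>x::real. fact (Suc k) * exp (1 / 2) * inverse \<bar>x\<bar>) \<longlongrightarrow> 0) at_infinity" by simp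
    then show ?thesis
    proof (rule Lim_null_comparison[rotated])
      show "\<forall>\<^sub>F x in at_infinity. norm (x ^ k * exp (- x\<^sup>2 / 2)) \<le> fact (Suc k) * exp (1 / 2) * inverse \<bar>x\<bar>"
        unfolding eventually_at_infinity by (intro exI[of _ 1] allI impI b) auto
    qed
  qed
  then show ?thesis
    unfolding poly_altdef sum_distrib_right mult.assoc
    by (intro tendsto_null_sum tendsto_mult_right_zero)
qed

text \<open>The unnormalised Fourier transform of a polynomial times exp (- x^2 / 2). Indexing by
  the polynomial turns multiplication by x and differentiation into algebra.\<close>

definition gauss_fourier :: "real poly \<Rightarrow> real \<Rightarrow> complex" where
  "gauss_fourier p t = (\<integral>x. iexp (t * x) * of_real (poly p x * exp (- x\<^sup>2 / 2)) \<partial>lborel)"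

lemma gauss_fourier_diff: "gauss_fourier (p - q) t = gauss_fourier p t - gauss_fourier q t"
  unfolding gauss_fourier_def
  by (subst Bochner_Integration.integral_diff[symmetric]; (rule integrable_iexp_poly_gaussian)?)
     (simp add: algebra_simps)

lemma gauss_fourier_smult: "gauss_fourier (smult c p) t = of_real c * gauss_fourier p t"
  unfolding gauss_fourier_def
  by (subst integral_mult_right_zero[symmetric]) (simp add: ac_simps)

lemma gauss_fourier_1: "gauss_fourier 1 t = of_real (sqrt (2 * pi) * exp (- t\<^sup>2 / 2))"
proof -
  have "of_real (exp (- t\<^sup>2 / 2)) = char std_normal_distribution t"
    by (simp add: char_std_normal_distribution)
  also have "\<dots> = (\<integral>x. std_normal_density x *\<^sub>R iexp (t * x) \<partial>lborel)"
    unfolding char_def by (subst integral_density) auto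
  also have "\<dots> = (\<integral>x. of_real (1 / sqrt (2 * pi)) * (iexp (t * x) * of_real (poly 1 x * exp (- x\<^sup>2 / 2))) \<partial>lborel)"
    by (intro Bochner_Integration.integral_cong refl) (simp add: std_normal_density_def scaleR_conv_of_real)
  also have "\<dots> = of_real (1 / sqrt (2 * pi)) * gauss_fourier 1 t"
    unfolding gauss_fourier_def by (rule integral_mult_right_zero)
  finally show ?thesis by (simp add: field_simps)
qed

lemma has_vector_derivative_iexp_poly_gaussian:
  "((\<lambda>x::real. iexp (t * x) * of_real (poly p x * exp (- x\<^sup>2 / 2))) has_vector_derivative
     \<i> * of_real t * (iexp (t * x) * of_real (poly p x * exp (- x\<^sup>2 / 2)))
     + iexp (t * x) * of_real (poly (pderiv p) x * exp (- x\<^sup>2 / 2))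
     - iexp (t * x) * of_real (poly ([:0, 1:] * p) x * exp (- x\<^sup>2 / 2))) (at x)"
proof -
  have 1: "((\<lambda>x. iexp (t * x)) has_vector_derivative \<i> * of_real t * iexp (t * x)) (at x)"
  proof -
    have "((\<lambda>z. exp (\<i> * (of_real t * z))) has_field_derivative \<i> * of_real t * iexp (t * x)) (at (of_real x))"
      by (auto intro!: derivative_eq_intros)
    from has_vector_derivative_real_field[OF this] show ?thesis by simp
  qed
  have "((\<lambda>x. poly p x * exp (- x\<^sup>2 / 2)) has_real_derivative
      (poly (pderiv p) x * exp (- x\<^sup>2 / 2) - x * poly p x * exp (- x\<^sup>2 / 2))) (at x)"
    by (auto intro!: derivative_eq_intros poly_DERIV simp: field_simps)
  then have 2: "((\<lambda>x. complex_of_real (poly p x * exp (- x\<^sup>2 / 2))) has_vector_derivative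
      of_real (poly (pderiv p) x * exp (- x\<^sup>2 / 2) - x * poly p x * exp (- x\<^sup>2 / 2))) (at x)"
    by (intro has_vector_derivative_of_real) (simp add: has_real_derivative_iff_has_vector_derivative)
  show ?thesis
    using has_vector_derivative_mult[OF 1 2] by (rule has_vector_derivative_eq_rhs) (simp add: algebra_simps)
qed

text \<open>Integration by parts: the derivative of iexp (t x) p(x) exp (- x^2 / 2) integrates to 0
  over the line because the function vanishes at both ends.\<close>

lemma gauss_fourier_mult_X:
  "gauss_fourier ([:0, 1:] * p) t = \<i> * of_real t * gauss_fourier p t + gauss_fourier (pderiv p) t"
proof -
  define F where "F = (\<lambda>x::real. iexp (t * x) * of_real (poly p x * exp (- x\<^sup>2 / 2)))"
  define f where "f = (\<lambda>x::real. \<i> * of_real t * (iexp (t * x) * of_real (poly p x * exp (- x\<^sup>2 / 2)))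
     + iexp (t * x) * of_real (poly (pderiv p) x * exp (- x\<^sup>2 / 2))
     - iexp (t * x) * of_real (poly ([:0, 1:] * p) x * exp (- x\<^sup>2 / 2)))"
  have fi: "integrable lborel f"
    unfolding f_def
    by (intro Bochner_Integration.integrable_add Bochner_Integration.integrable_diff integrable_mult_right
        integrable_iexp_poly_gaussian)
  have d: "(F has_vector_derivative f x) (at x)" for x
    unfolding F_def f_def by (rule has_vector_derivative_iexp_poly_gaussian)
  have "(F \<longlongrightarrow> 0) at_infinity"
    using tendsto_norm_zero[OF tendsto_poly_gaussian[of p]]
    by (intro tendsto_norm_zero_cancel[of F]) (simp add: F_def norm_mult abs_mult)
  then have lim: "(F \<longlongrightarrow> 0) at_top" "(F \<longlongrightarrow> 0) at_bot"
    by (rule tendsto_mono[OF at_top_le_at_infinity], rule tendsto_mono[OF at_bot_le_at_infinity])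
  have cf: "isCont f x" for x
    unfolding f_def
    by (intro continuous_add continuous_diff continuous_mult continuous_const
        has_vector_derivative_continuous[OF has_vector_derivative_iexp_poly_gaussian])
  have si: "set_integrable lborel (einterval (- \<infinity>) \<infinity>) f"
    unfolding set_integrable_def using fi by simp
  have l1: "((F \<circ> real_of_ereal) \<longlongrightarrow> 0) (at_right (- \<infinity>))"
    unfolding ereal_tendsto_simps by (rule lim)
  have l2: "((F \<circ> real_of_ereal) \<longlongrightarrow> 0) (at_left \<infinity>)"
    unfolding ereal_tendsto_simps by (rule lim)
  have "(LBINT x=-\<infinity>..\<infinity>. f x) = 0 - 0"
    using cf by (intro interval_integral_FTC_integrable[OF _ d _ si l1 l2]) auto
  then have "integral\<^sup>L lborel f = 0"
    by (simp add: interval_lebesgue_integral_def set_lebesgue_integral_def)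
  moreover have "integral\<^sup>L lborel f = \<i> * of_real t * gauss_fourier p t + gauss_fourier (pderiv p) t
      - gauss_fourier ([:0, 1:] * p) t"
    unfolding f_def gauss_fourier_def integral_mult_right_zero[symmetric]
    by (simp only: Bochner_Integration.integral_diff Bochner_Integration.integral_add
      Bochner_Integration.integrable_add integrable_mult_right integrable_iexp_poly_gaussian)
  ultimately show ?thesis by simp
qed


text \<open>The probabilists' Hermite polynomials. With this recursion,
  \<open>gauss_fourier_mult_X\<close> says that each step multiplies the transform by i t.\<close>

fun hermite :: "nat \<Rightarrow> real poly" where
  "hermite 0 = 1"
| "hermite (Suc k) = [:0, 1:] * hermite k - pderiv (hermite k)"

text \<open>The Appell property; it turns the defining recursion into the three-term recurrence
  without derivatives.\<close>

lemma pderiv_hermite: "pderiv (hermite (Suc k)) = smult (Suc k) (hermite k)"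
proof (induction k)
  case 0
  then show ?case by (simp add: pderiv_pCons)
next
  case (Suc k)
  have "pderiv (hermite (Suc (Suc k))) = hermite (Suc k) + [:0, 1:] * smult (Suc k) (hermite k)
     - pderiv (smult (Suc k) (hermite k))"
    by (subst hermite.simps(2)) (simp add: pderiv_diff pderiv_mult pderiv_pCons Suc del: hermite.simps)
  also have "\<dots> = hermite (Suc k) + smult (Suc k) (hermite (Suc k))"
    by (simp add: pderiv_smult smult_diff_right)
  also have "\<dots> = smult (1 + real (Suc k)) (hermite (Suc k))"
    by (simp only: smult_add_left smult_1_left)
  finally show ?case by (simp only: of_nat_Suc add.commute)
qed

lemma gauss_fourier_hermite:
  "gauss_fourier (hermite k) t = (\<i> * of_real t) ^ k * of_real (sqrt (2 * pi) * exp (- t\<^sup>2 / 2))"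
  by (induction k) (simp_all add: gauss_fourier_1 gauss_fourier_diff gauss_fourier_mult_X del: mult_pCons_left)

text \<open>The inverse of \<open>gauss_fourier_hermite\<close>, by direct computation: both sides
  obey the three-term Hermite recurrence, which refers to two predecessors and hence asks for
  complete induction.\<close>

lemma gauss_fourier_monom:
  "\<i> ^ k * gauss_fourier (monom 1 k) (- x) = of_real (poly (hermite k) x * (sqrt (2 * pi) * exp (- x\<^sup>2 / 2)))"
proof (induction k rule: less_induct)
  case (less k)
  show ?case
  proof (cases k)
    case 0
    then show ?thesis by (simp add: gauss_fourier_1 flip: one_poly_eq_simps monom_0)
  next
    case (Suc j)
    have m: "monom 1 k = [:0, 1:] * monom (1::real) j" by (simp add: Suc monom_Suc)
    have e: "\<i> ^ k * gauss_fourier (monom 1 k) (- x)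
      = of_real x * (\<i> ^ j * gauss_fourier (monom 1 j) (- x)) + \<i> ^ k * gauss_fourier (monom (real j) (j - 1)) (- x)"
      unfolding m gauss_fourier_mult_X by (simp add: Suc pderiv_monom algebra_simps)
    show ?thesis
    proof (cases j)
      case 0
      have "gauss_fourier 0 t = 0" for t by (simp add: gauss_fourier_def)
      with 0 show ?thesis using less[of j] Suc unfolding e by (simp add: pderiv_1)
    next
      case (Suc i)
      have "monom (real j) (j - 1) = smult (real j) (monom 1 i)" by (simp add: Suc smult_monom)
      then have "\<i> ^ k * gauss_fourier (monom (real j) (j - 1)) (- x) = - of_nat j * (\<i> ^ i * gauss_fourier (monom 1 i) (- x))"
        by (simp add: gauss_fourier_smult \<open>k = Suc j\<close> Suc algebra_simps)
      moreover have "poly (hermite k) x = x * poly (hermite j) x - real j * poly (hermite i) x"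
        using pderiv_hermite[of i] by (simp add: \<open>k = Suc j\<close> Suc del: hermite.simps(2)[of i])
      ultimately show ?thesis
        using less[of j] less[of i] \<open>k = Suc j\<close> Suc unfolding e
        by (simp only: lessI less_SucI) (simp add: algebra_simps del: hermite.simps)
    qed
  qed
qed

section \<open>Moments in the Poisson scheme\<close>

lemma abs_lin_power_le:
  fixes u v a x :: real
  shows "\<bar>u * a + v * x\<bar> ^ j \<le> (1 + \<bar>u\<bar> + \<bar>v\<bar>) ^ j * (\<bar>a\<bar> ^ j + \<bar>x\<bar> ^ j)"
proof -
  define b where "b = max \<bar>a\<bar> \<bar>x\<bar>"
  have "\<bar>u * a + v * x\<bar> \<le> \<bar>u\<bar> * \<bar>a\<bar> + \<bar>v\<bar> * \<bar>x\<bar>"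
    by (metis abs_mult abs_triangle_ineq)
  also have "\<dots> \<le> \<bar>u\<bar> * b + \<bar>v\<bar> * b" by (intro add_mono mult_left_mono) (auto simp: b_def)
  also have "\<dots> \<le> (1 + \<bar>u\<bar> + \<bar>v\<bar>) * b" by (simp add: b_def algebra_simps)
  finally have "\<bar>u * a + v * x\<bar> ^ j \<le> ((1 + \<bar>u\<bar> + \<bar>v\<bar>) * b) ^ j" by (rule power_mono) simp
  also have "\<dots> = (1 + \<bar>u\<bar> + \<bar>v\<bar>) ^ j * b ^ j" by (rule power_mult_distrib)
  also have "\<dots> \<le> (1 + \<bar>u\<bar> + \<bar>v\<bar>) ^ j * (\<bar>a\<bar> ^ j + \<bar>x\<bar> ^ j)"
    by (intro mult_left_mono) (auto simp: b_def max_def)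
  finally show ?thesis .
qed

lemma one_plus_abs_sq_le:
  fixes u v :: real
  shows "(1 + \<bar>u\<bar> + \<bar>v\<bar>)\<^sup>2 \<le> 3 * (1 + u\<^sup>2 + v\<^sup>2)"
proof -
  have "0 \<le> (\<bar>u\<bar> - 1)\<^sup>2 + (\<bar>v\<bar> - 1)\<^sup>2 + (\<bar>u\<bar> - \<bar>v\<bar>)\<^sup>2" by simp
  also have "\<dots> = 3 * (1 + u\<^sup>2 + v\<^sup>2) - (1 + \<bar>u\<bar> + \<bar>v\<bar>)\<^sup>2"
    by (simp add: power2_eq_square algebra_simps flip: abs_mult)
  finally show ?thesis by simp
qed

lemma (in prob_space) expectation_sq_le:
  assumes "integrable M X" "integrable M (\<lambda>\<omega>. (X \<omega>)\<^sup>2)"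
  shows "(expectation X)\<^sup>2 \<le> expectation (\<lambda>\<omega>. (X \<omega> :: real)\<^sup>2)"
  using variance_positive[of X] variance_eq[OF assms] by simp

lemma power_le_imp_le:
  fixes a b :: real
  shows "a ^ k \<le> b ^ k \<Longrightarrow> 0 \<le> b \<Longrightarrow> 0 < k \<Longrightarrow> a \<le> b"
  by (metis not_le power_strict_mono)

text \<open>Here \<open>a m\<close> stands for the normalised
  \<open>g\<^sub>m(\<xi>\<^sub>m) / \<sigma>\<^sub>N\<close>. Only the pairs with
  \<open>\<xi> m\<close> are independent over m, and \<open>a m\<close> need not be a function of
  \<open>\<xi> m\<close>; this covers random functions. Covariances vanish in total, not cell by
  cell.\<close>

locale poisson_scheme = prob_space M for M :: "'a measure" +
  fixes N n :: nat and p :: "nat \<Rightarrow> real" and \<xi> :: "nat \<Rightarrow> 'a \<Rightarrow> nat" and a :: "nat \<Rightarrow> 'a \<Rightarrow> real"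
  assumes n_ge_2: "2 \<le> n"
    and p_pos: "\<And>m. m \<in> {1..N} \<Longrightarrow> 0 < p m"
    and p_sum: "(\<Sum>m=1..N. p m) = 1"
    and poisson: "\<And>m. m \<in> {1..N} \<Longrightarrow> poisson_variable M (\<xi> m) (n * p m)"
    and a_meas: "\<And>m. m \<in> {1..N} \<Longrightarrow> a m \<in> borel_measurable M"
    and indep: "indep_vars (\<lambda>_. borel) (\<lambda>m \<omega>. (a m \<omega>, real (\<xi> m \<omega>))) {1..N}"
    and a_int: "\<And>m. m \<in> {1..N} \<Longrightarrow> integrable M (\<lambda>\<omega>. \<bar>a m \<omega>\<bar> ^ 5)"
    and a_mean: "\<And>m. m \<in> {1..N} \<Longrightarrow> expectation (a m) = 0"
    and a_var: "(\<Sum>m=1..N. expectation (\<lambda>\<omega>. (a m \<omega>)\<^sup>2)) = 1"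
    and a_cov: "(\<Sum>m=1..N. expectation (\<lambda>\<omega>. a m \<omega> * (real (\<xi> m \<omega>) - n * p m))) = 0"
    and P2_le: "(\<Sum>m=1..N. (p m)\<^sup>2) \<le> 1 / (10 * ln n)"
begin

definition "x m \<omega> = (real (\<xi> m \<omega>) - n * p m) / sqrt n"
definition "beta j = (\<Sum>m=1..N. expectation (\<lambda>\<omega>. \<bar>a m \<omega>\<bar> ^ j))"
definition "xbeta j = (\<Sum>m=1..N. expectation (\<lambda>\<omega>. \<bar>x m \<omega>\<bar> ^ j))"
text \<open>The scale of the Poisson coordinate: \<open>xbeta 4\<close> is at most of order
  \<open>eps\<close> and \<open>xbeta 3\<close> at most of order \<open>sqrt eps\<close>.\<close>

definition "eps = 1 / n + (\<Sum>m=1..N. (p m)\<^sup>2)"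
definition "delta = root 4 ((\<Sum>m=1..N. p m ^ 3) + 1 / (real n)\<^sup>2) ^ 3"
text \<open>The factor 46 is the constant of \<open>xbeta_5\<close>, so that \<open>rho ^ 3\<close>
  dominates the fifth moment sums of both coordinates.\<close>

definition "rho = root 3 (beta 5 + 46 * delta)"
definition "lin u v m \<omega> = u * a m \<omega> + v * x m \<omega>"

lemma n_pos: "0 < real n" using n_ge_2 by simp

lemma N_pos: "0 < N" using p_sum by (cases N) auto

lemma x_meas: "m \<in> {1..N} \<Longrightarrow> x m \<in> borel_measurable M"
proof -
  assume m: "m \<in> {1..N}"
  interpret P: poisson_variable M "\<xi> m" "n * p m" by (rule poisson[OF m])
  show ?thesis unfolding x_def by measurable
qed

lemmas [measurable] = a_meas x_meas

lemma lin_meas [measurable]: "m \<in> {1..N} \<Longrightarrow> lin u v m \<in> borel_measurable M"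
  unfolding lin_def by measurable

lemma x_int: "m \<in> {1..N} \<Longrightarrow> integrable M (\<lambda>\<omega>. \<bar>x m \<omega>\<bar> ^ j)"
proof -
  assume m: "m \<in> {1..N}"
  interpret P: poisson_variable M "\<xi> m" "n * p m" by (rule poisson[OF m])
  show ?thesis using P.integrable_abs_central[of j] by (simp add: x_def abs_divide power_divide)
qed

lemma x_power_moments:
  assumes m: "m \<in> {1..N}"
  shows "expectation (x m) = 0" "expectation (\<lambda>\<omega>. (x m \<omega>)\<^sup>2) = p m"
    "expectation (\<lambda>\<omega>. \<bar>x m \<omega>\<bar> ^ 4) = 3 * (p m)\<^sup>2 + p m / n"
    "expectation (\<lambda>\<omega>. \<bar>x m \<omega>\<bar> ^ 5) \<le> 23 * (p m / (n * sqrt n) + (p m)\<^sup>2 * sqrt (p m))"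
proof -
  interpret P: poisson_variable M "\<xi> m" "n * p m" by (rule poisson[OF m])
  note c = P.central_moments
  show "expectation (x m) = 0" using c(1) unfolding x_def by simp
  show "expectation (\<lambda>\<omega>. (x m \<omega>)\<^sup>2) = p m"
    using c(2) n_pos unfolding x_def by (simp add: power_divide)
  show "expectation (\<lambda>\<omega>. \<bar>x m \<omega>\<bar> ^ 4) = 3 * (p m)\<^sup>2 + p m / n"
  proof -
    have "sqrt n ^ 4 = (real n)\<^sup>2" using n_pos by (simp add: power_numeral_reduce power2_eq_square)
    then show ?thesis
      using c(4) n_pos unfolding x_def by (simp add: power_divide power_even_abs field_simps power2_eq_square)
  qed
  have s5: "sqrt n ^ 5 = (real n)\<^sup>2 * sqrt n" using n_pos by (simp add: power_numeral_reduce power2_eq_square)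
  have "expectation (\<lambda>\<omega>. \<bar>x m \<omega>\<bar> ^ 5) = expectation (\<lambda>\<omega>. \<bar>real (\<xi> m \<omega>) - n * p m\<bar> ^ 5) / sqrt n ^ 5"
    unfolding x_def by (simp add: abs_divide power_divide)
  also have "\<dots> \<le> 23 * (n * p m + (n * p m)\<^sup>2 * sqrt (n * p m)) / sqrt n ^ 5"
    using P.abs_central_moment_5 by (intro divide_right_mono) auto
  also have "\<dots> = 23 * (p m / (n * sqrt n) + (p m)\<^sup>2 * sqrt (p m))"
    unfolding s5 using n_pos by (simp add: real_sqrt_mult field_simps power2_eq_square)
  finally show "expectation (\<lambda>\<omega>. \<bar>x m \<omega>\<bar> ^ 5) \<le> 23 * (p m / (n * sqrt n) + (p m)\<^sup>2 * sqrt (p m))" .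
qed

lemma xbeta_2: "(\<Sum>m=1..N. expectation (\<lambda>\<omega>. (x m \<omega>)\<^sup>2)) = 1"
  unfolding p_sum[symmetric] by (intro sum.cong refl x_power_moments(2))

lemma eps_pos: "0 < eps"
  unfolding eps_def using n_pos by (intro add_pos_nonneg sum_nonneg) auto

lemma xbeta_4: "xbeta 4 \<le> 3 * eps"
proof -
  have "xbeta 4 = (\<Sum>m=1..N. 3 * (p m)\<^sup>2 + p m / n)"
    unfolding xbeta_def using x_power_moments(3) by (intro sum.cong) auto
  also have "\<dots> = 3 * (\<Sum>m=1..N. (p m)\<^sup>2) + 1 / n"
    using p_sum by (simp add: sum.distrib sum_distrib_left sum_divide_distrib[symmetric])
  also have "\<dots> \<le> 3 * eps" using n_pos by (simp add: eps_def divide_right_mono)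
  finally show ?thesis .
qed

text \<open>Third powers are split at \<open>sqrt eps\<close> between second and fourth ones. The
  bound is kept in terms of \<open>eps\<close>, since the ranges of v are cut at a multiple of 1 /
  \<open>sqrt eps\<close>.\<close>

lemma xbeta_3: "xbeta 3 \<le> 4 * sqrt eps"
proof -
  have le: "\<bar>y\<bar> ^ 3 \<le> sqrt eps * y\<^sup>2 + \<bar>y\<bar> ^ 4 / sqrt eps" for y :: real
  proof (cases "\<bar>y\<bar> \<le> sqrt eps")
    case True
    have "\<bar>y\<bar> ^ 3 = \<bar>y\<bar> * y\<^sup>2" by (simp add: power3_eq_cube power2_eq_square flip: abs_mult)
    also have "\<dots> \<le> sqrt eps * y\<^sup>2" using True by (intro mult_right_mono) auto
    finally show ?thesis using eps_pos by (simp add: add_increasing2)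
  next
    case False
    have "\<bar>y\<bar> ^ 3 * sqrt eps \<le> \<bar>y\<bar> ^ 3 * \<bar>y\<bar>" using False by (intro mult_left_mono) auto
    then have "\<bar>y\<bar> ^ 3 \<le> \<bar>y\<bar> ^ 4 / sqrt eps"
      using eps_pos by (simp add: field_simps power_numeral_reduce)
    then show ?thesis using eps_pos by (simp add: add_increasing)
  qed
  have "xbeta 3 \<le> (\<Sum>m=1..N. expectation (\<lambda>\<omega>. sqrt eps * (x m \<omega>)\<^sup>2 + \<bar>x m \<omega>\<bar> ^ 4 / sqrt eps))"
    unfolding xbeta_def using x_int[of _ 2] le
    by (intro sum_mono integral_mono x_int Bochner_Integration.integrable_add integrable_mult_right integrable_divide) auto
  also have "\<dots> = sqrt eps * (\<Sum>m=1..N. expectation (\<lambda>\<omega>. (x m \<omega>)\<^sup>2)) + xbeta 4 / sqrt eps"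
    unfolding xbeta_def sum_distrib_left sum_divide_distrib sum.distrib[symmetric]
    using x_int[of _ 2] x_int[of _ 4] by (intro sum.cong refl) (simp add: power_even_abs)
  also have "\<dots> \<le> sqrt eps + 3 * eps / sqrt eps"
    unfolding xbeta_2 using xbeta_4 eps_pos by (simp add: divide_right_mono)
  also have "\<dots> = 4 * sqrt eps" using eps_pos by (simp add: field_simps)
  finally show ?thesis .
qed

definition "dl = root 4 ((\<Sum>m=1..N. p m ^ 3) + 1 / (real n)\<^sup>2)"

lemma dl_nonneg: "0 \<le> dl"
  unfolding dl_def using p_pos by (auto intro!: add_nonneg_nonneg sum_nonneg simp: less_imp_le)

lemma dl_pow4: "dl ^ 4 = (\<Sum>m=1..N. p m ^ 3) + 1 / (real n)\<^sup>2"
  unfolding dl_def using p_pos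
  by (intro real_root_pow_pos2) (auto intro!: add_nonneg_nonneg sum_nonneg simp: less_imp_le)

text \<open>Cauchy-Schwarz for p^2 = p^(1/2) p^(3/2), with the p m adding up to 1.\<close>

lemma P2_sq_le: "(\<Sum>m=1..N. (p m)\<^sup>2)\<^sup>2 \<le> (\<Sum>m=1..N. p m ^ 3)"
proof -
  have "(\<Sum>m=1..N. (p m)\<^sup>2)\<^sup>2 = (\<Sum>m=1..N. sqrt (p m) * (p m * sqrt (p m)))\<^sup>2"
    using p_pos by (intro arg_cong[where f = "\<lambda>y. y\<^sup>2"] sum.cong refl)
      (simp add: power2_eq_square less_imp_le mult.left_commute)
  also have "\<dots> \<le> (\<Sum>m=1..N. (sqrt (p m))\<^sup>2) * (\<Sum>m=1..N. (p m * sqrt (p m))\<^sup>2)"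
    by (rule Cauchy_Schwarz_ineq_sum)
  also have "(\<Sum>m=1..N. (sqrt (p m))\<^sup>2) = 1" using p_pos p_sum by (simp add: less_imp_le)
  also have "(\<Sum>m=1..N. (p m * sqrt (p m))\<^sup>2) = (\<Sum>m=1..N. p m ^ 3)"
    using p_pos by (intro sum.cong refl)
      (simp add: power_mult_distrib less_imp_le power3_eq_cube power2_eq_square)
  finally show ?thesis by simp
qed

lemma inverse_sqrt_n_le: "1 / sqrt n \<le> dl"
proof -
  have "(1 / sqrt n) ^ 4 \<le> dl ^ 4"
  proof -
    have "(1 / sqrt n) ^ 4 = ((1 / sqrt n)\<^sup>2)\<^sup>2" by (simp flip: power_mult)
    also have "\<dots> = 1 / (real n)\<^sup>2" using n_pos by (simp add: power_divide)
    also have "\<dots> \<le> dl ^ 4" unfolding dl_pow4 using p_pos by (auto intro!: sum_nonneg simp: less_imp_le)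
    finally show ?thesis .
  qed
  then show ?thesis using dl_nonneg by (rule power_le_imp_le) simp
qed

text \<open>The sum s of p^(5/2) satisfies s^2 \<le> P3 P2, and P2^2 \<le> P3, hence s^4 \<le> P3^3.
  This is the origin of the exponent 3/4 in the error term; the contribution n^(-3/2) has the same
  form with n^(-2) in place of P3.\<close>

lemma xbeta_5: "xbeta 5 \<le> 46 * delta"
proof -
  define s where "s = (\<Sum>m=1..N. (p m)\<^sup>2 * sqrt (p m))"
  have P3: "0 \<le> (\<Sum>m=1..N. p m ^ 3)" using p_pos by (auto intro!: sum_nonneg simp: less_imp_le)
  have s0: "0 \<le> s" unfolding s_def using p_pos by (auto intro!: sum_nonneg simp: less_imp_le)
  have "s\<^sup>2 = (\<Sum>m=1..N. (p m * sqrt (p m)) * p m)\<^sup>2"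
    unfolding s_def by (simp add: power2_eq_square ac_simps)
  also have "\<dots> \<le> (\<Sum>m=1..N. (p m * sqrt (p m))\<^sup>2) * (\<Sum>m=1..N. (p m)\<^sup>2)"
    by (rule Cauchy_Schwarz_ineq_sum)
  also have "(\<Sum>m=1..N. (p m * sqrt (p m))\<^sup>2) = (\<Sum>m=1..N. p m ^ 3)"
    using p_pos by (intro sum.cong refl)
      (simp add: power_mult_distrib less_imp_le power3_eq_cube power2_eq_square)
  finally have s2: "s\<^sup>2 \<le> (\<Sum>m=1..N. p m ^ 3) * (\<Sum>m=1..N. (p m)\<^sup>2)" .
  have "(s\<^sup>2)\<^sup>2 \<le> ((\<Sum>m=1..N. p m ^ 3) * (\<Sum>m=1..N. (p m)\<^sup>2))\<^sup>2"
    using s2 by (intro power_mono) auto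
  also have "\<dots> \<le> (\<Sum>m=1..N. p m ^ 3)\<^sup>2 * (\<Sum>m=1..N. p m ^ 3)"
    unfolding power_mult_distrib by (intro mult_left_mono P2_sq_le) auto
  also have "\<dots> = (\<Sum>m=1..N. p m ^ 3) ^ 3" by (simp add: power2_eq_square power3_eq_cube)
  also have "\<dots> \<le> (dl ^ 4) ^ 3" unfolding dl_pow4 using P3 by (intro power_mono) auto
  finally have "s ^ 4 \<le> (dl ^ 3) ^ 4" by (simp flip: power_mult)
  then have s: "s \<le> dl ^ 3"
    by (rule power_le_imp_le) (use dl_nonneg in auto)
  have "(1 / sqrt n) ^ 3 \<le> dl ^ 3" using inverse_sqrt_n_le by (intro power_mono) auto
  also have "(1 / sqrt n) ^ 3 = 1 / (n * sqrt n)" using n_pos by (simp add: power_divide power3_eq_cube)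
  finally have t: "1 / (n * sqrt n) \<le> dl ^ 3" .
  have "xbeta 5 \<le> (\<Sum>m=1..N. 23 * (p m / (n * sqrt n) + (p m)\<^sup>2 * sqrt (p m)))"
    unfolding xbeta_def using x_power_moments(4) by (intro sum_mono) auto
  also have "\<dots> = 23 * (1 / (n * sqrt n) + s)"
    using p_sum by (simp add: s_def sum.distrib flip: sum_distrib_left sum_divide_distrib)
  also have "\<dots> \<le> 23 * (dl ^ 3 + dl ^ 3)" using s t by (intro mult_left_mono add_mono) auto
  also have "\<dots> = 46 * dl ^ 3" by simp
  finally show ?thesis unfolding delta_def dl_def .
qed

lemma beta_nonneg: "0 \<le> beta j" unfolding beta_def by (intro sum_nonneg) auto

lemma delta_pos: "0 < delta"
proof -
  have "0 < 1 / sqrt n" using n_pos by simp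
  then have "0 < dl" using inverse_sqrt_n_le by linarith
  then show ?thesis by (simp add: delta_def dl_def)
qed

lemma rho_pow3: "rho ^ 3 = beta 5 + 46 * delta"
  unfolding rho_def using beta_nonneg[of 5] delta_pos by (intro real_root_pow_pos2) auto

lemma rho_pos: "0 < rho"
  unfolding rho_def using beta_nonneg[of 5] delta_pos by (simp add: add_nonneg_pos)

text \<open>The square of \<open>eps\<close> is at most 2 \<open>dl ^ 4\<close>, so
  \<open>sqrt eps\<close> is at most 2 \<open>dl\<close>, and its cube 8 \<open>dl ^ 3\<close> fits
  into 46 \<open>delta\<close>.\<close>

lemma sqrt_eps_le_rho: "sqrt eps \<le> rho"
proof -
  have "eps\<^sup>2 \<le> 2 * ((\<Sum>m=1..N. (p m)\<^sup>2)\<^sup>2 + 1 / (real n)\<^sup>2)"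
    unfolding eps_def using sum_squares_bound[of "1 / n" "\<Sum>m=1..N. (p m)\<^sup>2"]
    by (simp add: power2_sum power_divide)
  also have "\<dots> \<le> 2 * dl ^ 4" unfolding dl_pow4 using P2_sq_le by simp
  also have "\<dots> \<le> (2 * dl) ^ 4" using dl_nonneg by (simp add: power_mult_distrib)
  finally have "sqrt eps ^ 4 \<le> (2 * dl) ^ 4"
    using eps_pos power_mult[of "sqrt eps" 2 2] by simp
  then have "sqrt eps \<le> 2 * dl" by (rule power_le_imp_le) (use dl_nonneg in auto)
  then have "sqrt eps ^ 3 \<le> (2 * dl) ^ 3" using eps_pos by (intro power_mono) auto
  also have "\<dots> \<le> 46 * delta" unfolding delta_def dl_def[symmetric] using dl_nonneg by (simp add: power_mult_distrib)
  also have "\<dots> \<le> rho ^ 3" unfolding rho_pow3 using beta_nonneg[of 5] by simp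
  finally show ?thesis by (rule power_le_imp_le) (use rho_pos in auto)
qed

text \<open>Lyapunov's inequality in summed form: \<open>power_interpolation\<close> at the
  threshold \<open>rho\<close>, where both halves are at most \<open>rho ^ (j - 2)\<close>.\<close>

lemma sum_moments_le:
  assumes m: "\<And>m. m \<in> {1..N} \<Longrightarrow> y m \<in> borel_measurable M"
    and i: "\<And>m. m \<in> {1..N} \<Longrightarrow> integrable M (\<lambda>\<omega>. \<bar>y m \<omega>\<bar> ^ 5)"
    and 2: "(\<Sum>m=1..N. expectation (\<lambda>\<omega>. (y m \<omega>)\<^sup>2)) = 1"
    and 5: "(\<Sum>m=1..N. expectation (\<lambda>\<omega>. \<bar>y m \<omega>\<bar> ^ 5)) \<le> rho ^ 3"
    and j: "2 \<le> j" "j \<le> 5"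
  shows "(\<Sum>m=1..N. expectation (\<lambda>\<omega>. \<bar>y m \<omega> :: real\<bar> ^ j)) \<le> 2 * rho ^ (j - 2)"
proof -
  note ij = integrable_abs_power_mono[OF m i]
  have "(\<Sum>m=1..N. expectation (\<lambda>\<omega>. \<bar>y m \<omega>\<bar> ^ j))
    \<le> (\<Sum>m=1..N. expectation (\<lambda>\<omega>. rho ^ (j - 2) * \<bar>y m \<omega>\<bar>\<^sup>2 + \<bar>y m \<omega>\<bar> ^ 5 / rho ^ (5 - j)))"
    using j rho_pos by (intro sum_mono integral_mono ij Bochner_Integration.integrable_add
      integrable_mult_right integrable_divide power_interpolation) auto
  also have "\<dots> = rho ^ (j - 2) * (\<Sum>m=1..N. expectation (\<lambda>\<omega>. (y m \<omega>)\<^sup>2))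
     + (\<Sum>m=1..N. expectation (\<lambda>\<omega>. \<bar>y m \<omega>\<bar> ^ 5)) / rho ^ (5 - j)"
    unfolding sum_distrib_left sum_divide_distrib sum.distrib[symmetric]
    using ij[of _ 2] i by (intro sum.cong refl) simp
  also have "\<dots> \<le> rho ^ (j - 2) + rho ^ 3 / rho ^ (5 - j)"
    unfolding 2 using 5 rho_pos by (simp add: divide_right_mono)
  also have "rho ^ 3 / rho ^ (5 - j) = rho ^ (j - 2)"
  proof -
    have "rho ^ (j - 2) * rho ^ (5 - j) = rho ^ 3" using j by (simp flip: power_add)
    then show ?thesis using rho_pos by (simp add: field_simps)
  qed
  finally show ?thesis by simp
qed

lemma beta_le:
  assumes "2 \<le> j" "j \<le> 5"
  shows "beta j \<le> 2 * rho ^ (j - 2)"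
proof -
  have "beta 5 \<le> rho ^ 3" unfolding rho_pow3 using delta_pos by simp
  then show ?thesis
    using sum_moments_le[of a, OF a_meas a_int a_var _ assms] unfolding beta_def by blast
qed

lemma xbeta_le:
  assumes "2 \<le> j" "j \<le> 5"
  shows "xbeta j \<le> 2 * rho ^ (j - 2)"
proof -
  have "xbeta 5 \<le> rho ^ 3" unfolding rho_pow3 using xbeta_5 beta_nonneg[of 5] by simp
  then show ?thesis
    using sum_moments_le[of x, OF x_meas x_int xbeta_2 _ assms] unfolding xbeta_def by blast
qed

lemma a_int': "m \<in> {1..N} \<Longrightarrow> j \<le> 5 \<Longrightarrow> integrable M (\<lambda>\<omega>. a m \<omega> ^ j)"
  by (rule integrable_power_mono[OF a_meas a_int])

lemma x_int': "m \<in> {1..N} \<Longrightarrow> integrable M (\<lambda>\<omega>. x m \<omega> ^ j)"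
  by (rule integrable_power_mono[OF x_meas x_int order_refl])

lemma lin_int: "m \<in> {1..N} \<Longrightarrow> j \<le> 5 \<Longrightarrow> integrable M (\<lambda>\<omega>. \<bar>lin u v m \<omega>\<bar> ^ j)"
proof -
  assume m: "m \<in> {1..N}" "j \<le> 5"
  note ij = integrable_abs_power_mono[OF a_meas a_int]
  show ?thesis
  proof (rule Bochner_Integration.integrable_bound)
    show "integrable M (\<lambda>\<omega>. (1 + \<bar>u\<bar> + \<bar>v\<bar>) ^ j * (\<bar>a m \<omega>\<bar> ^ j + \<bar>x m \<omega>\<bar> ^ j))"
      using m ij x_int by simp
    show "AE \<omega> in M. norm (\<bar>lin u v m \<omega>\<bar> ^ j) \<le> norm ((1 + \<bar>u\<bar> + \<bar>v\<bar>) ^ j * (\<bar>a m \<omega>\<bar> ^ j + \<bar>x m \<omega>\<bar> ^ j))"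
    proof (rule AE_I2)
      fix \<omega>
      show "norm (\<bar>lin u v m \<omega>\<bar> ^ j) \<le> norm ((1 + \<bar>u\<bar> + \<bar>v\<bar>) ^ j * (\<bar>a m \<omega>\<bar> ^ j + \<bar>x m \<omega>\<bar> ^ j))"
        using order_trans[OF abs_lin_power_le[of u "a m \<omega>" v "x m \<omega>" j] abs_ge_self]
        by (simp only: real_norm_def lin_def power_abs abs_idempotent)
    qed
    show "(\<lambda>\<omega>. \<bar>lin u v m \<omega>\<bar> ^ j) \<in> borel_measurable M" using m by measurable
  qed
qed

lemma lin_int': "m \<in> {1..N} \<Longrightarrow> j \<le> 5 \<Longrightarrow> integrable M (\<lambda>\<omega>. lin u v m \<omega> ^ j)"
  by (rule integrable_power_mono[OF lin_meas lin_int[OF _ order_refl]])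

lemma sum_lin_le:
  assumes "j \<le> 5"
  shows "(\<Sum>m=1..N. expectation (\<lambda>\<omega>. \<bar>lin u v m \<omega>\<bar> ^ j)) \<le> (1 + \<bar>u\<bar> + \<bar>v\<bar>) ^ j * (beta j + xbeta j)"
proof -
  note ij = integrable_abs_power_mono[OF a_meas a_int]
  have "(\<Sum>m=1..N. expectation (\<lambda>\<omega>. \<bar>lin u v m \<omega>\<bar> ^ j))
     \<le> (\<Sum>m=1..N. expectation (\<lambda>\<omega>. (1 + \<bar>u\<bar> + \<bar>v\<bar>) ^ j * (\<bar>a m \<omega>\<bar> ^ j + \<bar>x m \<omega>\<bar> ^ j)))"
    using assms unfolding lin_def[abs_def]
    by (intro sum_mono integral_mono lin_int[unfolded lin_def] Bochner_Integration.integrable_add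
      integrable_mult_right ij x_int abs_lin_power_le) auto
  also have "\<dots> = (1 + \<bar>u\<bar> + \<bar>v\<bar>) ^ j * (beta j + xbeta j)"
    unfolding beta_def xbeta_def sum_distrib_left sum.distrib[symmetric]
    using ij assms x_int by (intro sum.cong refl) simp
  finally show ?thesis .
qed

lemma lin_mean: "m \<in> {1..N} \<Longrightarrow> expectation (lin u v m) = 0"
  using a_int'[of m 1] x_int'[of m 1]
    a_mean[of m] x_power_moments(1)[of m]
  unfolding lin_def[abs_def] by simp

text \<open>The mixed terms add up to 0 by \<open>a_cov\<close>. This is the purpose of subtracting
  the regression on \<xi> in g.\<close>

lemma sum_lin_sq: "(\<Sum>m=1..N. expectation (\<lambda>\<omega>. (lin u v m \<omega>)\<^sup>2)) = u\<^sup>2 + v\<^sup>2"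
proof -
  have i: "integrable M (\<lambda>\<omega>. (a m \<omega>)\<^sup>2)" "integrable M (\<lambda>\<omega>. (x m \<omega>)\<^sup>2)" if "m \<in> {1..N}" for m
    using a_int'[of m 2] x_int'[of m 2] that by auto
  have ix: "integrable M (\<lambda>\<omega>. a m \<omega> * x m \<omega>)" if m: "m \<in> {1..N}" for m
  proof (rule Bochner_Integration.integrable_bound)
    show "integrable M (\<lambda>\<omega>. (a m \<omega>)\<^sup>2 + (x m \<omega>)\<^sup>2)" using i[OF m] by simp
    have "\<bar>y * z\<bar> \<le> y\<^sup>2 + z\<^sup>2" for y z :: real
    proof -
      have "0 \<le> \<bar>y\<bar> * \<bar>z\<bar>" by simp
      then show ?thesis using sum_squares_bound[of "\<bar>y\<bar>" "\<bar>z\<bar>"] unfolding abs_mult power2_abs by linarith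
    qed
    then show "AE \<omega> in M. norm (a m \<omega> * x m \<omega>) \<le> norm ((a m \<omega>)\<^sup>2 + (x m \<omega>)\<^sup>2)" by simp
  qed (use m in simp)
  have "expectation (\<lambda>\<omega>. (lin u v m \<omega>)\<^sup>2) = u\<^sup>2 * expectation (\<lambda>\<omega>. (a m \<omega>)\<^sup>2)
      + v\<^sup>2 * expectation (\<lambda>\<omega>. (x m \<omega>)\<^sup>2) + 2 * u * v * expectation (\<lambda>\<omega>. a m \<omega> * x m \<omega>)"
    if m: "m \<in> {1..N}" for m
  proof -
    have "(\<lambda>\<omega>. (lin u v m \<omega>)\<^sup>2) = (\<lambda>\<omega>. u\<^sup>2 * (a m \<omega>)\<^sup>2 + v\<^sup>2 * (x m \<omega>)\<^sup>2 + 2 * u * v * (a m \<omega> * x m \<omega>))"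
      by (simp add: lin_def power2_eq_square algebra_simps fun_eq_iff)
    then show ?thesis using i[OF m] ix[OF m] by simp
  qed
  then have "(\<Sum>m=1..N. expectation (\<lambda>\<omega>. (lin u v m \<omega>)\<^sup>2)) = u\<^sup>2 * (\<Sum>m=1..N. expectation (\<lambda>\<omega>. (a m \<omega>)\<^sup>2))
      + v\<^sup>2 * (\<Sum>m=1..N. expectation (\<lambda>\<omega>. (x m \<omega>)\<^sup>2)) + 2 * u * v * (\<Sum>m=1..N. expectation (\<lambda>\<omega>. a m \<omega> * x m \<omega>))"
    by (simp add: sum.distrib sum_distrib_left)
  also have "(\<Sum>m=1..N. expectation (\<lambda>\<omega>. a m \<omega> * x m \<omega>)) = 0"
    using a_cov by (simp add: x_def sum_divide_distrib[symmetric])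
  finally show ?thesis unfolding a_var xbeta_2 by simp
qed

end

section \<open>Expansion of the joint characteristic function\<close>

text \<open>The numbers 8, 3 and 100 give 24/100 < 1/4, so that higher cumulants consume at most
  half of the Gaussian exponent, up to an additive 1.\<close>

lemma quarter_bound:
  fixes x y :: real
  assumes "z \<le> 8 * (3 * (1 + x\<^sup>2 + y\<^sup>2)) / 100"
  shows "z \<le> 1 + (x\<^sup>2 + y\<^sup>2) / 4"
proof -
  have "8 * (3 * (1 + x\<^sup>2 + y\<^sup>2)) / 100 = 24 / 100 + 24 / 100 * x\<^sup>2 + 24 / 100 * y\<^sup>2" by simp
  also have "\<dots> \<le> 1 + 1 / 4 * x\<^sup>2 + 1 / 4 * y\<^sup>2" by (intro add_mono mult_right_mono) auto
  also have "\<dots> = 1 + (x\<^sup>2 + y\<^sup>2) / 4" by (simp add: field_simps)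
  finally show ?thesis using assms by linarith
qed

context poisson_scheme
begin

definition "psi u v m = expectation (\<lambda>\<omega>. iexp (lin u v m \<omega>))"
definition "Psi u v = (\<Prod>m=1..N. psi u v m)"
definition "Q3 u v = (\<Sum>m=1..N. expectation (\<lambda>\<omega>. lin u v m \<omega> ^ 3))"
definition "Q4 u v = (\<Sum>m=1..N. expectation (\<lambda>\<omega>. lin u v m \<omega> ^ 4) - 3 * (expectation (\<lambda>\<omega>. (lin u v m \<omega>)\<^sup>2))\<^sup>2)"
text \<open>The Edgeworth polynomial of the sum: exp (- i Q3 / 6 + Q4 / 24) truncated, with Q4
  counted as second order. The first-order correction is exactly the imaginary part and the
  second-order one sits in the real part.\<close>

definition "Pol u v = Complex (1 + Q4 u v / 24 - (Q3 u v)\<^sup>2 / 72) (- Q3 u v / 6)"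

abbreviation q :: "real \<Rightarrow> real \<Rightarrow> real" where "q u v \<equiv> 1 + \<bar>u\<bar> + \<bar>v\<bar>"

lemma sum_lin_le_rho:
  assumes "2 \<le> j" "j \<le> 5"
  shows "(\<Sum>m=1..N. expectation (\<lambda>\<omega>. \<bar>lin u v m \<omega>\<bar> ^ j)) \<le> 4 * rho ^ (j - 2) * q u v ^ j"
proof -
  have "(\<Sum>m=1..N. expectation (\<lambda>\<omega>. \<bar>lin u v m \<omega>\<bar> ^ j)) \<le> q u v ^ j * (beta j + xbeta j)"
    using assms by (intro sum_lin_le) auto
  also have "\<dots> \<le> q u v ^ j * (4 * rho ^ (j - 2))"
    using beta_le[OF assms] xbeta_le[OF assms] by (intro mult_left_mono) auto
  finally show ?thesis by (simp add: ac_simps)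
qed

lemma abs_Q3_le: "\<bar>Q3 u v\<bar> \<le> 4 * rho * q u v ^ 3"
proof -
  have "\<bar>Q3 u v\<bar> \<le> (\<Sum>m=1..N. \<bar>expectation (\<lambda>\<omega>. lin u v m \<omega> ^ 3)\<bar>)"
    unfolding Q3_def by (rule sum_abs)
  also have "\<dots> \<le> (\<Sum>m=1..N. expectation (\<lambda>\<omega>. \<bar>lin u v m \<omega>\<bar> ^ 3))"
    by (intro sum_mono order_trans[OF integral_abs_bound]) (simp add: power_abs)
  finally show ?thesis using sum_lin_le_rho[of 3 u v] by simp
qed

lemma lin_sq_sq_le:
  assumes "m \<in> {1..N}"
  shows "(expectation (\<lambda>\<omega>. (lin u v m \<omega>)\<^sup>2))\<^sup>2 \<le> expectation (\<lambda>\<omega>. lin u v m \<omega> ^ 4)"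
  using expectation_sq_le[of "\<lambda>\<omega>. (lin u v m \<omega>)\<^sup>2"] lin_int'[OF assms, of 2 u v] lin_int'[OF assms, of 4 u v]
  by (simp flip: power_mult)

lemma abs_Q4_le: "\<bar>Q4 u v\<bar> \<le> 16 * rho\<^sup>2 * q u v ^ 4"
proof -
  have "\<bar>Q4 u v\<bar> \<le> (\<Sum>m=1..N. 4 * expectation (\<lambda>\<omega>. \<bar>lin u v m \<omega>\<bar> ^ 4))"
    unfolding Q4_def
  proof (intro order_trans[OF sum_abs] sum_mono)
    fix m assume m: "m \<in> {1..N}"
    show "\<bar>expectation (\<lambda>\<omega>. lin u v m \<omega> ^ 4) - 3 * (expectation (\<lambda>\<omega>. (lin u v m \<omega>)\<^sup>2))\<^sup>2\<bar>
       \<le> 4 * expectation (\<lambda>\<omega>. \<bar>lin u v m \<omega>\<bar> ^ 4)"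
    proof -
      have "expectation (\<lambda>\<omega>. \<bar>lin u v m \<omega>\<bar> ^ 4) = expectation (\<lambda>\<omega>. lin u v m \<omega> ^ 4)"
        by (simp add: power_even_abs)
      then show ?thesis
        using lin_sq_sq_le[OF m, of u v] zero_le_power2[of "expectation (\<lambda>\<omega>. (lin u v m \<omega>)\<^sup>2)"] by linarith
    qed
  qed
  also have "\<dots> = 4 * (\<Sum>m=1..N. expectation (\<lambda>\<omega>. \<bar>lin u v m \<omega>\<bar> ^ 4))"
    by (rule sum_distrib_left[symmetric])
  finally show ?thesis using sum_lin_le_rho[of 4 u v] by simp
qed

lemma cmod_Pol_le: "cmod (Pol u v) \<le> 1 + rho * q u v ^ 3 + rho\<^sup>2 * q u v ^ 6"
proof -
  have "cmod (Pol u v) \<le> \<bar>1 + Q4 u v / 24 - (Q3 u v)\<^sup>2 / 72\<bar> + \<bar>- Q3 u v / 6\<bar>"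
    unfolding Pol_def by (rule order_trans[OF cmod_le]) simp
  also have "\<dots> \<le> 1 + \<bar>Q4 u v\<bar> / 24 + (Q3 u v)\<^sup>2 / 72 + \<bar>Q3 u v\<bar> / 6"
  proof -
    have "\<bar>1 + y - z\<bar> \<le> 1 + \<bar>y\<bar> + z" if "0 \<le> z" for y z :: real using that by linarith
    from this[of "(Q3 u v)\<^sup>2 / 72" "Q4 u v / 24"] show ?thesis by simp
  qed
  also have "(Q3 u v)\<^sup>2 \<le> (4 * rho * q u v ^ 3)\<^sup>2"
    using abs_Q3_le[of u v] by (metis abs_ge_zero power2_abs power_mono)
  also have "\<dots> = 16 * (rho\<^sup>2 * q u v ^ 6)" by (simp add: power_mult_distrib flip: power_mult)
  finally have "cmod (Pol u v) \<le> 1 + \<bar>Q4 u v\<bar> / 24 + 16 * (rho\<^sup>2 * q u v ^ 6) / 72 + \<bar>Q3 u v\<bar> / 6"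
    by simp
  moreover have "rho\<^sup>2 * q u v ^ 4 \<le> rho\<^sup>2 * q u v ^ 6"
    by (intro mult_left_mono power_increasing) auto
  moreover have "0 \<le> rho * q u v ^ 3" using rho_pos by simp
  moreover have "0 \<le> rho\<^sup>2 * q u v ^ 6" by simp
  ultimately show ?thesis using abs_Q3_le[of u v] abs_Q4_le[of u v] by linarith
qed

text \<open>Both products are divided by a common majorant \<open>w\<close>. Then all factors lie in
  the unit disc, the difference of the products is at most the sum of the differences, and the
  product of the majorants still provides Gaussian decay.\<close>

lemma psi_expansion_product:
  assumes small: "rho ^ 3 * q u v ^ 5 \<le> 1 / 10 ^ 6"
  shows "cmod (Psi u v - exp (Complex (- (u\<^sup>2 + v\<^sup>2) / 2 + Q4 u v / 24) (- Q3 u v / 6)))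
      \<le> 2800 * rho ^ 3 * q u v ^ 5 * exp (- (u\<^sup>2 + v\<^sup>2) / 4)"
proof -
  define Q where "Q = q u v"
  define d where "d = rho ^ 3 * Q ^ 5"
  define s where "s m = expectation (\<lambda>\<omega>. (lin u v m \<omega>)\<^sup>2)" for m
  define b where "b j m = expectation (\<lambda>\<omega>. \<bar>lin u v m \<omega>\<bar> ^ j)" for j m
  \<comment> \<open>The summand d / N makes \<open>r m\<close> positive, as
    \<open>char_variable_cumulants\<close> demands, and adds only d in total.\<close>
  define r where "r m = root 5 (b 5 m + d / N)" for m
  define ch where "ch m = exp (Complex (- s m / 2 + (expectation (\<lambda>\<omega>. lin u v m \<omega> ^ 4) - 3 * (s m)\<^sup>2) / 24)
     (- expectation (\<lambda>\<omega>. lin u v m \<omega> ^ 3) / 6))" for m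
  \<comment> \<open>The third moment is there for the characteristic function, the fourth for the
    exponential of the cumulants.\<close>
  define w where "w m = exp (- s m / 2 + b 3 m + b 4 m)" for m
  have Q1: "1 \<le> Q" by (simp add: Q_def)
  have d0: "0 < d" using rho_pos Q1 by (simp add: d_def)
  have d_le: "d \<le> 1 / 10 ^ 6" using small by (simp add: d_def Q_def)
  have b0: "0 \<le> b j m" for j m by (simp add: b_def)
  have bsum: "(\<Sum>m=1..N. b j m) \<le> 4 * rho ^ (j - 2) * Q ^ j" if "2 \<le> j" "j \<le> 5" for j
    unfolding b_def Q_def using that by (rule sum_lin_le_rho)
  have ssum: "(\<Sum>m=1..N. s m) = u\<^sup>2 + v\<^sup>2" unfolding s_def by (rule sum_lin_sq)
  have b5: "(\<Sum>m=1..N. b 5 m) \<le> 4 * d" using bsum[of 5] by (simp add: d_def)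
  have b5m: "b 5 m \<le> 4 * d" if "m \<in> {1..N}" for m
    using member_le_sum[OF that, of "b 5"] b0 b5 by simp
  have r5: "r m ^ 5 = b 5 m + d / N" and r0: "0 < r m" for m
    using b0[of 5 m] d0 N_pos unfolding r_def
    by (auto intro!: real_root_pow_pos2 add_nonneg_nonneg add_nonneg_pos)
  have r1: "r m \<le> 1" if "m \<in> {1..N}" for m
  proof (rule power_le_imp_le)
    have "d / N \<le> d" using d0 N_pos by (simp add: divide_le_eq)
    then show "r m ^ 5 \<le> 1 ^ 5" using r5 b5m[OF that] d_le by simp
  qed auto
  have rsum: "(\<Sum>m=1..N. r m ^ 5) \<le> 5 * d"
    unfolding r5 using b5 N_pos by (simp add: sum.distrib)
  have s2: "s m \<le> 2" if m: "m \<in> {1..N}" for m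
  proof -
    have "s m \<le> expectation (\<lambda>\<omega>. 1 + \<bar>lin u v m \<omega>\<bar> ^ 5)"
      unfolding s_def using lin_int[OF m, of 5 u v] lin_int'[OF m, of 2 u v]
        power_le_one_plus_power[of "\<bar>lin u v m _\<bar>" 2 5]
      by (intro integral_mono) auto
    also have "\<dots> = 1 + b 5 m" using lin_int[OF m, of 5 u v] by (simp add: b_def prob_space)
    finally show ?thesis using b5m[OF m] d_le by simp
  qed
  have psi_w: "cmod (psi u v m) \<le> w m" if m: "m \<in> {1..N}" for m
  proof -
    have "cmod (psi u v m) \<le> exp (- s m / 2 + b 3 m)"
      unfolding psi_def s_def b_def using lin_int[OF m, of 3 u v] lin_mean[OF m] m
      by (intro char_variable_le_exp) auto
    also have "\<dots> \<le> w m" unfolding w_def using b0[of 4 m] by simp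
    finally show ?thesis .
  qed
  have ch_w: "cmod (ch m) \<le> w m" if m: "m \<in> {1..N}" for m
  proof -
    have "expectation (\<lambda>\<omega>. lin u v m \<omega> ^ 4) = b 4 m" unfolding b_def by (simp add: power_even_abs)
    then show ?thesis unfolding ch_def w_def
      by (simp add: norm_exp_eq_Re) (use b0[of 3 m] b0[of 4 m] zero_le_power2[of "s m"] in linarith)
  qed
  have diff: "cmod (psi u v m - ch m) \<le> 70 * r m ^ 5" if m: "m \<in> {1..N}" for m
    unfolding psi_def ch_def s_def
    using lin_int[OF m, of 5 u v] lin_mean[OF m] m r0 r1[OF m] r5[of m] d0 N_pos
    by (intro char_variable_cumulants) (auto simp: b_def)
  have w0: "0 < w m" for m by (simp add: w_def)
  \<comment> \<open>Each single variance is at most 2, so undoing one majorant costs no more than a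
    factor e.\<close>
  have iw: "1 / w m \<le> exp 1" if m: "m \<in> {1..N}" for m
  proof -
    have "1 / w m = exp (- (- s m / 2 + b 3 m + b 4 m))" by (simp only: w_def exp_minus inverse_eq_divide)
    also have "\<dots> \<le> exp 1" using s2[OF m] b0[of 3 m] b0[of 4 m] by simp
    finally show ?thesis .
  qed
  have wprod: "(\<Prod>m=1..N. w m) \<le> exp (1 - (u\<^sup>2 + v\<^sup>2) / 4)"
  proof -
    \<comment> \<open>Since 10^6 = 100^3, the smallness of \<open>rho ^ 3 * Q ^ 5\<close> passes to
      \<open>rho * Q\<close>; this bounds the third and fourth moment sums by a hundredth of a
      multiple of \<open>Q\<^sup>2\<close>.\<close>
    have rQ: "rho * Q \<le> 1 / 100"
    proof (rule power_le_imp_le)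
      have "(rho * Q) ^ 3 \<le> rho ^ 3 * Q ^ 5"
        unfolding power_mult_distrib using Q1 rho_pos by (intro mult_left_mono power_increasing) auto
      also have "\<dots> \<le> (1 / 100) ^ 3" using d_le unfolding d_def by (simp add: power_divide)
      finally show "(rho * Q) ^ 3 \<le> (1 / 100) ^ 3" .
    qed auto
    have "rho * Q ^ 3 = (rho * Q) * Q\<^sup>2" by (simp add: power3_eq_cube power2_eq_square)
    also have "\<dots> \<le> 1 / 100 * Q\<^sup>2" using rQ by (intro mult_right_mono) auto
    finally have 1: "rho * Q ^ 3 \<le> Q\<^sup>2 / 100" by simp
    have "rho\<^sup>2 * Q ^ 4 = (rho * Q) * ((rho * Q) * Q\<^sup>2)" by (simp add: power2_eq_square power4_eq_xxxx)
    also have "\<dots> \<le> 1 * (1 / 100 * Q\<^sup>2)"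
      using rQ rho_pos Q1 by (intro mult_mono mult_right_mono) auto
    finally have 2: "rho\<^sup>2 * Q ^ 4 \<le> Q\<^sup>2 / 100" by simp
    have "(\<Prod>m=1..N. w m) = exp (\<Sum>m=1..N. - s m / 2 + b 3 m + b 4 m)"
      unfolding w_def by (rule exp_sum[symmetric]) simp
    also have "(\<Sum>m=1..N. - s m / 2 + b 3 m + b 4 m) = - (u\<^sup>2 + v\<^sup>2) / 2 + (\<Sum>m=1..N. b 3 m) + (\<Sum>m=1..N. b 4 m)"
      unfolding ssum[symmetric] by (simp add: sum.distrib sum_negf sum_subtractf sum_divide_distrib diff_divide_distrib)
    also have "exp \<dots> \<le> exp (1 - (u\<^sup>2 + v\<^sup>2) / 4)"
    proof -
      have "(\<Sum>m=1..N. b 3 m) + (\<Sum>m=1..N. b 4 m) \<le> 8 * Q\<^sup>2 / 100"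
        using bsum[of 3] bsum[of 4] 1 2 by simp
      also have "\<dots> \<le> 8 * (3 * (1 + u\<^sup>2 + v\<^sup>2)) / 100"
        using one_plus_abs_sq_le[of u v, folded Q_def] by (intro divide_right_mono mult_left_mono) auto
      finally have "(\<Sum>m=1..N. b 3 m) + (\<Sum>m=1..N. b 4 m) \<le> 1 + (u\<^sup>2 + v\<^sup>2) / 4"
        by (rule quarter_bound)
      then show ?thesis by (simp add: field_simps)
    qed
    finally show ?thesis .
  qed
  have split: "(\<Prod>m=1..N. f m) = of_real (\<Prod>m=1..N. w m) * (\<Prod>m=1..N. f m / of_real (w m))" for f :: "nat \<Rightarrow> complex"
    using w0 by (simp add: prod.distrib[symmetric] less_imp_neq[OF w0, symmetric])
  have "cmod ((\<Prod>m=1..N. psi u v m / of_real (w m)) - (\<Prod>m=1..N. ch m / of_real (w m)))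
      \<le> (\<Sum>m=1..N. cmod (psi u v m / of_real (w m) - ch m / of_real (w m)))"
    using psi_w ch_w w0 by (intro norm_prod_diff) (auto simp: norm_divide less_imp_le)
  also have "\<dots> \<le> (\<Sum>m=1..N. 70 * r m ^ 5 * exp 1)"
  proof (rule sum_mono)
    fix m assume m: "m \<in> {1..N}"
    have "cmod (psi u v m / of_real (w m) - ch m / of_real (w m)) = cmod (psi u v m - ch m) * (1 / w m)"
      using w0[of m] by (simp add: norm_divide flip: diff_divide_distrib)
    also have "\<dots> \<le> 70 * r m ^ 5 * exp 1"
      using diff[OF m] iw[OF m] w0[of m] r0[of m] by (intro mult_mono) auto
    finally show "cmod (psi u v m / of_real (w m) - ch m / of_real (w m)) \<le> 70 * r m ^ 5 * exp 1" .
  qed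
  also have "\<dots> = 70 * exp 1 * (\<Sum>m=1..N. r m ^ 5)" by (simp add: sum_distrib_left ac_simps)
  also have "\<dots> \<le> 70 * exp 1 * (5 * d)" using rsum by (intro mult_left_mono) auto
  finally have e1: "cmod ((\<Prod>m=1..N. psi u v m / of_real (w m)) - (\<Prod>m=1..N. ch m / of_real (w m))) \<le> 350 * exp 1 * d"
    by simp
  have "cmod (Psi u v - (\<Prod>m=1..N. ch m)) = (\<Prod>m=1..N. w m) *
      cmod ((\<Prod>m=1..N. psi u v m / of_real (w m)) - (\<Prod>m=1..N. ch m / of_real (w m)))"
    unfolding Psi_def split[of "psi u v"] split[of ch] right_diff_distrib[symmetric] norm_mult norm_of_real
    using w0 by (simp add: prod_nonneg less_imp_le)
  also have "\<dots> \<le> exp (1 - (u\<^sup>2 + v\<^sup>2) / 4) * (350 * exp 1 * d)"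
    using wprod e1 by (intro mult_mono) auto
  also have "exp (1 - (u\<^sup>2 + v\<^sup>2) / 4) = exp 1 * exp (- (u\<^sup>2 + v\<^sup>2) / 4)"
    unfolding exp_add[symmetric] by (rule arg_cong[where f = exp]) (simp add: field_simps)
  also have "exp 1 * exp (- (u\<^sup>2 + v\<^sup>2) / 4) * (350 * exp 1 * d)
      = 350 * d * exp (- (u\<^sup>2 + v\<^sup>2) / 4) * (exp 1 * exp 1)" by (simp only: ac_simps)
  also have "\<dots> \<le> 350 * d * exp (- (u\<^sup>2 + v\<^sup>2) / 4) * (2.8 * 2.8)"
    using e_less_272 d0 by (intro mult_left_mono mult_mono) auto
  also have "\<dots> \<le> 2800 * d * exp (- (u\<^sup>2 + v\<^sup>2) / 4)" using d0 by simp
  finally have main: "cmod (Psi u v - (\<Prod>m=1..N. ch m)) \<le> 2800 * d * exp (- (u\<^sup>2 + v\<^sup>2) / 4)" .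
  have "(\<Prod>m=1..N. ch m) = exp (\<Sum>m=1..N. Complex (- s m / 2 + (expectation (\<lambda>\<omega>. lin u v m \<omega> ^ 4) - 3 * (s m)\<^sup>2) / 24)
     (- expectation (\<lambda>\<omega>. lin u v m \<omega> ^ 3) / 6))"
    unfolding ch_def by (rule exp_sum[symmetric]) simp
  also have "(\<Sum>m=1..N. Complex (- s m / 2 + (expectation (\<lambda>\<omega>. lin u v m \<omega> ^ 4) - 3 * (s m)\<^sup>2) / 24)
     (- expectation (\<lambda>\<omega>. lin u v m \<omega> ^ 3) / 6)) = Complex (- (u\<^sup>2 + v\<^sup>2) / 2 + Q4 u v / 24) (- Q3 u v / 6)"
    unfolding ssum[symmetric] Q4_def Q3_def s_def[symmetric]
    by (simp add: complex_eq_iff Re_sum Im_sum sum.distrib sum_negf sum_subtractf sum_divide_distrib diff_divide_distrib)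
  finally show ?thesis using main by (simp add: d_def Q_def ac_simps)
qed

text \<open>With t = \<open>rho * q u v ^ 3\<close> both cumulant terms are O(t), and t^3 explains
  the power nine of q. The quartic term Y2 is even O(\<open>rho * q u v\<close> t), which puts Y1 Y2
  and Y2^2 / 2, absent from \<open>Pol\<close>, at third order as well.\<close>

lemma psi_expansion_small:
  assumes small: "rho ^ 3 * q u v ^ 5 \<le> 1 / 10 ^ 6"
  shows "cmod (Psi u v - of_real (exp (- (u\<^sup>2 + v\<^sup>2) / 2)) * Pol u v)
      \<le> 3000 * rho ^ 3 * q u v ^ 9 * exp (- (u\<^sup>2 + v\<^sup>2) / 4)"
proof -
  define Q where "Q = q u v"
  define E where "E = exp (- (u\<^sup>2 + v\<^sup>2) / 4)"
  define Y1 where "Y1 = Complex 0 (- Q3 u v / 6)"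
  define Y2 where "Y2 = complex_of_real (Q4 u v / 24)"
  have Q1: "1 \<le> Q" by (simp add: Q_def)
  have E0: "0 < E" by (simp add: E_def)
  have rQ: "rho * Q \<le> 1 / 100"
  proof (rule power_le_imp_le)
    have "(rho * Q) ^ 3 \<le> rho ^ 3 * Q ^ 5"
      unfolding power_mult_distrib using Q1 rho_pos by (intro mult_left_mono power_increasing) auto
    also have "\<dots> \<le> (1 / 100) ^ 3" using small unfolding Q_def by (simp add: power_divide)
    finally show "(rho * Q) ^ 3 \<le> (1 / 100) ^ 3" .
  qed auto
  define t where "t = rho * Q ^ 3"
  have t0: "0 \<le> t" using rho_pos Q1 by (simp add: t_def)
  have t3: "t ^ 3 = rho ^ 3 * Q ^ 9" by (simp add: t_def power_mult_distrib flip: power_mult)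
  have Y1: "cmod Y1 \<le> 2 / 3 * t"
    using abs_Q3_le[of u v] by (simp add: Y1_def t_def Q_def cmod_def)
  have r2: "rho\<^sup>2 * Q ^ 4 = (rho * Q) * t" by (simp add: t_def power2_eq_square power3_eq_cube power4_eq_xxxx)
  have Y2: "cmod Y2 \<le> 2 / 3 * ((rho * Q) * t)"
    using abs_Q4_le[of u v] r2 by (simp add: Y2_def Q_def)
  have Y2': "cmod Y2 \<le> 2 / 3 * t"
    using Y2 mult_right_mono[OF rQ t0] t0 by linarith
  have rt: "rho * Q * t ^ 2 \<le> t ^ 3"
  proof -
    have "rho * Q \<le> t" unfolding t_def using rho_pos Q1 power_increasing[of 1 3 Q] by simp
    then show ?thesis using mult_right_mono[of "rho * Q" t "t * t"] t0 by (simp add: power3_eq_cube power2_eq_square ac_simps)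
  qed
  have "t = (rho * Q) * Q\<^sup>2" by (simp add: t_def power3_eq_cube power2_eq_square)
  also have "\<dots> \<le> 1 / 100 * Q\<^sup>2" using rQ by (intro mult_right_mono) auto
  finally have tQ: "t \<le> Q\<^sup>2 / 100" by simp
  have Y: "cmod (Y1 + Y2) \<le> 4 / 3 * t" using norm_triangle_ineq[of Y1 Y2] Y1 Y2' by simp
  have eY: "exp (cmod (Y1 + Y2)) \<le> 2.72 * exp ((u\<^sup>2 + v\<^sup>2) / 4)"
  proof -
    have "cmod (Y1 + Y2) \<le> 1 + (u\<^sup>2 + v\<^sup>2) / 4"
    proof (rule quarter_bound)
      have "cmod (Y1 + Y2) \<le> 8 * t" using Y t0 by simp
      also have "\<dots> \<le> 8 * (Q\<^sup>2 / 100)" using tQ by simp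
      also have "\<dots> \<le> 8 * (3 * (1 + u\<^sup>2 + v\<^sup>2) / 100)"
        using one_plus_abs_sq_le[of u v, folded Q_def] by (intro divide_right_mono mult_left_mono) auto
      finally show "cmod (Y1 + Y2) \<le> 8 * (3 * (1 + u\<^sup>2 + v\<^sup>2)) / 100" by simp
    qed
    then have "exp (cmod (Y1 + Y2)) \<le> exp 1 * exp ((u\<^sup>2 + v\<^sup>2) / 4)" by (simp flip: exp_add)
    also have "\<dots> \<le> 2.72 * exp ((u\<^sup>2 + v\<^sup>2) / 4)" using e_less_272 by (intro mult_right_mono) auto
    finally show ?thesis .
  qed
  have ge1: "1 \<le> exp ((u\<^sup>2 + v\<^sup>2) / 4)" by simp
  have "cmod (exp (Y1 + Y2) - (1 + (Y1 + Y2) + (Y1 + Y2)\<^sup>2 / 2)) \<le> cmod (Y1 + Y2) ^ 3 * exp (cmod (Y1 + Y2))"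
    by (rule norm_exp_minus_quadratic_le)
  also have "\<dots> \<le> (4 / 3 * t) ^ 3 * (2.72 * exp ((u\<^sup>2 + v\<^sup>2) / 4))"
    using Y eY t0 by (intro mult_mono power_mono) auto
  also have "\<dots> \<le> 7 * t ^ 3 * exp ((u\<^sup>2 + v\<^sup>2) / 4)"
    using t0 by (simp add: power_mult_distrib power_divide)
  finally have A: "cmod (exp (Y1 + Y2) - (1 + (Y1 + Y2) + (Y1 + Y2)\<^sup>2 / 2)) \<le> 7 * t ^ 3 * exp ((u\<^sup>2 + v\<^sup>2) / 4)" .
  have "Y1\<^sup>2 = - of_real ((Q3 u v)\<^sup>2 / 36)"
    by (simp add: Y1_def complex_eq_iff power2_eq_square)
  then have "1 + (Y1 + Y2) + (Y1 + Y2)\<^sup>2 / 2 = Pol u v + (Y1 * Y2 + Y2\<^sup>2 / 2)"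
    by (simp add: power2_sum Pol_def Y1_def Y2_def complex_eq_iff)
  then have "cmod (1 + (Y1 + Y2) + (Y1 + Y2)\<^sup>2 / 2 - Pol u v) \<le> cmod Y1 * cmod Y2 + (cmod Y2)\<^sup>2 / 2"
    using norm_triangle_ineq[of "Y1 * Y2" "Y2\<^sup>2 / 2"] by (simp add: norm_mult norm_divide norm_power)
  also have "\<dots> \<le> 2 / 3 * t * (2 / 3 * ((rho * Q) * t)) + 2 / 3 * t * (2 / 3 * ((rho * Q) * t)) / 2"
    unfolding power2_eq_square using Y1 Y2 Y2' t0 by (intro add_mono mult_mono divide_right_mono) auto
  also have "\<dots> \<le> rho * Q * t ^ 2" using t0 rho_pos Q1 by (simp add: power2_eq_square)
  also have "\<dots> \<le> t ^ 3 * exp ((u\<^sup>2 + v\<^sup>2) / 4)"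
    using rt mult_left_mono[OF ge1, of "t ^ 3"] t0 by simp
  finally have B: "cmod (1 + (Y1 + Y2) + (Y1 + Y2)\<^sup>2 / 2 - Pol u v) \<le> t ^ 3 * exp ((u\<^sup>2 + v\<^sup>2) / 4)" .
  have C: "cmod (exp (Y1 + Y2) - Pol u v) \<le> 8 * t ^ 3 * exp ((u\<^sup>2 + v\<^sup>2) / 4)"
    using A B norm_triangle_ineq[of "exp (Y1 + Y2) - (1 + (Y1 + Y2) + (Y1 + Y2)\<^sup>2 / 2)" "1 + (Y1 + Y2) + (Y1 + Y2)\<^sup>2 / 2 - Pol u v"]
    by simp
  have e: "exp (Complex (- (u\<^sup>2 + v\<^sup>2) / 2 + Q4 u v / 24) (- Q3 u v / 6)) = of_real (exp (- (u\<^sup>2 + v\<^sup>2) / 2)) * exp (Y1 + Y2)"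
  proof -
    have "Complex (- (u\<^sup>2 + v\<^sup>2) / 2 + Q4 u v / 24) (- Q3 u v / 6) = of_real (- (u\<^sup>2 + v\<^sup>2) / 2) + (Y1 + Y2)"
      by (simp add: Y1_def Y2_def complex_eq_iff)
    then show ?thesis by (simp only: exp_add exp_of_real)
  qed
  have "cmod (of_real (exp (- (u\<^sup>2 + v\<^sup>2) / 2)) * exp (Y1 + Y2) - of_real (exp (- (u\<^sup>2 + v\<^sup>2) / 2)) * Pol u v)
     = exp (- (u\<^sup>2 + v\<^sup>2) / 2) * cmod (exp (Y1 + Y2) - Pol u v)"
    unfolding right_diff_distrib[symmetric] norm_mult by simp
  also have "\<dots> \<le> exp (- (u\<^sup>2 + v\<^sup>2) / 2) * (8 * t ^ 3 * exp ((u\<^sup>2 + v\<^sup>2) / 4))"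
    using C by (intro mult_left_mono) auto
  also have "\<dots> = 8 * t ^ 3 * (exp (- (u\<^sup>2 + v\<^sup>2) / 2) * exp ((u\<^sup>2 + v\<^sup>2) / 4))" by (simp only: ac_simps)
  also have "exp (- (u\<^sup>2 + v\<^sup>2) / 2) * exp ((u\<^sup>2 + v\<^sup>2) / 4) = E"
    unfolding E_def exp_add[symmetric] by (rule arg_cong[where f = exp]) (simp add: field_simps)
  finally have D: "cmod (of_real (exp (- (u\<^sup>2 + v\<^sup>2) / 2)) * exp (Y1 + Y2) - of_real (exp (- (u\<^sup>2 + v\<^sup>2) / 2)) * Pol u v) \<le> 8 * t ^ 3 * E" .
  have F: "cmod (Psi u v - of_real (exp (- (u\<^sup>2 + v\<^sup>2) / 2)) * exp (Y1 + Y2)) \<le> 2800 * t ^ 3 * E"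
  proof -
    have "rho ^ 3 * Q ^ 5 \<le> t ^ 3" unfolding t3 using Q1 rho_pos by (intro mult_left_mono power_increasing) auto
    then have "2800 * (rho ^ 3 * Q ^ 5) * E \<le> 2800 * t ^ 3 * E" using E0 by simp
    then show ?thesis using psi_expansion_product[OF small] unfolding e Q_def[symmetric] E_def[symmetric]
      by (simp add: mult.assoc)
  qed
  have tri: "cmod (x - z) \<le> cmod (x - y) + cmod (y - z)" for x y z :: complex
    using norm_triangle_ineq[of "x - y" "y - z"] by simp
  have "cmod (Psi u v - of_real (exp (- (u\<^sup>2 + v\<^sup>2) / 2)) * Pol u v) \<le> 2800 * t ^ 3 * E + 8 * t ^ 3 * E"
    by (rule order_trans[OF tri add_mono[OF F D]])
  also have "\<dots> \<le> 3000 * t ^ 3 * E" using t0 E0 by simp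
  finally show ?thesis by (simp add: t3 E_def Q_def ac_simps)
qed

end

text \<open>The Gaussian absorbs the ninth power together with an extra factor 1 + v^2, via z^6
  \<le> 6^6 * 6! exp (z / 6) for z = 1 + u^2 + v^2. What is left is integrable in v and still
  Gaussian in u.\<close>

lemma poly_times_gauss_le:
  fixes u v :: real
  shows "(1 + \<bar>u\<bar> + \<bar>v\<bar>) ^ 9 * exp (- (u\<^sup>2 + v\<^sup>2) / 4) \<le> 3 * 10 ^ 10 * exp (- u\<^sup>2 / 16) / (1 + v\<^sup>2)"
proof -
  define z where "z = 1 + u\<^sup>2 + v\<^sup>2"
  have z1: "1 \<le> z" by (simp add: z_def)
  have "(1 + \<bar>u\<bar> + \<bar>v\<bar>) ^ 9 \<le> (1 + \<bar>u\<bar> + \<bar>v\<bar>) ^ (2 * 5)" by (intro power_increasing) auto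
  also have "\<dots> = ((1 + \<bar>u\<bar> + \<bar>v\<bar>)\<^sup>2) ^ 5" by (rule power_mult)
  also have "\<dots> \<le> (3 * z) ^ 5" unfolding z_def by (intro power_mono one_plus_abs_sq_le) auto
  also have "\<dots> = 243 * z ^ 5" by (simp add: power_mult_distrib)
  finally have "(1 + v\<^sup>2) * (1 + \<bar>u\<bar> + \<bar>v\<bar>) ^ 9 \<le> z * (243 * z ^ 5)"
    using z1 by (intro mult_mono) (auto simp: z_def)
  also have "\<dots> = 243 * 6 ^ 6 * (z / 6) ^ 6" by (simp add: power_divide power_numeral_reduce)
  also have "\<dots> \<le> 243 * 6 ^ 6 * (fact 6 * exp (z / 6))"
    using z1 by (intro mult_left_mono power_le_fact_exp) auto
  also have "\<dots> = 8162933760 * exp (z / 6)" by (simp add: fact_numeral)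
  finally have "(1 + v\<^sup>2) * (1 + \<bar>u\<bar> + \<bar>v\<bar>) ^ 9 * exp (- (u\<^sup>2 + v\<^sup>2) / 4)
      \<le> 8162933760 * exp (z / 6) * exp (- (u\<^sup>2 + v\<^sup>2) / 4)"
    by (rule mult_right_mono) simp
  also have "\<dots> = 8162933760 * exp (z / 6 - (u\<^sup>2 + v\<^sup>2) / 4)"
    unfolding mult.assoc exp_add[symmetric] by (simp add: field_simps)
  also have "\<dots> \<le> 8162933760 * exp (1 + - u\<^sup>2 / 16)"
  proof -
    have "z / 6 - (u\<^sup>2 + v\<^sup>2) / 4 = 1 / 6 - u\<^sup>2 / 12 - v\<^sup>2 / 12" by (simp add: z_def field_simps)
    also have "\<dots> \<le> 1 + - u\<^sup>2 / 16"
      by simp (use zero_le_power2[of u] zero_le_power2[of v] in linarith)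
    finally show ?thesis by simp
  qed
  also have "\<dots> = 8162933760 * exp 1 * exp (- u\<^sup>2 / 16)" by (simp only: exp_add mult.assoc)
  also have "\<dots> \<le> 30000000000 * exp (- u\<^sup>2 / 16)"
    using e_less_272 by (intro mult_right_mono) auto
  finally have *: "(1 + v\<^sup>2) * (1 + \<bar>u\<bar> + \<bar>v\<bar>) ^ 9 * exp (- (u\<^sup>2 + v\<^sup>2) / 4) \<le> 3 * 10 ^ 10 * exp (- u\<^sup>2 / 16)"
    by simp
  have "0 < 1 + v\<^sup>2" by (simp add: add_pos_nonneg)
  then show ?thesis using * by (simp add: pos_le_divide_eq ac_simps)
qed

lemma abs_add_cube_le:
  fixes x y :: real
  shows "\<bar>x + y\<bar> ^ 3 \<le> 4 * (\<bar>x\<bar> ^ 3 + \<bar>y\<bar> ^ 3)"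
proof -
  have "\<bar>x + y\<bar> ^ 3 \<le> (\<bar>x\<bar> + \<bar>y\<bar>) ^ 3" by (intro power_mono abs_triangle_ineq) auto
  also have "\<dots> \<le> 4 * (\<bar>x\<bar> ^ 3 + \<bar>y\<bar> ^ 3)"
  proof -
    have "0 \<le> 3 * (\<bar>x\<bar> + \<bar>y\<bar>) * (\<bar>x\<bar> - \<bar>y\<bar>)\<^sup>2" by simp
    also have "\<dots> = 4 * (\<bar>x\<bar> ^ 3 + \<bar>y\<bar> ^ 3) - (\<bar>x\<bar> + \<bar>y\<bar>) ^ 3" by algebra
    finally show ?thesis by simp
  qed
  finally show ?thesis .
qed

text \<open>Once y is not small, its lower powers are dominated by its cube. This is the device that
  settles the cases in which an expansion would require smallness.\<close>

lemma one_plus_y_plus_sq_le: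
  fixes y K :: real
  assumes "1 \<le> K * y" "0 < K" "1 \<le> K"
  shows "1 \<le> (K * y) ^ 3" "y \<le> K\<^sup>2 * y ^ 3" "y\<^sup>2 \<le> K * y ^ 3"
proof -
  have y: "0 < y" using assms by (metis not_le order_less_le_trans zero_less_mult_iff zero_less_one less_asym)
  show "1 \<le> (K * y) ^ 3" using assms by simp
  have "y * 1 \<le> y * (K * y)\<^sup>2" using assms y by (intro mult_left_mono) auto
  then show "y \<le> K\<^sup>2 * y ^ 3" by (simp add: power2_eq_square power3_eq_cube ac_simps)
  have "y\<^sup>2 * 1 \<le> y\<^sup>2 * (K * y)" using assms y by (intro mult_left_mono) auto
  then show "y\<^sup>2 \<le> K * y ^ 3" by (simp add: power2_eq_square power3_eq_cube ac_simps)
qed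

section \<open>Moderate v, and the size of the expansion for large v\<close>

context poisson_scheme
begin

text \<open>\<open>char_variable_le_exp\<close> factor by factor. The constant 4 of
  \<open>abs_add_cube_le\<close> times 1/16 lets the third moments use up exactly half of the
  exponent (u^2 + v^2) / 2.\<close>

lemma cmod_Psi_mid:
  assumes u: "\<bar>u\<bar> * beta 3 \<le> 1 / 16" and v: "\<bar>v\<bar> * xbeta 3 \<le> 1 / 16"
  shows "cmod (Psi u v) \<le> exp (- (u\<^sup>2 + v\<^sup>2) / 4)"
proof -
  let ?b = "\<lambda>m. expectation (\<lambda>\<omega>. \<bar>lin u v m \<omega>\<bar> ^ 3)"
  let ?s = "\<lambda>m. expectation (\<lambda>\<omega>. (lin u v m \<omega>)\<^sup>2)"
  have "(\<Sum>m=1..N. ?b m) \<le> (\<Sum>m=1..N. 4 * (\<bar>u\<bar> ^ 3 * expectation (\<lambda>\<omega>. \<bar>a m \<omega>\<bar> ^ 3) + \<bar>v\<bar> ^ 3 * expectation (\<lambda>\<omega>. \<bar>x m \<omega>\<bar> ^ 3)))"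
  proof (rule sum_mono)
    fix m assume m: "m \<in> {1..N}"
    have i: "integrable M (\<lambda>\<omega>. \<bar>a m \<omega>\<bar> ^ 3)" "integrable M (\<lambda>\<omega>. \<bar>x m \<omega>\<bar> ^ 3)"
      using integrable_abs_power_mono[OF a_meas a_int, OF m m, of 3] x_int[OF m] by auto
    have "?b m \<le> expectation (\<lambda>\<omega>. 4 * (\<bar>u\<bar> ^ 3 * \<bar>a m \<omega>\<bar> ^ 3 + \<bar>v\<bar> ^ 3 * \<bar>x m \<omega>\<bar> ^ 3))"
    proof (rule integral_mono)
      show "integrable M (\<lambda>\<omega>. \<bar>lin u v m \<omega>\<bar> ^ 3)" using lin_int[OF m, of 3] by simp
      show "\<bar>lin u v m \<omega>\<bar> ^ 3 \<le> 4 * (\<bar>u\<bar> ^ 3 * \<bar>a m \<omega>\<bar> ^ 3 + \<bar>v\<bar> ^ 3 * \<bar>x m \<omega>\<bar> ^ 3)" for \<omega>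
        using abs_add_cube_le[of "u * a m \<omega>" "v * x m \<omega>"] by (simp add: lin_def abs_mult power_mult_distrib)
    qed (use i in simp)
    also have "\<dots> = 4 * (\<bar>u\<bar> ^ 3 * expectation (\<lambda>\<omega>. \<bar>a m \<omega>\<bar> ^ 3) + \<bar>v\<bar> ^ 3 * expectation (\<lambda>\<omega>. \<bar>x m \<omega>\<bar> ^ 3))"
      using i by simp
    finally show "?b m \<le> \<dots>" .
  qed
  also have "\<dots> = 4 * (u\<^sup>2 * (\<bar>u\<bar> * beta 3) + v\<^sup>2 * (\<bar>v\<bar> * xbeta 3))"
  proof -
    have e: "\<bar>y\<bar> ^ 3 * b = y\<^sup>2 * (\<bar>y\<bar> * b)" for y b :: real
      by (simp add: power3_eq_cube power2_eq_square)
    show ?thesis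
      unfolding beta_def xbeta_def e[symmetric] sum_distrib_left sum.distrib[symmetric] ..
  qed
  also have "\<dots> \<le> 4 * (u\<^sup>2 * (1 / 16) + v\<^sup>2 * (1 / 16))"
    using u v by (intro mult_left_mono add_mono) auto
  also have "\<dots> = (u\<^sup>2 + v\<^sup>2) / 4" by simp
  finally have B: "(\<Sum>m=1..N. ?b m) \<le> (u\<^sup>2 + v\<^sup>2) / 4" .
  have "cmod (Psi u v) = (\<Prod>m=1..N. cmod (psi u v m))" unfolding Psi_def by (rule prod_norm[symmetric])
  also have "\<dots> \<le> (\<Prod>m=1..N. exp (- ?s m / 2 + ?b m))"
  proof (rule prod_mono)
    fix m assume m: "m \<in> {1..N}"
    show "0 \<le> cmod (psi u v m) \<and> cmod (psi u v m) \<le> exp (- ?s m / 2 + ?b m)"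
      unfolding psi_def using lin_int[OF m, of 3 u v] lin_mean[OF m] m
      by (intro conjI norm_ge_zero char_variable_le_exp) auto
  qed
  also have "\<dots> = exp (\<Sum>m=1..N. - ?s m / 2 + ?b m)" by (rule exp_sum[symmetric]) simp
  also have "(\<Sum>m=1..N. - ?s m / 2 + ?b m) = - (\<Sum>m=1..N. ?s m) / 2 + (\<Sum>m=1..N. ?b m)"
    by (simp add: sum.distrib sum_negf sum_subtractf sum_divide_distrib)
  also have "exp \<dots> \<le> exp (- (u\<^sup>2 + v\<^sup>2) / 4)"
  proof -
    have "- r / 2 + s \<le> - r / 4" if "s \<le> r / 4" for r s :: real using that by (simp add: field_simps)
    from this[OF B] show ?thesis unfolding sum_lin_sq by (simp only: exp_le_cancel_iff)
  qed
  finally show ?thesis .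
qed

text \<open>If the condition of \<open>psi_expansion_small\<close> fails, then 100
  \<open>rho * q u v ^ 3\<close> is at least 1, and the product and its expansion are each below the
  error term, by Gaussian decay of both.\<close>

lemma psi_expansion_mid:
  assumes u: "\<bar>u\<bar> * beta 3 \<le> 1 / 16" and v: "\<bar>v\<bar> * xbeta 3 \<le> 1 / 16"
  shows "cmod (Psi u v - of_real (exp (- (u\<^sup>2 + v\<^sup>2) / 2)) * Pol u v)
      \<le> 3 * 10 ^ 6 * rho ^ 3 * q u v ^ 9 * exp (- (u\<^sup>2 + v\<^sup>2) / 4)"
proof (cases "rho ^ 3 * q u v ^ 5 \<le> 1 / 10 ^ 6")
  case True
  have "3000 * rho ^ 3 * q u v ^ 9 * exp (- (u\<^sup>2 + v\<^sup>2) / 4) \<le> 3 * 10 ^ 6 * rho ^ 3 * q u v ^ 9 * exp (- (u\<^sup>2 + v\<^sup>2) / 4)"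
    using rho_pos by (intro mult_right_mono) auto
  then show ?thesis using psi_expansion_small[OF True] by linarith
next
  case False
  define y where "y = rho * q u v ^ 3"
  define E where "E = exp (- (u\<^sup>2 + v\<^sup>2) / 4)"
  have E0: "0 \<le> E" by (simp add: E_def)
  have y3: "y ^ 3 = rho ^ 3 * q u v ^ 9" by (simp add: y_def power_mult_distrib flip: power_mult)
  have y1: "1 \<le> 100 * y"
  proof (rule power_le_imp_le)
    have "1 \<le> 10 ^ 6 * (rho ^ 3 * q u v ^ 5)" using False by simp
    also have "\<dots> \<le> 10 ^ 6 * (rho ^ 3 * q u v ^ 9)"
      using rho_pos by (intro mult_left_mono power_increasing) auto
    also have "\<dots> = (100 * y) ^ 3" by (simp add: y3 power_mult_distrib)
    finally show "1 ^ 3 \<le> (100 * y) ^ 3" by simp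
  qed (use rho_pos in \<open>auto simp: y_def\<close>)
  have y6: "y\<^sup>2 = rho\<^sup>2 * q u v ^ 6" by (simp add: y_def power_mult_distrib flip: power_mult)
  have "cmod (of_real (exp (- (u\<^sup>2 + v\<^sup>2) / 2)) * Pol u v) \<le> E * (1 + y + y\<^sup>2)"
    unfolding norm_mult norm_of_real
    using cmod_Pol_le[of u v] rho_pos by (intro mult_mono) (auto simp: E_def y_def y6[unfolded y_def])
  then have "cmod (Psi u v - of_real (exp (- (u\<^sup>2 + v\<^sup>2) / 2)) * Pol u v) \<le> E + E * (1 + y + y\<^sup>2)"
    using norm_triangle_ineq4[of "Psi u v" "of_real (exp (- (u\<^sup>2 + v\<^sup>2) / 2)) * Pol u v"] cmod_Psi_mid[OF u v]
    unfolding E_def by linarith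
  also have "\<dots> = E * (2 + y + y\<^sup>2)" by (simp add: algebra_simps)
  also have "\<dots> \<le> E * (3 * 10 ^ 6 * y ^ 3)"
  proof (rule mult_left_mono[OF _ E0])
    have "1 \<le> 10 ^ 6 * y ^ 3" "y \<le> 10 ^ 4 * y ^ 3" "y\<^sup>2 \<le> 100 * y ^ 3"
      using one_plus_y_plus_sq_le[of 100 y] y1 by (auto simp: power_mult_distrib)
    then show "2 + y + y\<^sup>2 \<le> 3 * 10 ^ 6 * y ^ 3" by simp
  qed
  finally show ?thesis by (simp add: y3 E_def ac_simps)
qed

text \<open>Because \<open>sqrt eps \<le> rho\<close>, the assumption makes
  \<open>rho * q u v ^ 3\<close> at least 1/64, so the expansion itself has the size of the error.
  The threshold fits \<open>psi_expansion_mid\<close>: \<open>xbeta 3\<close> is at most 4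
  \<open>sqrt eps\<close>, and 4 * 16 = 64.\<close>

lemma tail_expansion:
  assumes v: "1 \<le> 64 * (\<bar>v\<bar> * sqrt eps)"
  shows "cmod (of_real (exp (- (u\<^sup>2 + v\<^sup>2) / 2)) * Pol u v)
      \<le> 3 * 10 ^ 6 * rho ^ 3 * q u v ^ 9 * exp (- (u\<^sup>2 + v\<^sup>2) / 4)"
proof -
  define y where "y = rho * q u v ^ 3"
  define E where "E = exp (- (u\<^sup>2 + v\<^sup>2) / 4)"
  have E0: "0 \<le> E" by (simp add: E_def)
  have y3: "y ^ 3 = rho ^ 3 * q u v ^ 9" by (simp add: y_def power_mult_distrib flip: power_mult)
  have y6: "y\<^sup>2 = rho\<^sup>2 * q u v ^ 6" by (simp add: y_def power_mult_distrib flip: power_mult)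
  have y1: "1 \<le> 64 * y"
  proof -
    have "\<bar>v\<bar> * sqrt eps \<le> q u v * rho" using sqrt_eps_le_rho eps_pos by (intro mult_mono) auto
    also have "\<dots> \<le> q u v ^ 3 * rho" using rho_pos self_le_power[of "q u v" 3] by (intro mult_right_mono) auto
    finally show ?thesis using v by (simp add: y_def ac_simps)
  qed
  have "cmod (of_real (exp (- (u\<^sup>2 + v\<^sup>2) / 2)) * Pol u v) \<le> E * (1 + y + y\<^sup>2)"
    unfolding norm_mult norm_of_real
    using cmod_Pol_le[of u v] rho_pos by (intro mult_mono) (auto simp: E_def y_def y6[unfolded y_def])
  also have "\<dots> \<le> E * (3 * 10 ^ 6 * y ^ 3)"
  proof (rule mult_left_mono[OF _ E0])
    have "1 \<le> 64 ^ 3 * y ^ 3" "y \<le> 64\<^sup>2 * y ^ 3" "y\<^sup>2 \<le> 64 * y ^ 3"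
      using one_plus_y_plus_sq_le[of 64 y] y1 by (auto simp: power_mult_distrib)
    then show "1 + y + y\<^sup>2 \<le> 3 * 10 ^ 6 * y ^ 3" by simp
  qed
  finally show ?thesis by (simp add: y3 E_def ac_simps)
qed

section \<open>Large v: decay of the Poisson factors\<close>

definition "P2 = (\<Sum>m=1..N. (p m)\<^sup>2)"

lemma eps_eq: "eps = 1 / n + P2" unfolding eps_def P2_def ..

lemma P2_nonneg: "0 \<le> P2" unfolding P2_def by (simp add: sum_nonneg)

text \<open>The Poisson factor of a cell has squared modulus exp (- y m) with y m proportional to p
  m. The dependent \<open>a m\<close> is removed by \<open>cmod_char_variable_add_sq_le\<close>, at
  the total price exp (u^2 / 2) since the variances of the \<open>a m\<close> add up to 1. By
  \<open>sum_ratio_ge\<close> the remaining decay involves the cells only through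
  \<open>P2\<close>.\<close>

lemma cmod_Psi_large:
  assumes v0: "v \<noteq> 0" and v: "\<bar>v\<bar> \<le> pi * sqrt n"
  shows "cmod (Psi u v) \<le> exp (u\<^sup>2 / 2 - 1 / (4 * (4 / v\<^sup>2 + P2)))"
proof -
  define \<tau> where "\<tau> = v / sqrt n"
  define y where "y m = 2 * (n * p m) * (1 - cos \<tau>)" for m
  define S where "S = 2 * n * (1 - cos \<tau>)"
  have \<tau>: "\<bar>\<tau>\<bar> \<le> pi" using v n_pos by (simp add: \<tau>_def abs_divide field_simps)
  have t2: "\<tau>\<^sup>2 = v\<^sup>2 / n" using n_pos by (simp add: \<tau>_def power_divide)
  \<comment> \<open>The restriction of v to one period keeps \<tau> in [-\<pi>, \<pi>], where 1 -
    cos dominates a multiple of the square; 1/4 results from \<pi> \<le> 4.\<close>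
  have S: "v\<^sup>2 / 4 \<le> S"
  proof -
    have "pi\<^sup>2 \<le> 4\<^sup>2" using pi_less_4 by (intro power_mono) auto
    then have "2 / 4\<^sup>2 * (v\<^sup>2 / n) \<le> 2 / pi\<^sup>2 * (v\<^sup>2 / n)"
      using n_pos by (intro mult_right_mono divide_left_mono) auto
    also have "\<dots> \<le> 1 - cos \<tau>" using one_minus_cos_ge[OF \<tau>] by (simp add: t2)
    finally have "2 * n * (2 / 4\<^sup>2 * (v\<^sup>2 / n)) \<le> S" unfolding S_def by (intro mult_left_mono) auto
    then show ?thesis using n_pos by simp
  qed
  have S0: "0 < S" using S v0 by (smt (verit) divide_pos_pos zero_less_power2)
  then have c0: "0 < 1 - cos \<tau>" using n_pos by (simp add: S_def zero_less_mult_iff)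
  have y0: "0 < y m" if "m \<in> {1..N}" for m
    using c0 n_pos p_pos[OF that] by (simp add: y_def)
  have ysum: "(\<Sum>m=1..N. y m) = S"
    using p_sum unfolding y_def S_def by (simp flip: sum_distrib_left sum_distrib_right)
  have ysum2: "(\<Sum>m=1..N. y m + (y m)\<^sup>2) = S + S\<^sup>2 * P2"
  proof -
    have "(y m)\<^sup>2 = S\<^sup>2 * (p m)\<^sup>2" for m by (simp add: y_def S_def power_mult_distrib)
    then show ?thesis unfolding sum.distrib ysum by (simp add: P2_def sum_distrib_left)
  qed
  have "1 / (4 / v\<^sup>2 + P2) \<le> 1 / (1 / S + P2)"
  proof (rule divide_left_mono)
    show "1 / S + P2 \<le> 4 / v\<^sup>2 + P2" using S S0 v0 by (simp add: field_simps)
    show "0 < (4 / v\<^sup>2 + P2) * (1 / S + P2)"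
      using S0 v0 P2_nonneg by (intro mult_pos_pos add_pos_nonneg) auto
  qed simp
  also have "\<dots> = S\<^sup>2 / (S + S\<^sup>2 * P2)"
  proof -
    have "0 < 1 / S + P2" using S0 P2_nonneg by (intro add_pos_nonneg) auto
    moreover have "S + S\<^sup>2 * P2 = S\<^sup>2 * (1 / S + P2)" using S0 by (simp add: distrib_left power2_eq_square)
    ultimately show ?thesis using S0 by simp
  qed
  also have "\<dots> = (\<Sum>m=1..N. y m)\<^sup>2 / (\<Sum>m=1..N. y m + (y m)\<^sup>2)" by (simp only: ysum ysum2)
  also have "\<dots> \<le> (\<Sum>m=1..N. y m / (1 + y m))"
    using y0 N_pos by (intro sum_ratio_ge) auto
  also have "\<dots> \<le> (\<Sum>m=1..N. 1 - exp (- y m))"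
    using y0 by (intro sum_mono one_minus_exp_ge) (auto simp: less_imp_le)
  finally have D: "1 / (4 / v\<^sup>2 + P2) \<le> (\<Sum>m=1..N. 1 - exp (- y m))" .
  have fac: "(cmod (psi u v m))\<^sup>2 \<le> exp (- (1 - exp (- y m)) / 2 + u\<^sup>2 * expectation (\<lambda>\<omega>. (a m \<omega>)\<^sup>2))"
    if m: "m \<in> {1..N}" for m
  proof -
    interpret P: poisson_variable M "\<xi> m" "n * p m" by (rule poisson[OF m])
    have vx: "v * x m \<omega> = \<tau> * real (\<xi> m \<omega>) - \<tau> * (n * p m)" for \<omega>
      by (simp add: x_def \<tau>_def diff_divide_distrib right_diff_distrib)
    have "expectation (\<lambda>\<omega>. iexp (v * x m \<omega>)) = expectation (\<lambda>\<omega>. iexp (- (\<tau> * (n * p m))) * iexp (\<tau> * real (\<xi> m \<omega>)))"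
      unfolding vx by (intro Bochner_Integration.integral_cong refl) (simp add: exp_add[symmetric] algebra_simps)
    also have "\<dots> = iexp (- (\<tau> * (n * p m))) * expectation (\<lambda>\<omega>. iexp (\<tau> * real (\<xi> m \<omega>)))"
      by (rule integral_mult_right_zero)
    finally have "(cmod (expectation (\<lambda>\<omega>. iexp (v * x m \<omega>))))\<^sup>2 = exp (- y m)"
      using P.cmod_char_poisson_sq[of \<tau>] by (simp add: norm_mult y_def)
    moreover have "(cmod (psi u v m))\<^sup>2 \<le> 1 - (1 - (cmod (expectation (\<lambda>\<omega>. iexp (v * x m \<omega>))))\<^sup>2) / 2
        + expectation (\<lambda>\<omega>. (u * a m \<omega>)\<^sup>2)"
      unfolding psi_def lin_def
      using a_meas[OF m] x_meas[OF m] a_int'[OF m, of 2]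
      by (intro cmod_char_variable_add_sq_le) (auto simp: power_mult_distrib)
    moreover have "expectation (\<lambda>\<omega>. (u * a m \<omega>)\<^sup>2) = u\<^sup>2 * expectation (\<lambda>\<omega>. (a m \<omega>)\<^sup>2)"
      by (simp add: power_mult_distrib)
    ultimately have "(cmod (psi u v m))\<^sup>2 \<le> 1 + (- (1 - exp (- y m)) / 2 + u\<^sup>2 * expectation (\<lambda>\<omega>. (a m \<omega>)\<^sup>2))"
      by (simp add: diff_divide_distrib)
    also have "\<dots> \<le> exp (- (1 - exp (- y m)) / 2 + u\<^sup>2 * expectation (\<lambda>\<omega>. (a m \<omega>)\<^sup>2))"
      by (rule exp_ge_add_one_self)
    finally show ?thesis .
  qed
  have "(cmod (Psi u v))\<^sup>2 = (\<Prod>m=1..N. (cmod (psi u v m))\<^sup>2)"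
    unfolding Psi_def by (simp add: prod_norm[symmetric] prod_power_distrib)
  also have "\<dots> \<le> (\<Prod>m=1..N. exp (- (1 - exp (- y m)) / 2 + u\<^sup>2 * expectation (\<lambda>\<omega>. (a m \<omega>)\<^sup>2)))"
    using fac by (intro prod_mono) auto
  also have "\<dots> = exp (\<Sum>m=1..N. - (1 - exp (- y m)) / 2 + u\<^sup>2 * expectation (\<lambda>\<omega>. (a m \<omega>)\<^sup>2))"
    by (rule exp_sum[symmetric]) simp
  also have "(\<Sum>m=1..N. - (1 - exp (- y m)) / 2 + u\<^sup>2 * expectation (\<lambda>\<omega>. (a m \<omega>)\<^sup>2))
      = - (\<Sum>m=1..N. 1 - exp (- y m)) / 2 + u\<^sup>2 * (\<Sum>m=1..N. expectation (\<lambda>\<omega>. (a m \<omega>)\<^sup>2))"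
    unfolding sum.distrib sum_distrib_left sum_divide_distrib sum_negf[symmetric] ..
  also have "\<dots> \<le> - (1 / (4 / v\<^sup>2 + P2)) / 2 + u\<^sup>2" unfolding a_var using D by (intro add_mono divide_right_mono) auto
  also have "exp (- (1 / (4 / v\<^sup>2 + P2)) / 2 + u\<^sup>2) = (exp (u\<^sup>2 / 2 - 1 / (4 * (4 / v\<^sup>2 + P2))))\<^sup>2"
    unfolding power2_eq_square[of "exp _"] exp_add[symmetric]
  proof (rule arg_cong[where f = exp])
    have "- (1 / X) / 2 + w = (w / 2 - 1 / (4 * X)) + (w / 2 - 1 / (4 * X))" for X w :: real by simp
    then show "- (1 / (4 / v\<^sup>2 + P2)) / 2 + u\<^sup>2
      = u\<^sup>2 / 2 - 1 / (4 * (4 / v\<^sup>2 + P2)) + (u\<^sup>2 / 2 - 1 / (4 * (4 / v\<^sup>2 + P2)))" .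
  qed
  finally have "(cmod (Psi u v))\<^sup>2 \<le> (exp (u\<^sup>2 / 2 - 1 / (4 * (4 / v\<^sup>2 + P2))))\<^sup>2" by simp
  then show ?thesis by (rule power2_le_imp_le) simp
qed

text \<open>The hypothesis on the sum of squares is spent here. With L = ln n it gives
  \<open>eps\<close> \<le> 1 / n + 1 / (10 L), and the reciprocal of 10 times this bound falls short
  of L by at most 40, because L^2 \<le> 4 n.\<close>

lemma n_le_exp: "real n \<le> exp 40 * exp (1 / (10 * eps))"
proof -
  define L where "L = ln (real n)"
  have L: "0 < L" using n_ge_2 by (simp add: L_def)
  have "eps \<le> 1 / n + 1 / (10 * L)" unfolding eps_eq P2_def L_def using P2_le by simp
  then have "1 / (10 * (1 / n + 1 / (10 * L))) \<le> 1 / (10 * eps)"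
    using eps_pos by (intro divide_left_mono mult_pos_pos) (auto intro: mult_left_mono order_less_le_trans)
  moreover have "L - 40 \<le> 1 / (10 * (1 / n + 1 / (10 * L)))"
  proof -
    have "ln (sqrt n) \<le> sqrt n - 1" using n_pos by (intro ln_le_minus_one) auto
    then have "L \<le> 2 * sqrt n" using n_pos by (simp add: L_def ln_sqrt)
    then have "L\<^sup>2 \<le> (2 * sqrt n)\<^sup>2" using L by (intro power_mono) auto
    then have L2: "L\<^sup>2 \<le> 4 * n" using n_pos by (simp add: power_mult_distrib)
    have "(L - 40) * (n + 10 * L) \<le> L * n"
      using L L2 by (simp add: algebra_simps power2_eq_square)
    moreover have "1 / (10 * (1 / n + 1 / (10 * L))) = L * n / (n + 10 * L)"
      using L n_pos by (simp add: field_simps)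
    ultimately show ?thesis using L n_pos by (simp add: pos_le_divide_eq)
  qed
  ultimately have "L \<le> 40 + 1 / (10 * eps)" by linarith
  then have "exp L \<le> exp (40 + 1 / (10 * eps))" by simp
  then show ?thesis using n_pos by (simp add: L_def exp_add)
qed

end

text \<open>The two summands belong to the two cases of \<open>cmod_Psi_tail\<close>; exp 40 stems
  from \<open>n_le_exp\<close>.\<close>

definition K1 :: real where "K1 = 10 ^ 19 + 4000 * exp 40"
definition K2 :: real where "K2 = 10 ^ 18 + K1"

lemma K_pos: "0 < K1" "0 < K2"
  by (auto simp: K1_def K2_def intro!: add_pos_pos)

lemma exp_minus_le_power:
  fixes z :: real
  assumes "0 < z"
  shows "exp (- z) \<le> fact k / z ^ k"
  using power_le_fact_exp[of z k] assms by (simp add: exp_minus field_simps)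

lemma gauss_poly6:
  "has_bochner_integral lborel
    (\<lambda>v. std_normal_density v * (c0 + c1 * v + c2 * v ^ 2 + c3 * v ^ 3 + c4 * v ^ 4 + c5 * v ^ 5 + c6 * v ^ 6))
    (c0 + c2 + 3 * c4 + 15 * c6)"
proof -
  have m: "has_bochner_integral lborel (\<lambda>v. std_normal_density v * v ^ 0) 1"
    "has_bochner_integral lborel (\<lambda>v. std_normal_density v * v ^ 1) 0"
    "has_bochner_integral lborel (\<lambda>v. std_normal_density v * v ^ 2) 1"
    "has_bochner_integral lborel (\<lambda>v. std_normal_density v * v ^ 3) 0"
    "has_bochner_integral lborel (\<lambda>v. std_normal_density v * v ^ 4) 3"
    "has_bochner_integral lborel (\<lambda>v. std_normal_density v * v ^ 5) 0"
    "has_bochner_integral lborel (\<lambda>v. std_normal_density v * v ^ 6) 15"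
    using std_normal_moment_even[of 0] std_normal_moment_even[of 1] std_normal_moment_even[of 2]
      std_normal_moment_even[of 3] std_normal_moment_odd[of 0] std_normal_moment_odd[of 1] std_normal_moment_odd[of 2]
    by (simp_all add: fact_numeral)
  note h = has_bochner_integral_add[OF has_bochner_integral_add[OF has_bochner_integral_add[OF
    has_bochner_integral_add[OF has_bochner_integral_add[OF has_bochner_integral_add[OF
    has_bochner_integral_mult_right[OF m(1), of c0] has_bochner_integral_mult_right[OF m(2), of c1]]
    has_bochner_integral_mult_right[OF m(3), of c2]] has_bochner_integral_mult_right[OF m(4), of c3]]
    has_bochner_integral_mult_right[OF m(5), of c4]] has_bochner_integral_mult_right[OF m(6), of c5]]
    has_bochner_integral_mult_right[OF m(7), of c6]]
  have "(\<lambda>v. std_normal_density v * (c0 + c1 * v + c2 * v ^ 2 + c3 * v ^ 3 + c4 * v ^ 4 + c5 * v ^ 5 + c6 * v ^ 6))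
    = (\<lambda>v. c0 * (std_normal_density v * v ^ 0) + c1 * (std_normal_density v * v ^ 1) + c2 * (std_normal_density v * v ^ 2)
      + c3 * (std_normal_density v * v ^ 3) + c4 * (std_normal_density v * v ^ 4) + c5 * (std_normal_density v * v ^ 5)
      + c6 * (std_normal_density v * v ^ 6))"
    by (simp add: fun_eq_iff algebra_simps)
  moreover have "c0 + c2 + 3 * c4 + 15 * c6 = c0 * 1 + c1 * 0 + c2 * 1 + c3 * 0 + c4 * 3 + c5 * 0 + c6 * 15" by simp
  ultimately show ?thesis using h by (simp only:)
qed

section \<open>Joining the three ranges of v\<close>

context poisson_scheme
begin

lemma eps_le_2: "eps \<le> 2"
proof -
  have "p m \<le> 1" if "m \<in> {1..N}" for m
    using member_le_sum[of m "{1..N}" p] that p_pos p_sum by (force simp: less_imp_le)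
  then have "P2 \<le> (\<Sum>m=1..N. p m)"
    unfolding P2_def using p_pos by (intro sum_mono) (auto simp: power2_eq_square mult_left_le less_imp_le)
  moreover have "1 / real n \<le> 1" using n_ge_2 by simp
  ultimately show ?thesis unfolding eps_eq p_sum by linarith
qed

text \<open>As long as v^2 \<open>eps\<close> \<le> 400, the factor 1 + v^2 costs a power of 1 /
  \<open>eps\<close>, for which the weak decay exp (- 1 / (80000 \<open>eps\<close>)) is enough.
  Beyond that, 4 / v^2 is at most \<open>eps\<close> / 100 and the decay improves to exp (- 0.24 /
  \<open>eps\<close>); it has to beat 1 + v^2 \<le> 17 n, which by \<open>n_le_exp\<close> is a
  multiple of exp (0.1 / \<open>eps\<close>).\<close>

lemma cmod_Psi_tail:
  assumes u: "\<bar>u\<bar> * sqrt eps \<le> 1 / 1000" and v: "1 \<le> 64 * (\<bar>v\<bar> * sqrt eps)" and vn: "\<bar>v\<bar> \<le> pi * sqrt n"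
  shows "cmod (Psi u v) \<le> K1 * rho ^ 3 * exp (- u\<^sup>2 / 8) / (1 + v\<^sup>2)"
proof -
  define e where "e = sqrt eps"
  have e: "0 < e" "eps = e\<^sup>2" "e \<le> rho" using eps_pos sqrt_eps_le_rho by (auto simp: e_def)
  have e2: "e \<le> 2" using eps_le_2 e(1) unfolding e(2) by (auto intro: power2_le_imp_le[of e 2])
  have e3: "e ^ 3 \<le> rho ^ 3" using e by (intro power_mono) auto
  have v0: "v \<noteq> 0" using v by auto
  have u2: "u\<^sup>2 \<le> 1 / 10 ^ 6 / eps"
  proof -
    have "(\<bar>u\<bar> * e)\<^sup>2 \<le> (1 / 1000)\<^sup>2" using u[folded e_def] e(1) by (intro power_mono) auto
    then show ?thesis using e by (simp add: power_mult_distrib power_divide field_simps)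
  qed
  have ve: "1 \<le> 4096 * (v\<^sup>2 * eps)"
  proof -
    have "1\<^sup>2 \<le> (64 * (\<bar>v\<bar> * e))\<^sup>2" using v[folded e_def] by (intro power_mono) auto
    then show ?thesis using e by (simp add: power_mult_distrib)
  qed
  have P2_le': "P2 \<le> eps" using n_pos by (simp add: eps_eq)
  have X0: "0 < 4 / v\<^sup>2 + P2" using v0 P2_nonneg by (intro add_pos_nonneg) auto
  \<comment> \<open>The term 1 / 10 ^ 6 pays for u^2 / 2 + u^2 / 8, which is at most u^2 and hence
    at most 10^(-6) / \<open>eps\<close>.\<close>
  have key: "cmod (Psi u v) \<le> exp (- u\<^sup>2 / 8) * exp (- (k / eps))"
    if X: "4 / v\<^sup>2 + P2 \<le> K * eps" and K: "0 < K" and k: "k \<le> 1 / (4 * K) - 1 / 10 ^ 6" for k K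
  proof -
    have "1 / (4 * (K * eps)) \<le> 1 / (4 * (4 / v\<^sup>2 + P2))"
      using X X0 K eps_pos by (intro divide_left_mono mult_pos_pos) auto
    moreover have "k / eps \<le> (1 / (4 * K) - 1 / 10 ^ 6) / eps" using k eps_pos by (intro divide_right_mono) auto
    moreover have "(1 / (4 * K) - 1 / 10 ^ 6) / eps = 1 / (4 * (K * eps)) - 1 / 10 ^ 6 / eps"
      by (simp add: diff_divide_distrib)
    ultimately have "u\<^sup>2 / 2 - 1 / (4 * (4 / v\<^sup>2 + P2)) \<le> - (u\<^sup>2 / 8) + - (k / eps)"
      using u2 zero_le_power2[of u] by linarith
    then have "exp (u\<^sup>2 / 2 - 1 / (4 * (4 / v\<^sup>2 + P2))) \<le> exp (- (u\<^sup>2 / 8) + - (k / eps))" by simp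
    also have "\<dots> = exp (- u\<^sup>2 / 8) * exp (- (k / eps))" by (simp only: exp_add minus_divide_left)
    finally show ?thesis using cmod_Psi_large[OF v0 vn, of u] by linarith
  qed
  have fin: "cmod (Psi u v) \<le> K1 * rho ^ 3 * exp (- u\<^sup>2 / 8) / (1 + v\<^sup>2)"
    if "cmod (Psi u v) \<le> exp (- u\<^sup>2 / 8) * d" "(1 + v\<^sup>2) * d \<le> K1 * e ^ 3" for d
  proof -
    have v1: "0 < 1 + v\<^sup>2" by (simp add: add_pos_nonneg)
    have "(1 + v\<^sup>2) * cmod (Psi u v) \<le> exp (- u\<^sup>2 / 8) * ((1 + v\<^sup>2) * d)"
      using mult_left_mono[OF that(1), of "1 + v\<^sup>2"] by (simp add: ac_simps)
    also have "\<dots> \<le> exp (- u\<^sup>2 / 8) * (K1 * rho ^ 3)"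
      by (intro mult_left_mono order_trans[OF that(2) mult_left_mono[OF e3]]) (use K_pos in auto)
    finally show ?thesis using v1 by (simp add: pos_le_divide_eq ac_simps)
  qed
  have K1_le: "10 ^ 19 * e ^ 3 \<le> K1 * e ^ 3" "4000 * exp 40 * e ^ 3 \<le> K1 * e ^ 3"
    using e by (auto simp: K1_def intro!: mult_right_mono)
  have e4: "eps\<^sup>2 \<le> 2 * e ^ 3" "eps ^ 3 \<le> 8 * e ^ 3"
  proof -
    have A: "eps\<^sup>2 = e * e ^ 3" "eps ^ 3 = e ^ 3 * e ^ 3"
      using e by (simp_all add: power2_eq_square power3_eq_cube)
    have B: "e ^ 3 \<le> 2 ^ 3" using e e2 by (intro power_mono) auto
    show "eps\<^sup>2 \<le> 2 * e ^ 3" unfolding A by (rule mult_right_mono) (use e e2 in auto)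
    show "eps ^ 3 \<le> 8 * e ^ 3" unfolding A by (rule mult_right_mono) (use e B in auto)
  qed
  show ?thesis
  proof (cases "\<bar>v\<bar> * e \<le> 20")
    case True
    have X: "4 / v\<^sup>2 + P2 \<le> 16385 * eps"
    proof -
      have "4 / v\<^sup>2 \<le> 16384 * eps" using ve v0 by (simp add: field_simps)
      then show ?thesis using P2_le' by linarith
    qed
    have d: "exp (- (1 / 80000 / eps)) \<le> 6 * 80000 ^ 3 * eps ^ 3"
      using exp_minus_le_power[of "1 / 80000 / eps" 3] eps_pos by (simp add: fact_numeral power_divide)
    have "(\<bar>v\<bar> * e)\<^sup>2 \<le> 20\<^sup>2" using True e by (intro power_mono) auto
    then have "v\<^sup>2 * eps \<le> 400" using e by (simp add: power_mult_distrib)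
    then have v2: "1 + v\<^sup>2 \<le> 1 + 400 / eps" using eps_pos by (simp add: field_simps)
    have "(1 + v\<^sup>2) * exp (- (1 / 80000 / eps)) \<le> (1 + 400 / eps) * (6 * 80000 ^ 3 * eps ^ 3)"
      using v2 d eps_pos by (intro mult_mono) auto
    also have "\<dots> = 6 * 80000 ^ 3 * (eps ^ 3 + 400 * eps\<^sup>2)"
      using eps_pos by (simp add: field_simps power3_eq_cube power2_eq_square)
    also have "\<dots> \<le> 6 * 80000 ^ 3 * (8 * e ^ 3 + 400 * (2 * e ^ 3))"
      using e4 by (intro mult_left_mono add_mono) auto
    also have "\<dots> \<le> K1 * e ^ 3" using K1_le e by simp
    finally have F: "(1 + v\<^sup>2) * exp (- (1 / 80000 / eps)) \<le> K1 * e ^ 3" .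
    show ?thesis by (rule fin[OF key[OF X, of "1 / 80000"] F]) simp_all
  next
    case False
    have "20\<^sup>2 \<le> (\<bar>v\<bar> * e)\<^sup>2" using False by (intro power_mono) auto
    then have "400 \<le> v\<^sup>2 * eps" using e by (simp add: power_mult_distrib)
    then have X: "4 / v\<^sup>2 + P2 \<le> 101 / 100 * eps"
    proof -
      assume "400 \<le> v\<^sup>2 * eps"
      then have "4 / v\<^sup>2 \<le> 1 / 100 * eps" using v0 by (simp add: field_simps)
      then show ?thesis using P2_le' by linarith
    qed
    have "v\<^sup>2 \<le> (pi * sqrt n)\<^sup>2" using vn by (metis abs_ge_zero power2_abs power_mono)
    also have "\<dots> \<le> 4\<^sup>2 * n"
      using pi_less_4 n_pos power_mono[of pi 4 2] by (simp add: power_mult_distrib)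
    finally have "1 + v\<^sup>2 \<le> 17 * real n" using n_ge_2 by simp
    also have "\<dots> \<le> 17 * (exp 40 * exp (1 / (10 * eps)))" using n_le_exp by simp
    finally have "(1 + v\<^sup>2) * exp (- (24 / 100 / eps)) \<le> 17 * (exp 40 * exp (1 / (10 * eps))) * exp (- (24 / 100 / eps))"
      by (rule mult_right_mono) simp
    also have "\<dots> = 17 * exp 40 * exp (- (14 / 100 / eps))"
    proof -
      have "exp (1 / (10 * eps)) * exp (- (24 / 100 / eps)) = exp (- (14 / 100 / eps))"
        unfolding exp_add[symmetric] using eps_pos by (simp add: field_simps)
      then show ?thesis by (simp only: mult.assoc)
    qed
    also have "\<dots> \<le> 17 * exp 40 * (103 * eps\<^sup>2)"
    proof (rule mult_left_mono)
      have "exp (- (14 / 100 / eps)) \<le> fact 2 / (14 / 100 / eps)\<^sup>2"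
        using eps_pos by (intro exp_minus_le_power) auto
      also have "\<dots> \<le> 103 * eps\<^sup>2" using eps_pos by (simp add: power_divide field_simps)
      finally show "exp (- (14 / 100 / eps)) \<le> 103 * eps\<^sup>2" .
    qed simp
    also have "\<dots> \<le> 17 * exp 40 * (103 * (2 * e ^ 3))" using e4 by (intro mult_left_mono) auto
    also have "\<dots> \<le> 4000 * exp 40 * e ^ 3" using e by simp
    also have "\<dots> \<le> K1 * e ^ 3" by (rule K1_le)
    finally have F: "(1 + v\<^sup>2) * exp (- (24 / 100 / eps)) \<le> K1 * e ^ 3" .
    show ?thesis by (rule fin[OF key[OF X, of "24 / 100"] F]) simp_all
  qed
qed

definition "Pol_gauss u v = complex_of_real (exp (- (u\<^sup>2 + v\<^sup>2) / 2)) * Pol u v"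
definition "Psi_cut u v = indicator {- (pi * sqrt n)..pi * sqrt n} v *\<^sub>R Psi u v"

text \<open>The cut is at \<bar>v\<bar> \<open>sqrt eps\<close> = 1/64. Below it \<bar>v\<bar> is at
  most sqrt n, so the indicator is 1. Above it \<open>Psi_cut\<close> and \<open>Pol_gauss\<close>
  are estimated separately, also outside the period, where the former is 0. The factor
  \<open>inverse (1 + v\<^sup>2)\<close> prepares the integration over v.\<close>

lemma Psi_cut_expansion:
  assumes u3: "\<bar>u\<bar> * beta 3 \<le> 1 / 16" and u: "\<bar>u\<bar> * sqrt eps \<le> 1 / 1000"
  shows "cmod (Psi_cut u v - Pol_gauss u v) \<le> K2 * rho ^ 3 * exp (- u\<^sup>2 / 16) * inverse (1 + v\<^sup>2)"
proof -
  have "3 * 10 ^ 6 * rho ^ 3 * (q u v ^ 9 * exp (- (u\<^sup>2 + v\<^sup>2) / 4))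
     \<le> 3 * 10 ^ 6 * rho ^ 3 * (3 * 10 ^ 10 * exp (- u\<^sup>2 / 16) / (1 + v\<^sup>2))"
    using rho_pos by (intro mult_left_mono poly_times_gauss_le) auto
  also have "\<dots> = 9 * 10 ^ 16 * rho ^ 3 * exp (- u\<^sup>2 / 16) * inverse (1 + v\<^sup>2)"
    unfolding divide_inverse by simp
  also have "\<dots> \<le> 10 ^ 18 * rho ^ 3 * exp (- u\<^sup>2 / 16) * inverse (1 + v\<^sup>2)"
    using rho_pos by (intro mult_right_mono) auto
  finally have b: "3 * 10 ^ 6 * rho ^ 3 * q u v ^ 9 * exp (- (u\<^sup>2 + v\<^sup>2) / 4)
     \<le> 10 ^ 18 * rho ^ 3 * exp (- u\<^sup>2 / 16) * inverse (1 + v\<^sup>2)" by (simp only: mult.assoc)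
  have K2eq: "K2 * r * s * t = 10 ^ 18 * r * s * t + K1 * r * s * t" for r s t :: real
    by (simp add: K2_def algebra_simps)
  have pos: "0 \<le> K1 * rho ^ 3 * exp (- u\<^sup>2 / 16) * inverse (1 + v\<^sup>2)"
    using K_pos rho_pos by simp
  show ?thesis
  proof (cases "1 \<le> 64 * (\<bar>v\<bar> * sqrt eps)")
    case False
    have "1 / n \<le> eps" using P2_nonneg by (simp add: eps_eq)
    then have "1 / sqrt n \<le> sqrt eps" using real_sqrt_le_mono[of "1 / n" eps] by (simp add: real_sqrt_divide)
    then have "\<bar>v\<bar> * (1 / sqrt n) \<le> \<bar>v\<bar> * sqrt eps" by (intro mult_left_mono) auto
    with False have "\<bar>v\<bar> * (1 / sqrt n) \<le> 1" by linarith
    then have "\<bar>v\<bar> \<le> sqrt n" using n_pos by (simp add: field_simps)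
    also have "\<dots> \<le> pi * sqrt n" using n_pos pi_ge_two by simp
    finally have "\<bar>v\<bar> \<le> pi * sqrt n" .
    then have "Psi_cut u v = Psi u v" by (auto simp: Psi_cut_def indicator_def)
    moreover have "\<bar>v\<bar> * xbeta 3 \<le> 1 / 16"
      using mult_left_mono[OF xbeta_3, of "\<bar>v\<bar>"] False by simp
    ultimately have "cmod (Psi_cut u v - Pol_gauss u v) \<le> 10 ^ 18 * rho ^ 3 * exp (- u\<^sup>2 / 16) * inverse (1 + v\<^sup>2)"
      using order_trans[OF psi_expansion_mid[OF u3] b] unfolding Pol_gauss_def by (simp only:)
    then show ?thesis using pos K2eq by simp
  next
    case True
    have "cmod (Psi_cut u v) \<le> K1 * rho ^ 3 * exp (- u\<^sup>2 / 8) / (1 + v\<^sup>2)"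
    proof (cases "\<bar>v\<bar> \<le> pi * sqrt n")
      case vn: True
      then show ?thesis using cmod_Psi_tail[OF u True vn] by (auto simp: Psi_cut_def indicator_def)
    next
      case False
      then have "Psi_cut u v = 0" by (auto simp: Psi_cut_def indicator_def)
      then show ?thesis using K_pos rho_pos by simp
    qed
    also have "\<dots> \<le> K1 * rho ^ 3 * exp (- u\<^sup>2 / 16) * inverse (1 + v\<^sup>2)"
      unfolding divide_inverse[of "_ * exp _"] using K_pos rho_pos
      by (intro mult_right_mono mult_left_mono) auto
    finally have "cmod (Psi_cut u v) \<le> K1 * rho ^ 3 * exp (- u\<^sup>2 / 16) * inverse (1 + v\<^sup>2)" .
    moreover have "cmod (Pol_gauss u v) \<le> 10 ^ 18 * rho ^ 3 * exp (- u\<^sup>2 / 16) * inverse (1 + v\<^sup>2)"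
      using tail_expansion[OF True] b unfolding Pol_gauss_def by (rule order_trans)
    ultimately show ?thesis using norm_triangle_ineq4[of "Psi_cut u v" "Pol_gauss u v"] K2eq by simp
  qed
qed

end

context poisson_scheme
begin

section \<open>The Gaussian average of the expansion\<close>

lemma integrable_mixed:
  assumes m: "m \<in> {1..N}" and ij: "i + j \<le> 5"
  shows "integrable M (\<lambda>\<omega>. a m \<omega> ^ i * x m \<omega> ^ j)"
proof (rule Bochner_Integration.integrable_bound)
  show "integrable M (\<lambda>\<omega>. \<bar>a m \<omega>\<bar> ^ (i + j) + \<bar>x m \<omega>\<bar> ^ (i + j))"
    using integrable_abs_power_mono[OF a_meas[OF m] a_int[OF m] ij] x_int[OF m] by simp
  have "\<bar>y ^ i * z ^ j\<bar> \<le> \<bar>y\<bar> ^ (i + j) + \<bar>z\<bar> ^ (i + j)" for y z :: real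
  proof -
    define b where "b = max \<bar>y\<bar> \<bar>z\<bar>"
    have "\<bar>y ^ i * z ^ j\<bar> \<le> b ^ i * b ^ j"
      unfolding abs_mult power_abs by (intro mult_mono power_mono) (auto simp: b_def)
    also have "\<dots> = b ^ (i + j)" by (rule power_add[symmetric])
    also have "\<dots> \<le> \<bar>y\<bar> ^ (i + j) + \<bar>z\<bar> ^ (i + j)" by (auto simp: b_def max_def)
    finally show ?thesis .
  qed
  then show "AE \<omega> in M. norm (a m \<omega> ^ i * x m \<omega> ^ j) \<le> norm (\<bar>a m \<omega>\<bar> ^ (i + j) + \<bar>x m \<omega>\<bar> ^ (i + j))"
    by (intro AE_I2) (simp add: order_trans[OF _ abs_ge_self])
  show "(\<lambda>\<omega>. a m \<omega> ^ i * x m \<omega> ^ j) \<in> borel_measurable M" using m by measurable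
qed

definition "mom i j m = expectation (\<lambda>\<omega>. a m \<omega> ^ i * x m \<omega> ^ j)"

lemma lin_moments:
  assumes m: "m \<in> {1..N}"
  shows "expectation (\<lambda>\<omega>. (lin u v m \<omega>)\<^sup>2) = mom 2 0 m * u\<^sup>2 + 2 * mom 1 1 m * u * v + mom 0 2 m * v\<^sup>2"
    and "expectation (\<lambda>\<omega>. lin u v m \<omega> ^ 3)
      = mom 3 0 m * u ^ 3 + 3 * mom 2 1 m * u\<^sup>2 * v + 3 * mom 1 2 m * u * v\<^sup>2 + mom 0 3 m * v ^ 3"
    and "expectation (\<lambda>\<omega>. lin u v m \<omega> ^ 4)
      = mom 4 0 m * u ^ 4 + 4 * mom 3 1 m * u ^ 3 * v + 6 * mom 2 2 m * u\<^sup>2 * v\<^sup>2 + 4 * mom 1 3 m * u * v ^ 3 + mom 0 4 m * v ^ 4"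
proof -
  note i = integrable_mixed[OF m]
  have "(\<lambda>\<omega>. (lin u v m \<omega>)\<^sup>2) = (\<lambda>\<omega>. (a m \<omega> ^ 2 * x m \<omega> ^ 0) * u\<^sup>2 + (a m \<omega> ^ 1 * x m \<omega> ^ 1) * (2 * u * v)
      + (a m \<omega> ^ 0 * x m \<omega> ^ 2) * v\<^sup>2)"
    by (simp add: lin_def fun_eq_iff power2_eq_square algebra_simps)
  then show "expectation (\<lambda>\<omega>. (lin u v m \<omega>)\<^sup>2) = mom 2 0 m * u\<^sup>2 + 2 * mom 1 1 m * u * v + mom 0 2 m * v\<^sup>2"
    unfolding mom_def using i[of 2 0] i[of 1 1] i[of 0 2]
    by (simp only: Bochner_Integration.integral_add Bochner_Integration.integrable_add integrable_mult_left
      integral_mult_left_zero) simp?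
  have "(\<lambda>\<omega>. lin u v m \<omega> ^ 3) = (\<lambda>\<omega>. (a m \<omega> ^ 3 * x m \<omega> ^ 0) * u ^ 3 + (a m \<omega> ^ 2 * x m \<omega> ^ 1) * (3 * u\<^sup>2 * v)
      + (a m \<omega> ^ 1 * x m \<omega> ^ 2) * (3 * u * v\<^sup>2) + (a m \<omega> ^ 0 * x m \<omega> ^ 3) * v ^ 3)"
    by (simp add: lin_def fun_eq_iff power2_eq_square power3_eq_cube algebra_simps)
  then show "expectation (\<lambda>\<omega>. lin u v m \<omega> ^ 3)
      = mom 3 0 m * u ^ 3 + 3 * mom 2 1 m * u\<^sup>2 * v + 3 * mom 1 2 m * u * v\<^sup>2 + mom 0 3 m * v ^ 3"
    unfolding mom_def using i[of 3 0] i[of 2 1] i[of 1 2] i[of 0 3]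
    by (simp only: Bochner_Integration.integral_add Bochner_Integration.integrable_add integrable_mult_left
      integral_mult_left_zero) simp?
  have "(\<lambda>\<omega>. lin u v m \<omega> ^ 4) = (\<lambda>\<omega>. (a m \<omega> ^ 4 * x m \<omega> ^ 0) * u ^ 4 + (a m \<omega> ^ 3 * x m \<omega> ^ 1) * (4 * u ^ 3 * v)
      + (a m \<omega> ^ 2 * x m \<omega> ^ 2) * (6 * u\<^sup>2 * v\<^sup>2) + (a m \<omega> ^ 1 * x m \<omega> ^ 3) * (4 * u * v ^ 3) + (a m \<omega> ^ 0 * x m \<omega> ^ 4) * v ^ 4)"
    by (simp add: lin_def fun_eq_iff power2_eq_square power3_eq_cube power4_eq_xxxx algebra_simps)
  then show "expectation (\<lambda>\<omega>. lin u v m \<omega> ^ 4)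
      = mom 4 0 m * u ^ 4 + 4 * mom 3 1 m * u ^ 3 * v + 6 * mom 2 2 m * u\<^sup>2 * v\<^sup>2 + 4 * mom 1 3 m * u * v ^ 3 + mom 0 4 m * v ^ 4"
    unfolding mom_def using i[of 4 0] i[of 3 1] i[of 2 2] i[of 1 3] i[of 0 4]
    by (simp only: Bochner_Integration.integral_add Bochner_Integration.integrable_add integrable_mult_left
      integral_mult_left_zero) simp?
qed

text \<open>\<open>qA\<close> to \<open>qD\<close> are the coefficients of the cubic form
  \<open>Q3\<close> stripped of the binomial factors; each \<open>e\<close> with indices i, j is the
  full coefficient of u^i v^j in \<open>Q4\<close>.\<close>

definition "qA = (\<Sum>m=1..N. mom 3 0 m)"
definition "qB = (\<Sum>m=1..N. mom 2 1 m)"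
definition "qC = (\<Sum>m=1..N. mom 1 2 m)"
definition "qD = (\<Sum>m=1..N. mom 0 3 m)"
definition "e40 = (\<Sum>m=1..N. mom 4 0 m - 3 * (mom 2 0 m)\<^sup>2)"
definition "e31 = (\<Sum>m=1..N. 4 * mom 3 1 m - 12 * mom 2 0 m * mom 1 1 m)"
definition "e22 = (\<Sum>m=1..N. 6 * mom 2 2 m - 12 * (mom 1 1 m)\<^sup>2 - 6 * mom 2 0 m * mom 0 2 m)"
definition "e13 = (\<Sum>m=1..N. 4 * mom 1 3 m - 12 * mom 0 2 m * mom 1 1 m)"
definition "e04 = (\<Sum>m=1..N. mom 0 4 m - 3 * (mom 0 2 m)\<^sup>2)"

lemma Q3_eq: "Q3 u v = qA * u ^ 3 + 3 * qB * u\<^sup>2 * v + 3 * qC * u * v\<^sup>2 + qD * v ^ 3"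
  unfolding Q3_def qA_def qB_def qC_def qD_def sum_distrib_left sum_distrib_right sum.distrib[symmetric]
  by (intro sum.cong refl lin_moments)

lemma Q4_eq: "Q4 u v = e40 * u ^ 4 + e31 * u ^ 3 * v + e22 * u\<^sup>2 * v\<^sup>2 + e13 * u * v ^ 3 + e04 * v ^ 4"
  unfolding Q4_def e40_def e31_def e22_def e13_def e04_def sum_distrib_left sum_distrib_right sum.distrib[symmetric]
  by (intro sum.cong refl) (simp only: lin_moments, algebra)

text \<open>The Gaussian average of \<open>Pol\<close> over v, in which v^2, v^4, v^6 become 1, 3,
  15 and odd powers vanish, without the constant \<open>a2\<close> that is independent of u. In
  particular \<open>W 0 = 1\<close>.\<close>

definition "W u = 1 + complex_of_real ((e40 * u ^ 4 + e22 * u\<^sup>2) / 24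
    - (qA\<^sup>2 * u ^ 6 + (9 * qB\<^sup>2 + 6 * qA * qC) * u ^ 4 + (27 * qC\<^sup>2 + 18 * qB * qD) * u\<^sup>2) / 72)
    - \<i> * complex_of_real ((qA * u ^ 3 + 3 * qC * u) / 6)"
definition "a2 = 3 * e04 / 24 - 15 * qD\<^sup>2 / 72"

lemma has_bochner_integral_Pol:
  "has_bochner_integral lborel (\<lambda>v. of_real (std_normal_density v) * Pol u v) (W u + of_real a2)"
proof -
  have 1: "has_bochner_integral lborel (\<lambda>v. std_normal_density v *
     ((1 + e40 * u ^ 4 / 24 - qA\<^sup>2 * u ^ 6 / 72) + (e31 * u ^ 3 / 24 - 6 * qA * qB * u ^ 5 / 72) * v
      + (e22 * u\<^sup>2 / 24 - (9 * qB\<^sup>2 + 6 * qA * qC) * u ^ 4 / 72) * v ^ 2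
      + (e13 * u / 24 - (2 * qA * qD + 18 * qB * qC) * u ^ 3 / 72) * v ^ 3
      + (e04 / 24 - (9 * qC\<^sup>2 + 6 * qB * qD) * u\<^sup>2 / 72) * v ^ 4
      + (- 6 * qC * qD * u / 72) * v ^ 5 + (- qD\<^sup>2 / 72) * v ^ 6))
     ((1 + e40 * u ^ 4 / 24 - qA\<^sup>2 * u ^ 6 / 72) + (e22 * u\<^sup>2 / 24 - (9 * qB\<^sup>2 + 6 * qA * qC) * u ^ 4 / 72)
      + 3 * (e04 / 24 - (9 * qC\<^sup>2 + 6 * qB * qD) * u\<^sup>2 / 72) + 15 * (- qD\<^sup>2 / 72))"
    by (rule gauss_poly6)
  have 2: "has_bochner_integral lborel (\<lambda>v. std_normal_density v *
     (- qA * u ^ 3 / 6 + (- qB * u\<^sup>2 / 2) * v + (- qC * u / 2) * v ^ 2 + (- qD / 6) * v ^ 3 + 0 * v ^ 4 + 0 * v ^ 5 + 0 * v ^ 6))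
     (- qA * u ^ 3 / 6 + (- qC * u / 2) + 3 * 0 + 15 * 0)"
    by (rule gauss_poly6)
  have "(\<lambda>v. of_real (std_normal_density v) * Pol u v) = (\<lambda>v. complex_of_real (std_normal_density v *
     ((1 + e40 * u ^ 4 / 24 - qA\<^sup>2 * u ^ 6 / 72) + (e31 * u ^ 3 / 24 - 6 * qA * qB * u ^ 5 / 72) * v
      + (e22 * u\<^sup>2 / 24 - (9 * qB\<^sup>2 + 6 * qA * qC) * u ^ 4 / 72) * v ^ 2
      + (e13 * u / 24 - (2 * qA * qD + 18 * qB * qC) * u ^ 3 / 72) * v ^ 3
      + (e04 / 24 - (9 * qC\<^sup>2 + 6 * qB * qD) * u\<^sup>2 / 72) * v ^ 4
      + (- 6 * qC * qD * u / 72) * v ^ 5 + (- qD\<^sup>2 / 72) * v ^ 6))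
     + \<i> * complex_of_real (std_normal_density v *
     (- qA * u ^ 3 / 6 + (- qB * u\<^sup>2 / 2) * v + (- qC * u / 2) * v ^ 2 + (- qD / 6) * v ^ 3 + 0 * v ^ 4 + 0 * v ^ 5 + 0 * v ^ 6)))"
  proof
    fix v
    define d where "d = std_normal_density v"
    have r: "1 + Q4 u v / 24 - (Q3 u v)\<^sup>2 / 72 =
      ((1 + e40 * u ^ 4 / 24 - qA\<^sup>2 * u ^ 6 / 72) + (e31 * u ^ 3 / 24 - 6 * qA * qB * u ^ 5 / 72) * v
      + (e22 * u\<^sup>2 / 24 - (9 * qB\<^sup>2 + 6 * qA * qC) * u ^ 4 / 72) * v ^ 2
      + (e13 * u / 24 - (2 * qA * qD + 18 * qB * qC) * u ^ 3 / 72) * v ^ 3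
      + (e04 / 24 - (9 * qC\<^sup>2 + 6 * qB * qD) * u\<^sup>2 / 72) * v ^ 4
      + (- 6 * qC * qD * u / 72) * v ^ 5 + (- qD\<^sup>2 / 72) * v ^ 6)"
      unfolding Q3_eq Q4_eq by (simp add: field_simps) algebra
    have i: "- Q3 u v / 6 = - qA * u ^ 3 / 6 + (- qB * u\<^sup>2 / 2) * v + (- qC * u / 2) * v ^ 2 + (- qD / 6) * v ^ 3 + 0 * v ^ 4 + 0 * v ^ 5 + 0 * v ^ 6"
      unfolding Q3_eq by (simp add: field_simps)
    show "of_real (std_normal_density v) * Pol u v = complex_of_real (std_normal_density v *
     ((1 + e40 * u ^ 4 / 24 - qA\<^sup>2 * u ^ 6 / 72) + (e31 * u ^ 3 / 24 - 6 * qA * qB * u ^ 5 / 72) * v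
      + (e22 * u\<^sup>2 / 24 - (9 * qB\<^sup>2 + 6 * qA * qC) * u ^ 4 / 72) * v ^ 2
      + (e13 * u / 24 - (2 * qA * qD + 18 * qB * qC) * u ^ 3 / 72) * v ^ 3
      + (e04 / 24 - (9 * qC\<^sup>2 + 6 * qB * qD) * u\<^sup>2 / 72) * v ^ 4
      + (- 6 * qC * qD * u / 72) * v ^ 5 + (- qD\<^sup>2 / 72) * v ^ 6))
     + \<i> * complex_of_real (std_normal_density v *
     (- qA * u ^ 3 / 6 + (- qB * u\<^sup>2 / 2) * v + (- qC * u / 2) * v ^ 2 + (- qD / 6) * v ^ 3 + 0 * v ^ 4 + 0 * v ^ 5 + 0 * v ^ 6))"
      unfolding Pol_def r[symmetric] i[symmetric] d_def[symmetric] by (simp add: complex_eq_iff)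
  qed
  moreover have "W u + of_real a2 = complex_of_real ((1 + e40 * u ^ 4 / 24 - qA\<^sup>2 * u ^ 6 / 72) + (e22 * u\<^sup>2 / 24 - (9 * qB\<^sup>2 + 6 * qA * qC) * u ^ 4 / 72)
      + 3 * (e04 / 24 - (9 * qC\<^sup>2 + 6 * qB * qD) * u\<^sup>2 / 72) + 15 * (- qD\<^sup>2 / 72))
      + \<i> * complex_of_real (- qA * u ^ 3 / 6 + (- qC * u / 2) + 3 * 0 + 15 * 0)"
    by (simp add: W_def a2_def complex_eq_iff field_simps)
  ultimately show ?thesis
    using has_bochner_integral_add[OF has_bochner_integral_of_real[OF 1, where 'a = complex]
        has_bochner_integral_mult_right[OF has_bochner_integral_of_real[OF 2, where 'a = complex], of \<i>]]
    by (simp only:)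
qed

text \<open>The forms are evaluated at (1, 0), (0, 1), (1, 1) and (1, -1); sums and differences
  isolate these coefficients, so the bounds for \<open>Q3\<close> and \<open>Q4\<close> carry
  over.\<close>

lemma coefficient_bounds:
  "\<bar>qA\<bar> \<le> 100 * rho" "\<bar>qB\<bar> \<le> 100 * rho" "\<bar>qC\<bar> \<le> 100 * rho" "\<bar>qD\<bar> \<le> 100 * rho"
  "\<bar>e40\<bar> \<le> 10000 * rho\<^sup>2" "\<bar>e22\<bar> \<le> 10000 * rho\<^sup>2" "\<bar>e04\<bar> \<le> 10000 * rho\<^sup>2"
proof -
  have 3: "\<bar>Q3 1 0\<bar> \<le> 32 * rho" "\<bar>Q3 0 1\<bar> \<le> 32 * rho" "\<bar>Q3 1 1\<bar> \<le> 108 * rho" "\<bar>Q3 1 (- 1)\<bar> \<le> 108 * rho"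
    using abs_Q3_le[of 1 0] abs_Q3_le[of 0 1] abs_Q3_le[of 1 1] abs_Q3_le[of 1 "- 1"] by simp_all
  have "Q3 1 0 = qA" "Q3 0 1 = qD" "Q3 1 1 = qA + 3 * qB + 3 * qC + qD" "Q3 1 (- 1) = qA - 3 * qB + 3 * qC - qD"
    unfolding Q3_eq by simp_all
  with 3 show "\<bar>qA\<bar> \<le> 100 * rho" "\<bar>qB\<bar> \<le> 100 * rho" "\<bar>qC\<bar> \<le> 100 * rho" "\<bar>qD\<bar> \<le> 100 * rho"
    using rho_pos by linarith+
  have 4: "\<bar>Q4 1 0\<bar> \<le> 256 * rho\<^sup>2" "\<bar>Q4 0 1\<bar> \<le> 256 * rho\<^sup>2" "\<bar>Q4 1 1\<bar> \<le> 1296 * rho\<^sup>2" "\<bar>Q4 1 (- 1)\<bar> \<le> 1296 * rho\<^sup>2"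
    using abs_Q4_le[of 1 0] abs_Q4_le[of 0 1] abs_Q4_le[of 1 1] abs_Q4_le[of 1 "- 1"] by simp_all
  have "Q4 1 0 = e40" "Q4 0 1 = e04" "Q4 1 1 = e40 + e31 + e22 + e13 + e04" "Q4 1 (- 1) = e40 - e31 + e22 - e13 + e04"
    unfolding Q4_eq by simp_all
  moreover have "0 \<le> rho\<^sup>2" by simp
  ultimately show "\<bar>e40\<bar> \<le> 10000 * rho\<^sup>2" "\<bar>e22\<bar> \<le> 10000 * rho\<^sup>2" "\<bar>e04\<bar> \<le> 10000 * rho\<^sup>2"
    using 4 by linarith+
qed

lemma abs_a2_le: "\<bar>a2\<bar> \<le> 10000 * rho\<^sup>2"
proof -
  have "qD\<^sup>2 \<le> (100 * rho)\<^sup>2" using coefficient_bounds(4) by (metis abs_ge_zero power2_abs power_mono)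
  then have "qD\<^sup>2 \<le> 10000 * rho\<^sup>2" by (simp add: power_mult_distrib)
  then show ?thesis using coefficient_bounds(7) zero_le_power2[of qD] zero_le_power2[of rho]
    unfolding a2_def by linarith
qed

lemma cmod_W_le: "cmod (W u - 1) \<le> 10000 * (rho + rho\<^sup>2) * (1 + u\<^sup>2) ^ 3"
proof -
  define w where "w = (1 + u\<^sup>2) ^ 3"
  have le: "u\<^sup>2 \<le> w" "u ^ 4 \<le> w" "u ^ 6 \<le> w" "\<bar>u\<bar> \<le> w" "\<bar>u\<bar> ^ 3 \<le> w" "0 \<le> w"
  proof -
    have w: "w = 1 + 3 * u\<^sup>2 + 3 * u ^ 4 + u ^ 6" unfolding w_def by algebra
    have p: "0 \<le> u\<^sup>2" "0 \<le> u ^ 4" "0 \<le> u ^ 6" by simp_all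
    have "\<bar>u\<bar> \<le> 1 + \<bar>u\<bar>\<^sup>2" "\<bar>u\<bar> ^ 3 \<le> 1 + \<bar>u\<bar> ^ 4"
      using power_le_one_plus_power[of "\<bar>u\<bar>" 1 2] power_le_one_plus_power[of "\<bar>u\<bar>" 3 4] by simp_all
    then have "\<bar>u\<bar> \<le> 1 + u\<^sup>2" "\<bar>u\<bar> ^ 3 \<le> 1 + u ^ 4" by (simp_all add: power_even_abs)
    then show "u\<^sup>2 \<le> w" "u ^ 4 \<le> w" "u ^ 6 \<le> w" "\<bar>u\<bar> \<le> w" "\<bar>u\<bar> ^ 3 \<le> w" "0 \<le> w"
      using p unfolding w by linarith+
  qed
  have r: "0 \<le> rho" using rho_pos by simp
  have pr: "\<bar>y * z\<bar> \<le> 10000 * rho\<^sup>2" if "\<bar>y\<bar> \<le> 100 * rho" "\<bar>z\<bar> \<le> 100 * rho" for y z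
  proof -
    have "\<bar>y\<bar> * \<bar>z\<bar> \<le> (100 * rho) * (100 * rho)" using that r by (intro mult_mono) auto
    then show ?thesis by (simp add: abs_mult power2_eq_square)
  qed
  note c = coefficient_bounds
  have mm: "\<bar>y * z\<bar> \<le> b * w" if "\<bar>y\<bar> \<le> b" "\<bar>z\<bar> \<le> w" for y z b
    unfolding abs_mult using that by (intro mult_mono) auto
  have la: "\<bar>u\<^sup>2\<bar> \<le> w" "\<bar>u ^ 4\<bar> \<le> w" "\<bar>u ^ 6\<bar> \<le> w" "\<bar>u\<bar> \<le> w" "\<bar>u ^ 3\<bar> \<le> w"
    using le by (simp_all add: power_abs power_even_abs)
  note t = mm[OF c(5) la(2)] mm[OF c(6) la(1)] mm[OF pr[OF c(1) c(1)] la(3)] mm[OF pr[OF c(2) c(2)] la(2)]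
    mm[OF pr[OF c(1) c(3)] la(2)] mm[OF pr[OF c(3) c(3)] la(1)] mm[OF pr[OF c(2) c(4)] la(1)]
    mm[OF c(1) la(5)] mm[OF c(3) la(4)]
  have w0: "0 \<le> rho * w" "0 \<le> rho\<^sup>2 * w" using r le by simp_all
  have "cmod (W u - 1) \<le> \<bar>(e40 * u ^ 4 + e22 * u\<^sup>2) / 24
    - (qA\<^sup>2 * u ^ 6 + (9 * qB\<^sup>2 + 6 * qA * qC) * u ^ 4 + (27 * qC\<^sup>2 + 18 * qB * qD) * u\<^sup>2) / 72\<bar>
    + \<bar>(qA * u ^ 3 + 3 * qC * u) / 6\<bar>"
    unfolding W_def by (rule order_trans[OF cmod_le]) simp
  also have "(e40 * u ^ 4 + e22 * u\<^sup>2) / 24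
    - (qA\<^sup>2 * u ^ 6 + (9 * qB\<^sup>2 + 6 * qA * qC) * u ^ 4 + (27 * qC\<^sup>2 + 18 * qB * qD) * u\<^sup>2) / 72
    = e40 * u ^ 4 / 24 + e22 * u\<^sup>2 / 24 - qA * qA * u ^ 6 / 72 - qB * qB * u ^ 4 / 8 - qA * qC * u ^ 4 / 12
      - 3 * (qC * qC * u\<^sup>2) / 8 - qB * qD * u\<^sup>2 / 4" by (simp add: field_simps power2_eq_square)
  also have "(qA * u ^ 3 + 3 * qC * u) / 6 = qA * u ^ 3 / 6 + qC * u / 2" by (simp add: field_simps)
  also have "\<bar>e40 * u ^ 4 / 24 + e22 * u\<^sup>2 / 24 - qA * qA * u ^ 6 / 72 - qB * qB * u ^ 4 / 8 - qA * qC * u ^ 4 / 12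
      - 3 * (qC * qC * u\<^sup>2) / 8 - qB * qD * u\<^sup>2 / 4\<bar> + \<bar>qA * u ^ 3 / 6 + qC * u / 2\<bar>
      \<le> 10000 * (rho\<^sup>2 * w) + 10000 * (rho * w)"
  proof -
    have "\<bar>t1 / 24 + t2 / 24 - t3 / 72 - t4 / 8 - t5 / 12 - 3 * t6 / 8 - t7 / 4\<bar> \<le> b"
      if "\<bar>t1\<bar> \<le> b" "\<bar>t2\<bar> \<le> b" "\<bar>t3\<bar> \<le> b" "\<bar>t4\<bar> \<le> b" "\<bar>t5\<bar> \<le> b" "\<bar>t6\<bar> \<le> b" "\<bar>t7\<bar> \<le> b"
      for t1 t2 t3 t4 t5 t6 t7 b :: real
      using that unfolding abs_le_iff by linarith
    note A = this[OF t(1-7)]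
    have "\<bar>t1 / 6 + t2 / 2\<bar> \<le> b" if "\<bar>t1\<bar> \<le> b" "\<bar>t2\<bar> \<le> b" for t1 t2 b :: real
      using that unfolding abs_le_iff by linarith
    note B = this[OF t(8,9)]
    show ?thesis using add_mono[OF A B] w0 unfolding mult.assoc by linarith
  qed
  finally show ?thesis by (simp add: w_def algebra_simps)
qed

end

section \<open>Bartlett's formula and the characteristic function given the total\<close>

definition K4 :: real where "K4 = 100000000 * K2"

lemma integral_inverse_1_plus_square:
  "integrable lborel (\<lambda>x::real. inverse (1 + x\<^sup>2))" "(\<integral>x. inverse (1 + x\<^sup>2) \<partial>lborel) = pi"
  using integrable_inverse_1_plus_square LBINT_inverse_1_plus_square
  by (simp_all add: set_integrable_def interval_lebesgue_integral_def set_lebesgue_integral_def)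

lemma cube_times_gauss_le:
  fixes u :: real
  shows "(1 + u\<^sup>2) ^ 3 * exp (- u\<^sup>2 / 2) \<le> 120 * exp (- u\<^sup>2 / 16)"
proof -
  define z where "z = 7 / 16 * (1 + u\<^sup>2)"
  have z: "0 \<le> z" by (simp add: z_def)
  have "(1 + u\<^sup>2) ^ 3 = (16 / 7) ^ 3 * z ^ 3" unfolding z_def power_mult_distrib by (simp add: power_divide)
  also have "\<dots> \<le> (16 / 7) ^ 3 * (fact 3 * exp z)" using z by (intro mult_left_mono power_le_fact_exp) auto
  finally have "(1 + u\<^sup>2) ^ 3 * exp (- u\<^sup>2 / 2) \<le> (16 / 7) ^ 3 * (fact 3 * exp z) * exp (- u\<^sup>2 / 2)"
    by (rule mult_right_mono) simp
  also have "\<dots> = (16 / 7) ^ 3 * fact 3 * exp (7 / 16 + - u\<^sup>2 / 16)"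
    unfolding mult.assoc exp_add[symmetric] by (simp add: z_def algebra_simps)
  also have "\<dots> \<le> (16 / 7) ^ 3 * fact 3 * exp (1 / 2 + - u\<^sup>2 / 16)" by (intro mult_left_mono) auto
  also have "\<dots> \<le> 72 * (exp (1 / 2) * exp (- u\<^sup>2 / 16))"
    unfolding exp_add by (intro mult_right_mono) (auto simp: fact_numeral power3_eq_cube)
  also have "\<dots> \<le> 72 * (5 / 3 * exp (- u\<^sup>2 / 16))"
  proof (intro mult_left_mono mult_right_mono)
    have "(exp (1 / 2))\<^sup>2 = exp (1::real)" by (simp flip: exp_of_nat_mult)
    also have "\<dots> \<le> (5 / 3)\<^sup>2" using e_less_272 by (simp add: power_divide)
    finally show "exp (1 / 2) \<le> (5 / 3 :: real)" by (rule power2_le_imp_le) simp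
  qed auto
  finally show ?thesis by simp
qed

context poisson_scheme
begin

lemma \<xi>_meas: "m \<in> {1..N} \<Longrightarrow> \<xi> m \<in> measurable M (count_space UNIV)"
proof -
  assume m: "m \<in> {1..N}"
  interpret P: poisson_variable M "\<xi> m" "n * p m" by (rule poisson[OF m])
  show ?thesis by (rule P.\<xi>_meas)
qed

definition "tot \<omega> = (\<Sum>m=1..N. \<xi> m \<omega>)"
definition "excess \<omega> = int (tot \<omega>) - int n"
definition "asum \<omega> = (\<Sum>m=1..N. a m \<omega>)"
definition "P0 = prob {\<omega> \<in> space M. tot \<omega> = n}"
definition "I_int u = (\<integral>v. Psi_cut u v \<partial>lborel)"

lemma tot_meas [measurable]: "tot \<in> measurable M (count_space UNIV)"
proof -
  have "(\<lambda>\<omega>. \<Sum>m\<in>A. \<xi> m \<omega>) \<in> measurable M (count_space UNIV)" if "A \<subseteq> {1..N}" for A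
    using finite_subset[OF that finite_atLeastAtMost] that
  proof (induction A rule: finite_induct)
    case (insert m A)
    then have [measurable]: "\<xi> m \<in> measurable M (count_space UNIV)"
      "(\<lambda>\<omega>. \<Sum>m\<in>A. \<xi> m \<omega>) \<in> measurable M (count_space UNIV)" using \<xi>_meas by auto
    have "(\<lambda>\<omega>. \<xi> m \<omega> + (\<Sum>m\<in>A. \<xi> m \<omega>)) \<in> measurable M (count_space UNIV)" by measurable
    then show ?case using insert by simp
  qed simp
  then show ?thesis unfolding tot_def by auto
qed

lemma excess_meas [measurable]: "excess \<in> measurable M (count_space UNIV)"
  unfolding excess_def by measurable

lemma asum_meas [measurable]: "asum \<in> borel_measurable M"
  unfolding asum_def using a_meas by (intro borel_measurable_sum) auto

lemma sum_lin_eq: "(\<Sum>m=1..N. lin u v m \<omega>) = u * asum \<omega> + v * (excess \<omega> / sqrt n)"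
proof -
  have "(\<Sum>m=1..N. x m \<omega>) = (real (tot \<omega>) - n) / sqrt n"
    unfolding x_def tot_def using p_sum
    by (simp add: sum_subtractf flip: sum_divide_distrib sum_distrib_left)
  then have "(\<Sum>m=1..N. x m \<omega>) = excess \<omega> / sqrt n" by (simp add: excess_def)
  then show ?thesis by (simp add: lin_def asum_def sum.distrib flip: sum_distrib_left)
qed

lemma Psi_eq: "Psi u v = expectation (\<lambda>\<omega>. iexp (u * asum \<omega>) * iexp (v * (excess \<omega> / sqrt n)))"
proof -
  define Y where "Y m = (\<lambda>(y, k). iexp (u * y + v * ((k - n * p m) / sqrt n)))" for m
  have Ym: "Y m \<in> borel_measurable borel" for m
    unfolding Y_def borel_prod[symmetric] by measurable
  have Ylin: "Y m (a m \<omega>, real (\<xi> m \<omega>)) = iexp (lin u v m \<omega>)" for m \<omega>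
    by (simp add: Y_def lin_def x_def)
  have "indep_vars (\<lambda>_. borel) (\<lambda>m \<omega>. Y m (a m \<omega>, real (\<xi> m \<omega>))) {1..N}"
    using indep_vars_compose2[OF indep, of Y "\<lambda>_. borel"] Ym by simp
  then have iv: "indep_vars (\<lambda>_. borel) (\<lambda>m \<omega>. iexp (lin u v m \<omega>)) {1..N}" unfolding Ylin .
  have "expectation (\<lambda>\<omega>. \<Prod>m\<in>{1..N}. iexp (lin u v m \<omega>)) = (\<Prod>m\<in>{1..N}. expectation (\<lambda>\<omega>. iexp (lin u v m \<omega>)))"
    using N_pos by (intro indep_vars_lebesgue_integral iv integrable_iexp) auto
  then have "Psi u v = expectation (\<lambda>\<omega>. \<Prod>m\<in>{1..N}. iexp (lin u v m \<omega>))" by (simp add: Psi_def psi_def)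
  also have "\<dots> = expectation (\<lambda>\<omega>. iexp (u * asum \<omega>) * iexp (v * (excess \<omega> / sqrt n)))"
  proof (intro Bochner_Integration.integral_cong refl)
    fix \<omega>
    have "(\<Prod>m\<in>{1..N}. iexp (lin u v m \<omega>)) = iexp (\<Sum>m=1..N. lin u v m \<omega>)"
      by (simp add: exp_sum sum_distrib_left)
    then show "(\<Prod>m\<in>{1..N}. iexp (lin u v m \<omega>)) = iexp (u * asum \<omega>) * iexp (v * (excess \<omega> / sqrt n))"
      unfolding sum_lin_eq by (simp only: of_real_add distrib_left exp_add)
  qed
  finally show ?thesis .
qed

text \<open>Integrating v over one period of the total count selects the event that the total equals
  n.\<close>

lemma I_int_eq: "I_int u = of_real (2 * pi * sqrt n) * expectation (\<lambda>\<omega>. iexp (u * asum \<omega>) * indicator {\<omega>. excess \<omega> = 0} \<omega>)"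
  unfolding I_int_def Psi_cut_def Psi_eq using n_pos
  by (intro lattice_inversion) auto

lemma excess_0: "excess \<omega> = 0 \<longleftrightarrow> tot \<omega> = n"
  by (auto simp: excess_def)

lemma I_int_0: "I_int 0 = of_real (2 * pi * sqrt n * P0)"
proof -
  have "expectation (\<lambda>\<omega>. iexp (0 * asum \<omega>) * indicator {\<omega>. excess \<omega> = 0} \<omega>)
     = expectation (\<lambda>\<omega>. of_real (indicator {\<omega> \<in> space M. tot \<omega> = n} \<omega>))"
    by (intro Bochner_Integration.integral_cong) (auto simp: excess_0 indicator_def)
  also have "\<dots> = of_real P0" unfolding P0_def by (subst integral_complex_of_real) simp
  finally show ?thesis unfolding I_int_eq by simp
qed

text \<open>The total is Poisson with mean n. Instead of convolving laws, \<open>Psi 0\<close> is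
  recognised as the characteristic function of the centred and scaled Poisson law with mean n, and
  \<open>lattice_inversion\<close> is applied under both measures.\<close>

lemma P0_eq: "P0 = real n ^ n / fact n * exp (- real n)"
proof -
  interpret Q: poisson_variable "measure_pmf (poisson_pmf (real n))" "\<lambda>k. k" "real n"
  proof (unfold_locales)
    show "0 < real n" by (rule n_pos)
    show "distr (measure_pmf (poisson_pmf (real n))) (count_space UNIV) (\<lambda>k. k) = measure_pmf (poisson_pmf (real n))"
      by (rule distr_id2) simp
  qed auto
  have char: "Psi 0 v = integral\<^sup>L (measure_pmf (poisson_pmf (real n))) (\<lambda>k. 1 * iexp (v * ((int k - int n) / sqrt n)))" for v
  proof -
    define t where "t = v / sqrt n"
    have "psi 0 v m = exp (of_real (n * p m) * (iexp t - 1) - \<i> * of_real (n * p m * t))" if m: "m \<in> {1..N}" for m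
    proof -
      interpret P: poisson_variable M "\<xi> m" "n * p m" by (rule poisson[OF m])
      have l: "lin 0 v m \<omega> = t * real (\<xi> m \<omega>) + - (n * p m * t)" for \<omega>
        by (simp add: lin_def x_def t_def diff_divide_distrib right_diff_distrib)
      have "psi 0 v m = expectation (\<lambda>\<omega>. iexp (t * real (\<xi> m \<omega>)) * iexp (- (n * p m * t)))"
        unfolding psi_def l of_real_add distrib_left exp_add ..
      also have "\<dots> = expectation (\<lambda>\<omega>. iexp (t * real (\<xi> m \<omega>))) * iexp (- (n * p m * t))"
        by (rule integral_mult_left_zero)
      finally show ?thesis unfolding P.char_poisson exp_add[symmetric] by simp
    qed
    then have "Psi 0 v = (\<Prod>m=1..N. exp (of_real (n * p m) * (iexp t - 1) - \<i> * of_real (n * p m * t)))"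
      unfolding Psi_def by (intro prod.cong) auto
    also have "\<dots> = exp (\<Sum>m=1..N. of_real (p m) * (of_real n * (iexp t - 1) - \<i> * of_real (n * t)))"
      by (subst exp_sum) (auto intro!: prod.cong arg_cong[where f = exp] simp: algebra_simps)
    also have "(\<Sum>m=1..N. of_real (p m) * (of_real n * (iexp t - 1) - \<i> * of_real (n * t)))
       = of_real (\<Sum>m=1..N. p m) * (of_real n * (iexp t - 1) - \<i> * of_real (n * t))"
      by (simp add: sum_distrib_right)
    also have "\<dots> = of_real n * (iexp t - 1) + \<i> * of_real (- (n * t))" unfolding p_sum by simp
    also have "exp \<dots> = integral\<^sup>L (measure_pmf (poisson_pmf (real n))) (\<lambda>k. iexp (t * real k)) * iexp (- (n * t))"
      unfolding Q.char_poisson exp_add ..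
    also have "\<dots> = integral\<^sup>L (measure_pmf (poisson_pmf (real n))) (\<lambda>k. iexp (t * real k) * iexp (- (n * t)))"
      by (rule integral_mult_left_zero[symmetric])
    also have "\<dots> = integral\<^sup>L (measure_pmf (poisson_pmf (real n))) (\<lambda>k. 1 * iexp (v * ((int k - int n) / sqrt n)))"
    proof (intro Bochner_Integration.integral_cong refl)
      fix k :: nat
      have e: "v * ((int k - int n) / sqrt n) = t * real k + - (n * t)"
        by (simp add: t_def diff_divide_distrib right_diff_distrib)
      show "iexp (t * real k) * iexp (- (n * t)) = 1 * iexp (v * ((int k - int n) / sqrt n))"
        unfolding e of_real_add distrib_left exp_add by simp
    qed
    finally show ?thesis .
  qed
  have "I_int 0 = of_real (2 * pi * sqrt n) * integral\<^sup>L (measure_pmf (poisson_pmf (real n))) (\<lambda>k. 1 * indicator {k. int k - int n = 0} k)"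
    unfolding I_int_def Psi_cut_def char using n_pos by (intro measure_pmf.lattice_inversion) auto
  also have "integral\<^sup>L (measure_pmf (poisson_pmf (real n))) (\<lambda>k. 1 * indicator {k. int k - int n = 0} k) = integral\<^sup>L (measure_pmf (poisson_pmf (real n))) (\<lambda>k. complex_of_real (indicator {n} k))"
    by (intro Bochner_Integration.integral_cong refl) (auto simp: indicator_def)
  also have "\<dots> = of_real (pmf (poisson_pmf (real n)) n)"
    by (subst integral_complex_of_real) (simp add: measure_pmf_single)
  finally have "2 * pi * sqrt n * P0 = 2 * pi * sqrt n * pmf (poisson_pmf (real n)) n"
    unfolding I_int_0 of_real_mult[symmetric] of_real_eq_iff .
  then have "P0 = pmf (poisson_pmf (real n)) n" using n_pos by (simp del: pmf_poisson)
  then show ?thesis by (simp add: Q.pmf_eq)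
qed

lemma P0_ge: "1 / (exp 1 * sqrt n) \<le> P0"
proof -
  have "fact n \<le> exp 1 * sqrt n * (real n ^ n * exp (- real n))"
    using n_ge_2 by (intro fact_upper_bound) auto
  then have "1 \<le> exp 1 * sqrt n * P0" unfolding P0_eq by (simp add: field_simps)
  then show ?thesis using n_pos by (simp add: field_simps)
qed

text \<open>The total equals n with probability at least 1 / (e sqrt n), which cancels the factor
  sqrt n; the denominator of the quotient is thus bounded below by 2 \<pi> / e, an absolute
  constant.\<close>

lemma I_int_0_ge: "1 \<le> cmod (I_int 0)"
proof -
  have "2 * pi * sqrt n * (1 / (exp 1 * sqrt n)) \<le> 2 * pi * sqrt n * P0"
    using P0_ge by (intro mult_left_mono) auto
  then have "2 * pi / exp 1 \<le> 2 * pi * sqrt n * P0" using n_pos by simp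
  moreover have "1 \<le> 2 * pi / exp 1" using pi_ge_two e_less_272 by (simp add: le_divide_eq)
  ultimately have "1 \<le> 2 * pi * sqrt n * P0" by linarith
  then show ?thesis unfolding I_int_0 norm_of_real by linarith
qed

lemma Psi_meas [measurable]: "(\<lambda>v. Psi u v) \<in> borel_measurable borel"
proof -
  have "(\<lambda>(v, \<omega>). iexp (u * asum \<omega>) * iexp (v * (excess \<omega> / sqrt n))) \<in> borel_measurable (lborel \<Otimes>\<^sub>M M)"
    by measurable
  from borel_measurable_lebesgue_integral[OF this] show ?thesis unfolding Psi_eq by simp
qed

lemma cmod_Psi_le_1: "cmod (Psi u v) \<le> 1"
  unfolding Psi_def psi_def prod_norm[symmetric] by (intro prod_le_1) (auto intro: cmod_char_variable_le_1)

lemma integrable_Psi_cut: "integrable lborel (Psi_cut u)"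
  unfolding Psi_cut_def
proof (rule integrableI_bounded_set_indicator[where B = 1])
  show "emeasure lborel {- (pi * sqrt n)..pi * sqrt n} < \<infinity>" by simp
qed (auto simp: cmod_Psi_le_1)

lemma has_bochner_integral_Pol_gauss:
  "has_bochner_integral lborel (Pol_gauss u) (of_real (sqrt (2 * pi) * exp (- u\<^sup>2 / 2)) * (W u + of_real a2))"
proof -
  have "Pol_gauss u v = of_real (sqrt (2 * pi) * exp (- u\<^sup>2 / 2)) * (of_real (std_normal_density v) * Pol u v)" for v
  proof -
    have "exp (- (u\<^sup>2 + v\<^sup>2) / 2) = exp (- u\<^sup>2 / 2) * exp (- v\<^sup>2 / 2)"
      unfolding exp_add[symmetric] by (rule arg_cong[where f = exp]) (simp add: field_simps)
    then show ?thesis by (simp add: Pol_gauss_def std_normal_density_def)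
  qed
  then have "Pol_gauss u = (\<lambda>v. of_real (sqrt (2 * pi) * exp (- u\<^sup>2 / 2)) * (of_real (std_normal_density v) * Pol u v))"
    by (rule ext)
  then show ?thesis
    using has_bochner_integral_mult_right[OF has_bochner_integral_Pol[of u], of "of_real (sqrt (2 * pi) * exp (- u\<^sup>2 / 2))"]
    by (simp only:)
qed

lemma I_int_expansion:
  assumes "\<bar>u\<bar> * beta 3 \<le> 1 / 16" "\<bar>u\<bar> * sqrt eps \<le> 1 / 1000"
  shows "cmod (I_int u - of_real (sqrt (2 * pi) * exp (- u\<^sup>2 / 2)) * (W u + of_real a2))
    \<le> 4 * K2 * rho ^ 3 * exp (- u\<^sup>2 / 16)"
proof -
  have "I_int u - of_real (sqrt (2 * pi) * exp (- u\<^sup>2 / 2)) * (W u + of_real a2)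
      = (\<integral>v. Psi_cut u v - Pol_gauss u v \<partial>lborel)"
    unfolding I_int_def using has_bochner_integral_Pol_gauss[of u] integrable_Psi_cut[of u]
    by (subst Bochner_Integration.integral_diff) (auto simp: has_bochner_integral_iff)
  also have "cmod \<dots> \<le> (\<integral>v. K2 * rho ^ 3 * exp (- u\<^sup>2 / 16) * inverse (1 + v\<^sup>2) \<partial>lborel)"
    using Psi_cut_expansion[OF assms] integral_inverse_1_plus_square
    by (intro norm_integral_le_integral) auto
  also have "\<dots> = K2 * rho ^ 3 * exp (- u\<^sup>2 / 16) * pi"
    using integral_inverse_1_plus_square by simp
  also have "\<dots> \<le> K2 * rho ^ 3 * exp (- u\<^sup>2 / 16) * 4"
    using K_pos rho_pos pi_less_4 by (intro mult_left_mono) auto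
  finally show ?thesis by (simp add: ac_simps)
qed

text \<open>Numerator and denominator both contain \<open>a2\<close>. After multiplying crosswise
  only \<open>a2\<close> (1 - \<open>W u\<close>) is left of it, a product of order
  \<open>rho\<^sup>2\<close> and order \<open>rho\<close>, hence an error term when
  \<open>rho \<le> 1\<close>. For larger \<open>rho\<close> the quotient and \<open>W\<close> are
  bounded separately, with the denominator at least 1.\<close>

lemma phi_expansion:
  assumes u: "\<bar>u\<bar> * beta 3 \<le> 1 / 16" "\<bar>u\<bar> * sqrt eps \<le> 1 / 1000"
  shows "cmod (I_int u / I_int 0 - W u * of_real (exp (- u\<^sup>2 / 2))) \<le> K4 * rho ^ 3 * exp (- u\<^sup>2 / 16)"
proof -
  define s where "s = complex_of_real (sqrt (2 * pi) * exp (- u\<^sup>2 / 2))"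
  define g where "g = exp (- u\<^sup>2 / 2)"
  define h where "h = exp (- u\<^sup>2 / 16)"
  define w where "w = (1 + u\<^sup>2) ^ 3"
  define R where "R = I_int u - s * (W u + of_real a2)"
  define R0 where "R0 = I_int 0 - of_real (sqrt (2 * pi)) * (1 + of_real a2)"
  have W0: "W 0 = 1" by (simp add: W_def)
  have h0: "0 < h" "0 < g" by (simp_all add: h_def g_def)
  have w1: "1 \<le> w" by (simp add: w_def)
  have wg: "w * g \<le> 120 * h" unfolding w_def g_def h_def by (rule cube_times_gauss_le)
  then have g120: "g \<le> 120 * h" using mult_right_mono[OF w1, of g] h0 by linarith
  have R: "cmod R \<le> 4 * K2 * rho ^ 3 * h" unfolding R_def s_def h_def by (rule I_int_expansion[OF u])
  have R0: "cmod R0 \<le> 4 * K2 * rho ^ 3"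
    using I_int_expansion[of 0] unfolding R0_def by (simp add: W0)
  have sq: "sqrt (2 * pi) \<le> 3" using pi_less_4 by (intro real_le_lsqrt) auto
  have I0: "1 \<le> cmod (I_int 0)" by (rule I_int_0_ge)
  have r0: "0 < rho" by (rule rho_pos)
  have K2b: "1000000000000000000 \<le> K2" using K_pos by (simp add: K2_def)
  have W1: "cmod (W u - 1) \<le> 10000 * (rho + rho\<^sup>2) * w" unfolding w_def by (rule cmod_W_le)
  have a2: "\<bar>a2\<bar> \<le> 10000 * rho\<^sup>2" by (rule abs_a2_le)
  have K0: "0 \<le> K2 * rho ^ 3 * h" "0 \<le> K2 * rho ^ 3" "0 \<le> rho ^ 3 * h" using K_pos r0 h0 by auto
  have cs: "cmod s \<le> 3 * g" unfolding s_def norm_of_real using sq h0 by (simp add: g_def)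
  have Kh: "1000000000000000000 * (rho ^ 3 * h) \<le> K2 * rho ^ 3 * h" using mult_right_mono[OF K2b K0(3)] by (simp add: mult.assoc)
  have target: "100000000 * (K2 * rho ^ 3 * h) = K4 * rho ^ 3 * h" by (simp add: K4_def)
  have div: "cmod (z / I_int 0) \<le> cmod z" for z
    using I0 by (simp add: norm_divide divide_le_eq mult_left_le_one_le) (metis mult_left_mono mult.right_neutral norm_ge_zero)
  have "cmod (I_int u / I_int 0 - W u * of_real g) \<le> K4 * rho ^ 3 * h"
  proof (cases "rho \<le> 1")
    case True
    have r2: "rho\<^sup>2 \<le> rho" using True r0 by (simp add: power2_eq_square mult_left_le)
    have W1': "cmod (W u - 1) \<le> 20000 * rho * w"
    proof -
      have "10000 * (rho + rho\<^sup>2) * w \<le> 10000 * (2 * rho) * w" using r2 w1 by (intro mult_right_mono) auto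
      then show ?thesis using W1 by simp
    qed
    have Wn: "cmod (W u) \<le> 20001 * w"
    proof -
      have "cmod (W u) \<le> 1 + cmod (W u - 1)" using norm_triangle_ineq[of 1 "W u - 1"] by simp
      moreover have "20000 * rho * w \<le> 20000 * w" using True w1 by simp
      ultimately show ?thesis using W1' w1 by linarith
    qed
    have "I_int 0 \<noteq> 0" using I0 by auto
    then have "I_int u / I_int 0 - W u * of_real g = (I_int u - I_int 0 * W u * of_real g) / I_int 0"
      by (simp add: field_simps)
    also have "I_int u - I_int 0 * W u * of_real g = R - R0 * (W u * of_real g) + s * of_real a2 * (1 - W u)"
      by (simp add: R_def R0_def s_def g_def algebra_simps)
    finally have "cmod (I_int u / I_int 0 - W u * of_real g)
        \<le> cmod (R - R0 * (W u * of_real g) + s * of_real a2 * (1 - W u))"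
      using div by simp
    also have "\<dots> \<le> cmod R + cmod (R0 * (W u * of_real g)) + cmod (s * of_real a2 * (1 - W u))"
      by (intro order_trans[OF norm_triangle_ineq] add_right_mono norm_triangle_ineq4)
    also have "\<dots> \<le> 4 * (K2 * rho ^ 3 * h) + 10000000 * (K2 * rho ^ 3 * h) + K2 * rho ^ 3 * h"
    proof (intro add_mono)
      show "cmod R \<le> 4 * (K2 * rho ^ 3 * h)" using R by (simp add: mult.assoc)
      have "cmod (W u * of_real g) \<le> 20001 * (120 * h)"
      proof -
        have "cmod (W u * of_real g) \<le> 20001 * w * g"
          unfolding norm_mult norm_of_real using Wn h0 by (simp add: mult_right_mono)
        also have "\<dots> \<le> 20001 * (120 * h)" using wg unfolding mult.assoc by (intro mult_left_mono) auto
        finally show ?thesis .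
      qed
      then have "cmod (R0 * (W u * of_real g)) \<le> 4 * K2 * rho ^ 3 * (20001 * (120 * h))"
        unfolding norm_mult[of R0] using R0 K0 by (intro mult_mono) auto
      also have "\<dots> = 9600480 * (K2 * rho ^ 3 * h)" by simp
      also have "\<dots> \<le> 10000000 * (K2 * rho ^ 3 * h)" using K0(1) by linarith
      finally show "cmod (R0 * (W u * of_real g)) \<le> 10000000 * (K2 * rho ^ 3 * h)" .
      have "cmod (s * of_real a2 * (1 - W u)) \<le> (3 * g) * (10000 * rho\<^sup>2) * (20000 * rho * w)"
        unfolding norm_mult norm_of_real norm_minus_commute[of 1]
        using cs a2 W1' h0 by (intro mult_mono) auto
      also have "\<dots> = 600000000 * (rho ^ 3 * (w * g))" by (simp add: power2_eq_square power3_eq_cube)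
      also have "\<dots> \<le> 600000000 * (rho ^ 3 * (120 * h))" using wg r0 by (intro mult_left_mono) auto
      also have "\<dots> = 72000000000 * (rho ^ 3 * h)" by simp
      also have "\<dots> \<le> K2 * rho ^ 3 * h" using Kh K0(3) by linarith
      finally show "cmod (s * of_real a2 * (1 - W u)) \<le> K2 * rho ^ 3 * h" .
    qed
    also have "\<dots> \<le> 100000000 * (K2 * rho ^ 3 * h)" using K0(1) by linarith
    finally show ?thesis using target by simp
  next
    case False
    have r23: "rho \<le> rho ^ 3" "rho\<^sup>2 \<le> rho ^ 3" "1 \<le> rho ^ 3"
      using False by (auto intro: self_le_power power_increasing)
    have rw: "1 \<le> rho ^ 3 * w" using mult_mono[OF r23(3) w1] r0 by simp
    have Wn: "cmod (W u) \<le> 20001 * (rho ^ 3 * w)"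
    proof -
      have "cmod (W u) \<le> 1 + cmod (W u - 1)" using norm_triangle_ineq[of 1 "W u - 1"] by simp
      moreover have "10000 * (rho + rho\<^sup>2) * w \<le> 10000 * (rho ^ 3 + rho ^ 3) * w"
        using r23 w1 by (intro mult_right_mono mult_left_mono add_mono) auto
      ultimately show ?thesis using W1 rw by simp
    qed
    have Wa: "cmod (W u + of_real a2) \<le> 40000 * (rho ^ 3 * w)"
    proof -
      have "cmod (W u + of_real a2) \<le> cmod (W u) + \<bar>a2\<bar>"
        using norm_triangle_ineq[of "W u" "of_real a2"] by simp
      moreover have "10000 * rho\<^sup>2 \<le> 10000 * (rho ^ 3 * w)"
        using mult_mono[OF r23(2) w1] r0 by simp
      ultimately show ?thesis using Wn a2 rw by linarith
    qed
    have rwg: "rho ^ 3 * (w * g) \<le> 120 * (rho ^ 3 * h)" using mult_left_mono[OF wg, of "rho ^ 3"] r0 by simp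
    have A: "cmod (I_int u) \<le> 5 * (K2 * rho ^ 3 * h)"
    proof -
      have "cmod (I_int u) \<le> cmod R + cmod (s * (W u + of_real a2))"
        using norm_triangle_ineq[of R "s * (W u + of_real a2)"] by (simp add: R_def)
      also have "cmod (s * (W u + of_real a2)) \<le> 3 * g * (40000 * (rho ^ 3 * w))"
        unfolding norm_mult using cs Wa h0 by (intro mult_mono) auto
      also have "\<dots> = 120000 * (rho ^ 3 * (w * g))" by simp
      also have "\<dots> \<le> K2 * rho ^ 3 * h" using Kh K0(3) rwg by linarith
      finally show ?thesis using R by (simp add: mult.assoc)
    qed
    have B: "cmod (W u * of_real g) \<le> K2 * rho ^ 3 * h"
    proof -
      have "cmod (W u * of_real g) \<le> 20001 * (rho ^ 3 * w) * g"
        unfolding norm_mult norm_of_real using Wn h0 by (simp add: mult_right_mono)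
      also have "\<dots> = 20001 * (rho ^ 3 * (w * g))" by simp
      also have "\<dots> \<le> K2 * rho ^ 3 * h" using Kh K0(3) rwg by linarith
      finally show ?thesis .
    qed
    have "cmod (I_int u / I_int 0 - W u * of_real g) \<le> cmod (I_int u / I_int 0) + cmod (W u * of_real g)"
      by (rule norm_triangle_ineq4)
    also have "\<dots> \<le> 5 * (K2 * rho ^ 3 * h) + K2 * rho ^ 3 * h"
      using div[of "I_int u"] A B by linarith
    also have "\<dots> \<le> 100000000 * (K2 * rho ^ 3 * h)" using K0(1) by linarith
    finally show ?thesis using target by simp
  qed
  then show ?thesis by (simp add: g_def h_def)
qed

end

section \<open>Fourier--Stieltjes transforms\<close>

text \<open>Sums serve to rewrite an equality of differences \<mu> - \<nu> as an equality between
  finite measures, to which uniqueness of characteristic functions applies.\<close>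

definition add_measure :: "real measure \<Rightarrow> real measure \<Rightarrow> real measure" where
  "add_measure \<mu> \<nu> = measure_of UNIV (sets borel) (\<lambda>A. emeasure \<mu> A + emeasure \<nu> A)"

lemma sets_add_measure [simp, measurable_cong]: "sets (add_measure \<mu> \<nu>) = sets borel"
  by (simp add: add_measure_def sets.sigma_sets_eq[of borel, simplified])

lemma space_add_measure [simp]: "space (add_measure \<mu> \<nu>) = UNIV"
  by (simp add: add_measure_def)

lemma emeasure_add_measure:
  assumes [simp]: "sets \<mu> = sets borel" "sets \<nu> = sets borel" and A: "A \<in> sets borel"
  shows "emeasure (add_measure \<mu> \<nu>) A = emeasure \<mu> A + emeasure \<nu> A"
proof (rule emeasure_measure_of[OF add_measure_def])
  show "countably_additive (sets (add_measure \<mu> \<nu>)) (\<lambda>A. emeasure \<mu> A + emeasure \<nu> A)"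
  proof (rule countably_additiveI)
    fix F :: "nat \<Rightarrow> real set"
    assume F: "range F \<subseteq> sets (add_measure \<mu> \<nu>)" "disjoint_family F"
    then show "(\<Sum>i. emeasure \<mu> (F i) + emeasure \<nu> (F i)) = emeasure \<mu> (\<Union>i. F i) + emeasure \<nu> (\<Union>i. F i)"
      by (subst suminf_add[symmetric]) (auto simp: suminf_emeasure)
  qed
qed (use A in \<open>auto simp: positive_def\<close>)

lemma nn_integral_add_measure:
  assumes [simp]: "sets \<mu> = sets borel" "sets \<nu> = sets borel" and f: "f \<in> borel_measurable borel"
  shows "(\<integral>\<^sup>+x. f x \<partial>add_measure \<mu> \<nu>) = (\<integral>\<^sup>+x. f x \<partial>\<mu>) + (\<integral>\<^sup>+x. f x \<partial>\<nu>)"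
  using f
proof (induction rule: borel_measurable_induct)
  case (cong f g)
  then show ?case by (simp cong: nn_integral_cong)
next
  case (set A)
  then show ?case by (simp add: emeasure_add_measure)
next
  case (mult u c)
  have [measurable]: "u \<in> borel_measurable \<mu>" "u \<in> borel_measurable \<nu>" "u \<in> borel_measurable (add_measure \<mu> \<nu>)"
    using mult by (simp_all cong: measurable_cong_sets)
  show ?case using mult by (simp add: nn_integral_cmult distrib_left)
next
  case (add u v)
  have [measurable]: "u \<in> borel_measurable \<mu>" "u \<in> borel_measurable \<nu>" "u \<in> borel_measurable (add_measure \<mu> \<nu>)"
    "v \<in> borel_measurable \<mu>" "v \<in> borel_measurable \<nu>" "v \<in> borel_measurable (add_measure \<mu> \<nu>)"
    using add by (simp_all cong: measurable_cong_sets)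
  show ?case using add by (simp add: nn_integral_add ac_simps)
next
  case (seq U)
  have [measurable]: "U i \<in> borel_measurable \<mu>" "U i \<in> borel_measurable \<nu>" "U i \<in> borel_measurable (add_measure \<mu> \<nu>)" for i
    using seq by (simp_all cong: measurable_cong_sets)
  have m: "(\<integral>\<^sup>+x. (SUP i. U i x) \<partial>L) = (SUP i. \<integral>\<^sup>+x. U i x \<partial>L)" if "\<And>i. U i \<in> borel_measurable L" for L :: "real measure"
    using seq that by (intro nn_integral_monotone_convergence_SUP) auto
  have "(SUP i. integral\<^sup>N \<mu> (U i)) + (SUP i. integral\<^sup>N \<nu> (U i)) = (SUP i. integral\<^sup>N \<mu> (U i) + integral\<^sup>N \<nu> (U i))"
    using seq by (intro ennreal_SUP_add[symmetric]) (auto simp: incseq_def le_fun_def intro!: nn_integral_mono)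
  then show ?case using seq by (simp add: m SUP_apply[abs_def])
qed

lemma finite_borel_measure_add:
  assumes "finite_borel_measure \<mu>" "finite_borel_measure \<nu>"
  shows "finite_borel_measure (add_measure \<mu> \<nu>)"
proof -
  interpret m: finite_borel_measure \<mu> by fact
  interpret n: finite_borel_measure \<nu> by fact
  show ?thesis
  proof (intro finite_borel_measure.intro finite_measureI finite_borel_measure_axioms.intro)
    show "emeasure (add_measure \<mu> \<nu>) (space (add_measure \<mu> \<nu>)) \<noteq> \<infinity>"
      using m.emeasure_finite[of UNIV] n.emeasure_finite[of UNIV] m.M_is_borel n.M_is_borel
      by (simp add: emeasure_add_measure)
  qed simp
qed

lemma (in finite_borel_measure) integrable_bounded:
  fixes f :: "real \<Rightarrow> 'b::{banach, second_countable_topology}"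
  assumes "f \<in> borel_measurable borel" "\<And>x. norm (f x) \<le> B"
  shows "integrable M f"
  using assms M_is_borel by (intro integrable_const_bound[of _ B]) (auto cong: measurable_cong_sets)

lemma integral_add_measure:
  fixes f :: "real \<Rightarrow> real"
  assumes mu: "finite_borel_measure \<mu>" and nu: "finite_borel_measure \<nu>"
    and f: "f \<in> borel_measurable borel" "\<And>x. \<bar>f x\<bar> \<le> B"
  shows "integral\<^sup>L (add_measure \<mu> \<nu>) f = integral\<^sup>L \<mu> f + integral\<^sup>L \<nu> f"
proof -
  interpret m: finite_borel_measure \<mu> by fact
  interpret n: finite_borel_measure \<nu> by fact
  interpret s: finite_borel_measure "add_measure \<mu> \<nu>" by (rule finite_borel_measure_add[OF mu nu])
  have i: "integrable \<mu> f" "integrable \<nu> f" "integrable (add_measure \<mu> \<nu>) f"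
    using m.integrable_bounded[OF f(1)] n.integrable_bounded[OF f(1)] s.integrable_bounded[OF f(1)] f(2)
    by auto
  have fin: "(\<integral>\<^sup>+x. ennreal (f x) \<partial>\<mu>) < \<infinity>" "(\<integral>\<^sup>+x. ennreal (f x) \<partial>\<nu>) < \<infinity>"
    "(\<integral>\<^sup>+x. ennreal (- f x) \<partial>\<mu>) < \<infinity>" "(\<integral>\<^sup>+x. ennreal (- f x) \<partial>\<nu>) < \<infinity>"
    using i by (auto simp: real_integrable_def less_top)
  have [measurable]: "f \<in> borel_measurable borel" by fact
  show ?thesis
    unfolding real_lebesgue_integral_def[OF i(1)] real_lebesgue_integral_def[OF i(2)] real_lebesgue_integral_def[OF i(3)]
    using fin m.M_is_borel n.M_is_borel by (simp add: nn_integral_add_measure enn2real_plus)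
qed

lemma (in finite_borel_measure) char_Re_Im:
  "Re (char M t) = integral\<^sup>L M (\<lambda>x. cos (t * x))" "Im (char M t) = integral\<^sup>L M (\<lambda>x. sin (t * x))"
proof -
  have i: "integrable M (\<lambda>x. iexp (t * x))" by (rule integrable_bounded[of _ 1]) auto
  show "Re (char M t) = integral\<^sup>L M (\<lambda>x. cos (t * x))"
    unfolding char_def using integral_Re[OF i] by (simp add: Re_exp)
  show "Im (char M t) = integral\<^sup>L M (\<lambda>x. sin (t * x))"
    unfolding char_def using integral_Im[OF i] by (simp add: Im_exp)
qed

lemma char_add_measure:
  assumes mu: "finite_borel_measure \<mu>" and nu: "finite_borel_measure \<nu>"
  shows "char (add_measure \<mu> \<nu>) t = char \<mu> t + char \<nu> t"
proof -
  interpret m: finite_borel_measure \<mu> by fact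
  interpret n: finite_borel_measure \<nu> by fact
  interpret s: finite_borel_measure "add_measure \<mu> \<nu>" by (rule finite_borel_measure_add[OF mu nu])
  show ?thesis
    by (simp add: complex_eq_iff m.char_Re_Im n.char_Re_Im s.char_Re_Im integral_add_measure[OF mu nu, of _ 1])
qed

text \<open>Both measures have the same total mass, the value of the characteristic function at 0.
  Dividing by it reduces the claim to Levy's theorem for probability measures; mass 0 is treated
  apart.\<close>

lemma finite_measure_char_unique:
  assumes "finite_borel_measure \<mu>" "finite_borel_measure \<nu>" and eq: "\<And>t. char \<mu> t = char \<nu> t"
  shows "\<mu> = \<nu>"
proof -
  interpret m: finite_borel_measure \<mu> by fact
  interpret n: finite_borel_measure \<nu> by fact
  have sp: "space \<mu> = UNIV" "space \<nu> = UNIV"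
    using sets_eq_imp_space_eq[OF m.M_is_borel] sets_eq_imp_space_eq[OF n.M_is_borel] by simp_all
  define c where "c = measure \<mu> UNIV"
  have c: "measure \<nu> UNIV = c"
    using eq[of 0] sp by (simp add: char_def c_def)
  show ?thesis
  proof (cases "c = 0")
    case True
    have "emeasure \<mu> A = 0" "emeasure \<nu> A = 0" for A
      using m.emeasure_eq_measure[of UNIV] n.emeasure_eq_measure[of UNIV] True c
        emeasure_mono[of A UNIV \<mu>] emeasure_mono[of A UNIV \<nu>] m.M_is_borel n.M_is_borel
      by (auto simp: c_def)
    then show ?thesis using m.M_is_borel n.M_is_borel by (intro measure_eqI) auto
  next
    case False
    then have c0: "0 < c" using measure_nonneg[of \<mu> UNIV] unfolding c_def by linarith
    define \<mu>' where "\<mu>' = density \<mu> (\<lambda>_. ennreal (1 / c))"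
    define \<nu>' where "\<nu>' = density \<nu> (\<lambda>_. ennreal (1 / c))"
    have emu: "emeasure \<mu>' A = ennreal (1 / c) * emeasure \<mu> A" if "A \<in> sets borel" for A
      unfolding \<mu>'_def using that m.M_is_borel by (subst emeasure_density) (auto simp: nn_integral_cmult_indicator)
    have enu: "emeasure \<nu>' A = ennreal (1 / c) * emeasure \<nu> A" if "A \<in> sets borel" for A
      unfolding \<nu>'_def using that n.M_is_borel by (subst emeasure_density) (auto simp: nn_integral_cmult_indicator)
    have "real_distribution \<mu>'"
      using emu[of UNIV] c0 m.M_is_borel sp
      by (intro real_distribution.intro prob_spaceI real_distribution_axioms.intro)
        (auto simp: \<mu>'_def m.emeasure_eq_measure c_def[symmetric] ennreal_mult[symmetric])
    moreover have "real_distribution \<nu>'"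
      using enu[of UNIV] c0 n.M_is_borel sp c
      by (intro real_distribution.intro prob_spaceI real_distribution_axioms.intro)
        (auto simp: \<nu>'_def n.emeasure_eq_measure ennreal_mult[symmetric])
    moreover have "char \<mu>' t = char \<nu>' t" for t
    proof -
      have "char \<mu>' t = (1 / c) *\<^sub>R char \<mu> t"
        unfolding char_def \<mu>'_def using c0 m.M_is_borel by (subst integral_density) (auto cong: measurable_cong_sets)
      also have "\<dots> = char \<nu>' t"
        unfolding eq unfolding char_def \<nu>'_def using c0 n.M_is_borel by (subst integral_density) (auto cong: measurable_cong_sets)
      finally show ?thesis .
    qed
    ultimately have e: "\<mu>' = \<nu>'" by (intro Levy_uniqueness) auto
    have "emeasure \<mu> A = emeasure \<nu> A" if "A \<in> sets borel" for A
    proof -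
      have "ennreal c * emeasure \<mu>' A = ennreal c * emeasure \<nu>' A" by (simp add: e)
      then have "ennreal c * ennreal (1 / c) * emeasure \<mu> A = ennreal c * ennreal (1 / c) * emeasure \<nu> A"
        by (simp only: emu[OF that] enu[OF that] mult.assoc)
      moreover have "ennreal c * ennreal (1 / c) = 1" using c0 by (simp flip: ennreal_mult')
      ultimately show ?thesis by simp
    qed
    then show ?thesis using m.M_is_borel n.M_is_borel by (intro measure_eqI) auto
  qed
qed

text \<open>Equal transforms of \<mu> - \<nu> and \<mu>' - \<nu>' mean equal characteristic
  functions of \<mu> + \<nu>' and \<mu>' + \<nu>. This makes the definite description in
  \<open>bbW5\<close> determinate.\<close>

lemma has_fourier_stieltjes_unique:
  assumes "has_fourier_stieltjes F \<phi>" "has_fourier_stieltjes G \<phi>"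
  shows "F = G"
proof
  fix u
  obtain \<mu> \<nu> where 1: "finite_borel_measure \<mu>" "finite_borel_measure \<nu>"
    "\<And>u. F u = cdf \<mu> u - cdf \<nu> u" "\<And>t. \<phi> t = char \<mu> t - char \<nu> t"
    using assms(1) unfolding has_fourier_stieltjes_def by auto
  obtain \<mu>' \<nu>' where 2: "finite_borel_measure \<mu>'" "finite_borel_measure \<nu>'"
    "\<And>u. G u = cdf \<mu>' u - cdf \<nu>' u" "\<And>t. \<phi> t = char \<mu>' t - char \<nu>' t"
    using assms(2) unfolding has_fourier_stieltjes_def by auto
  have "char (add_measure \<mu> \<nu>') t = char (add_measure \<mu>' \<nu>) t" for t
  proof -
    have "char \<mu> t + char \<nu>' t = (char \<mu> t - char \<nu> t) + (char \<nu> t + char \<nu>' t)" by simp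
    also have "char \<mu> t - char \<nu> t = char \<mu>' t - char \<nu>' t" using 1(4)[of t] 2(4)[of t] by simp
    finally show ?thesis using 1(1,2) 2(1,2) by (simp add: char_add_measure)
  qed
  then have e: "add_measure \<mu> \<nu>' = add_measure \<mu>' \<nu>"
    using 1(1,2) 2(1,2) by (intro finite_measure_char_unique finite_borel_measure_add)
  interpret m: finite_borel_measure \<mu> by fact
  interpret n: finite_borel_measure \<nu> by fact
  interpret m': finite_borel_measure \<mu>' by fact
  interpret n': finite_borel_measure \<nu>' by fact
  have "emeasure \<mu> {..u} + emeasure \<nu>' {..u} = emeasure \<mu>' {..u} + emeasure \<nu> {..u}"
    using arg_cong[OF e, of "\<lambda>L. emeasure L {..u}"] m.M_is_borel n.M_is_borel m'.M_is_borel n'.M_is_borel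
    by (simp add: emeasure_add_measure)
  then have "measure \<mu> {..u} + measure \<nu>' {..u} = measure \<mu>' {..u} + measure \<nu> {..u}"
    by (simp add: m.emeasure_eq_measure n.emeasure_eq_measure m'.emeasure_eq_measure n'.emeasure_eq_measure
      flip: ennreal_plus)
  then show "F u = G u" unfolding 1(3) 2(3) cdf_def by simp
qed

text \<open>The two finite measures have the positive and negative part of w as densities; the sign
  s = 1 or -1 treats them together.\<close>

lemma has_fourier_stieltjes_density:
  fixes w :: "real \<Rightarrow> real"
  assumes w: "integrable lborel w"
  shows "has_fourier_stieltjes (\<lambda>u. \<integral>x. indicator {..u} x * w x \<partial>lborel) (\<lambda>t. \<integral>x. iexp (t * x) * of_real (w x) \<partial>lborel)"
proof -
  define \<mu> where "\<mu> s = density lborel (\<lambda>x. ennreal (max 0 (s * w x)))" for s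
  have [measurable]: "w \<in> borel_measurable borel" using borel_measurable_integrable[OF w] by simp
  have i: "integrable lborel (\<lambda>x. max 0 (s * w x))" for s
    using w by (intro integrable_max) auto
  have fin: "finite_borel_measure (\<mu> s)" for s
  proof (intro finite_borel_measure.intro finite_measureI finite_borel_measure_axioms.intro)
    have "(\<integral>\<^sup>+x. ennreal (max 0 (s * w x)) \<partial>lborel) = ennreal (\<integral>x. max 0 (s * w x) \<partial>lborel)"
      by (rule nn_integral_eq_integral[OF i]) auto
    then show "emeasure (\<mu> s) (space (\<mu> s)) \<noteq> \<infinity>" unfolding \<mu>_def by (subst emeasure_density) auto
  qed (simp add: \<mu>_def)
  have cdf: "cdf (\<mu> s) u = (\<integral>x. indicator {..u} x * max 0 (s * w x) \<partial>lborel)" for s u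
  proof -
    have "emeasure (\<mu> s) {..u} = (\<integral>\<^sup>+x. ennreal (indicator {..u} x * max 0 (s * w x)) \<partial>lborel)"
      unfolding \<mu>_def by (subst emeasure_density) (auto intro!: nn_integral_cong simp: indicator_def)
    also have "\<dots> = ennreal (\<integral>x. indicator {..u} x * max 0 (s * w x) \<partial>lborel)"
      using integrable_real_mult_indicator[OF _ i, of "{..u}" s]
      by (intro nn_integral_eq_integral) (auto simp: mult.commute)
    finally show ?thesis unfolding cdf_def measure_def
      by (simp add: enn2real_ennreal integral_nonneg_AE)
  qed
  have ii: "integrable lborel (\<lambda>x. indicator {..u} x * max 0 (s * w x))" for s u
    using integrable_real_mult_indicator[OF _ i, of "{..u}" s] by (simp add: mult.commute)
  have ch: "char (\<mu> s) t = (\<integral>x. iexp (t * x) * of_real (max 0 (s * w x)) \<partial>lborel)" for s t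
    unfolding char_def \<mu>_def
    by (subst integral_density) (auto simp: scaleR_conv_of_real mult.commute intro!: Bochner_Integration.integral_cong)
  have ic: "integrable lborel (\<lambda>x. iexp (t * x) * of_real (max 0 (s * w x)))" for s t
    by (intro integrable_iexp_mult integrable_of_real i)
  have mx: "max 0 (1 * y) - max 0 (- 1 * y) = y" for y :: real by (auto simp: max_def)
  show ?thesis
    unfolding has_fourier_stieltjes_def
  proof (rule exI[of _ "\<mu> 1"], rule exI[of _ "\<mu> (- 1)"], intro conjI allI fin)
    show "(\<integral>x. indicator {..u} x * w x \<partial>lborel) = cdf (\<mu> 1) u - cdf (\<mu> (- 1)) u" for u
      unfolding cdf Bochner_Integration.integral_diff[OF ii ii, symmetric] right_diff_distrib[symmetric] mx ..
    show "(\<integral>x. iexp (t * x) * of_real (w x) \<partial>lborel) = char (\<mu> 1) t - char (\<mu> (- 1)) t" for t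
      unfolding ch Bochner_Integration.integral_diff[OF ic ic, symmetric] right_diff_distrib[symmetric]
        of_real_diff[symmetric] mx ..
  qed
qed

lemma DERIV_integral_atMost:
  fixes w :: "real \<Rightarrow> real"
  assumes w: "integrable lborel w" and c: "\<And>x. isCont w x"
  shows "((\<lambda>u. \<integral>x. indicator {..u} x * w x \<partial>lborel) has_real_derivative w u) (at u)"
proof -
  let ?F = "\<lambda>u. \<integral>x. indicator {..u} x * w x \<partial>lborel"
  have ii: "integrable lborel (\<lambda>x. indicator {..u} x * w x)" for u
    using integrable_real_mult_indicator[OF _ w, of "{..u}"] by (simp add: mult.commute)
  have F: "?F y = ?F (u - 1) + (LBINT x=u - 1..y. w x)" if "y \<in> {u - 1..u + 1}" for y
  proof -
    have "(LBINT x=u - 1..y. w x) = (\<integral>x. indicator {u - 1<..y} x *\<^sub>R w x \<partial>lborel)"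
      using that by (subst interval_integral_Ioc) (auto simp: set_lebesgue_integral_def)
    also have "\<dots> = (\<integral>x. indicator {..y} x * w x - indicator {..u - 1} x * w x \<partial>lborel)"
      using that by (intro Bochner_Integration.integral_cong refl) (auto simp: indicator_def)
    also have "\<dots> = ?F y - ?F (u - 1)" by (rule Bochner_Integration.integral_diff[OF ii ii])
    finally show ?thesis by simp
  qed
  have "((\<lambda>y. LBINT x=u - 1..y. w x) has_vector_derivative w u) (at u within {u - 1..u + 1})"
    using c by (intro interval_integral_FTC2) (auto intro!: continuous_at_imp_continuous_on)
  then have "((\<lambda>y. ?F (u - 1) + (LBINT x=u - 1..y. w x)) has_vector_derivative 0 + w u) (at u within {u - 1..u + 1})"
    by (intro has_vector_derivative_add has_vector_derivative_const)
  then have *: "((\<lambda>y. ?F (u - 1) + (LBINT x=u - 1..y. w x)) has_vector_derivative w u) (at u within {u - 1..u + 1})"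
    by (simp only: add_0)
  have "(?F has_vector_derivative w u) (at u within {u - 1..u + 1})"
    by (rule has_vector_derivative_transform[OF _ F *]) auto
  then have "(?F has_vector_derivative w u) (at u)"
    by (simp add: at_within_interior[of u "{u - 1..u + 1}"])
  then show ?thesis by (simp add: has_real_derivative_iff_has_vector_derivative)
qed

text \<open>A polynomial in \<open>i t\<close> with real coefficients times \<open>exp (- t\<^sup>2 / 2)\<close> is the transform of a combination of
  Hermite functions, whose value at \<open>u\<close> is recovered by Fourier inversion.\<close>

lemma deriv_fourier_stieltjes:
  fixes c :: "nat \<Rightarrow> real" and V :: "real \<Rightarrow> complex"
  assumes V: "\<And>t. V t = (\<Sum>k\<le>d. of_real (c k) * (\<i> * of_real t) ^ k)"
  shows "complex_of_real (deriv (THE F. has_fourier_stieltjes F (\<lambda>t. V t * of_real (exp (- t\<^sup>2 / 2)))) u)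
    = of_real (1 / (2 * pi)) * (\<integral>t. iexp (- (u * t)) * (V t * of_real (exp (- t\<^sup>2 / 2))) \<partial>lborel)"
    and "integrable lborel (\<lambda>t. V t * of_real (exp (- t\<^sup>2 / 2)))"
proof -
  define r where "r = (\<Sum>k\<le>d. smult (c k / sqrt (2 * pi)) (hermite k))"
  define w where "w x = poly r x * exp (- x\<^sup>2 / 2)" for x
  have wi: "integrable lborel w" unfolding w_def by (rule integrable_poly_gaussian)
  have wc: "isCont w x" for x
  proof -
    have "\<exists>D. (w has_real_derivative D) (at x)"
      unfolding w_def by (rule exI) (auto intro!: derivative_eq_intros poly_DERIV)
    then show ?thesis by (auto intro: DERIV_isCont)
  qed
  have gs: "gauss_fourier (\<Sum>k\<in>A. smult (b k) (P k)) t = (\<Sum>k\<in>A. of_real (b k) * gauss_fourier (P k) t)"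
    if "finite A" for A :: "nat set" and b P t
    using that
  proof (induction A rule: finite_induct)
    case (insert k A)
    have "gauss_fourier (x + y) t = gauss_fourier x t + gauss_fourier y t" for x y
      using gauss_fourier_diff[of "x + y" y t] by simp
    then show ?case using insert by (simp add: gauss_fourier_smult)
  qed (simp add: gauss_fourier_def)
  have "gauss_fourier r t = V t * of_real (exp (- t\<^sup>2 / 2))" for t
  proof -
    have "gauss_fourier r t = (\<Sum>k\<le>d. of_real (c k / sqrt (2 * pi)) * gauss_fourier (hermite k) t)"
      unfolding r_def by (rule gs) simp
    also have "\<dots> = (\<Sum>k\<le>d. of_real (c k) * (\<i> * of_real t) ^ k * of_real (exp (- t\<^sup>2 / 2)))"
      unfolding gauss_fourier_hermite by (intro sum.cong refl) simp
    finally show ?thesis by (simp add: V sum_distrib_right)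
  qed
  then have "has_fourier_stieltjes (\<lambda>u. \<integral>x. indicator {..u} x * w x \<partial>lborel) (\<lambda>t. V t * of_real (exp (- t\<^sup>2 / 2)))"
    using has_fourier_stieltjes_density[OF wi] by (simp add: gauss_fourier_def w_def)
  then have "(THE F. has_fourier_stieltjes F (\<lambda>t. V t * of_real (exp (- t\<^sup>2 / 2)))) = (\<lambda>u. \<integral>x. indicator {..u} x * w x \<partial>lborel)"
    by (intro the_equality) (auto intro: has_fourier_stieltjes_unique)
  then have d: "deriv (THE F. has_fourier_stieltjes F (\<lambda>t. V t * of_real (exp (- t\<^sup>2 / 2)))) u = w u"
    using DERIV_integral_atMost[OF wi wc] by (simp add: DERIV_imp_deriv)
  have Veq: "V t * of_real (exp (- t\<^sup>2 / 2)) = (\<Sum>k\<le>d. of_real (c k) * \<i> ^ k * of_real (poly (monom 1 k) t * exp (- t\<^sup>2 / 2)))" for t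
    by (simp add: V sum_distrib_right poly_monom power_mult_distrib mult.assoc)
  show "integrable lborel (\<lambda>t. V t * of_real (exp (- t\<^sup>2 / 2)))"
    unfolding Veq by (intro Bochner_Integration.integrable_sum integrable_mult_right integrable_of_real integrable_poly_gaussian)
  have "(\<integral>t. iexp (- (u * t)) * (V t * of_real (exp (- t\<^sup>2 / 2))) \<partial>lborel)
     = (\<integral>t. (\<Sum>k\<le>d. of_real (c k) * \<i> ^ k * (iexp (- u * t) * of_real (poly (monom 1 k) t * exp (- t\<^sup>2 / 2)))) \<partial>lborel)"
    unfolding Veq sum_distrib_left by (intro Bochner_Integration.integral_cong refl sum.cong) simp
  also have "\<dots> = (\<Sum>k\<le>d. of_real (c k) * \<i> ^ k * gauss_fourier (monom 1 k) (- u))"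
    unfolding gauss_fourier_def
    by (subst Bochner_Integration.integral_sum)
       (simp_all only: integral_mult_right_zero integrable_mult_right integrable_iexp_poly_gaussian)
  also have "\<dots> = (\<Sum>k\<le>d. of_real (c k) * of_real (poly (hermite k) u * (sqrt (2 * pi) * exp (- u\<^sup>2 / 2))))"
    by (simp only: mult.assoc gauss_fourier_monom)
  also have "\<dots> = of_real (\<Sum>k\<le>d. c k * (poly (hermite k) u * (sqrt (2 * pi) * exp (- u\<^sup>2 / 2))))" by simp
  also have "(\<Sum>k\<le>d. c k * (poly (hermite k) u * (sqrt (2 * pi) * exp (- u\<^sup>2 / 2)))) = 2 * pi * w u"
  proof -
    have "c k * (poly (hermite k) u * (sqrt (2 * pi) * exp (- u\<^sup>2 / 2)))
       = 2 * pi * (c k / sqrt (2 * pi) * poly (hermite k) u * exp (- u\<^sup>2 / 2))" for k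
    proof -
      have "y * (h * (S * E)) = T * (y / S * h * E)" if "S * S = T" "S \<noteq> 0" for y h S T E :: real
        using that by (auto simp: field_simps)
      then show ?thesis by simp
    qed
    then show ?thesis by (simp add: w_def r_def poly_sum sum_distrib_left sum_distrib_right)
  qed
  finally show "complex_of_real (deriv (THE F. has_fourier_stieltjes F (\<lambda>t. V t * of_real (exp (- t\<^sup>2 / 2)))) u)
    = of_real (1 / (2 * pi)) * (\<integral>t. iexp (- (u * t)) * (V t * of_real (exp (- t\<^sup>2 / 2))) \<partial>lborel)"
    unfolding d by simp
qed

section \<open>The local estimate in the Poisson scheme\<close>

text \<open>\<open>rho * KM < 1\<close> is what small \<open>rho\<close> means from here on. It
  keeps \<open>10 ^ 7 * rho + rho * K4\<close> below 1/10, so that the approximation forbids modulus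
  1 away from the origin.\<close>

definition KM :: real where "KM = 10 * (K4 + 10 ^ 7)"
text \<open>The summand with 16 comes from \<open>exp_sixteenth_le\<close> on the central range, the
  other two from \<open>cmod_W_gauss_tail\<close>.\<close>

definition K5 :: real where "K5 = 16 * K4 + 40000000 * KM ^ 3 + 10 ^ 22"

lemma K_pos': "0 < K4" "10 ^ 8 \<le> KM" "0 < K5"
  using K_pos by (auto simp: K4_def KM_def K5_def intro!: add_pos_pos add_nonneg_pos)

lemma exp_sixteenth_le: "exp (- u\<^sup>2 / 16) \<le> 16 * inverse (1 + u\<^sup>2)" for u :: real
proof -
  have "1 + u\<^sup>2 \<le> 16 * (1 + u\<^sup>2 / 16)" by simp
  also have "\<dots> \<le> 16 * exp (u\<^sup>2 / 16)" by (intro mult_left_mono exp_ge_add_one_self) auto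
  finally have "(1 + u\<^sup>2) * exp (- (u\<^sup>2 / 16)) \<le> 16 * exp (u\<^sup>2 / 16) * exp (- (u\<^sup>2 / 16))"
    by (rule mult_right_mono) simp
  also have "\<dots> = 16" by (simp add: mult.assoc flip: exp_add)
  finally have "(1 + u\<^sup>2) * exp (- (u\<^sup>2 / 16)) \<le> 16" .
  moreover have "0 < 1 + u\<^sup>2" by (simp add: add_pos_nonneg)
  ultimately show ?thesis by (simp add: field_simps)
qed

lemma seventh_power_times_gauss_le:
  fixes u :: real
  shows "(1 + u\<^sup>2) ^ 6 * exp (- u\<^sup>2 / 2) \<le> 1100000 * inverse (1 + u\<^sup>2)"
proof -
  define z where "z = (1 + u\<^sup>2) / 2"
  have z: "0 \<le> z" by (simp add: z_def)
  have "(1 + u\<^sup>2) ^ 7 = 2 ^ 7 * z ^ 7" unfolding z_def power_divide by simp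
  also have "\<dots> \<le> 2 ^ 7 * (fact 7 * exp z)" using z by (intro mult_left_mono power_le_fact_exp) auto
  finally have "(1 + u\<^sup>2) ^ 7 * exp (- u\<^sup>2 / 2) \<le> 2 ^ 7 * (fact 7 * exp z) * exp (- u\<^sup>2 / 2)"
    by (rule mult_right_mono) simp
  also have "\<dots> = 645120 * exp (1 / 2)"
    unfolding mult.assoc exp_add[symmetric] by (simp add: z_def fact_numeral field_simps)
  also have "\<dots> \<le> 645120 * (5 / 3)"
  proof (intro mult_left_mono)
    have "(exp (1 / 2))\<^sup>2 = exp (1::real)" by (simp flip: exp_of_nat_mult)
    also have "\<dots> \<le> (5 / 3)\<^sup>2" using e_less_272 by (simp add: power_divide)
    finally show "exp (1 / 2) \<le> (5 / 3 :: real)" by (rule power2_le_imp_le) simp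
  qed auto
  finally have "(1 + u\<^sup>2) * ((1 + u\<^sup>2) ^ 6 * exp (- u\<^sup>2 / 2)) \<le> 1100000"
    by (simp add: power_numeral_reduce mult.assoc)
  moreover have "0 < 1 + u\<^sup>2" by (simp add: add_pos_nonneg)
  ultimately have "(1 + u\<^sup>2) ^ 6 * exp (- u\<^sup>2 / 2) \<le> 1100000 / (1 + u\<^sup>2)"
    by (subst pos_le_divide_eq) (simp_all only: mult.commute)
  then show ?thesis by (simp only: divide_inverse)
qed

context poisson_scheme
begin

definition "phi u = I_int u / I_int 0"
definition "W_gauss u = W u * complex_of_real (exp (- u\<^sup>2 / 2))"
text \<open>The expansion holds up to 2 \<open>U_cut\<close>, where \<bar>u\<bar>
  (\<open>beta 3 + sqrt eps\<close>) reaches 1/1000. The range between \<open>U_cut\<close> and its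
  double serves to catch a multiple of the period.\<close>

definition "U_cut = 1 / (2000 * (beta 3 + sqrt eps))"

lemma phi_eq: "phi u = expectation (\<lambda>\<omega>. iexp (u * asum \<omega>) * indicator {\<omega>. tot \<omega> = n} \<omega>) / of_real P0"
  using n_pos unfolding phi_def I_int_0 by (simp add: I_int_eq excess_0)

lemma P0_pos: "0 < P0"
  using P0_ge n_pos by (smt (verit) divide_pos_pos exp_gt_zero mult_pos_pos real_sqrt_gt_zero)

lemma U_cut_pos: "0 < U_cut"
  unfolding U_cut_def using beta_nonneg[of 3] eps_pos by (simp add: add_nonneg_pos)

text \<open>\<open>beta 3\<close> is at most 2 \<open>rho\<close> and \<open>sqrt eps\<close> at
  most \<open>rho\<close>. Beyond \<open>U_cut\<close>, a factor 1 may therefore be traded for 6000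
  \<open>rho\<close> \<bar>u\<bar>.\<close>

lemma U_cut_ge: "1 \<le> 6000 * rho * U_cut"
proof -
  have "beta 3 + sqrt eps \<le> 3 * rho" using beta_le[of 3] sqrt_eps_le_rho by simp
  moreover have "0 < beta 3 + sqrt eps" using beta_nonneg[of 3] eps_pos by (simp add: add_nonneg_pos)
  ultimately show ?thesis by (simp add: U_cut_def le_divide_eq)
qed

lemma phi_W_gauss:
  assumes "\<bar>u\<bar> \<le> 2 * U_cut"
  shows "cmod (phi u - W_gauss u) \<le> K4 * rho ^ 3 * exp (- u\<^sup>2 / 16)"
proof -
  have d: "0 < beta 3 + sqrt eps" using beta_nonneg[of 3] eps_pos by (simp add: add_nonneg_pos)
  have "\<bar>u\<bar> * (beta 3 + sqrt eps) \<le> 2 * U_cut * (beta 3 + sqrt eps)"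
    using assms d by (intro mult_right_mono) auto
  also have "\<dots> = 1 / 1000" using d by (simp add: U_cut_def)
  finally have "\<bar>u\<bar> * beta 3 + \<bar>u\<bar> * sqrt eps \<le> 1 / 1000" by (simp add: distrib_left)
  moreover have "0 \<le> \<bar>u\<bar> * beta 3" "0 \<le> \<bar>u\<bar> * sqrt eps" using beta_nonneg[of 3] eps_pos by auto
  ultimately show ?thesis
    unfolding phi_def W_gauss_def by (intro phi_expansion) linarith+
qed

lemma cmod_W_gauss_le: "cmod (W_gauss u) \<le> (exp (- u\<^sup>2 / 2) + 10000 * (rho + rho\<^sup>2) * ((1 + u\<^sup>2) ^ 3 * exp (- u\<^sup>2 / 2)))"
proof -
  have "cmod (W u) \<le> 1 + 10000 * (rho + rho\<^sup>2) * (1 + u\<^sup>2) ^ 3"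
    using norm_triangle_ineq[of 1 "W u - 1"] cmod_W_le[of u] by simp
  then have "cmod (W u) * exp (- u\<^sup>2 / 2) \<le> (1 + 10000 * (rho + rho\<^sup>2) * (1 + u\<^sup>2) ^ 3) * exp (- u\<^sup>2 / 2)"
    by (rule mult_right_mono) simp
  then show ?thesis unfolding W_gauss_def norm_mult norm_of_real by (simp add: algebra_simps)
qed

text \<open>The lattice structure makes \<open>\<bar>phi\<bar>\<close> periodic with value 1 at the period, so the approximation by
  \<^term>\<open>W_gauss\<close> forces the period to exceed \<^term>\<open>2 * U_cut\<close> when \<^term>\<open>rho\<close> is small.\<close>

context
  fixes L z :: real and Y :: "'a \<Rightarrow> int"
  assumes L_pos: "0 < L" and Y_meas [measurable]: "Y \<in> measurable M (count_space UNIV)"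
    and Y: "AE \<omega> in M. tot \<omega> = n \<longrightarrow> asum \<omega> = z + Y \<omega> / L"
begin

lemma expectation_lattice:
  "expectation (\<lambda>\<omega>. indicator {\<omega>. tot \<omega> = n} \<omega> * iexp (u * (Y \<omega> / L))) = iexp (- (u * z)) * (of_real P0 * phi u)"
proof -
  have "expectation (\<lambda>\<omega>. indicator {\<omega>. tot \<omega> = n} \<omega> * iexp (u * (Y \<omega> / L)))
      = expectation (\<lambda>\<omega>. iexp (- (u * z)) * (iexp (u * asum \<omega>) * indicator {\<omega>. tot \<omega> = n} \<omega>))"
  proof (rule integral_cong_AE)
    show "AE \<omega> in M. indicator {\<omega>. tot \<omega> = n} \<omega> * iexp (u * (Y \<omega> / L))
        = iexp (- (u * z)) * (iexp (u * asum \<omega>) * indicator {\<omega>. tot \<omega> = n} \<omega>)"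
      using Y
    proof eventually_elim
      case (elim \<omega>)
      show ?case
      proof (cases "tot \<omega> = n")
        case True
        have "u * (Y \<omega> / L) = - (u * z) + u * asum \<omega>" using elim True by (simp add: algebra_simps)
        then have "iexp (u * (Y \<omega> / L)) = iexp (- (u * z)) * iexp (u * asum \<omega>)"
          by (simp only: of_real_add distrib_left exp_add)
        then show ?thesis using True by simp
      qed simp
    qed
  qed measurable
  also have "\<dots> = iexp (- (u * z)) * expectation (\<lambda>\<omega>. iexp (u * asum \<omega>) * indicator {\<omega>. tot \<omega> = n} \<omega>)"
    by (rule integral_mult_right_zero)
  finally show ?thesis using P0_pos by (simp add: phi_eq)
qed

lemma lattice_density:
  "(\<integral>u. indicator {- (pi * L)..pi * L} u *\<^sub>R (iexp (- (u * z)) * phi u) \<partial>lborel)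
    = of_real (2 * pi * L * prob {\<omega> \<in> space M. tot \<omega> = n \<and> Y \<omega> = 0} / P0)"
proof -
  have "(\<integral>u. indicator {- (pi * L)..pi * L} u *\<^sub>R (iexp (- (u * z)) * phi u) \<partial>lborel)
     = (\<integral>u. (indicator {- (pi * L)..pi * L} u *\<^sub>R expectation (\<lambda>\<omega>. indicator {\<omega>. tot \<omega> = n} \<omega> * iexp (u * (Y \<omega> / L)))) / of_real P0 \<partial>lborel)"
    unfolding expectation_lattice using P0_pos by (intro Bochner_Integration.integral_cong refl) (simp add: scaleR_conv_of_real)
  also have "\<dots> = of_real (2 * pi * L) * expectation (\<lambda>\<omega>. indicator {\<omega>. tot \<omega> = n} \<omega> * indicator {\<omega>. Y \<omega> = 0} \<omega>) / of_real P0"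
    using L_pos by (subst integral_divide_zero, subst lattice_inversion) (auto simp: indicator_def)
  also have "expectation (\<lambda>\<omega>. indicator {\<omega>. tot \<omega> = n} \<omega> * indicator {\<omega>. Y \<omega> = 0} \<omega>)
     = expectation (\<lambda>\<omega>. complex_of_real (indicator {\<omega> \<in> space M. tot \<omega> = n \<and> Y \<omega> = 0} \<omega>))"
    by (intro Bochner_Integration.integral_cong) (auto simp: indicator_def)
  also have "\<dots> = of_real (prob {\<omega> \<in> space M. tot \<omega> = n \<and> Y \<omega> = 0})"
    by (subst integral_complex_of_real) simp
  finally show ?thesis by simp
qed

text \<open>At multiples of 2 \<pi> L the exponential of the lattice part is 1 and only the phase
  caused by z remains.\<close>

lemma cmod_phi_period: "cmod (phi (2 * pi * L * real k)) = 1"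
proof -
  have "indicator {\<omega>. tot \<omega> = n} \<omega> * iexp (2 * pi * L * real k * (Y \<omega> / L)) = complex_of_real (indicator {\<omega>. tot \<omega> = n} \<omega>)" for \<omega>
  proof -
    have "2 * pi * L * real k * (Y \<omega> / L) = 2 * real_of_int (int k * Y \<omega>) * pi" using L_pos by simp
    then have "iexp (2 * pi * L * real k * (Y \<omega> / L)) = exp (2 * of_int (int k * Y \<omega>) * of_real pi * \<i>)"
      by (simp only:) (simp add: ac_simps)
    also have "\<dots> = 1" using exp_integer_2pi[of "of_int (int k * Y \<omega>)"] by (simp add: ac_simps)
    finally have e: "iexp (2 * pi * L * real k * (Y \<omega> / L)) = 1" .
    show ?thesis unfolding e by (simp add: indicator_def)
  qed
  then have "expectation (\<lambda>\<omega>. indicator {\<omega>. tot \<omega> = n} \<omega> * iexp (2 * pi * L * real k * (Y \<omega> / L)))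
     = expectation (\<lambda>\<omega>. complex_of_real (indicator {\<omega>. tot \<omega> = n} \<omega>))" by (simp only:)
  also have "\<dots> = expectation (\<lambda>\<omega>. complex_of_real (indicator {\<omega> \<in> space M. tot \<omega> = n} \<omega>))"
    by (intro Bochner_Integration.integral_cong) (auto simp: indicator_def)
  also have "\<dots> = of_real P0" unfolding P0_def by (subst integral_complex_of_real) simp
  finally have "iexp (- (2 * pi * L * real k * z)) * (of_real P0 * phi (2 * pi * L * real k)) = of_real P0"
    unfolding expectation_lattice .
  from arg_cong[OF this, of cmod] have "P0 * cmod (phi (2 * pi * L * real k)) = P0"
    using P0_pos by (simp only: norm_mult norm_exp_i_times norm_of_real)
  then show ?thesis using P0_pos by simp
qed

lemma U_cut_less_period:
  assumes r: "rho * KM < 1"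
  shows "U_cut < pi * L"
proof (rule ccontr)
  assume "\<not> U_cut < pi * L"
  then have le: "2 * pi * L \<le> 2 * U_cut" by simp
  have rr: "10 * (rho * K4) + 10 ^ 8 * rho < 1" using r by (simp add: KM_def algebra_simps)
  have rK: "0 < rho * K4" using rho_pos K_pos' by simp
  have r1: "rho \<le> 1" using rr rK rho_pos by simp
  have U1: "2 \<le> 2 * U_cut"
  proof -
    have "6000 * rho \<le> 1" using rr rK rho_pos by simp
    then have "6000 * rho * U_cut \<le> U_cut" using U_cut_pos by (simp add: mult_left_le_one_le)
    then show ?thesis using U_cut_ge by linarith
  qed
  \<comment> \<open>Near the origin \<open>W_gauss\<close> is close to 1, so a contradiction needs a
    multiple of the period that is at least 1. If the period is shorter than 1, the least multiple
    reaching 1 is still below 2, hence within 2 \<open>U_cut\<close>.\<close>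
  obtain k :: nat where k: "1 \<le> 2 * pi * L * real k" "2 * pi * L * real k \<le> 2 * U_cut"
  proof (cases "1 \<le> 2 * pi * L")
    case True
    then show ?thesis using le that[of 1] by simp
  next
    case False
    define d where "d = 2 * pi * L"
    have d: "0 < d" "d < 1" using L_pos False by (auto simp: d_def)
    define k where "k = nat \<lceil>1 / d\<rceil>"
    have rk: "real k = of_int \<lceil>1 / d\<rceil>" using d by (simp add: k_def)
    have "1 / d \<le> real k" "real k < 1 / d + 1" unfolding rk by linarith+
    then have "1 \<le> d * real k" "d * real k \<le> 1 + d" using d by (simp_all add: field_simps)
    then show ?thesis using that[of k] d U1 by (simp add: d_def)
  qed
  define u where "u = 2 * pi * L * real k"
  have u: "1 \<le> u" "\<bar>u\<bar> \<le> 2 * U_cut" using k by (auto simp: u_def)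
  have "1 = cmod (phi u)" using cmod_phi_period[of k] by (simp add: u_def)
  also have "\<dots> \<le> cmod (W_gauss u) + cmod (phi u - W_gauss u)"
    using norm_triangle_ineq[of "W_gauss u" "phi u - W_gauss u"] by simp
  also have "\<dots> \<le> 2 / 3 + 10 ^ 7 * rho + rho * K4"
  proof -
    have "exp (- u\<^sup>2 / 2) \<le> 2 / 3"
    proof -
      have "3 / 2 \<le> exp (1 / 2 :: real)" using exp_ge_add_one_self[of "1 / 2 :: real"] by simp
      also have "\<dots> \<le> exp (u\<^sup>2 / 2)" using u by (simp add: one_le_power)
      finally show ?thesis by (simp add: exp_minus field_simps)
    qed
    moreover have "10000 * (rho + rho\<^sup>2) * ((1 + u\<^sup>2) ^ 3 * exp (- u\<^sup>2 / 2)) \<le> 10000 * (rho + rho) * 120"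
    proof (intro mult_mono mult_left_mono add_left_mono)
      show "rho\<^sup>2 \<le> rho" using r1 rho_pos by (simp add: power2_eq_square mult_left_le)
      have "(1 + u\<^sup>2) ^ 3 * exp (- u\<^sup>2 / 2) \<le> 120 * exp (- u\<^sup>2 / 16)" by (rule cube_times_gauss_le)
      also have "\<dots> \<le> 120 * 1" by (intro mult_left_mono) auto
      finally show "(1 + u\<^sup>2) ^ 3 * exp (- u\<^sup>2 / 2) \<le> 120" by simp
    qed (use rho_pos in auto)
    moreover have "cmod (phi u - W_gauss u) \<le> rho * K4"
    proof -
      have "cmod (phi u - W_gauss u) \<le> K4 * rho ^ 3 * exp (- u\<^sup>2 / 16)" by (rule phi_W_gauss[OF u(2)])
      also have "\<dots> \<le> K4 * rho * 1"
      proof (intro mult_mono)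
        show "rho ^ 3 \<le> rho" using power_decreasing[of 1 3 rho] r1 rho_pos by simp
      qed (use K_pos' rho_pos in auto)
      finally show ?thesis by (simp add: mult.commute)
    qed
    ultimately show ?thesis using cmod_W_gauss_le[of u] rho_pos by simp
  qed
  finally show False using rr rK rho_pos by simp
qed

text \<open>The factor \<open>rho ^ 3\<close> has two sources. If \<open>rho * KM \<ge> 1\<close> it
  is bounded below outright. Otherwise \<open>U_cut_less_period\<close> places u beyond
  \<open>U_cut\<close>, and (6000 \<open>rho\<close> \<bar>u\<bar>)^3 \<ge> 1 can be inserted, the
  extra power of u being absorbed by the Gaussian.\<close>

lemma cmod_W_gauss_tail:
  assumes u: "min U_cut (pi * L) < \<bar>u\<bar>"
  shows "cmod (W_gauss u) \<le> (40000000 * KM ^ 3 + 10 ^ 22) * rho ^ 3 * inverse (1 + u\<^sup>2)"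
proof -
  define w where "w = (1 + u\<^sup>2) ^ 3"
  define g where "g = exp (- u\<^sup>2 / 2)"
  define t where "t = rho ^ 3 * inverse (1 + u\<^sup>2)"
  have w1: "1 \<le> w" by (simp add: w_def)
  have g0: "0 < g" by (simp add: g_def)
  have i0: "0 < inverse (1 + u\<^sup>2)" by (simp add: add_pos_nonneg)
  have t0: "0 < t" unfolding t_def using rho_pos i0 by (intro mult_pos_pos) auto
  have KM0: "0 < KM" using K_pos' by simp
  have Wg: "cmod (W_gauss u) \<le> (1 + 10000 * (rho + rho\<^sup>2)) * (w * g)"
  proof -
    have "g \<le> w * g" using mult_right_mono[OF w1, of g] g0 by simp
    then show ?thesis using cmod_W_gauss_le[of u, folded w_def g_def]
      by (simp only: distrib_right[of 1] mult_1_left)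
  qed
  have "cmod (W_gauss u) \<le> (40000000 * KM ^ 3 + 10 ^ 22) * t"
  proof (cases "rho * KM < 1")
    case False
    define y where "y = rho * KM"
    have y1: "1 \<le> y" using False by (simp add: y_def)
    have ry: "rho \<le> y" using K_pos' rho_pos by (simp add: y_def)
    have yp: "y \<le> y ^ 3" "y\<^sup>2 \<le> y ^ 3" "1 \<le> y ^ 3" using y1 by (auto intro: self_le_power power_increasing)
    have "rho + rho\<^sup>2 \<le> y ^ 3 + y ^ 3"
      by (intro add_mono order_trans[OF ry yp(1)] order_trans[OF power_mono[OF ry] yp(2)])
        (use rho_pos in auto)
    then have a: "1 + 10000 * (rho + rho\<^sup>2) \<le> 20001 * y ^ 3" using yp by simp
    have b: "w * g \<le> 1920 * inverse (1 + u\<^sup>2)"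
      using cube_times_gauss_le[of u] exp_sixteenth_le[of u] unfolding w_def g_def by simp
    have "cmod (W_gauss u) \<le> (20001 * y ^ 3) * (1920 * inverse (1 + u\<^sup>2))"
      using order_trans[OF Wg mult_mono[OF a b]] w1 g0 y1 by simp
    also have "\<dots> = 38401920 * (KM ^ 3 * t)" by (simp add: y_def t_def power_mult_distrib)
    also have "\<dots> \<le> (40000000 * KM ^ 3 + 10 ^ 22) * t"
      using t0 KM0 by (simp add: distrib_right)
    finally show ?thesis .
  next
    case True
    have rK: "100000000 * rho \<le> rho * KM" using K_pos'(2) rho_pos by simp
    have r1: "rho \<le> 1" using rK True rho_pos by linarith
    have "U_cut < \<bar>u\<bar>" using u U_cut_less_period[OF True] by (simp add: min_def split: if_splits)
    then have "6000 * rho * U_cut \<le> 6000 * rho * \<bar>u\<bar>" using rho_pos by (intro mult_left_mono) auto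
    then have "1 \<le> 6000 * rho * \<bar>u\<bar>" using U_cut_ge by linarith
    then have "1 \<le> (6000 * rho * \<bar>u\<bar>) ^ 3" by (rule one_le_power)
    also have "\<dots> = 216000000000 * (rho ^ 3 * \<bar>u\<bar> ^ 3)" by (simp add: power_mult_distrib)
    also have "\<dots> \<le> 216000000000 * (rho ^ 3 * w)"
    proof (intro mult_left_mono)
      have "\<bar>u\<bar> \<le> 1 + \<bar>u\<bar>\<^sup>2" using power_le_one_plus_power[of "\<bar>u\<bar>" 1 2] by simp
      then show "\<bar>u\<bar> ^ 3 \<le> w" unfolding w_def by (intro power_mono) auto
    qed (use rho_pos in auto)
    finally have o: "1 \<le> 216000000000 * (rho ^ 3 * w)" .
    have "rho\<^sup>2 \<le> 1" using r1 rho_pos by (simp add: power_le_one)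
    then have "(1 + 10000 * (rho + rho\<^sup>2)) * (w * g) \<le> 20001 * (w * g)"
      using r1 w1 g0 by (intro mult_right_mono) auto
    also have "\<dots> \<le> 20001 * (w * g) * (216000000000 * (rho ^ 3 * w))"
      using mult_left_mono[OF o, of "20001 * (w * g)"] w1 g0 by simp
    also have "\<dots> = 4320216000000000 * (rho ^ 3 * ((1 + u\<^sup>2) ^ 6 * g))"
      unfolding w_def by (simp flip: power_add)
    also have "\<dots> \<le> 4320216000000000 * (rho ^ 3 * (1100000 * inverse (1 + u\<^sup>2)))"
      unfolding g_def using rho_pos by (intro mult_left_mono seventh_power_times_gauss_le) auto
    also have "\<dots> = 4752237600000000000000 * t" by (simp add: t_def)
    also have "\<dots> \<le> (40000000 * KM ^ 3 + 10 ^ 22) * t"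
      using t0 KM0 by (intro mult_right_mono) (auto intro: add_increasing)
    finally show ?thesis using Wg by linarith
  qed
  then show ?thesis by (simp add: t_def mult.assoc)
qed

lemma phi_meas [measurable]: "phi \<in> borel_measurable borel"
proof -
  have "(\<lambda>(u, \<omega>). iexp (u * asum \<omega>) * indicator {\<omega>. tot \<omega> = n} \<omega>) \<in> borel_measurable (lborel \<Otimes>\<^sub>M M)"
    by measurable
  from borel_measurable_lebesgue_integral[OF this]
  have "(\<lambda>u. expectation (\<lambda>\<omega>. iexp (u * asum \<omega>) * indicator {\<omega>. tot \<omega> = n} \<omega>)) \<in> borel_measurable borel" by simp
  then show ?thesis unfolding phi_eq[abs_def] by measurable
qed

lemma cmod_phi_le_1: "cmod (phi u) \<le> 1"
proof -
  have "cmod (expectation (\<lambda>\<omega>. iexp (u * asum \<omega>) * indicator {\<omega>. tot \<omega> = n} \<omega>))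
      \<le> expectation (\<lambda>\<omega>. indicator {\<omega> \<in> space M. tot \<omega> = n} \<omega>)"
  proof (rule norm_integral_le_integral)
    show "integrable M (indicator {\<omega> \<in> space M. tot \<omega> = n} :: 'a \<Rightarrow> real)"
      by (intro integrable_real_indicator) (auto simp: less_top[symmetric])
  qed (auto simp: norm_mult indicator_def)
  also have "\<dots> = P0" by (simp add: P0_def)
  finally show ?thesis using P0_pos unfolding phi_eq by (simp add: norm_divide divide_le_eq)
qed

text \<open>The probability is an integral over one period, the derivative of the expansion an
  integral over the line. Up to \<open>min U_cut (pi * L)\<close> the integrands are compared;
  elsewhere each is bounded alone. The bound \<open>Xi\<close> for larger u stays abstract, and the
  length 2 \<pi> L of the period turns it into \<open>L * Xi\<close>.\<close>

lemma main_estimate: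
  assumes Xi: "0 \<le> Xi" "\<And>u. U_cut < \<bar>u\<bar> \<Longrightarrow> \<bar>u\<bar> \<le> pi * L \<Longrightarrow> cmod (phi u) \<le> Xi"
    and Wi: "integrable lborel W_gauss"
    and D: "complex_of_real D = of_real (1 / (2 * pi)) * (\<integral>u. iexp (- (z * u)) * W_gauss u \<partial>lborel)"
  shows "\<bar>L * prob {\<omega> \<in> space M. tot \<omega> = n \<and> Y \<omega> = 0} / P0 - D\<bar> \<le> K5 * rho ^ 3 + L * Xi"
proof -
  let ?S = "{- (pi * L)..pi * L}"
  let ?p = "prob {\<omega> \<in> space M. tot \<omega> = n \<and> Y \<omega> = 0}"
  define A where "A u = indicator ?S u *\<^sub>R (iexp (- (u * z)) * phi u)" for u
  define B where "B u = iexp (- (z * u)) * W_gauss u" for u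
  have Ai: "integrable lborel A"
    unfolding A_def
  proof (rule integrableI_bounded_set_indicator[where B = 1])
    show "emeasure lborel ?S < \<infinity>" by (simp add: emeasure_lborel_Icc_eq)
  qed (auto simp: norm_mult cmod_phi_le_1)
  have Bi: "integrable lborel B"
  proof -
    have "B = (\<lambda>u. iexp (- z * u) * W_gauss u)" by (simp add: B_def fun_eq_iff)
    then show ?thesis using integrable_iexp_mult[OF Wi, of "- z"] by simp
  qed
  have bound: "cmod (A u - B u) \<le> K5 * rho ^ 3 * inverse (1 + u\<^sup>2) + Xi * indicator ?S u" for u
  proof -
    have iz: "0 < inverse (1 + u\<^sup>2)" by (simp add: add_pos_nonneg)
    have r3: "0 < rho ^ 3" using rho_pos by simp
    have K5eq: "K5 * rho ^ 3 * inverse (1 + u\<^sup>2) = 16 * K4 * rho ^ 3 * inverse (1 + u\<^sup>2)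
       + (40000000 * KM ^ 3 + 10 ^ 22) * rho ^ 3 * inverse (1 + u\<^sup>2)"
      by (simp add: K5_def algebra_simps)
    have nn: "0 \<le> 16 * K4 * rho ^ 3 * inverse (1 + u\<^sup>2)" "0 \<le> (40000000 * KM ^ 3 + 10 ^ 22) * rho ^ 3 * inverse (1 + u\<^sup>2)"
      using K_pos' r3 iz by (auto intro!: mult_nonneg_nonneg add_nonneg_nonneg)
    have Xn: "0 \<le> Xi * indicator ?S u" using Xi(1) by simp
    show ?thesis
    proof (cases "\<bar>u\<bar> \<le> min U_cut (pi * L)")
      case True
      then have uS: "u \<in> ?S" and u2: "\<bar>u\<bar> \<le> 2 * U_cut" using U_cut_pos by auto
      have "cmod (A u - B u) = cmod (iexp (- (u * z)) * (phi u - W_gauss u))"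
        using uS by (simp add: A_def B_def algebra_simps)
      also have "\<dots> = cmod (phi u - W_gauss u)" by (simp add: norm_mult)
      also have "\<dots> \<le> K4 * rho ^ 3 * exp (- u\<^sup>2 / 16)" by (rule phi_W_gauss[OF u2])
      also have "\<dots> \<le> K4 * rho ^ 3 * (16 * inverse (1 + u\<^sup>2))"
        using K_pos' r3 by (intro mult_left_mono exp_sixteenth_le) auto
      finally show ?thesis using nn Xn K5eq by simp
    next
      case False
      then have f: "min U_cut (pi * L) < \<bar>u\<bar>" unfolding not_le .
      have "cmod (B u) \<le> (40000000 * KM ^ 3 + 10 ^ 22) * rho ^ 3 * inverse (1 + u\<^sup>2)"
        using cmod_W_gauss_tail[OF f] by (simp add: B_def norm_mult)
      moreover have "cmod (A u) \<le> Xi * indicator ?S u"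
      proof (cases "u \<in> ?S")
        case True
        then have "U_cut < \<bar>u\<bar>" "\<bar>u\<bar> \<le> pi * L" using f by auto
        then show ?thesis using Xi(2) True by (simp add: A_def norm_mult)
      qed (simp add: A_def)
      ultimately show ?thesis using norm_triangle_ineq4[of "A u" "B u"] nn K5eq by linarith
    qed
  qed
  have Si: "integrable lborel (\<lambda>u. Xi * indicator ?S u)" "(\<integral>u. Xi * indicator ?S u \<partial>lborel) = Xi * (2 * pi * L)"
    using L_pos by simp_all
  have "cmod ((\<integral>u. A u \<partial>lborel) - (\<integral>u. B u \<partial>lborel)) = cmod (\<integral>u. A u - B u \<partial>lborel)"
    using Ai Bi by simp
  also have "\<dots> \<le> (\<integral>u. K5 * rho ^ 3 * inverse (1 + u\<^sup>2) + Xi * indicator ?S u \<partial>lborel)"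
    using bound integral_inverse_1_plus_square(1) Si(1)
    by (intro norm_integral_le_integral Bochner_Integration.integrable_add integrable_mult_right) auto
  also have "\<dots> = K5 * rho ^ 3 * pi + Xi * (2 * pi * L)"
    using integral_inverse_1_plus_square Si by simp
  finally have E: "cmod ((\<integral>u. A u \<partial>lborel) - (\<integral>u. B u \<partial>lborel)) \<le> K5 * rho ^ 3 * pi + Xi * (2 * pi * L)" .
  have c: "complex_of_real (L * ?p / P0 - D) = of_real (1 / (2 * pi)) * ((\<integral>u. A u \<partial>lborel) - (\<integral>u. B u \<partial>lborel))"
    unfolding of_real_diff D A_def B_def lattice_density by (simp add: right_diff_distrib)
  have "\<bar>L * ?p / P0 - D\<bar> = cmod (of_real (1 / (2 * pi)) * ((\<integral>u. A u \<partial>lborel) - (\<integral>u. B u \<partial>lborel)))"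
    unfolding c[symmetric] norm_of_real ..
  also have "\<dots> = 1 / (2 * pi) * cmod ((\<integral>u. A u \<partial>lborel) - (\<integral>u. B u \<partial>lborel))"
    by (simp add: norm_mult norm_divide)
  also have "\<dots> \<le> 1 / (2 * pi) * (K5 * rho ^ 3 * pi + Xi * (2 * pi * L))"
    using E by (intro mult_left_mono) auto
  also have "\<dots> = K5 * rho ^ 3 / 2 + L * Xi" by (simp add: field_simps)
  also have "\<dots> \<le> K5 * rho ^ 3 + L * Xi" using K_pos' rho_pos by simp
  finally show ?thesis .
qed

end

end

section \<open>Sampling with replacement\<close>

text \<open>Modulo 2 \<pi> the argument is 2 \<pi> d with \<bar>d\<bar> \<le> 1/2, where
  \<open>one_minus_cos_ge\<close> applies; its constant 2 / \<pi>^2 times (2 \<pi>)^2 is 8.\<close>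

lemma one_minus_cos_ge_int_dist: "8 * (int_dist (x / (2 * pi)))\<^sup>2 \<le> 1 - cos x"
proof -
  define k where "k = round (x / (2 * pi))"
  define d where "d = x / (2 * pi) - of_int k"
  have d: "\<bar>d\<bar> \<le> 1 / 2" using of_int_round_abs_le[of "x / (2 * pi)"] by (simp add: d_def k_def abs_minus_commute)
  have "x = 2 * pi * d + of_int k * (2 * pi)" by (simp add: d_def algebra_simps)
  moreover have "cos (of_int k * (2 * pi)) = 1" "sin (of_int k * (2 * pi)) = 0"
    using cos_integer_2pi[of "of_int k"] sin_integer_2pi[of "of_int k"] by (simp_all add: mult.commute)
  ultimately have "cos x = cos (2 * pi * d)" by (simp only: cos_add)
  moreover have "2 / pi\<^sup>2 * (2 * pi * d)\<^sup>2 \<le> 1 - cos (2 * pi * d)"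
  proof (rule one_minus_cos_ge)
    have "2 * pi * \<bar>d\<bar> \<le> 2 * pi * (1 / 2)" using d by (intro mult_left_mono) auto
    then show "\<bar>2 * pi * d\<bar> \<le> pi" by (simp add: abs_mult)
  qed
  moreover have "2 / pi\<^sup>2 * (2 * pi * d)\<^sup>2 = 8 * d\<^sup>2" by (simp add: power_mult_distrib)
  ultimately show ?thesis by (simp add: int_dist_def d_def k_def)
qed

lemma int_dist_add_int: "int_dist (x + of_int k) = int_dist x"
proof -
  have "round (x + of_int k) = round x + k"
    unfolding round_def by (metis add.assoc add.commute floor_add_int)
  then show ?thesis by (simp add: int_dist_def)
qed

text \<open>Symmetrisation bounds the squared modulus by 1 - H and thus by exp (- H), H being the
  integral in the statement; the square root produces the factor 1/2 in the exponent.\<close>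

lemma (in prob_space) cmod_char_variable_le_int_dist:
  assumes [measurable]: "X \<in> borel_measurable M"
  shows "cmod (expectation (\<lambda>\<omega>. iexp (X \<omega>)))
    \<le> exp (- (1 / 2) * (\<integral>(\<omega>, \<omega>'). (int_dist ((X \<omega> - X \<omega>') / (2 * pi)))\<^sup>2 \<partial>(M \<Otimes>\<^sub>M M)))"
proof -
  interpret P: pair_prob_space M M ..
  let ?H = "\<integral>(\<omega>, \<omega>'). (int_dist ((X \<omega> - X \<omega>') / (2 * pi)))\<^sup>2 \<partial>(M \<Otimes>\<^sub>M M)"
  show ?thesis
  proof (cases "integrable (M \<Otimes>\<^sub>M M) (\<lambda>(\<omega>, \<omega>'). (int_dist ((X \<omega> - X \<omega>') / (2 * pi)))\<^sup>2)")
    \<comment> \<open>By convention the integral is 0 in this case, and the claimed bound is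
      1.\<close>
    case False
    then have "?H = 0" by (rule not_integrable_integral_eq)
    then show ?thesis using cmod_char_variable_le_1[of X] by simp
  next
    case True
    have H0: "0 \<le> ?H" by (rule integral_nonneg_AE) auto
    have "(cmod (expectation (\<lambda>\<omega>. iexp (X \<omega>))))\<^sup>2 \<le> (\<integral>p. 1 - (case p of (\<omega>, \<omega>') \<Rightarrow> (int_dist ((X \<omega> - X \<omega>') / (2 * pi)))\<^sup>2) \<partial>(M \<Otimes>\<^sub>M M))"
      unfolding cmod_char_variable_sq[OF assms]
    proof (rule integral_mono)
      show "integrable (M \<Otimes>\<^sub>M M) (\<lambda>(\<omega>, \<omega>'). cos (X \<omega> - X \<omega>'))" by (rule integrable_pair_cos) simp
      show "integrable (M \<Otimes>\<^sub>M M) (\<lambda>p. 1 - (case p of (\<omega>, \<omega>') \<Rightarrow> (int_dist ((X \<omega> - X \<omega>') / (2 * pi)))\<^sup>2))"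
        using True by simp
      fix p assume "p \<in> space (M \<Otimes>\<^sub>M M)"
      obtain \<omega> \<omega>' where p: "p = (\<omega>, \<omega>')" by (cases p)
      have "0 \<le> (int_dist ((X \<omega> - X \<omega>') / (2 * pi)))\<^sup>2" by simp
      then show "(case p of (\<omega>, \<omega>') \<Rightarrow> cos (X \<omega> - X \<omega>')) \<le> 1 - (case p of (\<omega>, \<omega>') \<Rightarrow> (int_dist ((X \<omega> - X \<omega>') / (2 * pi)))\<^sup>2)"
        using one_minus_cos_ge_int_dist[of "X \<omega> - X \<omega>'"] unfolding p prod.case by linarith
    qed
    also have "\<dots> = 1 - ?H" using True by (simp add: P.prob_space)
    also have "\<dots> \<le> exp (- ?H)" using exp_ge_add_one_self[of "- ?H"] by simp
    also have "\<dots> = (exp (- (1 / 2) * ?H))\<^sup>2" by (simp flip: exp_of_nat_mult)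
    finally show ?thesis by (rule power2_le_imp_le) simp
  qed
qed

locale sampling_scheme =
  fixes S :: "'a sampling" and n :: nat
  assumes swr: "sampling_with_replacement S" and ssize: "ssize S = n" and n2: "2 \<le> n"
    and sigma2_pos: "0 < sigma2_N S"
    and g5: "\<forall>m\<in>{1..cells S}. integrable (prob_sp S) (\<lambda>\<omega>. \<bar>gxi S m \<omega>\<bar> ^ 5)"
    and PN2: "P_N 2 S \<le> 1 / (10 * ln (real n))"
begin

sublocale prob_space "prob_sp S"
  using swr by (simp add: sampling_with_replacement_def)

lemma poisson_xi: "m \<in> {1..cells S} \<Longrightarrow> poisson_variable (prob_sp S) (xi S m) (n * prb S m)"
proof -
  assume m: "m \<in> {1..cells S}"
  have "indep_vars (\<lambda>_. count_space UNIV) (xi S) {1..cells S}" using swr by (simp add: sampling_with_replacement_def)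
  then have "xi S m \<in> measurable (prob_sp S) (count_space UNIV)" using m by (auto simp: indep_vars_def)
  then show ?thesis
    using swr m ssize n2 by unfold_locales (auto simp: sampling_with_replacement_def)
qed

lemma indep_pairs: "indep_vars (\<lambda>_. borel) (\<lambda>m \<omega>. (fxi S m \<omega>, xir S m \<omega>)) {1..cells S}"
  using swr by (simp add: sampling_with_replacement_def)

lemma fxi_meas: "m \<in> {1..cells S} \<Longrightarrow> fxi S m \<in> borel_measurable (prob_sp S)"
proof -
  assume "m \<in> {1..cells S}"
  then have "(\<lambda>\<omega>. (fxi S m \<omega>, xir S m \<omega>)) \<in> measurable (prob_sp S) (borel \<Otimes>\<^sub>M borel)"
    using indep_pairs by (auto simp: indep_vars_def borel_prod)
  from measurable_compose[OF this measurable_fst] show ?thesis by simp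
qed

lemma xir_facts:
  assumes m: "m \<in> {1..cells S}"
  shows "xir S m \<in> borel_measurable (prob_sp S)" "integrable (prob_sp S) (xir S m)"
    "mean S (xir S m) = n * prb S m" "variance (xir S m) = n * prb S m"
    "integrable (prob_sp S) (\<lambda>\<omega>. (xir S m \<omega> - n * prb S m)\<^sup>2)"
    "integrable (prob_sp S) (\<lambda>\<omega>. \<bar>xir S m \<omega> - n * prb S m\<bar> ^ 2)"
proof -
  interpret P: poisson_variable "prob_sp S" "xi S m" "n * prb S m" by (rule poisson_xi[OF m])
  show "xir S m \<in> borel_measurable (prob_sp S)" unfolding xir_def[abs_def] by measurable
  show i: "integrable (prob_sp S) (xir S m)" using P.integrable_power_nat[of 1] unfolding xir_def[abs_def] by simp
  show e: "mean S (xir S m) = n * prb S m"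
    using P.central_moments(1) i unfolding xir_def[abs_def] by (simp add: prob_space)
  show "variance (xir S m) = n * prb S m"
    unfolding e using P.central_moments(2) unfolding xir_def .
  show "integrable (prob_sp S) (\<lambda>\<omega>. (xir S m \<omega> - n * prb S m)\<^sup>2)"
    using P.integrable_shift_power[of "n * prb S m" 2] unfolding xir_def .
  then show "integrable (prob_sp S) (\<lambda>\<omega>. \<bar>xir S m \<omega> - n * prb S m\<bar> ^ 2)" by simp
qed

lemma B2_eq: "B2_N S = n"
proof -
  have "B2_N S = (\<Sum>m=1..cells S. n * prb S m)" unfolding B2_N_def using xir_facts(4) by (intro sum.cong) auto
  also have "\<dots> = n" using swr by (simp add: sampling_with_replacement_def flip: sum_distrib_left)
  finally show ?thesis .
qed

lemma gxi_eq: "m \<in> {1..cells S} \<Longrightarrow> gxi S m \<omega> = fxi S m \<omega> - mean S (fxi S m) - gamma_N S * (xir S m \<omega> - n * prb S m)"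
  using xir_facts(3) by (simp add: gxi_def g_fun_def fxi_def xir_def)

lemma gxi_facts:
  assumes m: "m \<in> {1..cells S}"
  shows "gxi S m \<in> borel_measurable (prob_sp S)" "integrable (prob_sp S) (fxi S m)" "mean S (gxi S m) = 0"
    "integrable (prob_sp S) (\<lambda>\<omega>. \<bar>gxi S m \<omega>\<bar> ^ 2)"
proof -
  note [measurable] = fxi_meas[OF m] xir_facts(1)[OF m]
  have ge: "gxi S m = (\<lambda>\<omega>. fxi S m \<omega> - mean S (fxi S m) - gamma_N S * (xir S m \<omega> - n * prb S m))"
    using gxi_eq[OF m] by (rule ext)
  show gm: "gxi S m \<in> borel_measurable (prob_sp S)" unfolding ge by measurable
  have gi: "integrable (prob_sp S) (gxi S m)"
    using integrable_power_mono[OF gm g5[rule_format, OF m], of 1] by simp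
  show "integrable (prob_sp S) (\<lambda>\<omega>. \<bar>gxi S m \<omega>\<bar> ^ 2)"
    using integrable_abs_power_mono[OF gm g5[rule_format, OF m], of 2] by simp
  have "fxi S m = (\<lambda>\<omega>. gxi S m \<omega> + (mean S (fxi S m) + gamma_N S * (xir S m \<omega> - n * prb S m)))"
    unfolding ge by (simp add: fun_eq_iff)
  moreover have "integrable (prob_sp S) (\<lambda>\<omega>. gxi S m \<omega> + (mean S (fxi S m) + gamma_N S * (xir S m \<omega> - n * prb S m)))"
    using gi xir_facts(2)[OF m] by simp
  ultimately show fi: "integrable (prob_sp S) (fxi S m)" by (simp only:)
  show "mean S (gxi S m) = 0"
    unfolding ge using fi xir_facts(2,3)[OF m] by (simp add: prob_space)
qed

lemma sigma_facts: "0 < sigma_N S" "(sigma_N S)\<^sup>2 = sigma2_N S"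
  using sigma2_pos by (simp_all add: sigma_N_def)

lemma sigma2_eq: "sigma2_N S = (\<Sum>m=1..cells S. mean S (\<lambda>\<omega>. (gxi S m \<omega>)\<^sup>2))"
  unfolding sigma2_N_def using gxi_facts(3) by (intro sum.cong) auto

text \<open>Each summand is cov(f, \<xi>) - \<gamma> Var \<xi> for its cell; summing gives 0 because
  \<open>gamma_N\<close> is the ratio of the two sums.\<close>

lemma covariance_zero: "(\<Sum>m=1..cells S. mean S (\<lambda>\<omega>. gxi S m \<omega> * (xir S m \<omega> - n * prb S m))) = 0"
proof -
  have "mean S (\<lambda>\<omega>. gxi S m \<omega> * (xir S m \<omega> - n * prb S m)) = covar (prob_sp S) (fxi S m) (xir S m) - gamma_N S * (n * prb S m)"
    if m: "m \<in> {1..cells S}" for m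
  proof -
    note [measurable] = gxi_facts(1)[OF m] xir_facts(1)[OF m]
    have i: "integrable (prob_sp S) (\<lambda>\<omega>. gxi S m \<omega> * (xir S m \<omega> - n * prb S m))"
    proof (rule Bochner_Integration.integrable_bound)
      show "integrable (prob_sp S) (\<lambda>\<omega>. \<bar>gxi S m \<omega>\<bar> ^ 2 + \<bar>xir S m \<omega> - n * prb S m\<bar> ^ 2)"
        using gxi_facts(4)[OF m] xir_facts(6)[OF m] by (rule Bochner_Integration.integrable_add)
      have "\<bar>y * z\<bar> \<le> \<bar>y\<bar>\<^sup>2 + \<bar>z\<bar>\<^sup>2" for y z :: real
      proof -
        have "0 \<le> \<bar>y\<bar> * \<bar>z\<bar>" by simp
        then show ?thesis using sum_squares_bound[of "\<bar>y\<bar>" "\<bar>z\<bar>"] unfolding abs_mult by linarith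
      qed
      then show "AE \<omega> in prob_sp S. norm (gxi S m \<omega> * (xir S m \<omega> - n * prb S m)) \<le> norm (\<bar>gxi S m \<omega>\<bar> ^ 2 + \<bar>xir S m \<omega> - n * prb S m\<bar> ^ 2)"
        by (intro AE_I2) (simp add: order_trans[OF _ abs_ge_self])
    qed simp
    have "covar (prob_sp S) (fxi S m) (xir S m)
      = mean S (\<lambda>\<omega>. gxi S m \<omega> * (xir S m \<omega> - n * prb S m) + gamma_N S * (xir S m \<omega> - n * prb S m)\<^sup>2)"
      unfolding covar_def xir_facts(3)[OF m]
      by (intro Bochner_Integration.integral_cong refl) (simp add: gxi_eq[OF m] power2_eq_square algebra_simps)
    also have "\<dots> = mean S (\<lambda>\<omega>. gxi S m \<omega> * (xir S m \<omega> - n * prb S m)) + gamma_N S * variance (xir S m)"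
      using i xir_facts(3,5)[OF m] by simp
    finally show ?thesis unfolding xir_facts(4)[OF m] by simp
  qed
  then have "(\<Sum>m=1..cells S. mean S (\<lambda>\<omega>. gxi S m \<omega> * (xir S m \<omega> - n * prb S m)))
      = (\<Sum>m=1..cells S. covar (prob_sp S) (fxi S m) (xir S m)) - gamma_N S * (\<Sum>m=1..cells S. n * prb S m)"
    by (simp add: sum_subtractf sum_distrib_left)
  also have "(\<Sum>m=1..cells S. n * prb S m) = B2_N S"
    unfolding B2_eq using swr by (simp add: sampling_with_replacement_def flip: sum_distrib_left)
  finally show ?thesis using B2_eq n2 by (simp add: gamma_N_def)
qed

sublocale C: poisson_scheme "prob_sp S" "cells S" n "prb S" "xi S" "\<lambda>m \<omega>. gxi S m \<omega> / sigma_N S"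
proof (intro poisson_scheme.intro poisson_scheme_axioms.intro)
  note s = sigma_facts
  show "prob_space (prob_sp S)" by unfold_locales
  show "2 \<le> n" by (rule n2)
  show "\<And>m. m \<in> {1..cells S} \<Longrightarrow> 0 < prb S m" "(\<Sum>m=1..cells S. prb S m) = 1"
    using swr by (simp_all add: sampling_with_replacement_def)
  show "\<And>m. m \<in> {1..cells S} \<Longrightarrow> poisson_variable (prob_sp S) (xi S m) (n * prb S m)" by (rule poisson_xi)
  show "\<And>m. m \<in> {1..cells S} \<Longrightarrow> (\<lambda>\<omega>. gxi S m \<omega> / sigma_N S) \<in> borel_measurable (prob_sp S)"
    using gxi_facts(1) by simp
  show "indep_vars (\<lambda>_. borel) (\<lambda>m \<omega>. (gxi S m \<omega> / sigma_N S, real (xi S m \<omega>))) {1..cells S}"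
  proof -
    define Y where "Y m = (\<lambda>(y, k). ((y - mean S (fxi S m) - gamma_N S * (k - n * prb S m)) / sigma_N S, k :: real))" for m
    have Ym: "Y m \<in> borel_measurable borel" for m unfolding Y_def borel_prod[symmetric] by measurable
    have "indep_vars (\<lambda>_. borel) (\<lambda>m \<omega>. Y m (fxi S m \<omega>, xir S m \<omega>)) {1..cells S}"
      using indep_vars_compose2[OF indep_pairs, of Y "\<lambda>_. borel"] Ym by simp
    then show ?thesis
      by (rule indep_vars_cong[THEN iffD1, rotated -1]) (auto simp: Y_def gxi_eq xir_def)
  qed
  show "\<And>m. m \<in> {1..cells S} \<Longrightarrow> integrable (prob_sp S) (\<lambda>\<omega>. \<bar>gxi S m \<omega> / sigma_N S\<bar> ^ 5)"
    using g5 by (simp add: abs_divide power_divide)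
  show "\<And>m. m \<in> {1..cells S} \<Longrightarrow> mean S (\<lambda>\<omega>. gxi S m \<omega> / sigma_N S) = 0"
    using gxi_facts(3) by simp
  show "(\<Sum>m=1..cells S. mean S (\<lambda>\<omega>. (gxi S m \<omega> / sigma_N S)\<^sup>2)) = 1"
    using sigma2_eq s sigma2_pos by (simp add: power_divide flip: sum_divide_distrib)
  show "(\<Sum>m=1..cells S. mean S (\<lambda>\<omega>. gxi S m \<omega> / sigma_N S * (real (xi S m \<omega>) - n * prb S m))) = 0"
    using covariance_zero s by (simp add: xir_def flip: sum_divide_distrib)
  show "(\<Sum>m=1..cells S. (prb S m)\<^sup>2) \<le> 1 / (10 * ln n)" using PN2 by (simp add: P_N_def)
qed

lemma g_hat_eq: "g_hat S m \<omega> = sqrt (cells S) * (gxi S m \<omega> / sigma_N S)"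
  using C.N_pos by (simp add: g_hat_def sigma_N_def real_sqrt_divide)

lemma xi_hat_eq: "m \<in> {1..cells S} \<Longrightarrow> xi_hat S m \<omega> = sqrt (cells S) * C.x m \<omega>"
  using C.N_pos xir_facts(3) by (simp add: xi_hat_def B2_eq C.x_def xir_def real_sqrt_divide)

lemma lin_comb_eq: "m \<in> {1..cells S} \<Longrightarrow> lin_comb S m t \<tau> \<omega> = sqrt (cells S) * C.lin t \<tau> m \<omega>"
  unfolding g_hat_eq C.lin_def by (subst xi_hat_eq) (simp_all add: algebra_simps)

lemma beta_eq: "beta_N j S = C.beta j"
proof -
  have N: "0 < real (cells S)" using C.N_pos by simp
  have p: "real (cells S) powr (- real j / 2) * sqrt (cells S) ^ j = 1"
    using N by (simp add: powr_half_sqrt[symmetric] powr_realpow[symmetric] powr_powr flip: powr_add)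
  have "beta_N j S = real (cells S) powr (- real j / 2) * (\<Sum>m=1..cells S. sqrt (cells S) ^ j * mean S (\<lambda>\<omega>. \<bar>gxi S m \<omega> / sigma_N S\<bar> ^ j))"
  proof -
    have "mean S (\<lambda>\<omega>. \<bar>g_hat S m \<omega>\<bar> ^ j) = sqrt (cells S) ^ j * mean S (\<lambda>\<omega>. \<bar>gxi S m \<omega> / sigma_N S\<bar> ^ j)" for m
      unfolding g_hat_eq abs_mult power_mult_distrib by (subst integral_mult_right_zero) simp
    then show ?thesis unfolding beta_N_def by simp
  qed
  also have "\<dots> = real (cells S) powr (- real j / 2) * sqrt (cells S) ^ j * C.beta j"
    by (simp add: C.beta_def sum_distrib_left ac_simps)
  finally show ?thesis unfolding p by simp
qed

lemma eps_eq: "C.eps = 1 / n + P_N 2 S"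
  by (simp add: C.eps_def P_N_def)

lemma delta_eq: "C.delta = (P_N 3 S + 1 / real n ^ 2) powr (3 / 4)"
proof -
  have "0 < P_N 3 S + 1 / real n ^ 2"
    using n2 C.p_pos unfolding P_N_def by (intro add_nonneg_pos sum_nonneg) (auto simp: less_imp_le)
  then have "root 4 (P_N 3 S + 1 / real n ^ 2) ^ 3 = (P_N 3 S + 1 / real n ^ 2) powr (3 / 4)"
    by (simp add: root_powr_inverse powr_powr flip: powr_realpow)
  then show ?thesis by (simp add: C.delta_def P_N_def)
qed

text \<open>The constant 1/4000 has its origin here: \<open>beta 3 + sqrt eps\<close> is at most
  twice the larger of the two terms, which doubles the 2000 in \<open>U_cut\<close>, and
  \<open>sqrt eps\<close> is at most \<open>calE_N S\<close>, whose second factor is at least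
  1.\<close>

lemma T_N_le: "1 / 4000 * T_N S \<le> C.U_cut"
proof -
  define b where "b = C.beta 3"
  define e where "e = sqrt C.eps"
  have b: "0 \<le> b" and e: "0 < e" using C.beta_nonneg[of 3] C.eps_pos by (auto simp: b_def e_def)
  have U: "C.U_cut = 1 / (2000 * (b + e))" by (simp add: C.U_cut_def b_def e_def)
  have cE: "e \<le> calE_N S"
  proof -
    have "e * 1 \<le> e * (1 + min 1 (lambda_N S powr (- 1 / 2)) * sqrt (1 + real (ssize S) * P_N 2 S))"
    proof (rule mult_left_mono)
      have "0 \<le> P_N 2 S" unfolding P_N_def by (intro sum_nonneg) auto
      then have "0 \<le> min 1 (lambda_N S powr (- 1 / 2)) * sqrt (1 + real (ssize S) * P_N 2 S)"
        by (intro mult_nonneg_nonneg) auto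
      then show "1 \<le> 1 + min 1 (lambda_N S powr (- 1 / 2)) * sqrt (1 + real (ssize S) * P_N 2 S)" by simp
    qed (use e in simp)
    then show ?thesis by (simp add: calE_N_def e_def eps_eq ssize)
  qed
  show ?thesis
  proof (cases "e \<le> b")
    case True
    then have b0: "0 < b" using e by simp
    have "1 / 4000 * T_N S \<le> 1 / 4000 * (1 / b)" by (simp add: T_N_def beta_eq b_def)
    also have "\<dots> = 1 / (2000 * (b + b))" by simp
    also have "\<dots> \<le> C.U_cut" unfolding U using True b0 e by (intro divide_left_mono) auto
    finally show ?thesis .
  next
    case False
    have "1 / 4000 * T_N S \<le> 1 / 4000 * (1 / calE_N S)" by (simp add: T_N_def)
    also have "\<dots> \<le> 1 / 4000 * (1 / e)" using cE e by (intro mult_left_mono divide_left_mono) auto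
    also have "\<dots> = 1 / (2000 * (e + e))" by simp
    also have "\<dots> \<le> C.U_cut" unfolding U using False b e by (intro divide_left_mono) auto
    finally show ?thesis .
  qed
qed

end

section \<open>Identification of the expansion \<open>W5\<close>\<close>

lemma (in poisson_scheme) W_polynomial:
  "\<exists>c :: nat \<Rightarrow> real. \<forall>u. W u = (\<Sum>k\<le>6. of_real (c k) * (\<i> * of_real u) ^ k)"
proof -
  \<comment> \<open>Writing \<open>W\<close> in powers of i u absorbs its imaginary unit and
    alternating signs; the coefficients become real, as \<open>deriv_fourier_stieltjes\<close>
    expects.\<close>
  define c where "c = (\<lambda>k::nat. [1, - qC / 2, (27 * qC\<^sup>2 + 18 * qB * qD) / 72 - e22 / 24, qA / 6,
    e40 / 24 - (9 * qB\<^sup>2 + 6 * qA * qC) / 72, 0, qA\<^sup>2 / 72] ! k)"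
  have six: "{..6::nat} = {0, 1, 2, 3, 4, 5, 6}" by auto
  have i: "\<i> ^ 3 = - \<i>" "\<i> ^ 4 = 1" "\<i> ^ 6 = -1"
    by (simp_all add: power3_eq_cube power4_eq_xxxx power_numeral_reduce)
  have "(\<Sum>k\<le>6. of_real (c k) * (\<i> * of_real u) ^ k) =
     1 + of_real (c 1) * (\<i> * of_real u) + of_real (c 2) * (- of_real (u ^ 2)) + of_real (c 3) * (- \<i> * of_real (u ^ 3))
     + of_real (c 4) * of_real (u ^ 4) + of_real (c 6) * (- of_real (u ^ 6))" for u
    unfolding six by (simp add: c_def power_mult_distrib i)
  also have "\<dots> u = W u" for u
    by (simp add: W_def c_def complex_eq_iff field_simps)
  finally show ?thesis by metis
qed

context sampling_scheme
begin

text \<open>The factors sqrt N in the normalised variables cancel against the denominators. The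
  first correction is purely imaginary and the second real, so both can be read off from the single
  complex polynomial \<open>Pol\<close>.\<close>

lemma Pol_parts:
  "P_exp1 S t \<tau> / of_real (sqrt (cells S)) = \<i> * of_real (Im (C.Pol t \<tau>))"
  "P_exp2 S t \<tau> / of_nat (cells S) = of_real (Re (C.Pol t \<tau>) - 1)"
proof -
  define r where "r = sqrt (cells S)"
  have r: "0 < r" "real (cells S) = r\<^sup>2" using C.N_pos by (auto simp: r_def)
  have rc: "of_nat (cells S) = complex_of_real (r\<^sup>2)" using r(2) by (metis of_real_of_nat_eq)
  have m: "mean S (\<lambda>\<omega>. lin_comb S m t \<tau> \<omega> ^ j) = r ^ j * mean S (\<lambda>\<omega>. C.lin t \<tau> m \<omega> ^ j)" if "m \<in> {1..cells S}" for m j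
    unfolding lin_comb_eq[OF that] power_mult_distrib by (subst integral_mult_right_zero) (simp add: r_def)
  have 3: "(\<Sum>m=1..cells S. mean S (\<lambda>\<omega>. lin_comb S m t \<tau> \<omega> ^ 3)) = r ^ 3 * C.Q3 t \<tau>"
    unfolding C.Q3_def sum_distrib_left using m by (intro sum.cong) auto
  have 4: "(\<Sum>m=1..cells S. mean S (\<lambda>\<omega>. lin_comb S m t \<tau> \<omega> ^ 4) - 3 * (mean S (\<lambda>\<omega>. lin_comb S m t \<tau> \<omega> ^ 2))\<^sup>2) = r ^ 4 * C.Q4 t \<tau>"
    unfolding C.Q4_def sum_distrib_left using m
    by (intro sum.cong) (auto simp: power_mult_distrib right_diff_distrib simp flip: power_mult)
  have i: "\<i> ^ 3 = - \<i>" "\<i> ^ 4 = 1" by (simp_all add: power3_eq_cube power4_eq_xxxx)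
  have P1: "P_exp1 S t \<tau> = - \<i> * of_real (r * C.Q3 t \<tau> / 6)"
    unfolding P_exp1_def 3 rc i using r(1) by (simp add: power2_eq_square power3_eq_cube)
  show "P_exp1 S t \<tau> / of_real (sqrt (cells S)) = \<i> * of_real (Im (C.Pol t \<tau>))"
    unfolding P1 r_def[symmetric] using r(1) by (simp add: C.Pol_def)
  have P2: "P_exp2 S t \<tau> = of_real (r\<^sup>2 * (C.Q4 t \<tau> / 24 - (C.Q3 t \<tau>)\<^sup>2 / 72))"
    unfolding P_exp2_def 4 rc i P1 using r(1)
    by (simp add: complex_eq_iff power2_eq_square power4_eq_xxxx field_simps)
  show "P_exp2 S t \<tau> / of_nat (cells S) = of_real (Re (C.Pol t \<tau>) - 1)"
    unfolding P2 rc using r(1) by (simp add: C.Pol_def)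
qed

lemma gauss_avg_eq: "gauss_avg Q = (\<integral>\<tau>. of_real (std_normal_density \<tau>) * Q \<tau> \<partial>lborel)"
  unfolding gauss_avg_def
  by (subst integral_mult_right_zero[symmetric], intro Bochner_Integration.integral_cong refl)
     (simp add: std_normal_density_def)

lemma G_parts:
  "G1_N S t / of_real (sqrt (cells S)) = \<i> * of_real (Im (C.W t))"
  "G2_N S t / of_nat (cells S) = of_real (Re (C.W t) + C.a2 - 1)"
proof -
  have h: "integrable lborel (\<lambda>v. of_real (std_normal_density v) * C.Pol t v)"
    "(\<integral>v. of_real (std_normal_density v) * C.Pol t v \<partial>lborel) = C.W t + of_real C.a2"
    using C.has_bochner_integral_Pol[of t] by (auto simp: has_bochner_integral_iff)
  have "G1_N S t / of_real (sqrt (cells S)) = (\<integral>v. of_real (std_normal_density v) * (P_exp1 S t v / of_real (sqrt (cells S))) \<partial>lborel)"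
    unfolding G1_N_def gauss_avg_eq by (simp only: times_divide_eq_right integral_divide_zero)
  also have "\<dots> = (\<integral>v. \<i> * of_real (Im (of_real (std_normal_density v) * C.Pol t v)) \<partial>lborel)"
    unfolding Pol_parts by (intro Bochner_Integration.integral_cong refl) simp
  also have "\<dots> = \<i> * of_real (\<integral>v. Im (of_real (std_normal_density v) * C.Pol t v) \<partial>lborel)"
    by (simp only: integral_mult_right_zero integral_complex_of_real)
  also have "(\<integral>v. Im (of_real (std_normal_density v) * C.Pol t v) \<partial>lborel) = Im (C.W t)"
    using integral_Im[OF h(1)] h(2) by simp
  finally show "G1_N S t / of_real (sqrt (cells S)) = \<i> * of_real (Im (C.W t))" .
  have "G2_N S t / of_nat (cells S) = (\<integral>v. of_real (std_normal_density v) * (P_exp2 S t v / of_nat (cells S)) \<partial>lborel)"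
    unfolding G2_N_def gauss_avg_eq by (simp only: times_divide_eq_right integral_divide_zero)
  also have "\<dots> = (\<integral>v. of_real (Re (of_real (std_normal_density v) * C.Pol t v) - std_normal_density v) \<partial>lborel)"
    unfolding Pol_parts by (intro Bochner_Integration.integral_cong refl) (simp add: algebra_simps)
  also have "\<dots> = of_real (\<integral>v. Re (of_real (std_normal_density v) * C.Pol t v) - std_normal_density v \<partial>lborel)"
    by (rule integral_complex_of_real)
  also have "(\<integral>v. Re (of_real (std_normal_density v) * C.Pol t v) - std_normal_density v \<partial>lborel)
      = (\<integral>v. Re (of_real (std_normal_density v) * C.Pol t v) \<partial>lborel) - 1"
    using integrable_Re[OF h(1)] by (subst Bochner_Integration.integral_diff) auto
  also have "(\<integral>v. Re (of_real (std_normal_density v) * C.Pol t v) \<partial>lborel) = Re (C.W t) + C.a2"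
    using integral_Re[OF h(1)] h(2) by simp
  finally show "G2_N S t / of_nat (cells S) = of_real (Re (C.W t) + C.a2 - 1)" .
qed

text \<open>At t = 0 the cubic form is a multiple of \<tau>^3, which averages to 0, so
  \<open>G1_N S 0\<close> vanishes and with it the product correction. Subtracting
  \<open>G2_N S 0\<close> removes exactly the constant \<open>a2\<close>.\<close>

lemma W5_eq: "W5 S t = C.W t"
proof -
  have W0: "C.W 0 = 1" by (simp add: C.W_def)
  have N: "complex_of_real (sqrt (cells S)) \<noteq> 0" using C.N_pos by simp
  have G10: "G1_N S 0 = 0" using G_parts(1)[of 0] N by (simp add: W0)
  show ?thesis
    unfolding W5_def G10 using G_parts[of t] G_parts(2)[of 0] C.N_pos
    by (auto simp: diff_divide_distrib W0 complex_eq_iff)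
qed

lemma deriv_bbW5:
  "complex_of_real (deriv (bbW5 S) u) = of_real (1 / (2 * pi)) * (\<integral>t. iexp (- (u * t)) * C.W_gauss t \<partial>lborel)"
  and integrable_W_gauss: "integrable lborel C.W_gauss"
proof -
  obtain c where c: "\<And>u. C.W u = (\<Sum>k\<le>6. of_real (c k) * (\<i> * of_real u) ^ k)"
    using C.W_polynomial by blast
  from deriv_fourier_stieltjes[of C.W c 6, OF c]
  show "complex_of_real (deriv (bbW5 S) u) = of_real (1 / (2 * pi)) * (\<integral>t. iexp (- (u * t)) * C.W_gauss t \<partial>lborel)"
    and "integrable lborel C.W_gauss"
    unfolding bbW5_def W5_eq C.W_gauss_def[abs_def] by blast+
qed

section \<open>Conditioning on the total count\<close>

definition fsum :: "'a \<Rightarrow> real" where "fsum \<omega> = (\<Sum>m=1..cells S. fxi S m \<omega>)"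
text \<open>Extensional functions are taken so that each vector of counts is represented once and
  the set is finite.\<close>

definition occupancies :: "(nat \<Rightarrow> nat) set" where "occupancies = {k \<in> PiE {1..cells S} (\<lambda>_. UNIV :: nat set). (\<Sum>m=1..cells S. k m) = n}"

lemma fsum_meas [measurable]: "fsum \<in> borel_measurable (prob_sp S)"
  unfolding fsum_def using fxi_meas by (intro borel_measurable_sum) auto

lemma finite_occupancies: "finite occupancies"
proof (rule finite_subset)
  show "occupancies \<subseteq> PiE {1..cells S} (\<lambda>_. {..n})"
  proof
    fix k assume k: "k \<in> occupancies"
    have "k m \<le> n" if "m \<in> {1..cells S}" for m
      using k member_le_sum[OF that, of k] by (auto simp: occupancies_def)
    then show "k \<in> PiE {1..cells S} (\<lambda>_. {..n})" using k by (auto simp: occupancies_def PiE_iff)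
  qed
qed (auto intro: finite_PiE)

text \<open>For fixed counts k the sum is a measurable function of the whole field
  \<open>random_functions S\<close>, and the field is independent of the count vector, so every
  summand factors. The general X lets the identity be used for both \<xi> and \<eta>.\<close>

lemma prob_decomposition:
  fixes X :: "nat \<Rightarrow> 'a \<Rightarrow> nat" and B :: "real set"
  assumes ind: "indep_rvs (prob_sp S) (fun_space (cells S)) (random_functions S) (vec_space (cells S)) (random_vector (cells S) X)"
    and B: "B \<in> sets borel"
  shows "prob {\<omega> \<in> space (prob_sp S). (\<Sum>m=1..cells S. X m \<omega>) = n \<and> (\<Sum>m=1..cells S. fn S m \<omega> (real (X m \<omega>))) \<in> B}
      = (\<Sum>k\<in>occupancies. prob {\<omega> \<in> space (prob_sp S). (\<Sum>m=1..cells S. fn S m \<omega> (real (k m))) \<in> B}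
          * prob {\<omega> \<in> space (prob_sp S). \<forall>m\<in>{1..cells S}. X m \<omega> = k m})"
proof -
  let ?I = "{1..cells S}"
  let ?F = "random_functions S" and ?V = "random_vector (cells S) X"
  have F: "?F \<in> measurable (prob_sp S) (fun_space (cells S))" and V: "?V \<in> measurable (prob_sp S) (vec_space (cells S))"
    and isv: "indep_set (sets (vimage_algebra (space (prob_sp S)) ?F (fun_space (cells S))))
      (sets (vimage_algebra (space (prob_sp S)) ?V (vec_space (cells S))))"
    using ind by (auto simp: indep_rvs_def)
  define C where "C k = {\<phi> \<in> space (fun_space (cells S)). (\<Sum>m=1..cells S. \<phi> (m, real (k m))) \<in> B}" for k :: "nat \<Rightarrow> nat"
  have C: "C k \<in> sets (fun_space (cells S))" for k
  proof -
    have "(\<lambda>\<phi>. \<Sum>m=1..cells S. \<phi> (m, real (k m))) \<in> borel_measurable (fun_space (cells S))"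
      by (intro borel_measurable_sum measurable_component_singleton) auto
    from measurable_sets[OF this B] show ?thesis by (simp add: C_def vimage_def Int_def conj_commute)
  qed
  have FC: "?F -` C k \<inter> space (prob_sp S) = {\<omega> \<in> space (prob_sp S). (\<Sum>m=1..cells S. fn S m \<omega> (real (k m))) \<in> B}" for k
  proof -
    have "?F \<omega> \<in> space (fun_space (cells S))" if "\<omega> \<in> space (prob_sp S)" for \<omega>
      using measurable_space[OF F that] .
    moreover have "(\<Sum>m=1..cells S. ?F \<omega> (m, real (k m))) = (\<Sum>m=1..cells S. fn S m \<omega> (real (k m)))" for \<omega>
      by (intro sum.cong refl) (simp add: random_functions_def)
    ultimately show ?thesis by (auto simp: C_def)
  qed
  have Vk: "?V -` {k} \<inter> space (prob_sp S) = {\<omega> \<in> space (prob_sp S). \<forall>m\<in>?I. X m \<omega> = k m}" if "k \<in> occupancies" for k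
  proof -
    have "?V \<omega> = k \<longleftrightarrow> (\<forall>m\<in>?I. X m \<omega> = k m)" for \<omega>
    proof
      assume "\<forall>m\<in>?I. X m \<omega> = k m"
      then show "?V \<omega> = k"
        using that unfolding random_vector_def
        by (intro extensionalityI[of _ ?I]) (auto simp: occupancies_def PiE_iff)
    qed (auto simp: random_vector_def)
    then show ?thesis by auto
  qed
  have sk: "{k} \<in> sets (vec_space (cells S))" if "k \<in> occupancies" for k
  proof -
    have "PiE ?I (\<lambda>m. {k m}) = {k}"
      using that by (intro PiE_singleton) (auto simp: occupancies_def PiE_iff)
    moreover have "PiE ?I (\<lambda>m. {k m}) \<in> sets (vec_space (cells S))" by (intro sets_PiM_I_finite) auto
    ultimately show ?thesis by simp
  qed
  have ev: "?F -` C k \<inter> space (prob_sp S) \<in> events" for k by (rule measurable_sets[OF F C])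
  have evV: "?V -` {k} \<inter> space (prob_sp S) \<in> events" if "k \<in> occupancies" for k
    by (rule measurable_sets[OF V sk[OF that]])
  have "{\<omega> \<in> space (prob_sp S). (\<Sum>m=1..cells S. X m \<omega>) = n \<and> (\<Sum>m=1..cells S. fn S m \<omega> (real (X m \<omega>))) \<in> B}
     = (\<Union>k\<in>occupancies. (?F -` C k \<inter> space (prob_sp S)) \<inter> (?V -` {k} \<inter> space (prob_sp S)))" (is "?L = ?R")
  proof
    show "?L \<subseteq> ?R"
    proof
      fix \<omega> assume w: "\<omega> \<in> ?L"
      define k where "k = (\<lambda>m\<in>?I. X m \<omega>)"
      have k: "k \<in> occupancies" using w by (auto simp: k_def occupancies_def)
      have "(\<Sum>m=1..cells S. fn S m \<omega> (real (k m))) = (\<Sum>m=1..cells S. fn S m \<omega> (real (X m \<omega>)))"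
        by (intro sum.cong) (auto simp: k_def)
      then show "\<omega> \<in> ?R" using w k unfolding FC by (intro UN_I[OF k]) (auto simp: Vk k_def)
    qed
    show "?R \<subseteq> ?L"
    proof
      fix \<omega> assume "\<omega> \<in> ?R"
      then obtain k where k: "k \<in> occupancies" "\<omega> \<in> ?F -` C k \<inter> space (prob_sp S)" "\<omega> \<in> ?V -` {k} \<inter> space (prob_sp S)"
        by blast
      have X: "X m \<omega> = k m" if "m \<in> ?I" for m using k(3) that unfolding Vk[OF k(1)] by auto
      have "(\<Sum>m=1..cells S. X m \<omega>) = (\<Sum>m=1..cells S. k m)"
        "(\<Sum>m=1..cells S. fn S m \<omega> (real (X m \<omega>))) = (\<Sum>m=1..cells S. fn S m \<omega> (real (k m)))"
        using X by (auto intro!: sum.cong)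
      then show "\<omega> \<in> ?L" using k unfolding FC by (auto simp: occupancies_def)
    qed
  qed
  moreover have "prob ?R = (\<Sum>k\<in>occupancies. prob ((?F -` C k \<inter> space (prob_sp S)) \<inter> (?V -` {k} \<inter> space (prob_sp S))))"
  proof (rule finite_measure_finite_Union[OF finite_occupancies])
    show "disjoint_family_on (\<lambda>k. (?F -` C k \<inter> space (prob_sp S)) \<inter> (?V -` {k} \<inter> space (prob_sp S))) occupancies"
      by (auto simp: disjoint_family_on_def)
  qed (use ev evV in auto)
  moreover have "prob ((?F -` C k \<inter> space (prob_sp S)) \<inter> (?V -` {k} \<inter> space (prob_sp S)))
     = prob (?F -` C k \<inter> space (prob_sp S)) * prob (?V -` {k} \<inter> space (prob_sp S))" if "k \<in> occupancies" for k
    by (intro indep_setD[OF isv] in_vimage_algebra C sk that)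
  ultimately show ?thesis by (simp add: FC Vk)
qed

text \<open>When the counts add up to n, the powers of n and the exponentials in the Poisson product
  combine to n^n exp (- n). Divided by n! this is \<open>C.P0\<close>, and the multinomial
  probability is what remains.\<close>

lemma prob_xi_eta:
  assumes k: "k \<in> occupancies"
  shows "prob {\<omega> \<in> space (prob_sp S). \<forall>m\<in>{1..cells S}. xi S m \<omega> = k m}
    = C.P0 * prob {\<omega> \<in> space (prob_sp S). \<forall>m\<in>{1..cells S}. eta S m \<omega> = k m}"
proof -
  let ?I = "{1..cells S}"
  have iv: "indep_vars (\<lambda>_. count_space UNIV) (xi S) ?I" using swr by (simp add: sampling_with_replacement_def)
  have sk: "(\<Sum>m=1..cells S. k m) = n" using k by (simp add: occupancies_def)
  have "{\<omega> \<in> space (prob_sp S). \<forall>m\<in>?I. xi S m \<omega> = k m} = (\<Inter>m\<in>?I. xi S m -` {k m} \<inter> space (prob_sp S))"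
    using C.N_pos by auto
  then have "prob {\<omega> \<in> space (prob_sp S). \<forall>m\<in>?I. xi S m \<omega> = k m} = (\<Prod>m\<in>?I. prob (xi S m -` {k m} \<inter> space (prob_sp S)))"
    using C.N_pos by (simp only:) (intro indep_varsD_finite[OF iv], auto)
  also have "\<dots> = (\<Prod>m\<in>?I. (n * prb S m) ^ k m / fact (k m) * exp (- (n * prb S m)))"
  proof (intro prod.cong refl)
    fix m assume m: "m \<in> ?I"
    interpret P: poisson_variable "prob_sp S" "xi S m" "n * prb S m" by (rule poisson_xi[OF m])
    show "prob (xi S m -` {k m} \<inter> space (prob_sp S)) = (n * prb S m) ^ k m / fact (k m) * exp (- (n * prb S m))"
      using P.prob_eq[of "k m"] by (simp add: vimage_def Int_def conj_commute)
  qed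
  also have "\<dots> = (\<Prod>m\<in>?I. real n ^ k m) * (\<Prod>m\<in>?I. exp (- (n * prb S m))) * ((\<Prod>m\<in>?I. prb S m ^ k m) / (\<Prod>m\<in>?I. fact (k m)))"
    by (simp add: power_mult_distrib prod.distrib prod_dividef ac_simps)
  also have "(\<Prod>m\<in>?I. real n ^ k m) = real n ^ n" using sk by (simp flip: power_sum)
  also have "(\<Prod>m\<in>?I. exp (- (n * prb S m))) = exp (- real n)"
    using C.p_sum by (simp add: sum_negf flip: exp_sum sum_distrib_left)
  also have "real n ^ n * exp (- real n) * ((\<Prod>m\<in>?I. prb S m ^ k m) / (\<Prod>m\<in>?I. fact (k m)))
    = C.P0 * (fact n / (\<Prod>m\<in>?I. fact (k m)) * (\<Prod>m\<in>?I. prb S m ^ k m))"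
    unfolding C.P0_eq by simp
  also have "fact n / (\<Prod>m\<in>?I. fact (k m)) * (\<Prod>m\<in>?I. prb S m ^ k m)
    = prob {\<omega> \<in> space (prob_sp S). \<forall>m\<in>?I. eta S m \<omega> = k m}"
    using swr sk ssize by (simp add: sampling_with_replacement_def multinomial_vector_def)
  finally show ?thesis .
qed

lemma R_N_conditional:
  assumes B: "B \<in> sets borel"
  shows "C.P0 * prob {\<omega> \<in> space (prob_sp S). R_N S \<omega> \<in> B} = prob {\<omega> \<in> space (prob_sp S). C.tot \<omega> = n \<and> fsum \<omega> \<in> B}"
proof -
  let ?A = "\<lambda>B. {\<omega> \<in> space (prob_sp S). (\<Sum>m=1..cells S. eta S m \<omega>) = n \<and> (\<Sum>m=1..cells S. fn S m \<omega> (real (eta S m \<omega>))) \<in> B}"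
  have ix: "indep_rvs (prob_sp S) (fun_space (cells S)) (random_functions S) (vec_space (cells S)) (random_vector (cells S) (xi S))"
    and ie: "indep_rvs (prob_sp S) (fun_space (cells S)) (random_functions S) (vec_space (cells S)) (random_vector (cells S) (eta S))"
    using swr by (simp_all add: sampling_with_replacement_def)
  have em: "eta S m \<in> measurable (prob_sp S) (count_space UNIV)" if "m \<in> {1..cells S}" for m
    using swr that by (simp add: sampling_with_replacement_def multinomial_vector_def)
  have *: "C.P0 * prob (?A B) = prob {\<omega> \<in> space (prob_sp S). C.tot \<omega> = n \<and> fsum \<omega> \<in> B}" if B: "B \<in> sets borel" for B
  proof -
    have "prob {\<omega> \<in> space (prob_sp S). C.tot \<omega> = n \<and> fsum \<omega> \<in> B}
      = (\<Sum>k\<in>occupancies. prob {\<omega> \<in> space (prob_sp S). (\<Sum>m=1..cells S. fn S m \<omega> (real (k m))) \<in> B}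
          * prob {\<omega> \<in> space (prob_sp S). \<forall>m\<in>{1..cells S}. xi S m \<omega> = k m})"
      unfolding C.tot_def fsum_def fxi_def by (rule prob_decomposition[OF ix B])
    also have "\<dots> = C.P0 * (\<Sum>k\<in>occupancies. prob {\<omega> \<in> space (prob_sp S). (\<Sum>m=1..cells S. fn S m \<omega> (real (k m))) \<in> B}
          * prob {\<omega> \<in> space (prob_sp S). \<forall>m\<in>{1..cells S}. eta S m \<omega> = k m})"
      unfolding sum_distrib_left by (intro sum.cong refl) (simp only: prob_xi_eta mult.left_commute)
    also have "\<dots> = C.P0 * prob (?A B)" unfolding prob_decomposition[OF ie B] ..
    finally show ?thesis by simp
  qed
  have tm: "(\<lambda>\<omega>. \<Sum>m=1..cells S. eta S m \<omega>) \<in> measurable (prob_sp S) (count_space UNIV)"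
  proof -
    have "(\<lambda>\<omega>. real (\<Sum>m=1..cells S. eta S m \<omega>)) \<in> borel_measurable (prob_sp S)"
      unfolding of_nat_sum using em by (intro borel_measurable_sum) (auto intro: measurable_compose)
    then have "(\<lambda>\<omega>. nat \<lfloor>real (\<Sum>m=1..cells S. eta S m \<omega>)\<rfloor>) \<in> measurable (prob_sp S) (count_space UNIV)" by measurable
    then show ?thesis by (simp only: floor_of_nat nat_int)
  qed
  \<comment> \<open>\<open>multinomial_vector\<close> prescribes only the probabilities of count
    vectors with sum n. The choice B = UNIV shows that they exhaust the mass, so the \<eta> add up
    to n almost surely.\<close>
  have "C.P0 * prob (?A UNIV) = C.P0" using *[of UNIV] by (simp add: C.P0_def)
  then have one: "prob {\<omega> \<in> space (prob_sp S). (\<Sum>m=1..cells S. eta S m \<omega>) = n} = 1" using C.P0_pos by simp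
  have ae: "AE \<omega> in prob_sp S. (\<Sum>m=1..cells S. eta S m \<omega>) = n"
    using AE_in_set_eq_1[of "{\<omega> \<in> space (prob_sp S). (\<Sum>m=1..cells S. eta S m \<omega>) = n}"] one tm
    by (auto simp: pred_def elim!: eventually_mono)
  have Fm: "random_functions S \<in> measurable (prob_sp S) (fun_space (cells S))" using ie by (simp add: indep_rvs_def)
  have fm: "(\<lambda>\<omega>. fn S m \<omega> (real k)) \<in> borel_measurable (prob_sp S)" if "m \<in> {1..cells S}" for m k
  proof -
    have "(\<lambda>\<omega>. random_functions S \<omega> (m, real k)) \<in> borel_measurable (prob_sp S)"
      using that by (intro measurable_compose[OF Fm measurable_component_singleton]) auto
    then show ?thesis using that by (simp add: random_functions_def)
  qed
  \<comment> \<open>A random function evaluated at a random count is measurable because counts range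
    over a countable set.\<close>
  have Rm: "R_N S \<in> borel_measurable (prob_sp S)"
    unfolding R_N_def[abs_def]
    by (intro borel_measurable_sum measurable_compose_countable[OF fm em])
  have "prob {\<omega> \<in> space (prob_sp S). R_N S \<omega> \<in> B} = prob (?A B)"
  proof (rule finite_measure_eq_AE)
    show "AE \<omega> in prob_sp S. (\<omega> \<in> {\<omega> \<in> space (prob_sp S). R_N S \<omega> \<in> B}) = (\<omega> \<in> ?A B)"
      using ae by eventually_elim (simp add: R_N_def)
    show "{\<omega> \<in> space (prob_sp S). R_N S \<omega> \<in> B} \<in> events"
      using measurable_sets[OF Rm B] by (simp add: vimage_def Int_def conj_commute)
    have "{\<omega> \<in> space (prob_sp S). (\<Sum>m=1..cells S. eta S m \<omega>) = n} \<inter> {\<omega> \<in> space (prob_sp S). R_N S \<omega> \<in> B} \<in> events"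
      using measurable_sets[OF Rm B] measurable_sets[OF tm, of "{n}"]
      by (intro sets.Int) (simp_all add: vimage_def Int_def conj_commute)
    moreover have "{\<omega> \<in> space (prob_sp S). (\<Sum>m=1..cells S. eta S m \<omega>) = n} \<inter> {\<omega> \<in> space (prob_sp S). R_N S \<omega> \<in> B} = ?A B"
      by (auto simp: R_N_def)
    ultimately show "?A B \<in> events" by simp
  qed
  then show ?thesis using *[OF B] by simp
qed

end

section \<open>Large u and the local estimate\<close>

context sampling_scheme
begin

lemma H_fun_nonneg: "0 \<le> H_fun S m t \<tau>"
  unfolding H_fun_def by (intro integral_nonneg_AE) auto

lemma Hbar_nonneg: "0 \<le> Hbar_N S b b'"
  unfolding Hbar_N_def by (rule Inf_greatest) (auto intro!: divide_nonneg_nonneg sum_nonneg H_fun_nonneg)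

text \<open>Expressed through f and \<xi>, the frequency of \<xi> is v / sqrt n shifted by the
  \<open>gamma_N\<close> term. Since \<xi> takes integer values, a multiple of 2 \<pi> in that
  frequency changes the argument of \<open>int_dist\<close> by an integer.\<close>

lemma cmod_psi_le:
  assumes m: "m \<in> {1..cells S}"
    and \<tau>: "\<tau> = v / sqrt n - gamma_N S * (u / sigma_N S) - 2 * pi * of_int k"
  shows "cmod (C.psi u v m) \<le> exp (- (1 / 2) * H_fun S m (u / sigma_N S / (2 * pi)) (\<tau> / (2 * pi)))"
proof -
  let ?t = "u / sigma_N S"
  let ?X = "C.lin u v m"
  have eq: "(?X \<omega> - ?X \<omega>') / (2 * pi)
      = ?t / (2 * pi) * (fxi S m \<omega> - fxi S m \<omega>') + \<tau> / (2 * pi) * (xir S m \<omega> - xir S m \<omega>')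
        + of_int (k * (int (xi S m \<omega>) - int (xi S m \<omega>')))" for \<omega> \<omega>'
  proof -
    define d e where "d = fxi S m \<omega> - fxi S m \<omega>'" and "e = xir S m \<omega> - xir S m \<omega>'"
    have "C.x m \<omega> - C.x m \<omega>' = e / sqrt n"
      by (simp add: C.x_def e_def xir_def diff_divide_distrib)
    moreover have "gxi S m \<omega> - gxi S m \<omega>' = d - gamma_N S * e"
      by (simp add: gxi_eq[OF m] d_def e_def algebra_simps)
    moreover have "?X \<omega> - ?X \<omega>' = ?t * (gxi S m \<omega> - gxi S m \<omega>') + v * (C.x m \<omega> - C.x m \<omega>')"
      by (simp add: C.lin_def algebra_simps diff_divide_distrib)
    ultimately have "?X \<omega> - ?X \<omega>' = ?t * (d - gamma_N S * e) + v * (e / sqrt n)" by simp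
    also have "\<dots> = ?t * d + (\<tau> + 2 * pi * of_int k) * e"
      unfolding \<tau> by (simp add: algebra_simps)
    finally have "?X \<omega> - ?X \<omega>' = ?t * d + (\<tau> + 2 * pi * of_int k) * e" .
    then have "(?X \<omega> - ?X \<omega>') / (2 * pi) = ?t / (2 * pi) * d + \<tau> / (2 * pi) * e + of_int k * e"
      by (simp add: add_divide_distrib distrib_right)
    then show ?thesis by (simp add: d_def e_def xir_def)
  qed
  have "cmod (C.psi u v m) \<le> exp (- (1 / 2) * (\<integral>(\<omega>, \<omega>'). (int_dist ((?X \<omega> - ?X \<omega>') / (2 * pi)))\<^sup>2 \<partial>(prob_sp S \<Otimes>\<^sub>M prob_sp S)))"
    unfolding C.psi_def using m by (intro cmod_char_variable_le_int_dist C.lin_meas)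
  then show ?thesis unfolding eq int_dist_add_int H_fun_def .
qed

text \<open>For every v the shifted frequency is reduced into [-\<pi>, \<pi>], so one bound holds
  along the whole range of integration. That range has length 2 \<pi> sqrt n, at most 8 sqrt n, and
  the denominator \<open>C.I_int 0\<close> has modulus at least 1.\<close>

lemma cmod_phi_le:
  assumes h: "0 < h" and u: "C.U_cut < \<bar>u\<bar>" "\<bar>u\<bar> \<le> pi * (sigma_N S / h)"
  shows "cmod (C.phi u) \<le> 8 * sqrt n * exp_minus (ereal (1 / 2 * real (cells S)) *
    Hbar_N S (1 / 4000 * T_N S) (pi * sigma_N S / h))" (is "_ \<le> 8 * sqrt n * ?X")
proof -
  let ?t = "u / sigma_N S"
  let ?H = "Hbar_N S (1 / 4000 * T_N S) (pi * sigma_N S / h)"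
  have N: "0 < real (cells S)" using C.N_pos by simp
  have s: "0 < sigma_N S" by (rule sigma_facts)
  have X0: "0 \<le> ?X" by (simp add: exp_minus_def)
  have Psi: "cmod (C.Psi u v) \<le> ?X" for v
  proof -
    define \<tau>0 where "\<tau>0 = v / sqrt n - gamma_N S * ?t"
    define k where "k = round (\<tau>0 / (2 * pi))"
    define \<tau> where "\<tau> = \<tau>0 - 2 * pi * of_int k"
    define E where "E = 1 / real (cells S) * (\<Sum>m=1..cells S. H_fun S m (?t / (2 * pi)) (\<tau> / (2 * pi)))"
    have "\<bar>\<tau>\<bar> = 2 * pi * \<bar>of_int k - \<tau>0 / (2 * pi)\<bar>"
    proof -
      have "\<tau> = - (2 * pi * (of_int k - \<tau>0 / (2 * pi)))" by (simp add: \<tau>_def right_diff_distrib)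
      then show ?thesis by (simp only: abs_minus_cancel abs_mult) simp
    qed
    also have "\<dots> \<le> 2 * pi * (1 / 2)"
      unfolding k_def by (intro mult_left_mono of_int_round_abs_le) auto
    finally have t: "\<bar>\<tau>\<bar> \<le> pi" by simp
    have t1: "1 / 4000 * T_N S / sigma_N S \<le> \<bar>?t\<bar>"
    proof -
      have "1 / 4000 * T_N S \<le> \<bar>u\<bar>" using T_N_le u(1) by linarith
      then have "1 / 4000 * T_N S / sigma_N S \<le> \<bar>u\<bar> / sigma_N S" using s by (intro divide_right_mono) auto
      then show ?thesis using s by (simp add: abs_divide)
    qed
    have t2: "\<bar>?t\<bar> \<le> pi * sigma_N S / h / sigma_N S"
    proof -
      have "\<bar>u\<bar> / sigma_N S \<le> pi * sigma_N S / h / sigma_N S" using s u(2) by (intro divide_right_mono) auto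
      then show ?thesis using s by (simp add: abs_divide)
    qed
    have HE: "?H \<le> ereal E"
      unfolding Hbar_N_def E_def
      by (rule Inf_lower, rule CollectI, rule exI[of _ ?t], rule exI[of _ \<tau>]) (intro conjI refl t1 t2 t)
    \<comment> \<open>A point of the index set has just been exhibited, so the infimum is a finite
      real and \<open>exp_minus\<close> is an ordinary exponential.\<close>
    then obtain r where r: "?H = ereal r" using Hbar_nonneg[of "1 / 4000 * T_N S" "pi * sigma_N S / h"]
      by (cases ?H) auto
    have rE: "r \<le> E" using HE r by simp
    have "cmod (C.Psi u v) = (\<Prod>m=1..cells S. cmod (C.psi u v m))" by (simp add: C.Psi_def prod_norm)
    also have "\<dots> \<le> (\<Prod>m=1..cells S. exp (- (1 / 2) * H_fun S m (?t / (2 * pi)) (\<tau> / (2 * pi))))"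
      by (intro prod_mono conjI cmod_psi_le[where k = k]) (auto simp: \<tau>_def \<tau>0_def)
    also have "\<dots> = exp (- (1 / 2) * (real (cells S) * E))"
      unfolding E_def sum_distrib_left exp_sum[OF finite_atLeastAtMost, symmetric] using N by simp
    also have "\<dots> \<le> exp (- (1 / 2 * real (cells S) * r))"
      using mult_left_mono[OF rE, of "real (cells S)"] N by simp
    also have "\<dots> = ?X" unfolding r exp_minus_def by simp
    finally show ?thesis .
  qed
  have b: "has_bochner_integral lborel (\<lambda>v. indicator {- (pi * sqrt n)..pi * sqrt n} v *\<^sub>R ?X) (measure lborel {- (pi * sqrt n)..pi * sqrt n} *\<^sub>R ?X)"
    by (intro has_bochner_integral_scaleR_left has_bochner_integral_real_indicator) auto
  have "cmod (C.I_int u) \<le> (\<integral>v. indicator {- (pi * sqrt n)..pi * sqrt n} v *\<^sub>R ?X \<partial>lborel)"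
    unfolding C.I_int_def using b Psi
    by (intro norm_integral_le_integral) (auto simp: has_bochner_integral_iff C.Psi_cut_def indicator_def)
  also have "\<dots> = 2 * pi * sqrt n * ?X" using b by (simp add: has_bochner_integral_iff)
  also have "\<dots> \<le> 8 * sqrt n * ?X" using pi_less_4 X0 by (intro mult_right_mono) auto
  finally have I: "cmod (C.I_int u) \<le> 8 * sqrt n * ?X" .
  have "cmod (C.phi u) = cmod (C.I_int u) / cmod (C.I_int 0)" by (simp add: C.phi_def norm_divide)
  also have "\<dots> \<le> cmod (C.I_int u) / 1" using C.I_int_0_ge by (intro divide_left_mono) auto
  finally show ?thesis using I by simp
qed

text \<open>When the total equals n, the \<open>gamma_N\<close> terms cancel: conditioning turns the
  sum of the g into the centred sum of the f.\<close>

lemma asum_eq: "C.tot \<omega> = n \<Longrightarrow> C.asum \<omega> = (fsum \<omega> - Lambda_N S) / sigma_N S"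
proof -
  assume t: "C.tot \<omega> = n"
  have t: "(\<Sum>m=1..cells S. xir S m \<omega>) = real n"
    unfolding t[symmetric] C.tot_def by (simp add: xir_def)
  have p: "(\<Sum>m=1..cells S. n * prb S m) = real n"
    unfolding sum_distrib_left[symmetric] C.p_sum by simp
  have "(\<Sum>m=1..cells S. gxi S m \<omega>) = (\<Sum>m=1..cells S. fxi S m \<omega> - mean S (fxi S m) - gamma_N S * (xir S m \<omega> - n * prb S m))"
    using gxi_eq by (intro sum.cong) auto
  also have "\<dots> = fsum \<omega> - Lambda_N S - gamma_N S * ((\<Sum>m=1..cells S. xir S m \<omega>) - (\<Sum>m=1..cells S. n * prb S m))"
    by (simp only: fsum_def Lambda_N_def sum_subtractf sum_distrib_left[symmetric])
  finally show ?thesis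
    unfolding t p by (simp add: C.asum_def flip: sum_divide_distrib)
qed

lemma local_estimate:
  assumes lat: "on_lattice (prob_sp S) (R_N S) h" and z: "z \<in> possible_values (prob_sp S) (R_N S)"
  shows "\<bar>sigma_N S / h * prob {\<omega> \<in> space (prob_sp S). R_N S \<omega> = z}
      - deriv (bbW5 S) ((z - Lambda_N S) / sigma_N S)\<bar>
    \<le> K5 * (beta_N 5 S + 46 * (P_N 3 S + 1 / real n ^ 2) powr (3 / 4))
      + sigma_N S / h * (8 * sqrt n * exp_minus (ereal (1 / 2 * real (cells S)) *
          Hbar_N S (1 / 4000 * T_N S) (pi * sigma_N S / h)))"
proof -
  let ?M = "prob_sp S"
  obtain a where h: "0 < h" and a: "AE \<omega> in ?M. \<exists>k::int. R_N S \<omega> = a + of_int k * h"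
    using lat unfolding on_lattice_def by blast
  define B where "B = range (\<lambda>k::int. a + of_int k * h)"
  have B: "B \<in> sets borel" by (rule sets.countable) (auto simp: B_def)
  have RB: "AE \<omega> in ?M. R_N S \<omega> \<in> B" using a unfolding B_def by eventually_elim blast
  \<comment> \<open>A value of positive probability cannot miss a set of full probability; the
    lattice may therefore be recentred at z.\<close>
  have zB: "z \<in> B"
  proof (rule ccontr)
    assume "z \<notin> B"
    then have "AE \<omega> in ?M. R_N S \<omega> \<noteq> z" using RB by (auto elim!: eventually_mono)
    then have "emeasure ?M {\<omega> \<in> space ?M. R_N S \<omega> = z} = 0" by (rule emeasure_eq_0_AE)
    then show False using z by (simp add: possible_values_def measure_def)
  qed
  then obtain k0 :: int where k0: "z = a + of_int k0 * h" by (auto simp: B_def)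
  \<comment> \<open>The lattice property is known for the statistic in \<eta>;
    \<open>R_N_conditional\<close> on the complement of the lattice transfers it to the Poisson sum
    on the event that the total is n.\<close>
  have "emeasure ?M {\<omega> \<in> space ?M. R_N S \<omega> \<in> - B} = 0"
    using RB by (intro emeasure_eq_0_AE) auto
  moreover have "- B \<in> sets borel" using borel_comp[OF B] .
  ultimately have "prob {\<omega> \<in> space ?M. C.tot \<omega> = n \<and> fsum \<omega> \<in> - B} = 0"
    using R_N_conditional[of "- B"] by (simp add: measure_def)
  moreover have "{\<omega> \<in> space ?M. C.tot \<omega> = n \<and> fsum \<omega> \<in> - B} \<in> events"
    using B by measurable
  ultimately have FB: "AE \<omega> in ?M. C.tot \<omega> = n \<longrightarrow> fsum \<omega> \<in> B"
    using prob_eq_0[of "{\<omega> \<in> space ?M. C.tot \<omega> = n \<and> fsum \<omega> \<in> - B}"] AE_space[of ?M] by auto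
  \<comment> \<open>The lattice coordinate relative to z. The floor makes it a measurable integer
    everywhere, and almost surely on the event \<open>C.tot \<omega> = n\<close> it is
    exact.\<close>
  define Y where "Y \<omega> = \<lfloor>(fsum \<omega> - z) / h\<rfloor>" for \<omega>
  have Ym [measurable]: "Y \<in> measurable ?M (count_space UNIV)"
    unfolding Y_def[abs_def] by measurable
  have Y: "AE \<omega> in ?M. C.tot \<omega> = n \<longrightarrow> fsum \<omega> = z + of_int (Y \<omega>) * h"
    using FB
  proof eventually_elim
    case (elim \<omega>)
    show ?case
    proof
      assume "C.tot \<omega> = n"
      then obtain k :: int where k: "fsum \<omega> = a + of_int k * h" using elim by (auto simp: B_def)
      have "(fsum \<omega> - z) / h = of_int (k - k0)" using h unfolding k k0 by (simp add: field_simps)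
      then have Yk: "Y \<omega> = k - k0" unfolding Y_def by (simp only: floor_of_int)
      show "fsum \<omega> = z + of_int (Y \<omega>) * h" unfolding Yk k k0 by (simp add: algebra_simps)
    qed
  qed
  define L where "L = sigma_N S / h"
  let ?z = "(z - Lambda_N S) / sigma_N S"
  let ?Xi = "8 * sqrt n * exp_minus (ereal (1 / 2 * real (cells S)) * Hbar_N S (1 / 4000 * T_N S) (pi * sigma_N S / h))"
  have L: "0 < L" using h sigma_facts by (simp add: L_def)
  have A: "AE \<omega> in ?M. C.tot \<omega> = n \<longrightarrow> C.asum \<omega> = ?z + of_int (Y \<omega>) / L"
    using Y
  proof eventually_elim
    case (elim \<omega>)
    show ?case
    proof
      assume t: "C.tot \<omega> = n"
      then have "C.asum \<omega> = (z + of_int (Y \<omega>) * h - Lambda_N S) / sigma_N S" using elim asum_eq by simp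
      then show "C.asum \<omega> = ?z + of_int (Y \<omega>) / L" by (simp add: L_def add_divide_distrib diff_divide_distrib)
    qed
  qed
  have "prob {\<omega> \<in> space ?M. C.tot \<omega> = n \<and> Y \<omega> = 0} = prob {\<omega> \<in> space ?M. C.tot \<omega> = n \<and> fsum \<omega> \<in> {z}}"
  proof (rule finite_measure_eq_AE)
    show "AE \<omega> in ?M. (\<omega> \<in> {\<omega> \<in> space ?M. C.tot \<omega> = n \<and> Y \<omega> = 0}) = (\<omega> \<in> {\<omega> \<in> space ?M. C.tot \<omega> = n \<and> fsum \<omega> \<in> {z}})"
      using Y by eventually_elim (use h in auto)
  qed measurable
  also have "\<dots> = C.P0 * prob {\<omega> \<in> space ?M. R_N S \<omega> \<in> {z}}"
    by (rule R_N_conditional[symmetric]) simp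
  finally have p: "L * prob {\<omega> \<in> space ?M. C.tot \<omega> = n \<and> Y \<omega> = 0} / C.P0 = L * prob {\<omega> \<in> space ?M. R_N S \<omega> = z}"
    using C.P0_pos by simp
  have "\<bar>L * prob {\<omega> \<in> space ?M. C.tot \<omega> = n \<and> Y \<omega> = 0} / C.P0 - deriv (bbW5 S) ?z\<bar> \<le> K5 * C.rho ^ 3 + L * ?Xi"
  proof (rule C.main_estimate[OF L Ym A _ _ integrable_W_gauss deriv_bbW5])
    show "0 \<le> ?Xi" by (simp add: exp_minus_def)
    show "cmod (C.phi u) \<le> ?Xi" if "C.U_cut < \<bar>u\<bar>" "\<bar>u\<bar> \<le> pi * L" for u
      using cmod_phi_le[OF h that[unfolded L_def]] .
  qed
  then show ?thesis
    unfolding p unfolding C.rho_pow3 beta_eq[symmetric] delta_eq L_def .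
qed

end

theorem theorem4p1:
  fixes h :: real
  assumes "0 < h"
  shows "\<exists>c>0. \<exists>C>0. \<forall>S :: nat \<Rightarrow> 'a sampling.
    (\<forall>n\<ge>1. sampling_with_replacement (S n) \<and> ssize (S n) = n) \<longrightarrow>
    filterlim (\<lambda>n. cells (S n)) at_top sequentially \<longrightarrow>
    (\<lambda>n. MAX m\<in>{1..cells (S n)}. prb (S n) m) \<longlonglongrightarrow> 0 \<longrightarrow>
    (\<forall>n\<ge>1.
       0 < sigma2_N (S n) \<longrightarrow>
       lattice_span (prob_sp (S n)) (R_N (S n)) h \<longrightarrow>
       (\<forall>m\<in>{1..cells (S n)}. integrable (prob_sp (S n)) (\<lambda>\<omega>. \<bar>gxi (S n) m \<omega>\<bar> ^ 5)) \<longrightarrow>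
       P_N 2 (S n) \<le> 1 / (10 * ln (real n)) \<longrightarrow>
       (\<forall>z \<in> possible_values (prob_sp (S n)) (R_N (S n)).
          \<bar>sigma_N (S n) / h * measure (prob_sp (S n)) {\<omega> \<in> space (prob_sp (S n)). R_N (S n) \<omega> = z}
             - deriv (bbW5 (S n)) ((z - Lambda_N (S n)) / sigma_N (S n))\<bar>
          \<le> C * (beta_N 5 (S n)
               + (P_N 3 (S n) + 1 / real n ^ 2) powr (3 / 4)
               + sigma_N (S n) * sqrt (real n) *
                 exp_minus (ereal (1 / 2 * real (cells (S n))) *
                   Hbar_N (S n) (c * T_N (S n)) (pi * sigma_N (S n) / h)))))"
proof (intro exI conjI allI impI ballI)
  \<comment> \<open>46 is the weight of \<open>delta\<close> in \<open>rho ^ 3\<close>. The summand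
    8 / h combines the bound 8 sqrt n for the range of v with the half-period factor
    \<open>L = sigma_N / h\<close>.\<close>
  define C where "C = 46 * K5 + 8 / h"
  show "(0::real) < 1 / 4000" by simp
  show C0: "0 < C" using K_pos' assms by (simp add: C_def add_pos_pos)
  fix S :: "nat \<Rightarrow> 'a sampling" and n :: nat and z
  assume swr: "\<forall>n\<ge>1. sampling_with_replacement (S n) \<and> ssize (S n) = n" and n: "1 \<le> n"
    and s2: "0 < sigma2_N (S n)" and lat: "lattice_span (prob_sp (S n)) (R_N (S n)) h"
    and g5: "\<forall>m\<in>{1..cells (S n)}. integrable (prob_sp (S n)) (\<lambda>\<omega>. \<bar>gxi (S n) m \<omega>\<bar> ^ 5)"
    and P2: "P_N 2 (S n) \<le> 1 / (10 * ln (real n))"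
    and z: "z \<in> possible_values (prob_sp (S n)) (R_N (S n))"
  have sw: "sampling_with_replacement (S n)" "ssize (S n) = n" using swr n by auto
  \<comment> \<open>At n = 1 the bound on \<open>P_N 2\<close> reads 0, by the conventions
    \<open>ln 1 = 0\<close> and \<open>1 / 0 = 0\<close>, which contradicts the positivity of the
    cell probabilities.\<close>
  have "n \<noteq> 1"
  proof
    assume "n = 1"
    then have "P_N 2 (S n) \<le> 0" using P2 by simp
    moreover have "0 < P_N 2 (S n)"
      unfolding P_N_def
    proof (rule sum_pos)
      show "{1..cells (S n)} \<noteq> {}"
        using sw(1) unfolding sampling_with_replacement_def by (metis sum.empty zero_neq_one)
      show "0 < prb (S n) m ^ 2" if "m \<in> {1..cells (S n)}" for m
        using sw(1) that unfolding sampling_with_replacement_def by (intro zero_less_power) blast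
    qed simp
    ultimately show False by simp
  qed
  then have n2: "2 \<le> n" using n by simp
  interpret sampling_scheme "S n" n
    by (rule sampling_scheme.intro[OF sw n2 s2 g5 P2])
  let ?b = "beta_N 5 (S n)" and ?d = "(P_N 3 (S n) + 1 / real n ^ 2) powr (3 / 4)"
    and ?e = "sigma_N (S n) * sqrt (real n) *
                 exp_minus (ereal (1 / 2 * real (cells (S n))) *
                   Hbar_N (S n) (1 / 4000 * T_N (S n)) (pi * sigma_N (S n) / h))"
  have nn: "0 \<le> ?b" "0 \<le> ?d" "0 \<le> ?e"
    using C.beta_nonneg sigma_facts(1) by (auto simp: beta_eq exp_minus_def)
  have "\<bar>sigma_N (S n) / h * prob {\<omega> \<in> space (prob_sp (S n)). R_N (S n) \<omega> = z}
             - deriv (bbW5 (S n)) ((z - Lambda_N (S n)) / sigma_N (S n))\<bar>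
      \<le> K5 * (?b + 46 * ?d) + 8 / h * ?e"
    using local_estimate[OF _ z, of h] lat by (simp add: lattice_span_def ac_simps)
  also have "\<dots> \<le> C * ?b + C * ?d + C * ?e"
  proof -
    have "K5 * ?b \<le> C * ?b" "46 * K5 * ?d \<le> C * ?d" "8 / h * ?e \<le> C * ?e"
      using nn K_pos' assms by (intro mult_right_mono; simp add: C_def)+
    then show ?thesis by (simp add: algebra_simps)
  qed
  finally show "\<bar>sigma_N (S n) / h * measure (prob_sp (S n)) {\<omega> \<in> space (prob_sp (S n)). R_N (S n) \<omega> = z}
             - deriv (bbW5 (S n)) ((z - Lambda_N (S n)) / sigma_N (S n))\<bar> \<le> C * (?b + ?d + ?e)"
    by (simp only: distrib_left)
qed

end
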